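(* Let $B$ be a thin Blaschke product whose zero set $Z(B)$ satisfies $\overline{Z(B)}\nsupseteq\mathbb{T}$, where $\mathbb{T}$ is the unit circle. Then $\mathcal{V}^*(B)$ is nontrivial (i.e. $\mathcal{V}^*(B)\neq\mathbb{C}I$) if and only if the Riemann surface $S_B$ has a nontrivial component with finite multiplicity.
   Context: $L^2_a(\mathbb{D})$ is the Bergman space of holomorphic functions on the open unit disk $\mathbb{D}$ that are square integrable with respect to normalized area measure. For a bounded holomorphic $\phi$ on $\mathbb{D}$, $M_\phi$ is the operator of multiplication by $\phi$ on $L^2_a(\mathbb{D})$, and $\mathcal{V}^*(\phi)=\{M_\phi,M_\phi^*\}'$ is the von Neumann algebra of bounded operators on $L^2_a(\mathbb{D})$ commuting with both $M_\phi$ and $M_\phi^*$. A thin Blaschke product is an infinite Blaschke product $B$ whose zero sequence $\{z_n\}$ satisfies $\lim_{k\to\infty}\prod_{j\ne k} d(z_j,z_k)=1$, where $d(z,\lambda)=\left|\frac{\lambda-z}{1-\overline{\lambda}z}\right|$. Let $\mathcal{E}_B=\{B(z): z\in\mathbb{D},\,B'(z)=0\}$ and $E=\mathbb{D}\setminus B^{-1}(\mathcal{E}_B)$, a connected open set. Let $S_B=\{(z,w)\in\mathbb{D}^2: z\in E,\ B(z)=B(w)\}$ with the topology inherited from $\mathbb{D}^2$; it is a (not necessarily connected) Riemann surface. Its connected components are called its components; the trivial component is $\{(z,z):z\in E\}$, and every other component is nontrivial. For each component $G$, the projection $G\to E$, $(z,w)\mapsto z$, is a covering map; the multiplicity of $G$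 is its number of sheets, i.e. the number (possibly $\infty$) of $w$ with $(z,w)\in G$, which is independent of $z\in E$. *)

theory Defs
  imports "HOL-Analysis.Analysis"
begin

abbreviation unit_disk :: "complex set" where
  "unit_disk \<equiv> ball 0 1"

section \<open>The Bergman space and its bounded operators\<close>

(* Normalized area measure: total mass 1, concentrated on the disk although its space is UNIV. *)
definition disk_area :: "complex measure" where
  "disk_area = uniform_measure lborel unit_disk"

(* A function on the disk is represented by its extension by 0 to the whole plane, so that equality
   of elements of the Bergman space is equality of HOL functions. *)
definition bergman :: "(complex \<Rightarrow> complex) set" where
  "bergman = {f. f holomorphic_on unit_disk \<and> (\<forall>z. z \<notin> unit_disk \<longrightarrow> f z = 0) \<and>
                 integrable disk_area (\<lambda>z. (cmod (f z))\<^sup>2)}"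

definition bergman_inner :: "(complex \<Rightarrow> complex) \<Rightarrow> (complex \<Rightarrow> complex) \<Rightarrow> complex" where
  "bergman_inner f g = (LINT z|disk_area. f z * cnj (g z))"

definition bergman_norm :: "(complex \<Rightarrow> complex) \<Rightarrow> real" where
  "bergman_norm f = sqrt (LINT z|disk_area. (cmod (f z))\<^sup>2)"

type_synonym bergman_op = "(complex \<Rightarrow> complex) \<Rightarrow> (complex \<Rightarrow> complex)"

(* Operators are extensional, i.e. undefined off the Bergman space, so that equality of operators
   is equality of HOL functions. *)
definition bounded_op :: "bergman_op \<Rightarrow> bool" where
  "bounded_op T \<longleftrightarrow>
     T \<in> bergman \<rightarrow>\<^sub>E bergman \<and>
     (\<forall>f\<in>bergman. \<forall>g\<in>bergman. T (\<lambda>z. f z + g z) = (\<lambda>z. T f z + T g z)) \<and>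
     (\<forall>c. \<forall>f\<in>bergman. T (\<lambda>z. c * f z) = (\<lambda>z. c * T f z)) \<and>
     (\<exists>C. \<forall>f\<in>bergman. bergman_norm (T f) \<le> C * bergman_norm f)"

definition adjoint_op :: "bergman_op \<Rightarrow> bergman_op" where
  "adjoint_op T = (THE S. bounded_op S \<and>
     (\<forall>f\<in>bergman. \<forall>g\<in>bergman. bergman_inner (T f) g = bergman_inner f (S g)))"

definition commutant :: "bergman_op set \<Rightarrow> bergman_op set" where
  "commutant \<A> = {S. bounded_op S \<and> (\<forall>T\<in>\<A>. \<forall>f\<in>bergman. S (T f) = T (S f))}"

definition mult_op :: "(complex \<Rightarrow> complex) \<Rightarrow> bergman_op" where
  "mult_op \<phi> = (\<lambda>f\<in>bergman. \<lambda>z. \<phi> z * f z)"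

definition V_star :: "(complex \<Rightarrow> complex) \<Rightarrow> bergman_op set" where
  "V_star \<phi> = commutant {mult_op \<phi>, adjoint_op (mult_op \<phi>)}"

definition scalar_ops :: "bergman_op set" where
  "scalar_ops = range (\<lambda>c. \<lambda>f\<in>bergman. \<lambda>z. c * f z)"

section \<open>Thin Blaschke products\<close>

definition blaschke_factor :: "complex \<Rightarrow> complex \<Rightarrow> complex" where
  "blaschke_factor a z =
     (if a = 0 then z else of_real (cmod a) / a * ((a - z) / (1 - cnj a * z)))"

(* B is, on the disk, the infinite Blaschke product with zero sequence a (zeros are repeated
   according to multiplicity), up to a unimodular constant; the values of B off the disk are
   irrelevant. *)
definition is_blaschke_product :: "(nat \<Rightarrow> complex) \<Rightarrow> (complex \<Rightarrow> complex) \<Rightarrow> bool" where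
  "is_blaschke_product a B \<longleftrightarrow>
     (\<forall>n. a n \<in> unit_disk) \<and> summable (\<lambda>n. 1 - cmod (a n)) \<and>
     (\<exists>c. cmod c = 1 \<and> (\<forall>z\<in>unit_disk. B z = c * (\<Prod>n. blaschke_factor (a n) z)))"

definition pseudohyp_dist :: "complex \<Rightarrow> complex \<Rightarrow> real" where
  "pseudohyp_dist z w = cmod ((w - z) / (1 - cnj w * z))"

(* The product over all j other than k is written as a product over all j with k-th factor 1.
   It may be 0: finitely many zeros of B may be multiple. *)
definition thin_blaschke_product :: "(complex \<Rightarrow> complex) \<Rightarrow> bool" where
  "thin_blaschke_product B \<longleftrightarrow>
     (\<exists>a. is_blaschke_product a B \<and>
          (\<lambda>k. \<Prod>j. if j = k then 1 else pseudohyp_dist (a j) (a k)) \<longlonglongrightarrow> 1)"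

definition disk_zeros :: "(complex \<Rightarrow> complex) \<Rightarrow> complex set" where
  "disk_zeros B = {z\<in>unit_disk. B z = 0}"

section \<open>The Riemann surface\<close>

definition critical_values :: "(complex \<Rightarrow> complex) \<Rightarrow> complex set" where
  "critical_values B = {B z | z. z \<in> unit_disk \<and> deriv B z = 0}"

definition regular_domain :: "(complex \<Rightarrow> complex) \<Rightarrow> complex set" where
  "regular_domain B = {z\<in>unit_disk. B z \<notin> critical_values B}"

definition riemann_surface :: "(complex \<Rightarrow> complex) \<Rightarrow> (complex \<times> complex) set" where
  "riemann_surface B = {(z, w). z \<in> regular_domain B \<and> w \<in> unit_disk \<and> B z = B w}"

definition trivial_component :: "(complex \<Rightarrow> complex) \<Rightarrow> (complex \<times> complex) set" where
  "trivial_component B = {(z, z) | z. z \<in> regular_domain B}"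

definition nontrivial_components :: "(complex \<Rightarrow> complex) \<Rightarrow> (complex \<times> complex) set set" where
  "nontrivial_components B = components (riemann_surface B) - {trivial_component B}"

(* The common number of points, possibly infinite, of the fibres of a component G over the
   regular domain. *)
definition multiplicity_of_component ::
    "(complex \<Rightarrow> complex) \<Rightarrow> (complex \<times> complex) set \<Rightarrow> enat" where
  "multiplicity_of_component B G =
     (THE m. \<forall>z\<in>regular_domain B.
        m = (if finite {w. (z, w) \<in> G} then enat (card {w. (z, w) \<in> G}) else \<infinity>))"

end

theory Submission
  imports Defs "HOL-Complex_Analysis.Complex_Analysis"
begin

text \<open>Over sets where $|B|$ stays away from 1, the hyperbolic derivative of a thin Blaschke product
  tends to 1 at the circle (Hoffman's minimum principle combined with the Schwarz-Pick lemma). Hence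
  $B$ is evenly covered over its regular values, with sheets of controlled hyperbolic size.

  Let $U$ commute with $M_B$ and $M_B^*$. Testing $U$ and its adjoint against weights that shrink to a
  regular value gives an identity between point values on the fibre. For the divided differences of
  $B$ it yields a kernel on the Riemann surface that is both holomorphic and antiholomorphic along the
  sheets, hence constant on each component. A Bergman function is $o(1/(1-|w|))$ along a fibre, which
  forces the constant to be 0 on a component of infinite multiplicity; if only the trivial component
  survives, then $U$ is a scalar.

  Conversely, let $G$ be a nontrivial component of finite multiplicity. Its converse has finite
  multiplicity as well: otherwise the product of a Moebius function over the fibres of $G$ is a
  bounded holomorphic function with too large a derivative at points tending to the circle.
  Then $f \mapsto \sum_{(z,w) \in G} f(w) B'(z)/B'(w)$ is a bounded operator whose adjoint is
  the same operator for the converse of $G$; both commute with $M_B$, and it is not a scalar.\<close>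

section \<open>Change of variables under injective holomorphic maps\<close>

text \<open>The branches w = \<rho>(z) of B(w) = B(z) exist only locally, so U cannot be written at
  once as a sum of weighted compositions c (f o \<rho>) \<rho>'; its coefficients are recovered by
  testing. Commutation with powers of B - l makes <U f, g> and <f, V g>, V the adjoint of U, agree
  after insertion of any polynomial in |B - l|^2, hence of any continuous function of it, and bumps
  around l localise to the fibre. Possibly infinitely many points contribute there, but the divided
  difference of B at w vanishes at all other points of the fibre, so one coefficient remains.
  Uniform sheet sizes control the other sheets together: a zero at the centre of each gains one
  power of the radius over the area. In the other direction each sum is finite, but its L^2 norm
  counts how often a point w is hit, which is the multiplicity of the converse; hence that has to be
  finite before the operator is even bounded. The factor B'(z)/B'(w) is \<rho>'(z), with which
  substitution becomes isometric.\<close>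

definition vec_of :: "complex \<Rightarrow> real^2" where
  "vec_of z = (\<chi> i. if i = 1 then Re z else Im z)"

definition of_vec :: "real^2 \<Rightarrow> complex" where
  "of_vec v = Complex (v $ 1) (v $ 2)"

lemma of_vec_vec_of [simp]: "of_vec (vec_of z) = z"
  by (simp add: of_vec_def vec_of_def)

lemma vec_of_of_vec [simp]: "vec_of (of_vec v) = v"
  by (simp add: of_vec_def vec_of_def vec_eq_iff forall_2)

lemma linear_vec_of: "linear vec_of"
  by (rule linearI) (auto simp: vec_of_def vec_eq_iff)

lemma linear_of_vec: "linear of_vec"
  by (rule linearI) (auto simp: of_vec_def complex_eq_iff)

lemma bounded_linear_vec_of: "bounded_linear vec_of"
  using linear_vec_of by (simp add: linear_conv_bounded_linear)

lemma bounded_linear_of_vec: "bounded_linear of_vec"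
  using linear_of_vec by (simp add: linear_conv_bounded_linear)

lemma vec_of_measurable [measurable]: "vec_of \<in> borel_measurable borel"
  by (intro borel_measurable_continuous_onI linear_continuous_on bounded_linear_vec_of)

lemma of_vec_measurable [measurable]: "of_vec \<in> borel_measurable borel"
  by (intro borel_measurable_continuous_onI linear_continuous_on bounded_linear_of_vec)

lemma vec_of_image: "vec_of ` X = of_vec -` X"
  by (force simp: image_iff) 

text \<open>Lebesgue measure is determined by boxes, and taking coordinates maps boxes to boxes with
  the same side lengths. The passage to \<open>real^2\<close> makes Jacobian determinants of
  matrices available.\<close>

lemma lborel_vec_of: "distr lborel borel vec_of = lborel"
proof (rule lborel_eqI[symmetric])
  fix l u :: "real^2"
  assume le: "\<And>b. b \<in> Basis \<Longrightarrow> l \<bullet> b \<le> u \<bullet> b"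
  have le': "l $ i \<le> u $ i" for i
    using le[of "axis i 1"] by (simp add: axis_in_Basis_iff cart_eq_inner_axis)
  have eq: "vec_of -` box l u = box (of_vec l) (of_vec u)"
    by (auto simp: mem_box_cart in_box_complex_iff vec_of_def of_vec_def forall_2)
  have "emeasure (distr lborel borel vec_of) (box l u) = emeasure lborel (box (of_vec l) (of_vec u))"
    by (subst emeasure_distr) (auto simp: eq)
  also have "\<dots> = (\<Prod>b\<in>Basis. (of_vec u - of_vec l) \<bullet> b)"
    by (rule emeasure_lborel_box) (auto simp: Basis_complex_def of_vec_def le')
  also have "(\<Prod>b\<in>Basis. (of_vec u - of_vec l) \<bullet> b) = (\<Prod>b\<in>Basis. (u - l) \<bullet> b)"
  proof -
    have ba: "(Basis :: (real^2) set) = {axis 1 1, axis 2 1}"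
      by (auto simp: Basis_vec_def UNIV_2)
    have "axis 1 1 \<noteq> (axis 2 1 :: real^2)"
      by (simp add: axis_eq_axis)
    then show ?thesis
      unfolding ba Basis_complex_def
      by (simp add: of_vec_def inner_axis)
  qed
  finally show "emeasure (distr lborel borel vec_of) (box l u) = (\<Prod>b\<in>Basis. (u - l) \<bullet> b)" .
qed simp

lemma emeasure_vec_of_image:
  assumes "X \<in> sets borel"
  shows "emeasure lborel (vec_of ` X) = emeasure lborel X" "vec_of ` X \<in> sets borel"
proof -
  show b: "vec_of ` X \<in> sets borel"
    unfolding vec_of_image using measurable_sets[OF of_vec_measurable assms] by simp
  have "emeasure lborel (vec_of ` X) = emeasure (distr lborel borel vec_of) (vec_of ` X)"
    by (simp add: lborel_vec_of)
  also have "\<dots> = emeasure lborel (vec_of -` vec_of ` X)"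
    by (subst emeasure_distr) (auto simp: b)
  also have "vec_of -` vec_of ` X = X"
    by (metis inj_on_inverseI inj_vimage_image_eq of_vec_vec_of)
  finally show "emeasure lborel (vec_of ` X) = emeasure lborel X" .
qed

text \<open>The image of \<open>A\<close> is the preimage of \<open>A\<close> under the holomorphic
  inverse of \<open>g\<close>, whose domain is open.\<close>

lemma holomorphic_image_borel:
  assumes "open S" "g holomorphic_on S" "inj_on g S" "A \<subseteq> S" "A \<in> sets borel"
  shows "g ` A \<in> sets borel"
proof -
  obtain h where h: "h holomorphic_on g ` S" "\<And>z. z \<in> S \<Longrightarrow> h (g z) = z"
    using holomorphic_has_inverse[OF assms(2,1,3)] by metis
  have og: "open (g ` S)"
    using assms open_mapping_thm3 by blast
  have "h \<in> borel_measurable (restrict_space borel (g ` S))"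
    by (intro borel_measurable_continuous_on_restrict holomorphic_on_imp_continuous_on h)
  then have "h -` A \<inter> space (restrict_space borel (g ` S)) \<in> sets (restrict_space borel (g ` S))"
    using assms(5) measurable_sets by blast
  moreover have "h -` A \<inter> space (restrict_space borel (g ` S)) = g ` A"
    using h(2) assms(4) by (auto simp: space_restrict_space)
  ultimately show ?thesis
    using og by (simp add: sets_restrict_space_iff)
qed

lemma borel_measurable_indicator_continuous:
  fixes f :: "complex \<Rightarrow> 'b::{real_normed_vector, second_countable_topology}"
  assumes "open S" "continuous_on S f" "A \<subseteq> S" "A \<in> sets borel"
  shows "(\<lambda>x. indicator A x *\<^sub>R f x) \<in> borel_measurable borel"
proof -
  have "(\<lambda>x. indicator S x *\<^sub>R f x) \<in> borel_measurable borel"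
    using assms by (intro borel_measurable_continuous_on_indicator) auto
  from borel_measurable_scaleR[OF borel_measurable_indicator this, of A]
  have "(\<lambda>x. indicator A x *\<^sub>R (indicator S x *\<^sub>R f x)) \<in> borel_measurable borel"
    using assms(4) by simp
  moreover have "(\<lambda>x. indicator A x *\<^sub>R (indicator S x *\<^sub>R f x)) = (\<lambda>x. indicator A x *\<^sub>R f x)"
  proof
    fix x show "indicator A x *\<^sub>R (indicator S x *\<^sub>R f x) = indicator A x *\<^sub>R f x"
      using subsetD[OF assms(3), of x] by (cases "x \<in> A") simp_all
  qed
  ultimately show ?thesis by (simp only:)
qed

text \<open>Multiplication by a complex number a acts on the plane with determinant |a|^2, so the
  real change of variables theorem produces the density |g'|^2. Boundedness of the image makes its
  measure a finite real number.\<close>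

lemma emeasure_holomorphic_image:
  assumes S: "open S" "g holomorphic_on S" "inj_on g S" "bounded (g ` S)"
    and A: "A \<subseteq> S" "A \<in> sets borel"
  shows "emeasure lborel (g ` A) = (\<integral>\<^sup>+x. ennreal ((cmod (deriv g x))\<^sup>2) * indicator A x \<partial>lborel)"
proof -
  define G where "G = vec_of \<circ> g \<circ> of_vec"
  define G' where "G' = (\<lambda>v. vec_of \<circ> (\<lambda>h. deriv g (of_vec v) * h) \<circ> of_vec)"
  define A2 where "A2 = vec_of ` A"
  have A2b: "A2 \<in> sets borel"
    using emeasure_vec_of_image(2) A(2) A2_def by blast
  have gA: "g ` A \<in> sets borel"
    using holomorphic_image_borel[OF S(1-3) A] .
  have GA: "G ` A2 = vec_of ` (g ` A)"
    by (simp add: G_def A2_def image_image)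
  have der: "(G has_derivative G' v) (at v within A2)" if "v \<in> A2" for v
  proof -
    have "of_vec v \<in> S"
      using that A by (auto simp: A2_def)
    then have "(g has_field_derivative deriv g (of_vec v)) (at (of_vec v))"
      using S holomorphic_derivI by blast
    then have "(g has_derivative (\<lambda>h. deriv g (of_vec v) * h)) (at (of_vec v))"
      by (simp add: has_field_derivative_def)
    then have "(g has_derivative (\<lambda>h. deriv g (of_vec v) * h)) (at (of_vec v) within of_vec ` A2)"
      using has_derivative_at_withinI by blast
    then show ?thesis
      unfolding G_def G'_def
      using bounded_linear_imp_has_derivative[OF bounded_linear_of_vec, of "at v within A2"]
        bounded_linear_imp_has_derivative[OF bounded_linear_vec_of]
      by (intro diff_chain_within) (auto simp: o_def)
  qed
  have inj: "inj_on G A2"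
    unfolding G_def A2_def inj_on_def
    using S(3) A(1) by (auto simp: inj_on_def) (metis of_vec_vec_of subsetD)
  have det: "\<bar>det (matrix (G' v))\<bar> = (cmod (deriv g (of_vec v)))\<^sup>2" for v
  proof -
    have a: "of_vec (axis 1 1) = 1" "of_vec (axis 2 1) = \<i>"
      by (auto simp: of_vec_def complex_eq_iff axis_def)
    have "det (matrix (G' v)) = Re (deriv g (of_vec v)) * Re (deriv g (of_vec v))
        + Im (deriv g (of_vec v)) * Im (deriv g (of_vec v))"
      by (simp add: det_2 matrix_def G'_def a vec_of_def)
    also have "\<dots> = (cmod (deriv g (of_vec v)))\<^sup>2"
      by (simp add: cmod_power2 power2_eq_square[symmetric])
    finally show ?thesis
      by (simp only: abs_power2)
  qed
  have bd: "bounded (G ` A2)"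
  proof -
    have "bounded (g ` A)"
      using A(1) S(4) by (meson bounded_subset image_mono)
    then show ?thesis
      unfolding GA by (rule bounded_linear_image[OF _ bounded_linear_vec_of])
  qed
  have lm: "G ` A2 \<in> lmeasurable"
  proof (rule bounded_set_imp_lmeasurable[OF bd])
    show "G ` A2 \<in> sets lebesgue"
      unfolding GA using emeasure_vec_of_image(2)[OF gA] by simp
  qed
  have "((\<lambda>x. \<bar>det (matrix (G' x))\<bar>) has_integral measure lebesgue (G ` A2)) A2"
  proof -
    have "A2 \<in> sets lebesgue" using A2b by simp
    from has_measure_differentiable_image[OF this der inj, of "measure lebesgue (G ` A2)"]
    show ?thesis using lm by simp
  qed
  then have hi: "((\<lambda>v. (cmod (deriv g (of_vec v)))\<^sup>2) has_integral measure lebesgue (G ` A2)) A2"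
    by (simp add: det)
  have meas: "(\<lambda>x. (cmod (deriv g x))\<^sup>2 * indicator A x) \<in> borel_measurable borel"
    using borel_measurable_indicator_continuous[of S "\<lambda>x. (cmod (deriv g x))\<^sup>2" A] S(1) A holomorphic_deriv[OF S(2,1)]
    by (simp add: mult.commute continuous_on_norm continuous_on_power holomorphic_on_imp_continuous_on)
  define F where "F = (\<lambda>x. (cmod (deriv g x))\<^sup>2 * indicator A x)"
  have F[measurable]: "F \<in> borel_measurable borel"
    using meas by (simp add: F_def)
  have "(\<integral>\<^sup>+x. ennreal (F x) \<partial>lborel) = (\<integral>\<^sup>+v. ennreal (F (of_vec v)) \<partial>distr lborel borel vec_of)"
    by (subst nn_integral_distr) simp_all
  also have "\<dots> = (\<integral>\<^sup>+v. ennreal (F (of_vec v)) \<partial>lborel)"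
    by (simp add: lborel_vec_of)
  also have "\<dots> = ennreal (measure lebesgue (G ` A2))"
  proof (rule nn_integral_has_integral_lborel)
    show "(\<lambda>v. F (of_vec v)) \<in> borel_measurable borel"
      by measurable
    have "F (of_vec v) = (if v \<in> A2 then (cmod (deriv g (of_vec v)))\<^sup>2 else 0)" for v
      by (simp add: F_def A2_def indicator_def vec_of_image)
    then show "((\<lambda>v. F (of_vec v)) has_integral measure lebesgue (G ` A2)) UNIV"
      using hi by (simp add: has_integral_restrict_UNIV)
  qed (auto simp: F_def)
  also have "\<dots> = emeasure lebesgue (G ` A2)"
    using lm by (simp add: emeasure_eq_measure2 fmeasurableD2)
  also have "\<dots> = emeasure lborel (g ` A)"
    unfolding GA using emeasure_vec_of_image[OF gA] by simp
  finally have "(\<integral>\<^sup>+x. ennreal (F x) \<partial>lborel) = emeasure lborel (g ` A)" .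
  moreover have "ennreal (F x) = ennreal ((cmod (deriv g x))\<^sup>2) * indicator A x" for x
    by (cases "x \<in> A") (simp_all add: F_def)
  ultimately show ?thesis
    by simp
qed


text \<open>Stated as an equality of measures, the substitution yields both the nonnegative and the
  Bochner version below through the general rules for \<open>distr\<close> and
  \<open>density\<close>. Weight and map are cut off to \<open>A\<close> in order to be measurable
  on the whole plane.\<close>

lemma distr_holomorphic_image:
  assumes S: "open S" "g holomorphic_on S" "inj_on g S" "bounded (g ` S)"
    and A: "A \<subseteq> S" "A \<in> sets borel"
  defines "w \<equiv> \<lambda>x. (cmod (deriv g x))\<^sup>2 * indicator A x"
    and "t \<equiv> \<lambda>x. indicator A x *\<^sub>R g x"
  shows "distr (density lborel (\<lambda>x. ennreal (w x))) borel t = density lborel (indicator (g ` A))"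
    and "w \<in> borel_measurable borel" and "t \<in> borel_measurable borel"
proof -
  have gA: "g ` A \<in> sets borel"
    using holomorphic_image_borel[OF S(1-3) A] .
  have dh: "deriv g holomorphic_on S"
    using S holomorphic_deriv by blast
  show w[measurable]: "w \<in> borel_measurable borel"
    using borel_measurable_indicator_continuous[of S "\<lambda>x. (cmod (deriv g x))\<^sup>2" A] S(1) A dh
    by (simp add: w_def mult.commute continuous_on_norm continuous_on_power holomorphic_on_imp_continuous_on)
  show t[measurable]: "t \<in> borel_measurable borel"
    unfolding t_def
    using borel_measurable_indicator_continuous[of S g A] S(1,2) A
    by (simp add: holomorphic_on_imp_continuous_on)
  show "distr (density lborel (\<lambda>x. ennreal (w x))) borel t = density lborel (indicator (g ` A))"
  proof (rule measure_eqI)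
    fix Y assume "Y \<in> sets (distr (density lborel (\<lambda>x. ennreal (w x))) borel t)"
    then have Y[measurable]: "Y \<in> sets borel" by simp
    define A' where "A' = A \<inter> t -` Y"
    have A'[measurable]: "A' \<in> sets borel"
      using measurable_sets[OF t Y] A(2) by (simp add: A'_def)
    have gA': "g ` A' = Y \<inter> g ` A"
      by (auto simp: A'_def t_def)
    have "emeasure (distr (density lborel (\<lambda>x. ennreal (w x))) borel t) Y
        = emeasure (density lborel (\<lambda>x. ennreal (w x))) (t -` Y)"
      by (subst emeasure_distr) simp_all
    also have "\<dots> = (\<integral>\<^sup>+x. ennreal (w x) * indicator (t -` Y) x \<partial>lborel)"
      using measurable_sets[OF t Y] by (subst emeasure_density) simp_all
    also have "\<dots> = (\<integral>\<^sup>+x. ennreal ((cmod (deriv g x))\<^sup>2) * indicator A' x \<partial>lborel)"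
      by (intro nn_integral_cong) (simp add: w_def A'_def split: split_indicator)
    also have "\<dots> = emeasure lborel (g ` A')"
    proof (rule emeasure_holomorphic_image[symmetric, OF S])
      show "A' \<subseteq> S" using A(1) by (auto simp: A'_def)
    qed (rule A')
    also have "\<dots> = emeasure (density lborel (indicator (g ` A))) Y"
    proof -
      have "emeasure (density lborel (indicator (g ` A))) Y = (\<integral>\<^sup>+x. indicator (g ` A) x * indicator Y x \<partial>lborel)"
        using gA by (subst emeasure_density) simp_all
      also have "\<dots> = (\<integral>\<^sup>+x. indicator (g ` A') x \<partial>lborel)"
        unfolding gA' by (intro nn_integral_cong) (simp split: split_indicator)
      also have "\<dots> = emeasure lborel (g ` A')"
        using gA gA' Y by (intro nn_integral_indicator) simp
      finally show ?thesis by simp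
    qed
    finally show "emeasure (distr (density lborel (\<lambda>x. ennreal (w x))) borel t) Y
      = emeasure (density lborel (indicator (g ` A))) Y" .
  qed simp
qed

lemma nn_integral_holomorphic_image:
  assumes S: "open S" "g holomorphic_on S" "inj_on g S" "bounded (g ` S)"
    and A: "A \<subseteq> S" "A \<in> sets borel" and h[measurable]: "h \<in> borel_measurable borel"
  shows "(\<integral>\<^sup>+y. h y * indicator (g ` A) y \<partial>lborel)
       = (\<integral>\<^sup>+x. h (g x) * ennreal ((cmod (deriv g x))\<^sup>2) * indicator A x \<partial>lborel)"
proof -
  note D = distr_holomorphic_image[OF S A]
  note [measurable] = D(2,3)
  have gA[measurable]: "g ` A \<in> sets borel"
    using holomorphic_image_borel[OF S(1-3) A] .
  have "(\<integral>\<^sup>+y. h y * indicator (g ` A) y \<partial>lborel) = (\<integral>\<^sup>+y. h y \<partial>density lborel (indicator (g ` A)))"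
    by (subst nn_integral_density) (auto simp: mult.commute)
  also have "\<dots> = (\<integral>\<^sup>+y. h y \<partial>distr (density lborel (\<lambda>x. ennreal ((cmod (deriv g x))\<^sup>2 * indicator A x))) borel
      (\<lambda>x. indicator A x *\<^sub>R g x))"
    by (simp only: D(1))
  also have "\<dots> = (\<integral>\<^sup>+x. ennreal ((cmod (deriv g x))\<^sup>2 * indicator A x) * h (indicator A x *\<^sub>R g x) \<partial>lborel)"
    by (subst nn_integral_distr, measurable, subst nn_integral_density) auto
  also have "\<dots> = (\<integral>\<^sup>+x. h (g x) * ennreal ((cmod (deriv g x))\<^sup>2) * indicator A x \<partial>lborel)"
    by (intro nn_integral_cong) (auto split: split_indicator simp: mult.commute)
  finally show ?thesis .
qed

lemma integral_holomorphic_image: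
  fixes h :: "complex \<Rightarrow> complex"
  assumes S: "open S" "g holomorphic_on S" "inj_on g S" "bounded (g ` S)"
    and A: "A \<subseteq> S" "A \<in> sets borel" and h[measurable]: "h \<in> borel_measurable borel"
  shows "set_integrable lborel (g ` A) h \<longleftrightarrow>
      set_integrable lborel A (\<lambda>x. h (g x) * (cmod (deriv g x))\<^sup>2)" (is ?P)
    and "(LINT y:g ` A|lborel. h y) = (LINT x:A|lborel. h (g x) * (cmod (deriv g x))\<^sup>2)" (is ?Q)
proof -
  note D = distr_holomorphic_image[OF S A]
  note [measurable] = D(2,3)
  have gA[measurable]: "g ` A \<in> sets borel"
    using holomorphic_image_borel[OF S(1-3) A] .
  let ?w = "\<lambda>x. (cmod (deriv g x))\<^sup>2 * indicator A x"
  let ?t = "\<lambda>x. indicator A x *\<^sub>R g x"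
  have i: "(indicator (g ` A) :: complex \<Rightarrow> ennreal) = (\<lambda>x. ennreal (indicator (g ` A) x))"
    by (auto simp: fun_eq_iff split: split_indicator)
  have eq: "?w x *\<^sub>R h (?t x) = indicator A x *\<^sub>R (h (g x) * (cmod (deriv g x))\<^sup>2)" for x
    by (auto split: split_indicator simp: scaleR_conv_of_real)
  have "set_integrable lborel (g ` A) h \<longleftrightarrow> integrable (density lborel (indicator (g ` A))) h"
    unfolding set_integrable_def i by (subst integrable_density) auto
  also have "\<dots> \<longleftrightarrow> integrable (distr (density lborel (\<lambda>x. ennreal (?w x))) borel ?t) h"
    by (simp only: D(1))
  also have "\<dots> \<longleftrightarrow> integrable lborel (\<lambda>x. ?w x *\<^sub>R h (?t x))"
    by (subst integrable_distr_eq, measurable, subst integrable_density) auto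
  finally show ?P
    by (simp only: eq set_integrable_def)
  have "(LINT y:g ` A|lborel. h y) = integral\<^sup>L (density lborel (indicator (g ` A))) h"
    unfolding set_lebesgue_integral_def i by (subst integral_density) auto
  also have "\<dots> = integral\<^sup>L (distr (density lborel (\<lambda>x. ennreal (?w x))) borel ?t) h"
    by (simp only: D(1))
  also have "\<dots> = integral\<^sup>L lborel (\<lambda>x. ?w x *\<^sub>R h (?t x))"
    by (subst integral_distr, measurable, subst integral_density) auto
  finally show ?Q
    by (simp only: eq set_lebesgue_integral_def)
qed

section \<open>The Bergman space and its operators\<close>

lemma ball_in_borel [measurable]: "ball a r \<in> sets borel"
  for a :: "'a::metric_space"
  by (simp add: borel_open)

lemma emeasure_unit_disk: "emeasure lborel unit_disk = ennreal (measure lborel unit_disk)"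
  "0 < measure lborel unit_disk"
proof -
  have "emeasure lborel unit_disk < \<infinity>"
    using emeasure_bounded_finite[of unit_disk] by simp
  then show e: "emeasure lborel unit_disk = ennreal (measure lborel unit_disk)"
    by (simp add: emeasure_eq_ennreal_measure less_top[symmetric])
  show "0 < measure lborel unit_disk"
    using content_ball_pos[of 1 "0::complex"] by (simp add: measure_def)
qed

lemma disk_area_density:
  "disk_area = density lborel (\<lambda>x. ennreal (indicator unit_disk x / measure lborel unit_disk))"
  unfolding disk_area_def uniform_measure_def emeasure_unit_disk(1)
proof (rule density_cong)
  show "AE x in lborel. indicator unit_disk x / ennreal (measure lborel unit_disk)
      = ennreal (indicator unit_disk x / measure lborel unit_disk)"
    using emeasure_unit_disk(2)
    by (intro AE_I2) (auto split: split_indicator simp: divide_ennreal simp flip: ennreal_1)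
qed measurable

lemma sets_disk_area [measurable_cong, simp]: "sets disk_area = sets borel"
  and space_disk_area [simp]: "space disk_area = UNIV"
  by (simp_all add: disk_area_def)

lemma nn_integral_disk_area:
  assumes [measurable]: "f \<in> borel_measurable borel"
  shows "ennreal (measure lborel unit_disk) * (\<integral>\<^sup>+x. f x \<partial>disk_area) = (\<integral>\<^sup>+x. f x * indicator unit_disk x \<partial>lborel)"
proof -
  have "(\<integral>\<^sup>+x. f x \<partial>disk_area) = (\<integral>\<^sup>+x. ennreal (indicator unit_disk x / measure lborel unit_disk) * f x \<partial>lborel)"
    unfolding disk_area_density by (subst nn_integral_density) simp_all
  also have "ennreal (measure lborel unit_disk) * \<dots>
      = (\<integral>\<^sup>+x. ennreal (measure lborel unit_disk) * (ennreal (indicator unit_disk x / measure lborel unit_disk) * f x) \<partial>lborel)"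
    by (subst nn_integral_cmult) simp_all
  also have "\<dots> = (\<integral>\<^sup>+x. f x * indicator unit_disk x \<partial>lborel)"
  proof (intro nn_integral_cong)
    fix x
    have "ennreal (measure lborel unit_disk) * ennreal (1 / measure lborel unit_disk) = 1"
      using emeasure_unit_disk(2) by (subst ennreal_mult[symmetric]) (simp_all add: less_imp_le)
    then show "ennreal (measure lborel unit_disk) * (ennreal (indicator unit_disk x / measure lborel unit_disk) * f x)
      = f x * indicator unit_disk x"
      by (cases "x \<in> unit_disk") (simp_all add: mult.assoc[symmetric])
  qed
  finally show "ennreal (measure lborel unit_disk) * (\<integral>\<^sup>+x. f x \<partial>disk_area) = (\<integral>\<^sup>+x. f x * indicator unit_disk x \<partial>lborel)" .
qed

lemma integral_disk_area:
  fixes f :: "complex \<Rightarrow> 'b::{banach, second_countable_topology}"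
  assumes [measurable]: "f \<in> borel_measurable borel"
  shows "integrable disk_area f \<longleftrightarrow> set_integrable lborel unit_disk f"
    and "(LINT x|disk_area. f x) = (1 / measure lborel unit_disk) *\<^sub>R (LINT x:unit_disk|lborel. f x)"
proof -
  let ?c = "measure lborel unit_disk"
  have eq: "(indicator unit_disk x / ?c) *\<^sub>R f x = (1 / ?c) *\<^sub>R (indicator unit_disk x *\<^sub>R f x)" for x
    by simp
  have "integrable disk_area f \<longleftrightarrow> integrable lborel (\<lambda>x. (indicator unit_disk x / ?c) *\<^sub>R f x)"
    unfolding disk_area_density by (subst integrable_density) simp_all
  then show "integrable disk_area f \<longleftrightarrow> set_integrable lborel unit_disk f"
    unfolding eq set_integrable_def
    using emeasure_unit_disk(2) integrable_scaleR_right[of "1 / ?c" lborel "\<lambda>x. indicator unit_disk x *\<^sub>R f x"]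
      integrable_scaleR_right[of "?c" lborel "\<lambda>x. (1 / ?c) *\<^sub>R indicator unit_disk x *\<^sub>R f x"]
    by auto
  have "(LINT x|disk_area. f x) = (LINT x|lborel. (indicator unit_disk x / ?c) *\<^sub>R f x)"
    unfolding disk_area_density by (subst integral_density) simp_all
  then show "(LINT x|disk_area. f x) = (1 / ?c) *\<^sub>R (LINT x:unit_disk|lborel. f x)"
    unfolding eq set_lebesgue_integral_def by (simp only: integral_scaleR_right)
qed

lemma finite_measure_disk_area: "finite_measure disk_area"
  and measure_disk_area: "measure disk_area UNIV = 1"
proof -
  have "emeasure disk_area UNIV = 1"
    unfolding disk_area_def using emeasure_unit_disk
    by (subst emeasure_uniform_measure) (simp_all add: divide_eq_1_ennreal)
  then show "finite_measure disk_area" "measure disk_area UNIV = 1"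
    by (auto intro: finite_measureI simp: measure_def)
qed

section \<open>Sub-mean value inequality for area integrals of |f|^2\<close>

lemma circle_mean_value:
  assumes "h holomorphic_on S" "open S" "cball 0 1 \<subseteq> S"
  shows "((\<lambda>t. h (exp (2 * of_real pi * \<i> * of_real t))) has_integral h 0) {0..1}"
proof -
  have "((\<lambda>u. h u / (u - 0)) has_contour_integral (2 * of_real pi * \<i>) * h 0) (circlepath 0 1)"
  proof (rule Cauchy_integral_circlepath)
    show "continuous_on (cball 0 1) h"
      using assms by (meson holomorphic_on_imp_continuous_on holomorphic_on_subset)
    show "h holomorphic_on unit_disk"
      using assms by (meson ball_subset_cball holomorphic_on_subset order_trans)
  qed simp
  then have "((\<lambda>t. h (circlepath 0 1 t) / circlepath 0 1 t * vector_derivative (circlepath 0 1) (at t within {0..1}))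
      has_integral (2 * of_real pi * \<i>) * h 0) {0..1}"
    by (simp add: has_contour_integral_def)
  then have "((\<lambda>t. (2 * of_real pi * \<i>) * h (circlepath 0 1 t)) has_integral (2 * of_real pi * \<i>) * h 0) {0..1}"
    by (rule has_integral_eq[rotated]) (simp add: vector_derivative_circlepath01, simp add: circlepath)
  then have "((\<lambda>t. inverse (2 * of_real pi * \<i>) * ((2 * of_real pi * \<i>) * h (circlepath 0 1 t)))
      has_integral inverse (2 * of_real pi * \<i>) * ((2 * of_real pi * \<i>) * h 0)) {0..1}"
    by (rule has_integral_mult_right)
  moreover have "((\<lambda>t. h (circlepath 0 1 t)) has_integral h 0) {0..1}" if "((\<lambda>t. inverse (2 * of_real pi * \<i>) * ((2 * of_real pi * \<i>) * h (circlepath 0 1 t)))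
      has_integral inverse (2 * of_real pi * \<i>) * ((2 * of_real pi * \<i>) * h 0)) {0..1}"
  proof -
    have "inverse (2 * of_real pi * \<i>) * ((2 * of_real pi * \<i>) * X) = X" for X :: complex
      using left_inverse[of "2 * of_real pi * \<i> :: complex"] by (simp only: mult.assoc[symmetric]) simp
    with that show ?thesis by (simp only:)
  qed
  ultimately show ?thesis
    by (simp add: circlepath)
qed

text \<open>Substitution by a linear map whose derivative has modulus 1 and which preserves the
  disc.\<close>

lemma nn_integral_rotation:
  assumes [measurable]: "h \<in> borel_measurable borel" and "cmod a = 1"
  shows "(\<integral>\<^sup>+w. h (a * w) * indicator (ball 0 s) w \<partial>lborel) = (\<integral>\<^sup>+w. h w * indicator (ball 0 s) w \<partial>lborel)"
proof -
  have [simp]: "a \<noteq> 0" using assms by auto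
  have im: "(\<lambda>w. a * w) ` ball 0 s = ball 0 s"
  proof -
    have "x \<in> (\<lambda>w. a * w) ` ball 0 s" if "x \<in> ball 0 s" for x
      using that assms(2) by (intro image_eqI[of _ _ "x / a"]) (auto simp: norm_divide)
    then show ?thesis using assms(2) by (auto simp: norm_mult)
  qed
  have d: "deriv (\<lambda>w. a * w) x = a" for x
    by simp
  have "(\<integral>\<^sup>+y. h y * indicator ((\<lambda>w. a * w) ` ball 0 s) y \<partial>lborel)
     = (\<integral>\<^sup>+x. h (a * x) * ennreal ((cmod (deriv (\<lambda>w. a * w) x))\<^sup>2) * indicator (ball 0 s) x \<partial>lborel)"
    by (rule nn_integral_holomorphic_image[of "ball 0 s"])
      (auto intro!: holomorphic_intros inj_onI simp: im)
  then show ?thesis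
    unfolding im d by (simp add: assms(2))
qed

text \<open>Areas of discs are expressed through the area of the unit disk, which later cancels
  against the normalisation of \<open>disk_area\<close>.\<close>

lemma emeasure_ball_scale:
  fixes x :: complex
  assumes "0 < s"
  shows "emeasure lborel (ball x s) = ennreal (measure lborel unit_disk * s\<^sup>2)"
proof -
  have im: "(\<lambda>w. x + of_real s * w) ` ball 0 1 = ball x s"
  proof -
    have "y \<in> (\<lambda>w. x + of_real s * w) ` ball 0 1" if "y \<in> ball x s" for y
      using that assms by (intro image_eqI[of _ _ "(y - x) / of_real s"]) (auto simp: norm_divide dist_norm norm_minus_commute)
    then show ?thesis using assms by (auto simp: norm_mult dist_norm)
  qed
  have d: "deriv (\<lambda>w. x + of_real s * w) z = of_real s" for z
    by (rule DERIV_imp_deriv) (auto intro!: derivative_eq_intros)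
  have "emeasure lborel ((\<lambda>w. x + of_real s * w) ` ball 0 1)
     = (\<integral>\<^sup>+z. ennreal ((cmod (deriv (\<lambda>w. x + of_real s * w) z))\<^sup>2) * indicator (ball 0 1) z \<partial>lborel)"
    using assms by (intro emeasure_holomorphic_image[of "ball 0 1"])
      (auto intro!: holomorphic_intros inj_onI simp: im)
  also have "\<dots> = ennreal (s\<^sup>2) * emeasure lborel unit_disk"
    unfolding d by (subst nn_integral_cmult) simp_all
  finally show ?thesis
    unfolding im emeasure_unit_disk(1) by (simp add: ennreal_mult' mult.commute)
qed

text \<open>For fixed w the value |f(x)|^2 is at most the mean of |f|^2 over the circle through x +
  w around x. Integrating over w, Fubini and rotation invariance of the disc remove the circle
  variable; this takes the place of polar coordinates.\<close>

theorem area_submean_value: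
  assumes f: "f holomorphic_on S" "open S" "cball x s \<subseteq> S" "0 < s"
  shows "ennreal ((cmod (f x))\<^sup>2 * (measure lborel unit_disk * s\<^sup>2)) \<le> (\<integral>\<^sup>+w. ennreal ((cmod (f w))\<^sup>2) * indicator (ball x s) w \<partial>lborel)"
proof -
  define F where "F = (\<lambda>w. ennreal (indicator (ball x s) w *\<^sub>R (cmod (f w))\<^sup>2))"
  have F[measurable]: "F \<in> borel_measurable borel"
    unfolding F_def using f
    by (intro measurable_compose[OF _ measurable_ennreal] borel_measurable_indicator_continuous[of S])
      (auto intro!: continuous_intros holomorphic_on_imp_continuous_on)
  define e where "e = (\<lambda>t::real. exp (2 * of_real pi * \<i> * of_real t) :: complex)"
  have [simp]: "cmod (e t) = 1" for t
    by (simp add: e_def)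
  have [measurable]: "e \<in> borel_measurable borel"
    unfolding e_def by (intro borel_measurable_continuous_onI continuous_intros)
  have trans: "(\<integral>\<^sup>+w. G (x + w) \<partial>lborel) = (\<integral>\<^sup>+w. G w \<partial>lborel)" if [measurable]: "G \<in> borel_measurable borel" for G :: "complex \<Rightarrow> ennreal"
  proof -
    have "(\<integral>\<^sup>+w. G w \<partial>distr lborel borel ((+) x)) = (\<integral>\<^sup>+w. G (x + w) \<partial>lborel)"
      by (subst nn_integral_distr) simp_all
    then show ?thesis using lborel_distr_plus[of x] by simp
  qed
  have pt: "ennreal ((cmod (f x))\<^sup>2) * indicator (ball 0 s) w \<le> (\<integral>\<^sup>+t. F (x + e t * w) * indicator {0..1} t \<partial>lborel) * indicator (ball 0 s) w" for w
  proof (cases "w \<in> ball 0 s")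
    case True
    \<comment> \<open>Squaring first makes |f|^2 the modulus of a holomorphic function, to which the
      mean value property applies directly.\<close>
    let ?h = "\<lambda>u. (f (x + u * w))\<^sup>2"
    define S' where "S' = (\<lambda>u. x + u * w) -` S"
    have "open S'"
      unfolding S'_def by (intro open_vimage f continuous_intros)
    have "cball 0 1 \<subseteq> S'"
    proof
      fix u :: complex assume "u \<in> cball 0 1"
      then have "cmod (u * w) \<le> 1 * s"
        unfolding norm_mult using True by (intro mult_mono) auto
      then show "u \<in> S'" using f(3) by (auto simp: S'_def dist_norm)
    qed
    have hol: "?h holomorphic_on S'"
      by (intro holomorphic_intros holomorphic_on_compose_gen[of _ S' f S, unfolded o_def] f) (auto simp: S'_def)
    have hi: "((\<lambda>t. ?h (e t)) has_integral ?h 0) {0..1}"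
      unfolding e_def by (rule circle_mean_value[OF hol \<open>open S'\<close> \<open>cball 0 1 \<subseteq> S'\<close>])
    have cont: "continuous_on {0..1} (\<lambda>t. cmod (?h (e t)))"
      using \<open>cball 0 1 \<subseteq> S'\<close>
      by (intro continuous_on_norm continuous_on_compose2[OF holomorphic_on_imp_continuous_on[OF hol]])
        (auto simp: e_def intro!: continuous_intros subsetD[of "cball 0 1" S'])
    then have int: "(\<lambda>t. cmod (?h (e t))) integrable_on {0..1}"
      by (rule integrable_continuous_real)
    have "cmod (?h 0) \<le> integral {0..1} (\<lambda>t. cmod (?h (e t)))"
      using hi integral_norm_bound_integral[of "\<lambda>t. ?h (e t)" "{0..1}" "\<lambda>t. cmod (?h (e t))"] int
      by (auto simp: has_integral_iff)
    then have "ennreal ((cmod (f x))\<^sup>2) \<le> ennreal (integral {0..1} (\<lambda>t. cmod (?h (e t))))"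
      by (intro ennreal_leI) (simp add: norm_power)
    also have "\<dots> = (\<integral>\<^sup>+t. ennreal (indicator {0..1} t * cmod (?h (e t))) \<partial>lborel)"
    proof (rule nn_integral_has_integral_lborel[symmetric])
      show "(\<lambda>t. indicator {0..1} t * cmod (?h (e t))) \<in> borel_measurable borel"
        using borel_measurable_continuous_on_indicator[OF _ cont] by simp
      have "indicator {0..1} t * cmod (?h (e t)) = (if t \<in> {0..1} then cmod (?h (e t)) else 0)" for t
        by simp
      then show "((\<lambda>t. indicator {0..1} t * cmod (?h (e t))) has_integral integral {0..1} (\<lambda>t. cmod (?h (e t)))) UNIV"
        using int by (simp only: has_integral_restrict_UNIV) auto
    qed simp
    also have "\<dots> = (\<integral>\<^sup>+t. F (x + e t * w) * indicator {0..1} t \<partial>lborel)"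
    proof (intro nn_integral_cong)
      fix t :: real
      have "x + e t * w \<in> ball x s" using True by (simp add: dist_norm norm_mult)
      then show "ennreal (indicator {0..1} t * cmod (?h (e t))) = F (x + e t * w) * indicator {0..1} t"
        by (simp add: F_def norm_power split: split_indicator)
    qed
    finally show ?thesis using True by simp
  qed simp
  have "ennreal ((cmod (f x))\<^sup>2 * (measure lborel unit_disk * s\<^sup>2)) = ennreal ((cmod (f x))\<^sup>2) * emeasure lborel (ball (0::complex) s)"
    using f(4) by (simp add: emeasure_ball_scale ennreal_mult')
  also have "\<dots> = (\<integral>\<^sup>+w. ennreal ((cmod (f x))\<^sup>2) * indicator (ball 0 s) w \<partial>(lborel :: complex measure))"
    by (subst nn_integral_cmult) simp_all
  also have "\<dots> \<le> (\<integral>\<^sup>+w. (\<integral>\<^sup>+t. F (x + e t * w) * indicator {0..1} t \<partial>lborel) * indicator (ball 0 s) w \<partial>lborel)"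
    by (intro nn_integral_mono pt)
  also have "\<dots> = (\<integral>\<^sup>+w. (\<integral>\<^sup>+t. F (x + e t * w) * indicator {0..1} t * indicator (ball 0 s) w \<partial>lborel) \<partial>lborel)"
    by (subst nn_integral_multc) simp_all
  also have "\<dots> = (\<integral>\<^sup>+t. (\<integral>\<^sup>+w. F (x + e t * w) * indicator {0..1} t * indicator (ball 0 s) w \<partial>lborel) \<partial>lborel)"
    by (rule lborel_pair.Fubini') measurable
  also have "\<dots> = (\<integral>\<^sup>+t. (\<integral>\<^sup>+w. F (x + e t * w) * indicator (ball 0 s) w \<partial>lborel) * indicator {0..1} t \<partial>lborel)"
    by (subst nn_integral_multc[symmetric], measurable) (simp add: ac_simps)
  also have "\<dots> = (\<integral>\<^sup>+t. (\<integral>\<^sup>+w. F (x + w) * indicator (ball 0 s) w \<partial>lborel) * indicator {0..1} (t::real) \<partial>lborel)"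
    by (subst nn_integral_rotation[of "\<lambda>w. F (x + w)"]) simp_all
  also have "\<dots> = (\<integral>\<^sup>+w. F (x + w) * indicator (ball 0 s) w \<partial>lborel)"
    by (subst nn_integral_cmult) simp_all
  also have "\<dots> = (\<integral>\<^sup>+w. F (x + w) \<partial>lborel)"
    by (intro nn_integral_cong) (auto simp: F_def dist_norm split: split_indicator)
  also have "\<dots> = (\<integral>\<^sup>+w. F w \<partial>lborel)"
    by (rule trans) simp
  also have "\<dots> = (\<integral>\<^sup>+w. ennreal ((cmod (f w))\<^sup>2) * indicator (ball x s) w \<partial>lborel)"
    by (intro nn_integral_cong) (auto simp: F_def split: split_indicator)
  finally show ?thesis .
qed

section \<open>The Bergman space as a Hilbert space of functions\<close>

lemma bergmanI:
  assumes "f holomorphic_on unit_disk" "\<And>z. z \<notin> unit_disk \<Longrightarrow> f z = 0"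
    and "integrable disk_area (\<lambda>z. (cmod (f z))\<^sup>2)"
  shows "f \<in> bergman"
  using assms by (simp add: bergman_def)

lemma bergmanD:
  assumes "f \<in> bergman"
  shows "f holomorphic_on unit_disk" "\<And>z. z \<notin> unit_disk \<Longrightarrow> f z = 0"
    and "integrable disk_area (\<lambda>z. (cmod (f z))\<^sup>2)"
  using assms by (auto simp: bergman_def)

lemma disk_supported_measurable:
  assumes "f holomorphic_on unit_disk" "\<And>z. z \<notin> unit_disk \<Longrightarrow> f z = 0"
  shows "f \<in> borel_measurable borel"
proof -
  have "(\<lambda>z. indicator unit_disk z *\<^sub>R f z) \<in> borel_measurable borel"
    using assms(1) by (intro borel_measurable_indicator_continuous[of unit_disk] holomorphic_on_imp_continuous_on) auto
  moreover have "(\<lambda>z. indicator unit_disk z *\<^sub>R f z) = f"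
    using assms(2) by (auto simp: fun_eq_iff split: split_indicator)
  ultimately show ?thesis by simp
qed

lemma bergman_measurable: "f \<in> bergman \<Longrightarrow> f \<in> borel_measurable borel"
  using bergmanD disk_supported_measurable by blast

lemma bergman_nn_integral_eq:
  assumes "f \<in> bergman"
  shows "ennreal ((bergman_norm f)\<^sup>2) = (\<integral>\<^sup>+z. ennreal ((cmod (f z))\<^sup>2) \<partial>disk_area)"
    and "(bergman_norm f)\<^sup>2 = (LINT z|disk_area. (cmod (f z))\<^sup>2)"
    and "bergman_norm f \<ge> 0"
proof -
  have i: "(LINT z|disk_area. (cmod (f z))\<^sup>2) \<ge> 0"
    by (intro integral_nonneg_AE AE_I2) simp
  then show "(bergman_norm f)\<^sup>2 = (LINT z|disk_area. (cmod (f z))\<^sup>2)" "bergman_norm f \<ge> 0"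
    by (auto simp: bergman_norm_def)
  then show "ennreal ((bergman_norm f)\<^sup>2) = (\<integral>\<^sup>+z. ennreal ((cmod (f z))\<^sup>2) \<partial>disk_area)"
    using nn_integral_eq_integral[OF bergmanD(3)[OF assms]] by simp
qed

text \<open>One bound on the nonnegative integral gives membership and the norm estimate together.
  Since \<open>ennreal C\<close> is 0 for negative \<open>C\<close>, the norm estimate is stated for
  \<open>0 \<le> C\<close>.\<close>

lemma bergmanI_nn:
  assumes "f holomorphic_on unit_disk" "\<And>z. z \<notin> unit_disk \<Longrightarrow> f z = 0"
    and "(\<integral>\<^sup>+z. ennreal ((cmod (f z))\<^sup>2) \<partial>disk_area) \<le> ennreal C"
  shows "f \<in> bergman" and "0 \<le> C \<Longrightarrow> (bergman_norm f)\<^sup>2 \<le> C"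
proof -
  have [measurable]: "f \<in> borel_measurable borel"
    using disk_supported_measurable assms by blast
  have "(\<integral>\<^sup>+z. ennreal ((cmod (f z))\<^sup>2) \<partial>disk_area) < \<infinity>"
    using assms(3) ennreal_less_top le_less_trans by (metis infinity_ennreal_def)
  then show "f \<in> bergman"
    using assms by (intro bergmanI integrableI_bounded) auto
  then show "(bergman_norm f)\<^sup>2 \<le> C" if "0 \<le> C"
    using assms(3) bergman_nn_integral_eq(1)[of f] that by (metis ennreal_le_iff)
qed

lemma cnj_measurable [measurable]: "cnj \<in> borel_measurable borel"
  by (intro borel_measurable_continuous_onI continuous_intros)

lemma bergman_integrable:
  assumes "f \<in> bergman" "g \<in> bergman"
  shows "integrable disk_area (\<lambda>z. f z * cnj (g z))"
proof (rule Bochner_Integration.integrable_bound)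
  show "integrable disk_area (\<lambda>z. (cmod (f z))\<^sup>2 + (cmod (g z))\<^sup>2)"
    using assms by (intro Bochner_Integration.integrable_add bergmanD)
  show "AE z in disk_area. norm (f z * cnj (g z)) \<le> norm ((cmod (f z))\<^sup>2 + (cmod (g z))\<^sup>2)"
  proof (intro AE_I2)
    fix z
    have "2 * (cmod (f z) * cmod (g z)) \<le> (cmod (f z))\<^sup>2 + (cmod (g z))\<^sup>2"
      using sum_squares_bound[of "cmod (f z)" "cmod (g z)"] by simp
    moreover have "0 \<le> cmod (f z) * cmod (g z)" by simp
    ultimately have "cmod (f z) * cmod (g z) \<le> (cmod (f z))\<^sup>2 + (cmod (g z))\<^sup>2"
      by linarith
    then show "norm (f z * cnj (g z)) \<le> norm ((cmod (f z))\<^sup>2 + (cmod (g z))\<^sup>2)"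
      by (simp add: norm_mult)
  qed
  have [measurable]: "f \<in> borel_measurable borel" "g \<in> borel_measurable borel"
    using assms bergman_measurable by auto
  show "(\<lambda>z. f z * cnj (g z)) \<in> borel_measurable disk_area"
    by measurable
qed

lemma bergman_zero: "(\<lambda>z. 0) \<in> bergman"
  by (intro bergmanI) (auto intro: holomorphic_intros)

lemma bergman_scale:
  assumes "f \<in> bergman"
  shows "(\<lambda>z. c * f z) \<in> bergman"
  using bergmanD[OF assms] by (intro bergmanI) (auto intro!: holomorphic_intros simp: norm_mult power_mult_distrib)

lemma bergman_add:
  assumes "f \<in> bergman" "g \<in> bergman"
  shows "(\<lambda>z. f z + g z) \<in> bergman"
proof (rule bergmanI)
  have [measurable]: "f \<in> borel_measurable borel" "g \<in> borel_measurable borel"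
    using assms bergman_measurable by auto
  show "integrable disk_area (\<lambda>z. (cmod (f z + g z))\<^sup>2)"
  proof (rule Bochner_Integration.integrable_bound)
    show "integrable disk_area (\<lambda>z. 2 * (cmod (f z))\<^sup>2 + 2 * (cmod (g z))\<^sup>2)"
      using assms by (intro Bochner_Integration.integrable_add integrable_mult_right bergmanD)
    show "AE z in disk_area. norm ((cmod (f z + g z))\<^sup>2) \<le> norm (2 * (cmod (f z))\<^sup>2 + 2 * (cmod (g z))\<^sup>2)"
    proof (intro AE_I2)
      fix z
      have "(cmod (f z + g z))\<^sup>2 \<le> (cmod (f z) + cmod (g z))\<^sup>2"
        by (intro power_mono norm_triangle_ineq) simp
      also have "\<dots> \<le> 2 * (cmod (f z))\<^sup>2 + 2 * (cmod (g z))\<^sup>2"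
        using sum_squares_bound[of "cmod (f z)" "cmod (g z)"] by (simp add: power2_sum)
      finally show "norm ((cmod (f z + g z))\<^sup>2) \<le> norm (2 * (cmod (f z))\<^sup>2 + 2 * (cmod (g z))\<^sup>2)"
        by simp
    qed
  qed measurable
qed (use bergmanD[OF assms(1)] bergmanD[OF assms(2)] in \<open>auto intro!: holomorphic_intros\<close>)

lemma bergman_diff:
  assumes "f \<in> bergman" "g \<in> bergman"
  shows "(\<lambda>z. f z - g z) \<in> bergman"
  using bergman_add[OF assms(1) bergman_scale[OF assms(2), of "-1"]] by simp

lemma bergman_mult_bounded:
  assumes \<phi>: "\<phi> holomorphic_on unit_disk" "\<And>z. z \<in> unit_disk \<Longrightarrow> cmod (\<phi> z) \<le> K" and f: "f \<in> bergman"
  shows "(\<lambda>z. \<phi> z * f z) \<in> bergman" "bergman_norm (\<lambda>z. \<phi> z * f z) \<le> K * bergman_norm f"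
proof -
  have K: "0 \<le> K" by (rule order_trans[OF norm_ge_zero \<phi>(2)[of 0]]) simp
  have le: "(cmod (\<phi> z * f z))\<^sup>2 \<le> K\<^sup>2 * (cmod (f z))\<^sup>2" for z
    using \<phi>(2)[of z] bergmanD(2)[OF f, of z] K
    by (cases "z \<in> unit_disk") (auto simp: norm_mult power_mult_distrib intro!: mult_right_mono power_mono)
  have *: "(\<integral>\<^sup>+z. ennreal ((cmod (\<phi> z * f z))\<^sup>2) \<partial>disk_area) \<le> ennreal (K\<^sup>2 * (bergman_norm f)\<^sup>2)"
  proof -
    have [measurable]: "f \<in> borel_measurable borel" using f bergman_measurable by auto
    have "(\<integral>\<^sup>+z. ennreal ((cmod (\<phi> z * f z))\<^sup>2) \<partial>disk_area) \<le> (\<integral>\<^sup>+z. ennreal (K\<^sup>2) * ennreal ((cmod (f z))\<^sup>2) \<partial>disk_area)"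
      using le by (intro nn_integral_mono) (simp add: ennreal_mult'[symmetric] ennreal_leI)
    also have "\<dots> = ennreal (K\<^sup>2) * ennreal ((bergman_norm f)\<^sup>2)"
      using bergman_nn_integral_eq(1)[OF f] by (subst nn_integral_cmult) simp_all
    finally show ?thesis by (simp add: ennreal_mult')
  qed
  have hol: "(\<lambda>z. \<phi> z * f z) holomorphic_on unit_disk"
    using \<phi> bergmanD[OF f] by (intro holomorphic_intros)
  note B = bergmanI_nn[OF hol _ *]
  show "(\<lambda>z. \<phi> z * f z) \<in> bergman" using B bergmanD(2)[OF f] by simp
  have "(bergman_norm (\<lambda>z. \<phi> z * f z))\<^sup>2 \<le> (K * bergman_norm f)\<^sup>2"
    using B(2) bergmanD(2)[OF f] by (simp add: power_mult_distrib)
  then show "bergman_norm (\<lambda>z. \<phi> z * f z) \<le> K * bergman_norm f"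
    using K bergman_nn_integral_eq(3)[OF f] by (meson mult_nonneg_nonneg power2_le_imp_le)
qed

lemma bergman_bounded:
  assumes "\<phi> holomorphic_on unit_disk" "\<And>z. z \<in> unit_disk \<Longrightarrow> cmod (\<phi> z) \<le> K"
  shows "(\<lambda>z. indicator unit_disk z * \<phi> z) \<in> bergman"
    and "bergman_norm (\<lambda>z. indicator unit_disk z * \<phi> z) \<le> K"
proof -
  let ?f = "\<lambda>z. indicator unit_disk z * \<phi> z"
  have K: "0 \<le> K" by (rule order_trans[OF norm_ge_zero assms(2)[of 0]]) simp
  have hol: "?f holomorphic_on unit_disk"
    using assms(1) by (rule holomorphic_transform) simp
  have "(\<integral>\<^sup>+z. ennreal ((cmod (?f z))\<^sup>2) \<partial>disk_area) \<le> (\<integral>\<^sup>+z. ennreal (K\<^sup>2) \<partial>disk_area)"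
    using assms(2) K by (intro nn_integral_mono ennreal_leI power_mono) (auto split: split_indicator)
  also have "\<dots> = ennreal (K\<^sup>2)"
    using measure_disk_area finite_measure.emeasure_eq_measure[OF finite_measure_disk_area, of UNIV] by simp
  finally have le: "(\<integral>\<^sup>+z. ennreal ((cmod (?f z))\<^sup>2) \<partial>disk_area) \<le> ennreal (K\<^sup>2)" .
  note B = bergmanI_nn[OF hol _ le]
  show "?f \<in> bergman" using B by simp
  have "(bergman_norm ?f)\<^sup>2 \<le> K\<^sup>2" using B(2) by simp
  then show "bergman_norm ?f \<le> K" using K power2_le_imp_le by blast
qed

lemma bergman_inner_add_left:
  assumes "f \<in> bergman" "g \<in> bergman" "h \<in> bergman"
  shows "bergman_inner (\<lambda>z. f z + g z) h = bergman_inner f h + bergman_inner g h"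
  unfolding bergman_inner_def using assms
  by (simp add: distrib_right bergman_integrable)

lemma bergman_inner_scale_left: "bergman_inner (\<lambda>z. c * f z) h = c * bergman_inner f h"
  unfolding bergman_inner_def by (simp add: mult.assoc)

lemma bergman_inner_diff_left:
  assumes "f \<in> bergman" "g \<in> bergman" "h \<in> bergman"
  shows "bergman_inner (\<lambda>z. f z - g z) h = bergman_inner f h - bergman_inner g h"
  using bergman_inner_add_left[OF assms(1) bergman_scale[OF assms(2), of "-1"] assms(3)]
  by (simp add: bergman_inner_scale_left[of "-1" g h, simplified])

lemma bergman_inner_commute: "bergman_inner g f = cnj (bergman_inner f g)"
  unfolding bergman_inner_def by (subst Bochner_Integration.integral_cnj[symmetric]) (simp add: mult.commute)

lemma bergman_inner_add_right:
  assumes "f \<in> bergman" "g \<in> bergman" "h \<in> bergman"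
  shows "bergman_inner h (\<lambda>z. f z + g z) = bergman_inner h f + bergman_inner h g"
  using bergman_inner_add_left[OF assms] by (subst (1 2 3) bergman_inner_commute) simp

lemma bergman_inner_scale_right: "bergman_inner h (\<lambda>z. c * f z) = cnj c * bergman_inner h f"
  by (subst (1 2) bergman_inner_commute) (simp add: bergman_inner_scale_left)

lemma bergman_inner_diff_right:
  assumes "f \<in> bergman" "g \<in> bergman" "h \<in> bergman"
  shows "bergman_inner h (\<lambda>z. f z - g z) = bergman_inner h f - bergman_inner h g"
  using bergman_inner_diff_left[OF assms] by (subst (1 2 3) bergman_inner_commute) simp

lemma bergman_inner_self:
  assumes "f \<in> bergman"
  shows "bergman_inner f f = of_real ((bergman_norm f)\<^sup>2)"
  unfolding bergman_inner_def bergman_nn_integral_eq(2)[OF assms]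
  by (simp add: complex_norm_square[symmetric] del: of_real_power flip: integral_complex_of_real)

lemma bergman_norm_add_sq:
  assumes "f \<in> bergman" "g \<in> bergman"
  shows "(bergman_norm (\<lambda>z. f z + g z))\<^sup>2 = (bergman_norm f)\<^sup>2 + (bergman_norm g)\<^sup>2 + 2 * Re (bergman_inner f g)"
proof -
  have "complex_of_real ((bergman_norm (\<lambda>z. f z + g z))\<^sup>2) = bergman_inner (\<lambda>z. f z + g z) (\<lambda>z. f z + g z)"
    using assms by (simp add: bergman_inner_self bergman_add)
  also have "\<dots> = bergman_inner f f + bergman_inner g g + (bergman_inner f g + cnj (bergman_inner f g))"
    using assms by (simp add: bergman_inner_add_left bergman_inner_add_right bergman_add bergman_inner_commute[of g f])
  also have "\<dots> = of_real ((bergman_norm f)\<^sup>2 + (bergman_norm g)\<^sup>2 + 2 * Re (bergman_inner f g))"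
    using assms by (simp add: bergman_inner_self complex_add_cnj)
  finally show ?thesis by (simp only: of_real_eq_iff)
qed

lemma bergman_norm_scale: "bergman_norm (\<lambda>z. c * f z) = cmod c * bergman_norm f"
  by (simp add: bergman_norm_def norm_mult power_mult_distrib real_sqrt_mult)

lemma bergman_norm_diff_sq:
  assumes "f \<in> bergman" "g \<in> bergman"
  shows "(bergman_norm (\<lambda>z. f z - g z))\<^sup>2 = (bergman_norm f)\<^sup>2 + (bergman_norm g)\<^sup>2 - 2 * Re (bergman_inner f g)"
  using bergman_norm_add_sq[OF assms(1) bergman_scale[OF assms(2), of "-1"]]
    bergman_norm_scale[of "-1" g] bergman_inner_scale_right[of f "-1" g] by simp

text \<open>The area of the unit disk cancels between the sub-mean value inequality and the
  normalised measure. Keeping the integral over the small disc, and not the full norm, later allows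
  summation over disjoint discs.\<close>

lemma bergman_local_eval:
  assumes "f \<in> bergman" "0 < s" "cmod z + s < 1"
  shows "ennreal ((cmod (f z))\<^sup>2 * s\<^sup>2) \<le> (\<integral>\<^sup>+w. ennreal ((cmod (f w))\<^sup>2) * indicator (ball z s) w \<partial>disk_area)"
proof -
  have [measurable]: "f \<in> borel_measurable borel" using assms bergman_measurable by auto
  have sub: "cball z s \<subseteq> unit_disk"
  proof
    fix w assume "w \<in> cball z s"
    then have "cmod (w - z) \<le> s" by (simp add: dist_norm norm_minus_commute)
    then show "w \<in> unit_disk" using norm_triangle_ineq2[of w z] assms(3) by simp
  qed
  let ?c = "measure lborel unit_disk"
  have "ennreal ?c * ennreal ((cmod (f z))\<^sup>2 * s\<^sup>2) = ennreal ((cmod (f z))\<^sup>2 * (?c * s\<^sup>2))"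
    by (simp add: ennreal_mult'[symmetric] ac_simps)
  also have "\<dots> \<le> (\<integral>\<^sup>+w. ennreal ((cmod (f w))\<^sup>2) * indicator (ball z s) w \<partial>lborel)"
    by (rule area_submean_value[OF bergmanD(1)[OF assms(1)] open_ball sub assms(2)])
  also have "\<dots> = (\<integral>\<^sup>+w. (ennreal ((cmod (f w))\<^sup>2) * indicator (ball z s) w) * indicator unit_disk w \<partial>lborel)"
  proof (intro nn_integral_cong)
    fix w
    show "ennreal ((cmod (f w))\<^sup>2) * indicator (ball z s) w = (ennreal ((cmod (f w))\<^sup>2) * indicator (ball z s) w) * indicator unit_disk w"
    proof (cases "w \<in> ball z s")
      case True
      then have "w \<in> unit_disk" using sub ball_subset_cball by blast
      then show ?thesis by simp
    qed simp
  qed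
  also have "\<dots> = ennreal ?c * (\<integral>\<^sup>+w. ennreal ((cmod (f w))\<^sup>2) * indicator (ball z s) w \<partial>disk_area)"
    by (subst nn_integral_disk_area) simp_all
  finally show ?thesis
    using emeasure_unit_disk(2) by (subst (asm) ennreal_mult_le_mult_iff) (auto simp: less_imp_le)
qed

lemma bergman_eval:
  assumes "f \<in> bergman" "z \<in> unit_disk"
  shows "cmod (f z) \<le> 2 / (1 - cmod z) * bergman_norm f"
proof -
  \<comment> \<open>Half the distance to the circle; it produces the constant 2 of the
    bound.\<close>
  let ?s = "(1 - cmod z) / 2"
  have s: "0 < ?s" "cmod z + ?s < 1" using assms by (auto simp: field_simps)
  have [measurable]: "f \<in> borel_measurable borel" using assms bergman_measurable by auto
  have "ennreal ((cmod (f z))\<^sup>2 * ?s\<^sup>2) \<le> (\<integral>\<^sup>+w. ennreal ((cmod (f w))\<^sup>2) * indicator (ball z ?s) w \<partial>disk_area)"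
    by (rule bergman_local_eval[OF assms(1) s])
  also have "\<dots> \<le> (\<integral>\<^sup>+w. ennreal ((cmod (f w))\<^sup>2) \<partial>disk_area)"
    by (intro nn_integral_mono) (auto split: split_indicator)
  also have "\<dots> = ennreal ((bergman_norm f)\<^sup>2)"
    using bergman_nn_integral_eq(1)[OF assms(1)] by simp
  finally have "(cmod (f z) * ?s)\<^sup>2 \<le> (bergman_norm f)\<^sup>2"
    by (simp only: power_mult_distrib ennreal_le_iff zero_le_power2)
  then have "cmod (f z) * ?s \<le> bergman_norm f"
    using bergman_nn_integral_eq(3)[OF assms(1)] power2_le_imp_le by blast
  then show ?thesis using s by (simp add: field_simps)
qed

lemma bergman_norm_eq_0:
  assumes "f \<in> bergman" "bergman_norm f = 0"
  shows "f = (\<lambda>z. 0)"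
proof
  fix z show "f z = 0"
    using bergman_eval[OF assms(1), of z] bergmanD(2)[OF assms(1), of z] assms(2) by (cases "z \<in> unit_disk") auto
qed

lemma bergman_cauchy_schwarz:
  assumes "f \<in> bergman" "g \<in> bergman"
  shows "cmod (bergman_inner f g) \<le> bergman_norm f * bergman_norm g"
proof (cases "bergman_norm g = 0")
  case True
  then have "g = (\<lambda>z. 0)" using bergman_norm_eq_0 assms by blast
  then show ?thesis using True by (simp add: bergman_inner_def)
next
  case False
  then have b: "(bergman_norm g)\<^sup>2 > 0" by simp
  define b a where "b = (bergman_norm g)\<^sup>2" and "a = bergman_inner f g"
  \<comment> \<open>The vector b f - a g is b times the component of f orthogonal to g.\<close>
  have "0 \<le> (bergman_norm (\<lambda>z. of_real b * f z - a * g z))\<^sup>2" by simp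
  also have "\<dots> = (b * bergman_norm f)\<^sup>2 + (cmod a * bergman_norm g)\<^sup>2 - 2 * Re (of_real b * (cnj a * a))"
    using assms b by (subst bergman_norm_diff_sq)
      (auto simp: bergman_scale bergman_norm_scale bergman_inner_scale_left bergman_inner_scale_right a_def b_def norm_power)
  also have "Re (of_real b * (cnj a * a)) = b * (cmod a)\<^sup>2"
    using cmod_power2[of a] by (simp add: power2_eq_square)
  also have "(b * bergman_norm f)\<^sup>2 + (cmod a * bergman_norm g)\<^sup>2 - 2 * (b * (cmod a)\<^sup>2) = b * (b * (bergman_norm f)\<^sup>2 - (cmod a)\<^sup>2)"
    by (simp add: b_def algebra_simps power2_eq_square)
  finally have "(cmod a)\<^sup>2 \<le> b * (bergman_norm f)\<^sup>2"
    using b by (simp add: zero_le_mult_iff b_def)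
  then have "(cmod a)\<^sup>2 \<le> (bergman_norm f * bergman_norm g)\<^sup>2"
    by (simp add: b_def power_mult_distrib mult.commute)
  then show ?thesis
    using assms bergman_nn_integral_eq(3) unfolding a_def by (meson mult_nonneg_nonneg power2_le_imp_le)
qed

text \<open>Point evaluations are uniformly bounded on smaller discs, so a Cauchy sequence converges
  locally uniformly and its limit is holomorphic; Fatou's lemma turns pointwise convergence into
  convergence in norm.\<close>

lemma bergman_complete:
  assumes F: "\<And>n. F n \<in> bergman"
    and cau: "\<And>e. 0 < e \<Longrightarrow> \<exists>N. \<forall>m\<ge>N. \<forall>n\<ge>N. bergman_norm (\<lambda>z. F m z - F n z) \<le> e"
  obtains f where "f \<in> bergman" "(\<lambda>n. bergman_norm (\<lambda>z. F n z - f z)) \<longlonglongrightarrow> 0"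
proof -
  define f where "f = (\<lambda>z. lim (\<lambda>n. F n z))"
  have ul: "uniform_limit (cball 0 r) F f sequentially" if r: "r < 1" for r
  proof -
    have "uniformly_Cauchy_on (cball 0 r) F"
      unfolding uniformly_Cauchy_on_def
    proof (intro allI impI)
      fix e :: real assume "0 < e"
      \<comment> \<open>The factor (1 - r)/4 cancels the evaluation constant 2/(1 - r) and leaves
        e/2.\<close>
      then have "0 < e * (1 - r) / 4" using r by simp
      from cau[OF this] obtain N where N: "\<And>m n. m \<ge> N \<Longrightarrow> n \<ge> N \<Longrightarrow> bergman_norm (\<lambda>z. F m z - F n z) \<le> e * (1 - r) / 4"
        by blast
      have "dist (F m z) (F n z) < e" if z: "z \<in> cball 0 r" and "m \<ge> N" "n \<ge> N" for z m n
      proof -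
        have zr: "cmod z \<le> r" using z by simp
        have "cmod (F m z - F n z) \<le> 2 / (1 - cmod z) * bergman_norm (\<lambda>z. F m z - F n z)"
          using bergman_eval[OF bergman_diff[OF F F], of z m n] zr r by simp
        also have "\<dots> \<le> 2 / (1 - r) * (e * (1 - r) / 4)"
          using zr r N[OF that(2,3)] bergman_nn_integral_eq(3)[OF bergman_diff[OF F F]]
          by (intro mult_mono frac_le) auto
        also have "\<dots> = e / 2" using r by simp
        finally show ?thesis using \<open>0 < e\<close> by (simp add: dist_norm)
      qed
      then show "\<exists>M. \<forall>x\<in>cball 0 r. \<forall>m\<ge>M. \<forall>n\<ge>M. dist (F m x) (F n x) < e" by blast
    qed
    then show ?thesis
      unfolding f_def using Cauchy_uniformly_convergent uniformly_convergent_uniform_limit_iff by blast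
  qed
  have ptw: "(\<lambda>n. F n z) \<longlonglongrightarrow> f z" for z
  proof (cases "z \<in> unit_disk")
    case True
    then show ?thesis using tendsto_uniform_limitI[OF ul[of "cmod z"], of z] by simp
  next
    case False
    then have "F n z = 0" for n using bergmanD(2)[OF F] by blast
    then show ?thesis by (simp add: f_def)
  qed
  have hol: "f holomorphic_on unit_disk"
  proof (rule holomorphic_uniform_sequence)
    fix x assume "x \<in> unit_disk"
    then have x: "cmod x < 1" by simp
    define d where "d = (1 - cmod x) / 2"
    have "cball x d \<subseteq> cball 0 ((1 + cmod x) / 2)"
    proof
      fix w assume "w \<in> cball x d"
      then have "cmod (w - x) \<le> d" by (simp add: dist_norm norm_minus_commute)
      then show "w \<in> cball 0 ((1 + cmod x) / 2)"
        using norm_triangle_ineq2[of w x] by (simp add: d_def field_simps)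
    qed
    moreover have "cball 0 ((1 + cmod x) / 2) \<subseteq> unit_disk" using x by (auto simp: field_simps)
    moreover have "uniform_limit (cball x d) F f sequentially"
      using ul[of "(1 + cmod x) / 2"] x calculation(1) uniform_limit_on_subset by fastforce
    moreover have "0 < d" using x by (simp add: d_def)
    ultimately show "\<exists>d>0. cball x d \<subseteq> unit_disk \<and> uniform_limit (cball x d) F f sequentially"
      by blast
  qed (use bergmanD(1)[OF F] in auto)
  have zero: "f z = 0" if "z \<notin> unit_disk" for z
    using bergmanD(2)[OF F that] by (simp add: f_def)
  have [measurable]: "F n \<in> borel_measurable borel" for n
    using F bergman_measurable by auto
  have close: "(\<lambda>z. F n z - f z) \<in> bergman \<and> bergman_norm (\<lambda>z. F n z - f z) \<le> e"
    if N: "\<And>m n. m \<ge> N \<Longrightarrow> n \<ge> N \<Longrightarrow> bergman_norm (\<lambda>z. F m z - F n z) \<le> e" and "n \<ge> N" and e: "0 < e" for N n e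
  proof -
    \<comment> \<open>The squared distance to the limit is written as a lower limit in m, the form
      needed for Fatou's lemma.\<close>
    have lim: "ennreal ((cmod (F n z - f z))\<^sup>2) = liminf (\<lambda>m. ennreal ((cmod (F n z - F m z))\<^sup>2))" for z
      by (rule lim_imp_Liminf[symmetric]) (auto intro!: tendsto_intros ptw)
    have "(\<integral>\<^sup>+z. ennreal ((cmod (F n z - f z))\<^sup>2) \<partial>disk_area)
       \<le> liminf (\<lambda>m. \<integral>\<^sup>+z. ennreal ((cmod (F n z - F m z))\<^sup>2) \<partial>disk_area)"
      unfolding lim by (rule nn_integral_liminf) measurable
    also have "\<dots> \<le> ennreal (e\<^sup>2)"
    proof (rule Liminf_le)
      show "\<forall>\<^sub>F m in sequentially. (\<integral>\<^sup>+z. ennreal ((cmod (F n z - F m z))\<^sup>2) \<partial>disk_area) \<le> ennreal (e\<^sup>2)"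
      proof (rule eventually_sequentiallyI[of N])
        fix m assume "m \<ge> N"
        then have "(bergman_norm (\<lambda>z. F n z - F m z))\<^sup>2 \<le> e\<^sup>2"
          using N[of n m] \<open>n \<ge> N\<close> bergman_nn_integral_eq(3)[OF bergman_diff[OF F F]] by (intro power_mono) auto
        then show "(\<integral>\<^sup>+z. ennreal ((cmod (F n z - F m z))\<^sup>2) \<partial>disk_area) \<le> ennreal (e\<^sup>2)"
          using bergman_nn_integral_eq(1)[OF bergman_diff[OF F F], of n m] by (metis ennreal_leI)
      qed
    qed simp
    finally have le: "(\<integral>\<^sup>+z. ennreal ((cmod (F n z - f z))\<^sup>2) \<partial>disk_area) \<le> ennreal (e\<^sup>2)" .
    have "(\<lambda>z. F n z - f z) holomorphic_on unit_disk"
      using bergmanD(1)[OF F] hol by (intro holomorphic_intros)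
    note B = bergmanI_nn[OF this _ le]
    have "(\<lambda>z. F n z - f z) \<in> bergman" "(bergman_norm (\<lambda>z. F n z - f z))\<^sup>2 \<le> e\<^sup>2"
      using B zero bergmanD(2)[OF F] by auto
    then show ?thesis using e power2_le_imp_le by fastforce
  qed
  have "f \<in> bergman"
  proof -
    obtain N where N: "\<And>m n. m \<ge> N \<Longrightarrow> n \<ge> N \<Longrightarrow> bergman_norm (\<lambda>z. F m z - F n z) \<le> 1"
      using cau[of 1] by auto
    have "(\<lambda>z. F N z - f z) \<in> bergman" using close[OF N, of N] by simp
    from bergman_diff[OF F[of N] this] show ?thesis by simp
  qed
  moreover have "(\<lambda>n. bergman_norm (\<lambda>z. F n z - f z)) \<longlonglongrightarrow> 0"
  proof (rule LIMSEQ_I)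
    fix e :: real assume "0 < e"
    then obtain N where N: "\<And>m n. m \<ge> N \<Longrightarrow> n \<ge> N \<Longrightarrow> bergman_norm (\<lambda>z. F m z - F n z) \<le> e / 2"
      using cau[of "e / 2"] by auto
    have "norm (bergman_norm (\<lambda>z. F n z - f z) - 0) < e" if "n \<ge> N" for n
      using close[OF N that] \<open>0 < e\<close> bergman_nn_integral_eq(3)[of "\<lambda>z. F n z - f z"] by auto
    then show "\<exists>no. \<forall>n\<ge>no. norm (bergman_norm (\<lambda>z. F n z - f z) - 0) < e" by blast
  qed
  ultimately show ?thesis using that by blast
qed

section \<open>Riesz representation and adjoints\<close>

lemma quadratic_nonneg_imp_zero:
  fixes a R :: real
  assumes "0 \<le> a" "\<And>s. 0 \<le> s\<^sup>2 * a + 2 * s * R"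
  shows "R = 0"
proof (rule ccontr)
  assume "R \<noteq> 0"
  define t where "t = 1 / (a + 1)"
  have t: "0 < t" "t * (a + 1) = 1" using assms(1) by (auto simp: t_def)
  \<comment> \<open>A step against the sign of R; with t = 1/(a + 1) it is so short that the linear
    term dominates the quadratic one.\<close>
  have "0 \<le> (- (R * t))\<^sup>2 * a + 2 * (- (R * t)) * R" by (rule assms(2))
  also have "\<dots> = (R * t)\<^sup>2 * a - 2 * (R * R) * t * (t * (a + 1))"
    by (simp only: t(2)) (simp add: power2_eq_square algebra_simps)
  also have "\<dots> = (R * t)\<^sup>2 * (a - 2 * (a + 1))"
    by (simp add: power2_eq_square algebra_simps)
  also have "\<dots> < 0" using \<open>R \<noteq> 0\<close> assms(1) t by (intro mult_pos_neg) auto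
  finally show False by simp
qed

text \<open>The representing vector minimises |f|^2 - 2 Re \<phi>(f). Boundedness of \<phi> bounds
  this functional below, the parallelogram law makes a minimising sequence Cauchy, and the vanishing
  first variation at the limit is the representation of real parts. Testing i times a function
  supplies the imaginary parts.\<close>

lemma bergman_riesz:
  assumes add: "\<And>f g. f \<in> bergman \<Longrightarrow> g \<in> bergman \<Longrightarrow> \<phi> (\<lambda>z. f z + g z) = \<phi> f + \<phi> g"
    and scale: "\<And>c f. f \<in> bergman \<Longrightarrow> \<phi> (\<lambda>z. c * f z) = c * \<phi> f"
    and bound: "\<And>f. f \<in> bergman \<Longrightarrow> cmod (\<phi> f) \<le> C * bergman_norm f"
  shows "\<exists>h\<in>bergman. \<forall>f\<in>bergman. \<phi> f = bergman_inner f h"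
proof -
  define J where "J = (\<lambda>f. (bergman_norm f)\<^sup>2 - 2 * Re (\<phi> f))"
  have Jlow: "- C\<^sup>2 \<le> J f" if "f \<in> bergman" for f
  proof -
    have "Re (\<phi> f) \<le> C * bergman_norm f"
      using bound[OF that] complex_Re_le_cmod order_trans by blast
    then have "J f \<ge> (bergman_norm f - C)\<^sup>2 - C\<^sup>2"
      by (simp add: J_def power2_diff mult.commute)
    then show ?thesis using zero_le_power2[of "bergman_norm f - C"] by linarith
  qed
  define I where "I = Inf (J ` bergman)"
  have bdd: "bdd_below (J ` bergman)" using Jlow by (rule bdd_belowI2)
  have ne: "J ` bergman \<noteq> {}" using bergman_zero by auto
  have IJ: "I \<le> J f" if "f \<in> bergman" for f
    unfolding I_def using bdd that by (simp add: cINF_lower)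
  have "\<exists>f\<in>bergman. J f < I + 1 / real (Suc n)" for n
    using cInf_lessD[OF ne, of "I + 1 / real (Suc n)"] unfolding I_def[symmetric] by auto
  then obtain F where F: "\<And>n. F n \<in> bergman" and JF: "\<And>n. J (F n) < I + 1 / real (Suc n)"
    by metis
  \<comment> \<open>The midpoint of F m and F n has a functional value of at least I; this bounds
    their squared distance by twice the sum of their excesses over I.\<close>
  have par: "(bergman_norm (\<lambda>z. F m z - F n z))\<^sup>2 \<le> 2 / real (Suc m) + 2 / real (Suc n)" for m n
  proof -
    let ?s = "\<lambda>z. F m z + F n z"
    let ?h = "\<lambda>z. (1/2) * (F m z + F n z)"
    have hb: "?h \<in> bergman" using bergman_scale[OF bergman_add[OF F F]] .
    have n: "(bergman_norm ?h)\<^sup>2 = (bergman_norm ?s)\<^sup>2 / 4"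
      unfolding bergman_norm_scale by (simp add: power2_eq_square)
    have p: "\<phi> ?h = 1/2 * (\<phi> (F m) + \<phi> (F n))"
      by (simp only: scale[OF bergman_add[OF F F]] add[OF F F])
    have "4 * J ?h = (bergman_norm ?s)\<^sup>2 - 4 * Re (\<phi> (F m)) - 4 * Re (\<phi> (F n))"
      unfolding J_def n p by (simp add: field_simps)
    moreover have "I \<le> J ?h" by (rule IJ[OF hb])
    moreover note bergman_norm_add_sq[OF F F, of m n] bergman_norm_diff_sq[OF F F, of m n]
    ultimately have "(bergman_norm (\<lambda>z. F m z - F n z))\<^sup>2 \<le> 2 * J (F m) + 2 * J (F n) - 4 * I"
      by (simp add: J_def)
    then show ?thesis using JF[of m] JF[of n] by simp
  qed
  have cau: "\<exists>N. \<forall>m\<ge>N. \<forall>n\<ge>N. bergman_norm (\<lambda>z. F m z - F n z) \<le> e" if "0 < e" for e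
  proof -
    obtain N where N: "4 / e\<^sup>2 < real N" using reals_Archimedean2 by blast
    have "bergman_norm (\<lambda>z. F m z - F n z) \<le> e" if "m \<ge> N" "n \<ge> N" for m n
    proof -
      have pos: "0 < 4 / e\<^sup>2" using \<open>0 < e\<close> by simp
      have le: "2 / real (Suc k) \<le> e\<^sup>2 / 2" if "k \<ge> N" for k
      proof -
        have "4 / e\<^sup>2 < real (Suc k)" using N that by linarith
        then show ?thesis using \<open>0 < e\<close> by (simp add: field_simps)
      qed
      have "(bergman_norm (\<lambda>z. F m z - F n z))\<^sup>2 \<le> e\<^sup>2"
        using par[of m n] le[OF that(1)] le[OF that(2)] by linarith
      then show ?thesis using \<open>0 < e\<close> power2_le_imp_le by fastforce
    qed
    then show ?thesis by blast
  qed
  obtain h where h: "h \<in> bergman" "(\<lambda>n. bergman_norm (\<lambda>z. F n z - h z)) \<longlonglongrightarrow> 0"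
    by (rule bergman_complete[OF F cau])
  have inner_lim: "(\<lambda>n. bergman_inner u (F n)) \<longlonglongrightarrow> bergman_inner u h" if u: "u \<in> bergman" for u
  proof -
    have "(\<lambda>n. bergman_inner u (F n) - bergman_inner u h) \<longlonglongrightarrow> 0"
    proof (rule Lim_null_comparison)
      show "\<forall>\<^sub>F n in sequentially. norm (bergman_inner u (F n) - bergman_inner u h) \<le> bergman_norm u * bergman_norm (\<lambda>z. F n z - h z)"
        using bergman_cauchy_schwarz[OF u bergman_diff[OF F h(1)]]
        by (intro always_eventually allI) (simp add: bergman_inner_diff_right[OF F h(1) u])
      show "(\<lambda>n. bergman_norm u * bergman_norm (\<lambda>z. F n z - h z)) \<longlonglongrightarrow> 0"
        by (rule tendsto_mult_right_zero[OF h(2)])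
    qed
    then show ?thesis by (rule LIM_zero_cancel)
  qed
  \<comment> \<open>First variation in the direction u. It is carried out along the minimising
    sequence, where the excess 1/(n+1) disappears in the limit.\<close>
  have re: "Re (bergman_inner u h - \<phi> u) = 0" if u: "u \<in> bergman" for u
  proof (rule quadratic_nonneg_imp_zero)
    show "0 \<le> (bergman_norm u)\<^sup>2" by simp
    fix s :: real
    have su: "(\<lambda>z. of_real s * u z) \<in> bergman" using bergman_scale[OF u] .
    have l1: "- (1 / real (Suc n)) \<le> s\<^sup>2 * (bergman_norm u)\<^sup>2 + 2 * s * Re (bergman_inner u (F n) - \<phi> u)" for n
    proof -
      have c: "Re (bergman_inner (F n) (\<lambda>z. of_real s * u z)) = s * Re (bergman_inner u (F n))"
        unfolding bergman_inner_scale_right bergman_inner_commute[of "F n" u] by simp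
      have p: "\<phi> (\<lambda>z. F n z + of_real s * u z) = \<phi> (F n) + of_real s * \<phi> u"
        by (simp only: add[OF F su] scale[OF u])
      have "I \<le> J (\<lambda>z. F n z + of_real s * u z)" by (rule IJ[OF bergman_add[OF F su]])
      also have "\<dots> = J (F n) + s\<^sup>2 * (bergman_norm u)\<^sup>2 + 2 * s * Re (bergman_inner u (F n) - \<phi> u)"
        unfolding J_def bergman_norm_add_sq[OF F su] p c bergman_norm_scale
        by (simp add: power_mult_distrib algebra_simps)
      finally show ?thesis using JF[of n] by linarith
    qed
    have l2: "(\<lambda>n. s\<^sup>2 * (bergman_norm u)\<^sup>2 + 2 * s * Re (bergman_inner u (F n) - \<phi> u)) \<longlonglongrightarrow>
        s\<^sup>2 * (bergman_norm u)\<^sup>2 + 2 * s * Re (bergman_inner u h - \<phi> u)"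
      by (intro tendsto_intros inner_lim[OF u])
    have l3: "(\<lambda>n. - (1 / real (Suc n))) \<longlonglongrightarrow> - 0"
      by (intro tendsto_minus LIMSEQ_Suc lim_1_over_n)
    have "- 0 \<le> s\<^sup>2 * (bergman_norm u)\<^sup>2 + 2 * s * Re (bergman_inner u h - \<phi> u)"
      using l1 by (intro LIMSEQ_le[OF l3 l2]) blast
    then show "0 \<le> s\<^sup>2 * (bergman_norm u)\<^sup>2 + 2 * s * Re (bergman_inner u h - \<phi> u)" by (simp only: minus_zero)
  qed
  have "\<phi> u = bergman_inner u h" if u: "u \<in> bergman" for u
  proof -
    have "Re (\<i> * bergman_inner u h - \<i> * \<phi> u) = 0"
      using re[OF bergman_scale[OF u, of \<i>]] by (simp only: bergman_inner_scale_left scale[OF u])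
    then show ?thesis using re[OF u] by (simp add: complex_eq_iff)
  qed
  then show ?thesis using h(1) by blast
qed

lemma bounded_opD:
  assumes "bounded_op T"
  shows "\<And>f. f \<in> bergman \<Longrightarrow> T f \<in> bergman"
    and "\<And>f g. f \<in> bergman \<Longrightarrow> g \<in> bergman \<Longrightarrow> T (\<lambda>z. f z + g z) = (\<lambda>z. T f z + T g z)"
    and "\<And>c f. f \<in> bergman \<Longrightarrow> T (\<lambda>z. c * f z) = (\<lambda>z. c * T f z)"
    and "\<And>f. f \<notin> bergman \<Longrightarrow> T f = undefined"
  using assms by (auto simp: bounded_op_def PiE_def extensional_def)

lemma bounded_op_bound:
  assumes "bounded_op T"
  obtains C where "0 \<le> C" "\<And>f. f \<in> bergman \<Longrightarrow> bergman_norm (T f) \<le> C * bergman_norm f"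
proof -
  obtain C where C: "\<And>f. f \<in> bergman \<Longrightarrow> bergman_norm (T f) \<le> C * bergman_norm f"
    using assms unfolding bounded_op_def by blast
  have "bergman_norm (T f) \<le> \<bar>C\<bar> * bergman_norm f" if "f \<in> bergman" for f
    using C[OF that] bergman_nn_integral_eq(3)[OF that] mult_right_mono[of C "\<bar>C\<bar>"]
    by (meson abs_ge_self order_trans)
  then show ?thesis using that[of "\<bar>C\<bar>"] by simp
qed

lemma bounded_op_diff:
  assumes "bounded_op T" "f \<in> bergman" "g \<in> bergman"
  shows "T (\<lambda>z. f z - g z) = (\<lambda>z. T f z - T g z)"
  using bounded_opD(2)[OF assms(1,2) bergman_scale[OF assms(3), of "-1"]] bounded_opD(3)[OF assms(1,3), of "-1"]
  by simp

text \<open>Test against a - b itself.\<close>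

lemma bergman_inner_ext:
  assumes "a \<in> bergman" "b \<in> bergman" "\<And>f. f \<in> bergman \<Longrightarrow> bergman_inner f a = bergman_inner f b"
  shows "a = b"
proof -
  have d: "(\<lambda>z. a z - b z) \<in> bergman" using bergman_diff assms by blast
  have "bergman_inner (\<lambda>z. a z - b z) (\<lambda>z. a z - b z) = 0"
    using assms(3)[OF d] bergman_inner_diff_right[OF assms(1,2) d] by simp
  then have "bergman_norm (\<lambda>z. a z - b z) = 0"
    using bergman_inner_self[OF d] by simp
  from bergman_norm_eq_0[OF d this] show ?thesis by (auto simp: fun_eq_iff)
qed

text \<open>Riesz representation of f -> <T f, g> defines S g. Linearity of S follows by testing,
  and the norm bound from |S g|^2 = <T (S g), g> after division by |S g|.\<close>

lemma adjoint_exists: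
  assumes T: "bounded_op T"
  shows "\<exists>S. bounded_op S \<and> (\<forall>f\<in>bergman. \<forall>g\<in>bergman. bergman_inner (T f) g = bergman_inner f (S g))"
proof -
  obtain C where C: "0 \<le> C" "\<And>f. f \<in> bergman \<Longrightarrow> bergman_norm (T f) \<le> C * bergman_norm f"
    using bounded_op_bound[OF T] by blast
  note TD = bounded_opD[OF T]
  have "\<exists>h\<in>bergman. \<forall>f\<in>bergman. bergman_inner (T f) g = bergman_inner f h" if g: "g \<in> bergman" for g
  proof (rule bergman_riesz)
    fix f assume f: "f \<in> bergman"
    have "cmod (bergman_inner (T f) g) \<le> bergman_norm (T f) * bergman_norm g"
      by (rule bergman_cauchy_schwarz[OF TD(1)[OF f] g])
    also have "\<dots> \<le> (C * bergman_norm f) * bergman_norm g"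
      by (rule mult_right_mono[OF C(2)[OF f] bergman_nn_integral_eq(3)[OF g]])
    finally show "cmod (bergman_inner (T f) g) \<le> C * bergman_norm g * bergman_norm f"
      by (simp add: ac_simps)
  qed (use TD g in \<open>simp_all add: bergman_inner_add_left bergman_inner_scale_left\<close>)
  then obtain S0 where S0: "\<And>g. g \<in> bergman \<Longrightarrow> S0 g \<in> bergman"
    "\<And>f g. f \<in> bergman \<Longrightarrow> g \<in> bergman \<Longrightarrow> bergman_inner (T f) g = bergman_inner f (S0 g)"
    by metis
  define S where "S = restrict S0 bergman"
  have S: "\<And>g. g \<in> bergman \<Longrightarrow> S g \<in> bergman"
    "\<And>f g. f \<in> bergman \<Longrightarrow> g \<in> bergman \<Longrightarrow> bergman_inner (T f) g = bergman_inner f (S g)"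
    using S0 by (auto simp: S_def)
  have "bounded_op S"
    unfolding bounded_op_def
  proof (intro conjI ballI allI)
    show "S \<in> bergman \<rightarrow>\<^sub>E bergman" using S0 by (auto simp: S_def)
    fix f g assume fg: "f \<in> bergman" "g \<in> bergman"
    show "S (\<lambda>z. f z + g z) = (\<lambda>z. S f z + S g z)"
    proof (rule bergman_inner_ext)
      fix u assume u: "u \<in> bergman"
      show "bergman_inner u (S (\<lambda>z. f z + g z)) = bergman_inner u (\<lambda>z. S f z + S g z)"
        using fg u by (simp add: S(2)[symmetric] bergman_add bergman_inner_add_right S(1) TD(1))
    qed (use fg in \<open>auto intro: S bergman_add\<close>)
  next
    fix c f assume f: "f \<in> bergman"
    show "S (\<lambda>z. c * f z) = (\<lambda>z. c * S f z)"
    proof (rule bergman_inner_ext)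
      fix u assume u: "u \<in> bergman"
      show "bergman_inner u (S (\<lambda>z. c * f z)) = bergman_inner u (\<lambda>z. c * S f z)"
        using f u by (simp add: S(2)[symmetric] bergman_scale bergman_inner_scale_right S(1) TD(1))
    qed (use f in \<open>auto intro: S bergman_scale\<close>)
  next
    have "bergman_norm (S g) \<le> C * bergman_norm g" if g: "g \<in> bergman" for g
    proof (cases "bergman_norm (S g) = 0")
      case True
      then show ?thesis using C(1) bergman_nn_integral_eq(3)[OF g] by simp
    next
      case False
      then have pos: "0 < bergman_norm (S g)" using bergman_nn_integral_eq(3)[OF S(1)[OF g]] by simp
      have "(bergman_norm (S g))\<^sup>2 = cmod (bergman_inner (S g) (S g))"
        using S(1)[OF g] by (simp add: bergman_inner_self norm_power)
      also have "\<dots> = cmod (bergman_inner (T (S g)) g)" using S g by simp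
      also have "\<dots> \<le> bergman_norm (T (S g)) * bergman_norm g"
        by (rule bergman_cauchy_schwarz[OF TD(1)[OF S(1)[OF g]] g])
      also have "\<dots> \<le> (C * bergman_norm (S g)) * bergman_norm g"
        by (rule mult_right_mono[OF C(2)[OF S(1)[OF g]] bergman_nn_integral_eq(3)[OF g]])
      finally have "bergman_norm (S g) * bergman_norm (S g) \<le> bergman_norm (S g) * (C * bergman_norm g)"
        by (simp add: power2_eq_square ac_simps)
      then show ?thesis using pos by simp
    qed
    then show "\<exists>C. \<forall>f\<in>bergman. bergman_norm (S f) \<le> C * bergman_norm f" by blast
  qed
  then show ?thesis using S(2) by blast
qed

text \<open>This resolves the \<open>THE\<close> in \<open>adjoint_op\<close>. Uniqueness extends to
  arguments outside the Bergman space because bounded operators are \<open>undefined\<close>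
  there.\<close>

lemma adjoint_op:
  assumes T: "bounded_op T"
  shows "bounded_op (adjoint_op T)"
    and "\<And>f g. f \<in> bergman \<Longrightarrow> g \<in> bergman \<Longrightarrow> bergman_inner (T f) g = bergman_inner f (adjoint_op T g)"
proof -
  let ?P = "\<lambda>S. bounded_op S \<and> (\<forall>f\<in>bergman. \<forall>g\<in>bergman. bergman_inner (T f) g = bergman_inner f (S g))"
  have "\<exists>!S. ?P S"
  proof (rule ex_ex1I)
    show "\<exists>S. ?P S" by (rule adjoint_exists[OF T])
    fix S S' assume P: "?P S" "?P S'"
    show "S = S'"
    proof
      fix g show "S g = S' g"
      proof (cases "g \<in> bergman")
        case True
        then show ?thesis
        proof (intro bergman_inner_ext)
          show "S g \<in> bergman" "S' g \<in> bergman"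
            using P bounded_opD(1) True by blast+
          show "bergman_inner f (S g) = bergman_inner f (S' g)" if "f \<in> bergman" for f
            using P True that by metis
        qed
      next
        case False
        then show ?thesis using P bounded_opD(4) by metis
      qed
    qed
  qed
  from theI'[OF this] have "?P (adjoint_op T)" unfolding adjoint_op_def .
  then show "bounded_op (adjoint_op T)"
    "\<And>f g. f \<in> bergman \<Longrightarrow> g \<in> bergman \<Longrightarrow> bergman_inner (T f) g = bergman_inner f (adjoint_op T g)"
    by auto
qed

lemma mult_op_bounded:
  assumes "\<phi> holomorphic_on unit_disk" "\<And>z. z \<in> unit_disk \<Longrightarrow> cmod (\<phi> z) \<le> K"
  shows "bounded_op (mult_op \<phi>)"
  unfolding bounded_op_def
proof (intro conjI ballI allI)
  show "mult_op \<phi> \<in> bergman \<rightarrow>\<^sub>E bergman"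
    using bergman_mult_bounded(1)[OF assms] by (auto simp: mult_op_def)
  show "\<exists>C. \<forall>f\<in>bergman. bergman_norm (mult_op \<phi> f) \<le> C * bergman_norm f"
    using bergman_mult_bounded(2)[OF assms] by (auto simp: mult_op_def)
qed (auto simp: mult_op_def bergman_add bergman_scale algebra_simps)

text \<open>One inclusion always holds, so \<open>V_star\<close> differs from the scalars exactly
  when it contains a further operator.\<close>

lemma scalar_op_in_V_star:
  assumes "\<phi> holomorphic_on unit_disk" "\<And>z. z \<in> unit_disk \<Longrightarrow> cmod (\<phi> z) \<le> K"
  shows "scalar_ops \<subseteq> V_star \<phi>"
proof
  fix S assume "S \<in> scalar_ops"
  then obtain c where S: "S = (\<lambda>f\<in>bergman. \<lambda>z. c * f z)" by (auto simp: scalar_ops_def)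
  note M = mult_op_bounded[OF assms]
  have "bounded_op S"
    unfolding bounded_op_def S using bergman_scale bergman_norm_scale
    by (auto simp: bergman_add algebra_simps intro!: exI[of _ "cmod c"])
  moreover have "S (T f) = T (S f)" if "bounded_op T" "f \<in> bergman" for T f
    using bounded_opD[OF that(1)] that(2) by (simp add: S bergman_scale)
  ultimately show "S \<in> V_star \<phi>"
    using M adjoint_op(1)[OF M] by (auto simp: V_star_def commutant_def)
qed

section \<open>Asymptotic isometry of thin Blaschke products\<close>

lemma Moebius_denominator_nonzero:
  assumes "cmod a < 1" "cmod z \<le> 1"
  shows "1 - cnj a * z \<noteq> 0"
proof
  assume "1 - cnj a * z = 0"
  then have "cmod (cnj a * z) = 1" by simp
  moreover have "cmod (cnj a * z) \<le> cmod a * 1"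
    unfolding norm_mult complex_mod_cnj using assms(2) by (intro mult_left_mono) auto
  ultimately show False using assms(1) by simp
qed

lemma Moebius_identity:
  "(cmod (1 - cnj a * z))\<^sup>2 - (cmod (z - a))\<^sup>2 = (1 - (cmod a)\<^sup>2) * (1 - (cmod z)\<^sup>2)"
  unfolding cmod_power2 by (simp add: algebra_simps power2_eq_square)

text \<open>Denominators are cleared so that the inequality remains meaningful for |f| = 1, that is
  for unimodular constants. The strict case is Schwarz's lemma between two Moebius maps; the general
  case is its limit for s f with s < 1 tending to 1.\<close>

lemma Schwarz_Pick:
  assumes hol: "f holomorphic_on unit_disk" and bd: "\<And>z. z \<in> unit_disk \<Longrightarrow> cmod (f z) \<le> 1"
    and z: "z \<in> unit_disk" and w: "w \<in> unit_disk"
  shows "cmod (f w - f z) * cmod (1 - cnj z * w) \<le> cmod (w - z) * cmod (1 - cnj (f z) * f w)"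
proof -
  have strict: "cmod (f w - f z) * cmod (1 - cnj z * w) \<le> cmod (w - z) * cmod (1 - cnj (f z) * f w)"
    if hol: "f holomorphic_on unit_disk" and bd: "\<And>z. z \<in> unit_disk \<Longrightarrow> cmod (f z) < 1" for f
  proof -
    \<comment> \<open>Moves both z and f(z) to the origin, where Schwarz's lemma applies.\<close>
    let ?g = "\<lambda>\<zeta>. Moebius_function 0 (f z) (f (Moebius_function 0 (- z) \<zeta>))"
    have in1: "Moebius_function 0 (- z) \<zeta> \<in> unit_disk" if "\<zeta> \<in> unit_disk" for \<zeta>
      using Moebius_function_norm_lt_1[of "- z" \<zeta> 0] that z by simp
    have in2: "f (Moebius_function 0 (- z) \<zeta>) \<in> unit_disk" if "\<zeta> \<in> unit_disk" for \<zeta>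
      using bd[OF in1[OF that]] by simp
    have "Moebius_function 0 (f z) \<circ> (f \<circ> Moebius_function 0 (- z)) holomorphic_on unit_disk"
      using in1 in2 bd[OF z] z
      by (intro holomorphic_on_compose_gen[OF _ Moebius_function_holomorphic]
          holomorphic_on_compose_gen[OF Moebius_function_holomorphic hol]) auto
    then have "?g holomorphic_on unit_disk" by (simp add: o_def)
    moreover have "?g 0 = 0"
      by (simp add: Moebius_function_of_zero Moebius_function_eq_zero)
    moreover have "cmod (?g \<zeta>) < 1" if "cmod \<zeta> < 1" for \<zeta>
      using Moebius_function_norm_lt_1[OF bd[OF z]] in2 that by simp
    moreover have "cmod (Moebius_function 0 z w) < 1"
      using Moebius_function_norm_lt_1 z w by simp
    ultimately have "cmod (?g (Moebius_function 0 z w)) \<le> cmod (Moebius_function 0 z w)"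
      by (rule Schwarz_Lemma(1))
    moreover have "Moebius_function 0 (- z) (Moebius_function 0 z w) = w"
      using z w by (intro Moebius_function_compose) auto
    ultimately have "cmod (f w - f z) / cmod (1 - cnj (f z) * f w) \<le> cmod (w - z) / cmod (1 - cnj z * w)"
      by (simp add: Moebius_function_simple norm_divide)
    moreover have "0 < cmod (1 - cnj (f z) * f w)" "0 < cmod (1 - cnj z * w)"
      using Moebius_denominator_nonzero[of "f z" "f w"] Moebius_denominator_nonzero[of z w] bd[OF z] bd[OF w] z w
      by auto
    ultimately show ?thesis by (simp add: field_simps)
  qed
  define s where "s = (\<lambda>n::nat. complex_of_real (1 - 1 / real (Suc (Suc n))))"
  have s1: "cmod (s n) < 1" for n
    unfolding s_def norm_of_real by (simp add: field_simps)
  have slim: "s \<longlonglongrightarrow> 1"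
  proof -
    have "(\<lambda>n. 1 - 1 / real (Suc (Suc n))) \<longlonglongrightarrow> 1 - 0"
      by (intro tendsto_diff tendsto_const LIMSEQ_Suc lim_1_over_n)
    from tendsto_of_real[OF this] show ?thesis unfolding s_def by (simp only: diff_zero of_real_1)
  qed
  have ineq: "cmod (s n * f w - s n * f z) * cmod (1 - cnj z * w) \<le> cmod (w - z) * cmod (1 - cnj (s n * f z) * (s n * f w))" for n
  proof (rule strict)
    show "(\<lambda>x. s n * f x) holomorphic_on unit_disk" using hol by (intro holomorphic_intros)
    fix x assume "x \<in> unit_disk"
    then have "cmod (s n) * cmod (f x) \<le> cmod (s n) * 1" using bd by (intro mult_left_mono) auto
    then show "cmod (s n * f x) < 1" using s1[of n] by (simp add: norm_mult)
  qed
  have "(\<lambda>n. cmod (s n * f w - s n * f z) * cmod (1 - cnj z * w)) \<longlonglongrightarrow> cmod (1 * f w - 1 * f z) * cmod (1 - cnj z * w)"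
    by (intro tendsto_intros slim)
  moreover have "(\<lambda>n. cmod (w - z) * cmod (1 - cnj (s n * f z) * (s n * f w))) \<longlonglongrightarrow> cmod (w - z) * cmod (1 - cnj (1 * f z) * (1 * f w))"
    by (intro tendsto_intros slim)
  ultimately have "cmod (1 * f w - 1 * f z) * cmod (1 - cnj z * w) \<le> cmod (w - z) * cmod (1 - cnj (1 * f z) * (1 * f w))"
    using ineq by (intro LIMSEQ_le) auto
  then show ?thesis by simp
qed

text \<open>Divide the Schwarz-Pick inequality by |w - z| and let w tend to z.\<close>

lemma Schwarz_Pick_deriv:
  assumes hol: "f holomorphic_on unit_disk" and bd: "\<And>z. z \<in> unit_disk \<Longrightarrow> cmod (f z) \<le> 1"
    and z: "z \<in> unit_disk"
  shows "(1 - (cmod z)\<^sup>2) * cmod (deriv f z) \<le> 1 - (cmod (f z))\<^sup>2"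
proof -
  have df: "(f has_field_derivative deriv f z) (at z)"
    using hol z holomorphic_derivI by blast
  then have "((\<lambda>w. (f w - f z) / (w - z)) \<longlongrightarrow> deriv f z) (at z)"
    by (simp add: has_field_derivative_iff)
  then have l1: "((\<lambda>w. cmod ((f w - f z) / (w - z)) * cmod (1 - cnj z * w)) \<longlongrightarrow> cmod (deriv f z) * cmod (1 - cnj z * z)) (at z)"
    by (intro tendsto_intros)
  have "(f \<longlongrightarrow> f z) (at z)"
    using df DERIV_isCont isCont_def by blast
  then have l2: "((\<lambda>w. cmod (1 - cnj (f z) * f w)) \<longlongrightarrow> cmod (1 - cnj (f z) * f z)) (at z)"
    by (intro tendsto_intros)
  have "\<forall>\<^sub>F w in at z. w \<in> unit_disk - {z}"
    using z by (intro eventually_at_in_open) auto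
  then have ev: "\<forall>\<^sub>F w in at z. cmod ((f w - f z) / (w - z)) * cmod (1 - cnj z * w) \<le> cmod (1 - cnj (f z) * f w)"
  proof eventually_elim
    case (elim w)
    then have "cmod (f w - f z) * cmod (1 - cnj z * w) \<le> cmod (w - z) * cmod (1 - cnj (f z) * f w)"
      using Schwarz_Pick[OF hol bd z] by auto
    then show ?case using elim by (simp add: norm_divide field_simps)
  qed
  have "cmod (deriv f z) * cmod (1 - cnj z * z) \<le> cmod (1 - cnj (f z) * f z)"
    by (rule tendsto_le[OF _ l2 l1 ev]) simp
  moreover have "cmod (1 - cnj u * u) = 1 - (cmod u)\<^sup>2" if "cmod u \<le> 1" for u
  proof -
    have "1 - cnj u * u = of_real (1 - (cmod u)\<^sup>2)"
      using complex_norm_square[of u] by (simp add: mult.commute)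
    then show ?thesis using that by (simp add: power_le_one del: of_real_diff of_real_power)
  qed
  ultimately show ?thesis
    using z bd[OF z] by (simp add: mult.commute)
qed

text \<open>Neither a self-map of the disk nor the passage to moduli increases pseudohyperbolic
  distance. So a modulus of at least \<delta> can drop, within distance \<eta>, at most to (\<delta>
  - \<eta>) / (1 - \<delta> \<eta>); the conclusion is this bound with the denominator
  cleared.\<close>

lemma Schwarz_Pick_lower:
  assumes hol: "f holomorphic_on unit_disk" and bd: "\<And>z. z \<in> unit_disk \<Longrightarrow> cmod (f z) \<le> 1"
    and z: "z \<in> unit_disk" and w: "w \<in> unit_disk"
    and d: "cmod (w - z) \<le> \<eta> * cmod (1 - cnj z * w)" "0 \<le> \<eta>" "\<eta> < 1"
    and \<delta>: "\<delta> \<le> cmod (f z)"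
  shows "\<delta> - \<eta> \<le> cmod (f w) * (1 - \<delta> * \<eta>)"
proof -
  define \<beta> \<gamma> where "\<beta> = cmod (f z)" and "\<gamma> = cmod (f w)"
  have b: "0 \<le> \<beta>" "\<beta> \<le> 1" "0 \<le> \<gamma>" "\<gamma> \<le> 1" using bd z w by (auto simp: \<beta>_def \<gamma>_def)
  have pos: "0 < cmod (1 - cnj z * w)" using Moebius_denominator_nonzero[of z w] z w by auto
  have "cmod (f w - f z) * cmod (1 - cnj z * w) \<le> cmod (w - z) * cmod (1 - cnj (f z) * f w)"
    by (rule Schwarz_Pick[OF hol bd z w])
  also have "\<dots> \<le> (\<eta> * cmod (1 - cnj z * w)) * cmod (1 - cnj (f z) * f w)"
    using d by (intro mult_right_mono) auto
  finally have "cmod (f w - f z) \<le> \<eta> * cmod (1 - cnj (f z) * f w)"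
    using pos by (simp add: ac_simps)
  then have "(cmod (f w - f z))\<^sup>2 \<le> (\<eta> * cmod (1 - cnj (f z) * f w))\<^sup>2"
    by (intro power_mono) auto
  then have sq: "(cmod (f w - f z))\<^sup>2 \<le> \<eta>\<^sup>2 * (cmod (1 - cnj (f z) * f w))\<^sup>2"
    by (simp add: power_mult_distrib)
  \<comment> \<open>Only X depends on the arguments of the two values; the worst case is X = \<beta>
    \<gamma>, where they are aligned.\<close>
  define X where "X = Re (cnj (f z) * f w)"
  have e1: "(cmod (f w - f z))\<^sup>2 = \<gamma>\<^sup>2 + \<beta>\<^sup>2 - 2 * X"
    unfolding \<beta>_def \<gamma>_def X_def cmod_power2 by (simp add: power2_eq_square algebra_simps)
  have e2: "(cmod (1 - cnj (f z) * f w))\<^sup>2 = 1 - 2 * X + \<beta>\<^sup>2 * \<gamma>\<^sup>2"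
    unfolding \<beta>_def \<gamma>_def X_def cmod_power2 by (simp add: power2_eq_square algebra_simps)
  have "X \<le> \<beta> * \<gamma>"
    unfolding X_def \<beta>_def \<gamma>_def using complex_Re_le_cmod[of "cnj (f z) * f w"] by (simp add: norm_mult)
  moreover have "\<eta>\<^sup>2 \<le> 1" using d by (simp add: power_le_one)
  ultimately have "X * (1 - \<eta>\<^sup>2) \<le> \<beta> * \<gamma> * (1 - \<eta>\<^sup>2)" by (intro mult_right_mono) auto
  moreover have "\<gamma>\<^sup>2 + \<beta>\<^sup>2 - 2 * X \<le> \<eta>\<^sup>2 * (1 - 2 * X + \<beta>\<^sup>2 * \<gamma>\<^sup>2)" using sq unfolding e1 e2 .
  ultimately have "(\<beta> - \<gamma>)\<^sup>2 \<le> (\<eta> * (1 - \<beta> * \<gamma>))\<^sup>2"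
    by (simp add: power2_eq_square algebra_simps)
  moreover have "0 \<le> \<eta> * (1 - \<beta> * \<gamma>)" using b d by (simp add: mult_le_one)
  ultimately have "\<beta> - \<gamma> \<le> \<eta> * (1 - \<beta> * \<gamma>)" using power2_le_imp_le by blast
  \<comment> \<open>The estimate reads \<beta> (1 + \<eta> \<gamma>) \<le> \<gamma> + \<eta>, so
    \<beta> may be replaced by the smaller \<delta>.\<close>
  moreover have "\<delta> * (1 + \<eta> * \<gamma>) \<le> \<beta> * (1 + \<eta> * \<gamma>)"
    using \<delta> b d by (intro mult_right_mono) (auto simp: \<beta>_def)
  ultimately show ?thesis unfolding \<gamma>_def[symmetric] by (simp add: algebra_simps)
qed

section \<open>Blaschke factors and their subproducts\<close>

lemma blaschke_factor_holomorphic: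
  assumes "cmod a < 1"
  shows "blaschke_factor a holomorphic_on unit_disk" "continuous_on (cball 0 1) (blaschke_factor a)"
proof -
  have "(\<lambda>z. if a = 0 then z else of_real (cmod a) / a * ((a - z) / (1 - cnj a * z))) holomorphic_on unit_disk"
    using Moebius_denominator_nonzero[OF assms] by (cases "a = 0") (auto intro!: holomorphic_intros simp: less_imp_le)
  then show "blaschke_factor a holomorphic_on unit_disk" by (simp add: blaschke_factor_def[abs_def])
  have "continuous_on (cball 0 1) (\<lambda>z. if a = 0 then z else of_real (cmod a) / a * ((a - z) / (1 - cnj a * z)))"
    using Moebius_denominator_nonzero[OF assms] by (cases "a = 0") (auto intro!: continuous_intros)
  then show "continuous_on (cball 0 1) (blaschke_factor a)" by (simp add: blaschke_factor_def[abs_def])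
qed

lemma blaschke_factor_cmod:
  "cmod (blaschke_factor a z) = cmod (z - a) / cmod (1 - cnj a * z)"
  by (simp add: blaschke_factor_def norm_mult norm_divide norm_minus_commute)

lemma blaschke_factor_cmod_sq:
  assumes "cmod a < 1" "cmod z \<le> 1"
  shows "1 - (cmod (blaschke_factor a z))\<^sup>2 = (1 - (cmod a)\<^sup>2) * (1 - (cmod z)\<^sup>2) / (cmod (1 - cnj a * z))\<^sup>2"
  using Moebius_identity[of a z] Moebius_denominator_nonzero[OF assms]
  by (simp add: blaschke_factor_cmod power_divide field_simps)

lemma blaschke_factor_lt_1:
  assumes "cmod a < 1" "cmod z < 1"
  shows "cmod (blaschke_factor a z) < 1"
proof -
  have "0 < (1 - (cmod a)\<^sup>2) * (1 - (cmod z)\<^sup>2) / (cmod (1 - cnj a * z))\<^sup>2"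
    using assms Moebius_denominator_nonzero[of a z] by (simp add: power_less_one_iff abs_square_less_1)
  then have "(cmod (blaschke_factor a z))\<^sup>2 < 1"
    using blaschke_factor_cmod_sq[of a z] assms by simp
  then show ?thesis by (simp add: abs_square_less_1)
qed

lemma blaschke_factor_boundary:
  assumes "cmod a < 1" "cmod z = 1"
  shows "cmod (blaschke_factor a z) = 1"
proof -
  have "1 - (cmod (blaschke_factor a z))\<^sup>2 = 0"
    using blaschke_factor_cmod_sq[of a z] assms by simp
  then have "(cmod (blaschke_factor a z))\<^sup>2 = 1\<^sup>2" by simp
  then show ?thesis by (subst (asm) power2_eq_iff_nonneg) auto
qed

text \<open>Blaschke factors are automorphisms of the disk, the equality case of Schwarz-Pick. Close
  to a zero of a thin product far out in the disk, this single factor accounts for almost the whole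
  hyperbolic derivative.\<close>

lemma blaschke_factor_deriv:
  assumes "cmod a < 1" "cmod z < 1"
  shows "(1 - (cmod z)\<^sup>2) * cmod (deriv (blaschke_factor a) z) = 1 - (cmod (blaschke_factor a z))\<^sup>2"
proof (cases "a = 0")
  case True
  have "deriv (blaschke_factor 0) z = 1"
    unfolding blaschke_factor_def[abs_def] by simp
  then show ?thesis using True by (simp add: blaschke_factor_cmod)
next
  case False
  have nz: "1 - cnj a * z \<noteq> 0" using Moebius_denominator_nonzero[of a z] assms by simp
  have "((\<lambda>z. a - z) has_field_derivative -1) (at z)" "((\<lambda>z. 1 - cnj a * z) has_field_derivative - cnj a) (at z)"
    by (auto intro!: derivative_eq_intros)
  from DERIV_cmult[OF DERIV_divide[OF this nz], of "of_real (cmod a) / a"]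
  have "((\<lambda>z. of_real (cmod a) / a * ((a - z) / (1 - cnj a * z))) has_field_derivative
      of_real (cmod a) / a * ((-1 * (1 - cnj a * z) - (a - z) * (- cnj a)) / ((1 - cnj a * z) * (1 - cnj a * z)))) (at z)" .
  then have "deriv (blaschke_factor a) z = of_real (cmod a) / a * ((-1 * (1 - cnj a * z) - (a - z) * (- cnj a)) / ((1 - cnj a * z) * (1 - cnj a * z)))"
    unfolding blaschke_factor_def[abs_def] using False by (simp only: if_False DERIV_imp_deriv)
  also have "-1 * (1 - cnj a * z) - (a - z) * (- cnj a) = - of_real (1 - (cmod a)\<^sup>2)"
    using complex_norm_square[of a] by (simp add: algebra_simps)
  finally have "cmod (deriv (blaschke_factor a) z) = (1 - (cmod a)\<^sup>2) / (cmod (1 - cnj a * z))\<^sup>2"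
    using False assms(1) by (simp add: norm_mult norm_divide power2_eq_square power_le_one abs_square_le_1 mult_le_one
        del: of_real_diff of_real_mult of_real_power)
  then show ?thesis using blaschke_factor_cmod_sq[of a z] assms by simp
qed

text \<open>The normalising constant |a|/a is what makes the factor tend to 1 as |a| tends to 1. The
  bound by a multiple of 1 - |a| turns the Blaschke condition into absolute convergence of the
  product.\<close>

lemma blaschke_factor_near_1:
  assumes "cmod a < 1" "cmod z \<le> r" "r < 1"
  shows "cmod (blaschke_factor a z - 1) \<le> 2 / (1 - r) * (1 - cmod a)"
proof -
  have le: "1 - r \<le> cmod (1 - cnj a * z)"
  proof -
    have "cmod (cnj a * z) \<le> 1 * r"
      unfolding norm_mult using assms by (intro mult_mono) auto
    then show ?thesis using norm_triangle_ineq2[of 1 "cnj a * z"] by simp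
  qed
  show ?thesis
  proof (cases "a = 0")
    case True
    have "cmod (z - 1) \<le> 2" using norm_triangle_ineq4[of z 1] assms by simp
    moreover have "0 \<le> r" using assms(2) norm_ge_zero order_trans by blast
    then have "2 \<le> 2 / (1 - r)" using assms(3) by (simp add: field_simps)
    ultimately show ?thesis using True by (simp add: blaschke_factor_def)
  next
    case False
    have nz: "1 - cnj a * z \<noteq> 0" using le assms(3) by auto
    \<comment> \<open>Over a common denominator, the identity |a|^2 = a \<open>cnj a\<close> exposes
      the factor 1 - |a|.\<close>
    have "blaschke_factor a z - 1 = - (of_real (1 - cmod a) * (a + of_real (cmod a) * z) / (a * (1 - cnj a * z)))"
      using False nz complex_norm_square[of a]
      by (simp add: blaschke_factor_def field_simps power2_eq_square)
    then have "cmod (blaschke_factor a z - 1) = (1 - cmod a) * cmod (a + of_real (cmod a) * z) / (cmod a * cmod (1 - cnj a * z))"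
      using assms(1) by (simp add: norm_mult norm_divide del: of_real_diff)
    also have "\<dots> \<le> (1 - cmod a) * (cmod a * 2) / (cmod a * (1 - r))"
    proof (intro frac_le mult_left_mono mult_pos_pos)
      have "cmod (a + of_real (cmod a) * z) \<le> cmod a + cmod a * cmod z"
        using norm_triangle_ineq[of a "of_real (cmod a) * z"] by (simp add: norm_mult)
      also have "\<dots> \<le> cmod a + cmod a * 1" using assms by (intro add_left_mono mult_left_mono) auto
      finally show "cmod (a + of_real (cmod a) * z) \<le> cmod a * 2" by simp
    qed (use assms le False in auto)
    also have "\<dots> = 2 / (1 - r) * (1 - cmod a)" using False assms(3) by (simp add: divide_simps)
    finally show ?thesis .
  qed
qed

text \<open>The index set stays all of \<open>nat\<close> and omitted factors become 1, so that
  heads, tails and products without one factor split termwise along \<open>J\<close> and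
  \<open>- J\<close> without any re-enumeration.\<close>

definition sub_blaschke :: "(nat \<Rightarrow> complex) \<Rightarrow> nat set \<Rightarrow> complex \<Rightarrow> complex" where
  "sub_blaschke a J z = (\<Prod>n. if n \<in> J then blaschke_factor (a n) z else 1)"

locale blaschke_sequence =
  fixes a :: "nat \<Rightarrow> complex"
  assumes a_disk: "\<And>n. cmod (a n) < 1" and a_summable: "summable (\<lambda>n. 1 - cmod (a n))"
begin

abbreviation "fac J n z \<equiv> if n \<in> J then blaschke_factor (a n) z else 1"

lemma sub_blaschke_limit:
  assumes "cmod z < 1"
  shows "(\<lambda>N. \<Prod>n<N. fac J n z) \<longlonglongrightarrow> sub_blaschke a J z"
proof -
  have "summable (\<lambda>n. norm (fac J n z - 1))"
  proof (rule summable_comparison_test)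
    show "\<exists>N. \<forall>n\<ge>N. norm (norm (fac J n z - 1)) \<le> 2 / (1 - cmod z) * (1 - cmod (a n))"
      using blaschke_factor_near_1[OF a_disk order_refl assms] a_disk assms
      by (auto simp: less_imp_le)
    show "summable (\<lambda>n. 2 / (1 - cmod z) * (1 - cmod (a n)))"
      by (intro summable_mult a_summable)
  qed
  then have "abs_convergent_prod (\<lambda>n. fac J n z)"
    by (simp add: abs_convergent_prod_conv_summable)
  then have "(\<lambda>n. \<Prod>i\<le>n. fac J i z) \<longlonglongrightarrow> sub_blaschke a J z"
    unfolding sub_blaschke_def by (intro convergent_prod_LIMSEQ abs_convergent_prod_imp_convergent_prod)
  then have "(\<lambda>n. \<Prod>i<Suc n. fac J i z) \<longlonglongrightarrow> sub_blaschke a J z"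
    by (simp only: lessThan_Suc_atMost)
  then show ?thesis by (rule LIMSEQ_imp_Suc)
qed

lemma fac_holomorphic: "(\<lambda>z. fac J n z) holomorphic_on unit_disk"
  using blaschke_factor_holomorphic(1)[OF a_disk[of n]] by (cases "n \<in> J") simp_all

lemma fac_le_1: "cmod z < 1 \<Longrightarrow> cmod (fac J n z) \<le> 1"
  using blaschke_factor_lt_1[OF a_disk] by (auto simp: less_imp_le)

text \<open>On discs of radius r < 1 the distances of the factors from 1 have a summable bound, so
  the partial products converge uniformly there.\<close>

lemma sub_blaschke_holomorphic: "sub_blaschke a J holomorphic_on unit_disk"
proof (rule holomorphic_uniform_sequence)
  show "(\<lambda>z. \<Prod>n<N. fac J n z) holomorphic_on unit_disk" for N
    by (intro holomorphic_on_prod fac_holomorphic)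
  fix x assume "x \<in> unit_disk"
  then have x: "cmod x < 1" by simp
  define r where "r = (1 + cmod x) / 2"
  have r: "0 \<le> r" "r < 1" "cmod x < r" using x by (simp_all add: r_def)
  have sub: "cball 0 r \<subseteq> unit_disk" using r by auto
  have "uniformly_convergent_on (cball 0 r) (\<lambda>N z. \<Prod>n<N. fac J n z)"
  proof (rule uniformly_convergent_on_prod')
    show "continuous_on (cball 0 r) (\<lambda>z. fac J n z)" for n
      using fac_holomorphic holomorphic_on_imp_continuous_on continuous_on_subset sub by blast
    show "uniformly_convergent_on (cball 0 r) (\<lambda>N x. \<Sum>n<N. norm (fac J n x - 1))"
    proof (rule Weierstrass_m_test')
      show "summable (\<lambda>n. 2 / (1 - r) * (1 - cmod (a n)))"
        by (intro summable_mult a_summable)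
      fix n and x :: complex assume "x \<in> cball 0 r"
      then show "norm (norm (fac J n x - 1)) \<le> 2 / (1 - r) * (1 - cmod (a n))"
        using blaschke_factor_near_1[OF a_disk, of x r n] r a_disk[of n] by (auto simp: less_imp_le)
    qed
  qed simp
  then obtain l where l: "uniform_limit (cball 0 r) (\<lambda>N z. \<Prod>n<N. fac J n z) l sequentially"
    by (auto simp: uniformly_convergent_on_def)
  have "l z = sub_blaschke a J z" if "z \<in> cball 0 r" for z
    using tendsto_uniform_limitI[OF l that] sub_blaschke_limit[of z J] that r LIMSEQ_unique by auto
  then have "uniform_limit (cball 0 r) (\<lambda>N z. \<Prod>n<N. fac J n z) l sequentially =
      uniform_limit (cball 0 r) (\<lambda>N z. \<Prod>n<N. fac J n z) (sub_blaschke a J) sequentially"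
    by (intro uniform_limit_cong') simp_all
  with l have ul: "uniform_limit (cball 0 r) (\<lambda>N z. \<Prod>n<N. fac J n z) (sub_blaschke a J) sequentially"
    by blast
  define d where "d = r - cmod x"
  have "cball x d \<subseteq> cball 0 r"
  proof
    fix w assume "w \<in> cball x d"
    then have "cmod (w - x) \<le> d" by (simp add: dist_norm norm_minus_commute)
    then show "w \<in> cball 0 r" using norm_triangle_ineq2[of w x] by (simp add: d_def)
  qed
  moreover have "0 < d" using r by (simp add: d_def)
  ultimately show "\<exists>d>0. cball x d \<subseteq> unit_disk \<and> uniform_limit (cball x d) (\<lambda>N z. \<Prod>n<N. fac J n z) (sub_blaschke a J) sequentially"
    using uniform_limit_on_subset[OF ul] sub by blast
qed simp

lemma sub_blaschke_cmod_limit: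
  "cmod z < 1 \<Longrightarrow> (\<lambda>N. \<Prod>n<N. cmod (fac J n z)) \<longlonglongrightarrow> cmod (sub_blaschke a J z)"
  using tendsto_norm[OF sub_blaschke_limit] by (simp add: prod_norm)

lemma sub_blaschke_le_1:
  assumes "cmod z < 1"
  shows "cmod (sub_blaschke a J z) \<le> 1"
proof (rule LIMSEQ_le_const2[OF sub_blaschke_cmod_limit[OF assms]])
  show "\<exists>N. \<forall>n\<ge>N. (\<Prod>i<n. cmod (fac J i z)) \<le> 1"
    using fac_le_1[OF assms] by (intro exI[of _ 0] allI impI prod_le_1) auto
qed

lemma sub_blaschke_split:
  assumes "cmod z < 1"
  shows "sub_blaschke a UNIV z = sub_blaschke a J z * sub_blaschke a (- J) z"
proof -
  have "(\<lambda>N. (\<Prod>n<N. fac J n z) * (\<Prod>n<N. fac (- J) n z)) \<longlonglongrightarrow> sub_blaschke a J z * sub_blaschke a (- J) z"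
    by (intro tendsto_mult sub_blaschke_limit assms)
  moreover have "(\<Prod>n<N. fac J n z) * (\<Prod>n<N. fac (- J) n z) = (\<Prod>n<N. fac UNIV n z)" for N
    unfolding prod.distrib[symmetric] by (intro prod.cong) auto
  ultimately have "(\<lambda>N. \<Prod>n<N. fac UNIV n z) \<longlonglongrightarrow> sub_blaschke a J z * sub_blaschke a (- J) z"
    by (simp only:)
  then show ?thesis using sub_blaschke_limit[OF assms, of UNIV] LIMSEQ_unique by blast
qed

lemma sub_blaschke_finite:
  assumes "cmod z < 1" "finite J"
  shows "sub_blaschke a J z = (\<Prod>n\<in>J. blaschke_factor (a n) z)"
proof -
  obtain M where M: "\<And>n. n \<in> J \<Longrightarrow> n < M"
    using assms(2) unfolding finite_nat_iff_bounded by blast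
  have "(\<Prod>n<N. fac J n z) = (\<Prod>n\<in>J. blaschke_factor (a n) z)" if "N \<ge> M" for N
  proof -
    have "J \<subseteq> {..<N}" using M that by force
    then have "{..<N} \<inter> J = J" by blast
    then show ?thesis
      using prod.inter_restrict[of "{..<N}" "\<lambda>n. blaschke_factor (a n) z" J] by simp
  qed
  then have "(\<lambda>N. \<Prod>n<N. fac J n z) \<longlonglongrightarrow> (\<Prod>n\<in>J. blaschke_factor (a n) z)"
    by (intro tendsto_eventually eventually_sequentiallyI[of M])
  then show ?thesis using sub_blaschke_limit[OF assms(1), of J] LIMSEQ_unique by blast
qed

lemma sub_blaschke_le_finite:
  assumes "cmod z < 1" "finite F" "F \<subseteq> J"
  shows "cmod (sub_blaschke a J z) \<le> (\<Prod>n\<in>F. cmod (blaschke_factor (a n) z))"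
proof (rule LIMSEQ_le_const2[OF sub_blaschke_cmod_limit[OF assms(1)]])
  obtain M where M: "\<And>n. n \<in> F \<Longrightarrow> n < M"
    using assms(2) unfolding finite_nat_iff_bounded by blast
  have "(\<Prod>i<n. cmod (fac J i z)) \<le> (\<Prod>n\<in>F. cmod (blaschke_factor (a n) z))" if "n \<ge> M" for n
  proof -
    have sub: "F \<subseteq> {..<n}" using M that by force
    have "(\<Prod>i<n. cmod (fac J i z)) = (\<Prod>i\<in>{..<n} - F. cmod (fac J i z)) * (\<Prod>i\<in>F. cmod (fac J i z))"
      using sub by (intro prod.subset_diff) auto
    also have "\<dots> \<le> 1 * (\<Prod>i\<in>F. cmod (fac J i z))"
      using fac_le_1[OF assms(1)] by (intro mult_right_mono prod_le_1 prod_nonneg) auto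
    also have "\<dots> = (\<Prod>n\<in>F. cmod (blaschke_factor (a n) z))"
      using assms(3) by (auto intro!: prod.cong)
    finally show ?thesis .
  qed
  then show "\<exists>N. \<forall>n\<ge>N. (\<Prod>i<n. cmod (fac J i z)) \<le> (\<Prod>n\<in>F. cmod (blaschke_factor (a n) z))" by blast
qed

text \<open>Hoffman's lemma: the minimum principle for a finite Blaschke product outside pseudohyperbolic
  discs around its zeros.\<close>

lemma finite_blaschke_lower:
  assumes F: "finite F" and \<delta>: "\<And>k. k \<in> F \<Longrightarrow> \<delta> \<le> (\<Prod>j\<in>F - {k}. cmod (blaschke_factor (a j) (a k)))"
    and \<eta>: "0 < \<eta>" "\<eta> < 1" and t: "0 < t" "t \<le> 1" "t * (1 - \<delta> * \<eta>) \<le> \<delta> - \<eta>" "\<delta> * \<eta> < 1"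
    and w: "cmod w < 1" "\<And>k. k \<in> F \<Longrightarrow> \<eta> \<le> cmod (blaschke_factor (a k) w)"
  shows "\<eta> * t \<le> (\<Prod>j\<in>F. cmod (blaschke_factor (a j) w))"
proof -
  let ?b = "\<lambda>k. blaschke_factor (a k)"
  define p where "p = (\<lambda>z. \<Prod>j\<in>F. ?b j z)"
  \<comment> \<open>On the rim of the disc around the zero a k the k-th factor has modulus \<eta>.
    The product q of the others is at least \<delta> at a k, hence still at least t on the rim by
    Schwarz-Pick.\<close>
  have edge: "\<eta> * t \<le> cmod (p z)" if z: "cmod z < 1" and k: "k \<in> F" "cmod (?b k z) = \<eta>" for z k
  proof -
    define q where "q = (\<lambda>z. \<Prod>j\<in>F - {k}. ?b j z)"
    have "q holomorphic_on unit_disk"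
      unfolding q_def by (intro holomorphic_on_prod blaschke_factor_holomorphic a_disk)
    moreover have "cmod (q u) \<le> 1" if "u \<in> unit_disk" for u
      unfolding q_def prod_norm[symmetric] using blaschke_factor_lt_1[OF a_disk] that
      by (intro prod_le_1) (auto simp: less_imp_le)
    moreover have "cmod (z - a k) \<le> \<eta> * cmod (1 - cnj (a k) * z)"
      using k(2) Moebius_denominator_nonzero[OF a_disk, of z k] z by (auto simp: blaschke_factor_cmod field_simps)
    moreover have "\<delta> \<le> cmod (q (a k))"
      using \<delta>[OF k(1)] by (simp add: q_def prod_norm)
    ultimately have "\<delta> - \<eta> \<le> cmod (q z) * (1 - \<delta> * \<eta>)"
      using \<eta> z a_disk by (intro Schwarz_Pick_lower[of q "a k" z]) auto
    then have "t * (1 - \<delta> * \<eta>) \<le> cmod (q z) * (1 - \<delta> * \<eta>)" using t by linarith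
    then have "t \<le> cmod (q z)" using t by simp
    moreover have "p z = ?b k z * q z"
      unfolding p_def q_def using F k(1) by (rule prod.remove)
    ultimately show ?thesis using k \<eta> by (simp add: norm_mult)
  qed
  \<comment> \<open>The region outside all the discs. The product p has no zeros on its closure, and
    its frontier consists of points of the unit circle, where |p| = 1, and of rim points; the
    maximum principle for 1/p does the rest.\<close>
  define S where "S = {z \<in> unit_disk. \<forall>k\<in>F. \<eta> < cmod (?b k z)}"
  have bcont: "continuous_on (cball 0 1) (?b k)" for k
    using blaschke_factor_holomorphic(2)[OF a_disk] .
  have Sopen: "open S"
  proof -
    have "open (unit_disk \<inter> (\<lambda>z. cmod (?b k z)) -` {\<eta><..})" for k
      using continuous_on_subset[OF bcont[of k] ball_subset_cball]
      by (intro continuous_open_preimage continuous_intros) auto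
    then have "open (unit_disk \<inter> (\<Inter>k\<in>F. unit_disk \<inter> (\<lambda>z. cmod (?b k z)) -` {\<eta><..}))"
      using F by (intro open_Int open_INT) auto
    moreover have "S = unit_disk \<inter> (\<Inter>k\<in>F. unit_disk \<inter> (\<lambda>z. cmod (?b k z)) -` {\<eta><..})"
      by (auto simp: S_def)
    ultimately show ?thesis by simp
  qed
  have clS: "closure S \<subseteq> {z \<in> cball 0 1. \<forall>k\<in>F. \<eta> \<le> cmod (?b k z)}"
  proof (rule closure_minimal)
    show "S \<subseteq> {z \<in> cball 0 1. \<forall>k\<in>F. \<eta> \<le> cmod (?b k z)}"
      by (auto simp: S_def)
    have "closed (cball 0 1 \<inter> (\<lambda>z. cmod (?b k z)) -` {\<eta>..})" for k
      using bcont[of k] by (intro continuous_closed_preimage continuous_intros) auto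
    then have "closed (cball 0 1 \<inter> (\<Inter>k\<in>F. cball 0 1 \<inter> (\<lambda>z. cmod (?b k z)) -` {\<eta>..}))"
      by (intro closed_Int closed_INT) auto
    moreover have "{z \<in> cball 0 1. \<forall>k\<in>F. \<eta> \<le> cmod (?b k z)} = cball 0 1 \<inter> (\<Inter>k\<in>F. cball 0 1 \<inter> (\<lambda>z. cmod (?b k z)) -` {\<eta>..})"
      by auto
    ultimately show "closed {z \<in> cball 0 1. \<forall>k\<in>F. \<eta> \<le> cmod (?b k z)}" by simp
  qed
  have nz: "p z \<noteq> 0" if "z \<in> closure S" for z
  proof
    assume "p z = 0"
    then obtain k where k: "k \<in> F" "?b k z = 0" using F by (auto simp: p_def prod_zero_iff)
    have "\<eta> \<le> cmod (?b k z)" using subsetD[OF clS that] k(1) by simp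
    then show False using k(2) \<eta> by simp
  qed
  have "cmod (1 / p z) \<le> 1 / (\<eta> * t)" if "z \<in> S" for z
  proof (rule maximum_modulus_frontier[of "\<lambda>z. 1 / p z" S])
    show "(\<lambda>z. 1 / p z) holomorphic_on interior S"
    proof (rule holomorphic_on_divide)
      have "S \<subseteq> unit_disk" by (auto simp: S_def)
      then show "p holomorphic_on interior S"
        unfolding p_def interior_open[OF Sopen]
        by (intro holomorphic_on_prod holomorphic_on_subset[OF blaschke_factor_holomorphic(1)[OF a_disk]])
      show "p z \<noteq> 0" if "z \<in> interior S" for z
        using nz that closure_subset interior_subset by blast
    qed simp
    have "continuous_on (closure S) p"
    proof -
      have "closure S \<subseteq> cball 0 1" using clS by blast
      then show ?thesis
        unfolding p_def by (intro continuous_on_prod continuous_on_subset[OF bcont])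
    qed
    then show "continuous_on (closure S) (\<lambda>z. 1 / p z)"
      using nz by (intro continuous_on_divide continuous_on_const) auto
    show "bounded S" by (rule bounded_subset[OF bounded_ball[of 0 1]]) (auto simp: S_def)
    show "z \<in> S" by (rule that)
    fix u assume "u \<in> frontier S"
    then have u: "u \<in> closure S" "u \<notin> S" using Sopen by (auto simp: frontier_def interior_open)
    have "\<eta> * t \<le> cmod (p u)"
    proof (cases "cmod u = 1")
      case True
      then have "cmod (p u) = 1"
        unfolding p_def prod_norm[symmetric] using blaschke_factor_boundary[OF a_disk] by simp
      then show ?thesis using \<eta> t by (simp add: mult_le_one)
    next
      case False
      then have u1: "cmod u < 1" using clS u by force
      then obtain k where k: "k \<in> F" "\<not> \<eta> < cmod (?b k u)" using u by (auto simp: S_def)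
      then have "cmod (?b k u) = \<eta>" using clS u(1) by fastforce
      then show ?thesis using edge[OF u1 k(1)] by blast
    qed
    then show "cmod (1 / p u) \<le> 1 / (\<eta> * t)"
      using \<eta> t by (simp add: norm_divide frac_le)
  qed
  note inS = this
  have "\<eta> * t \<le> cmod (p w)"
  proof (cases "w \<in> S")
    case True
    have "0 < cmod (p w)" using nz closure_subset True by auto
    then show ?thesis using inS[OF True] \<eta> t by (simp add: norm_divide field_simps)
  next
    case False
    then obtain k where k: "k \<in> F" "\<not> \<eta> < cmod (?b k w)" using w by (auto simp: S_def)
    then show ?thesis using edge[OF w(1) k(1)] w(2)[OF k(1)] by simp
  qed
  then show ?thesis by (simp add: p_def prod_norm)
qed

text \<open>A finite product has modulus 1 on the circle and is uniformly continuous on the closed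
  disk.\<close>

lemma finite_blaschke_near_boundary:
  assumes "finite F" "q < 1"
  shows "\<exists>R<1. \<forall>w. R < cmod w \<and> cmod w < 1 \<longrightarrow> q \<le> (\<Prod>j\<in>F. cmod (blaschke_factor (a j) w))"
proof -
  let ?p = "\<lambda>w. \<Prod>j\<in>F. cmod (blaschke_factor (a j) w)"
  have "continuous_on (cball 0 1) ?p"
    by (intro continuous_on_prod continuous_on_norm blaschke_factor_holomorphic a_disk)
  then have "uniformly_continuous_on (cball 0 1) ?p"
    by (intro compact_uniformly_continuous) auto
  then obtain d where d: "0 < d" "\<And>x y. x \<in> cball 0 1 \<Longrightarrow> y \<in> cball 0 1 \<Longrightarrow> dist y x < d \<Longrightarrow> dist (?p y) (?p x) < 1 - q"
  proof -
    have "0 < 1 - q" using assms(2) by simp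
    then show ?thesis
      using \<open>uniformly_continuous_on (cball 0 1) ?p\<close> that unfolding uniformly_continuous_on_def by blast
  qed
  have "q \<le> ?p w" if w: "max 0 (1 - d) < cmod w" "cmod w < 1" for w
  proof -
    \<comment> \<open>The radial projection of w to the circle, at distance 1 - |w|.\<close>
    define v where "v = w / of_real (cmod w)"
    have w0: "w \<noteq> 0" using w by auto
    have v: "cmod v = 1" using w0 by (simp add: v_def norm_divide)
    have "dist v w = 1 - cmod w"
    proof -
      have "v - w = of_real (1 - cmod w) * v" using w0 by (simp add: v_def field_simps)
      then have "cmod (v - w) = cmod (of_real (1 - cmod w)) * cmod v" by (simp only: norm_mult)
      then show ?thesis using v w by (simp add: dist_norm del: of_real_diff)
    qed
    then have "dist (?p v) (?p w) < 1 - q" using d(2)[of w v] v w by simp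
    moreover have "?p v = 1" using blaschke_factor_boundary[OF a_disk v] by simp
    ultimately show ?thesis by (simp add: dist_real_def)
  qed
  moreover have "max 0 (1 - d) < 1" using d(1) by simp
  ultimately show ?thesis by blast
qed

end

text \<open>The form in which thinness enters the operator theory. Schwarz-Pick bounds the
  hyperbolic derivative (1 - |w|^2) |B'(w)| / (1 - |B(w)|^2) by 1; \<open>isometric\<close> says
  that it comes arbitrarily close to 1 as w approaches the circle with |B(w)| \<le> \<rho>.\<close>

locale asymptotic_isometry =
  fixes B :: "complex \<Rightarrow> complex"
  assumes hol: "B holomorphic_on unit_disk"
    and lt1: "\<And>z. z \<in> unit_disk \<Longrightarrow> cmod (B z) < 1"
    and nonconst: "\<exists>z\<in>unit_disk. deriv B z \<noteq> 0"
    and isometric: "\<And>\<rho> \<epsilon>. \<rho> < 1 \<Longrightarrow> 0 < \<epsilon> \<Longrightarrow> \<exists>R<1. \<forall>w. R < cmod w \<and> cmod w < 1 \<and> cmod (B w) \<le> \<rho>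
        \<longrightarrow> (1 - \<epsilon>) * (1 - (cmod (B w))\<^sup>2) \<le> (1 - (cmod w)\<^sup>2) * cmod (deriv B w)"

context blaschke_sequence
begin

text \<open>Finite sections of the tail satisfy the hypothesis of the minimum principle with the
  same \<delta>, since a partial product without the factor k has larger modulus than the full one.
  The bound is therefore uniform and survives the limit.\<close>

lemma tail_lower:
  assumes \<delta>: "\<And>k. k \<ge> N \<Longrightarrow> \<delta> \<le> cmod (sub_blaschke a (- {k}) (a k))"
    and \<eta>: "0 < \<eta>" "\<eta> < 1" and t: "0 < t" "t \<le> 1" "t * (1 - \<delta> * \<eta>) \<le> \<delta> - \<eta>" "\<delta> * \<eta> < 1"
    and w: "cmod w < 1" "\<And>k. k \<ge> N \<Longrightarrow> \<eta> \<le> cmod (blaschke_factor (a k) w)"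
  shows "\<eta> * t \<le> cmod (sub_blaschke a {N..} w)"
proof (rule LIMSEQ_le_const[OF sub_blaschke_cmod_limit[OF w(1)]])
  have "\<eta> * t \<le> (\<Prod>i<M. cmod (fac {N..} i w))" for M
  proof -
    have "\<eta> * t \<le> (\<Prod>j\<in>{N..<M}. cmod (blaschke_factor (a j) w))"
    proof (rule finite_blaschke_lower[where \<delta> = \<delta>])
      fix k assume k: "k \<in> {N..<M}"
      then have "\<delta> \<le> cmod (sub_blaschke a (- {k}) (a k))" using \<delta> by simp
      also have "\<dots> \<le> (\<Prod>j\<in>{N..<M} - {k}. cmod (blaschke_factor (a j) (a k)))"
        by (rule sub_blaschke_le_finite[OF a_disk]) auto
      finally show "\<delta> \<le> (\<Prod>j\<in>{N..<M} - {k}. cmod (blaschke_factor (a j) (a k)))" .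
      show "\<eta> \<le> cmod (blaschke_factor (a k) w)" using w k by simp
    qed (use \<eta> t w in simp_all)
    also have "\<dots> = (\<Prod>i<M. cmod (fac {N..} i w))"
    proof -
      have "{..<M} \<inter> {N..} = {N..<M}" by auto
      moreover have "cmod (fac {N..} i w) = (if i \<in> {N..} then cmod (blaschke_factor (a i) w) else 1)" for i
        by simp
      ultimately show ?thesis
        using prod.inter_restrict[of "{..<M}" "\<lambda>n. cmod (blaschke_factor (a n) w)" "{N..}"] by simp
    qed
    finally show ?thesis .
  qed
  then show "\<exists>M. \<forall>n\<ge>M. \<eta> * t \<le> (\<Prod>i<n. cmod (fac {N..} i w))" by blast
qed

text \<open>\<eta> lies midway between \<rho> and 1. As t tends to 1, the left side of the last
  inequality tends to 0 and its right side to (1 - \<eta>^2) \<epsilon> > 0. That inequality is what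
  the final estimate of \<open>thin_asymptotic\<close> consumes.\<close>

lemma asymptotic_parameters:
  fixes \<rho> \<epsilon> :: real
  assumes "0 \<le> \<rho>" "\<rho> < 1" "0 < \<epsilon>"
  obtains \<eta> t where "0 < \<eta>" "\<eta> < 1" "0 < t" "t < 1" "\<rho> < \<eta> * t" "1 - \<epsilon> \<le> t"
    "(2 - \<epsilon>) * (1 - t\<^sup>2) \<le> (1 - \<eta>\<^sup>2) * (t - (1 - \<epsilon>))"
proof -
  define \<eta> where "\<eta> = (1 + \<rho>) / 2"
  have \<eta>: "0 < \<eta>" "\<eta> < 1" "\<rho> < \<eta>" using assms by (auto simp: \<eta>_def)
  have \<eta>2: "\<eta>\<^sup>2 < 1" using \<eta> by (simp add: abs_square_less_1)
  have l1: "((\<lambda>t. (1 - \<eta>\<^sup>2) * (t - (1 - \<epsilon>)) - (2 - \<epsilon>) * (1 - t\<^sup>2)) \<longlongrightarrow> (1 - \<eta>\<^sup>2) * (1 - (1 - \<epsilon>)) - (2 - \<epsilon>) * (1 - 1\<^sup>2)) (at_left 1)"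
    by (intro tendsto_intros)
  have "0 < (1 - \<eta>\<^sup>2) * (1 - (1 - \<epsilon>)) - (2 - \<epsilon>) * (1 - 1\<^sup>2)" using \<eta>2 assms by simp
  from order_tendstoD(1)[OF l1 this]
  have e1: "\<forall>\<^sub>F t in at_left 1. 0 < (1 - \<eta>\<^sup>2) * (t - (1 - \<epsilon>)) - (2 - \<epsilon>) * (1 - t\<^sup>2)" .
  have l2: "((\<lambda>t. \<eta> * t) \<longlongrightarrow> \<eta> * 1) (at_left 1)" by (intro tendsto_intros)
  have e2: "\<forall>\<^sub>F t in at_left 1. \<rho> < \<eta> * t"
    using order_tendstoD(1)[OF l2] \<eta> by simp
  have e3: "\<forall>\<^sub>F t in at_left (1::real). t \<in> {max 0 (1 - \<epsilon>)<..<1}"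
    using assms by (intro eventually_at_left_real) auto
  have "\<forall>\<^sub>F t in at_left 1. 0 < (1 - \<eta>\<^sup>2) * (t - (1 - \<epsilon>)) - (2 - \<epsilon>) * (1 - t\<^sup>2) \<and> \<rho> < \<eta> * t \<and> t \<in> {max 0 (1 - \<epsilon>)<..<1}"
    using e1 e2 e3 by eventually_elim blast
  then obtain t where "0 < (1 - \<eta>\<^sup>2) * (t - (1 - \<epsilon>)) - (2 - \<epsilon>) * (1 - t\<^sup>2)" "\<rho> < \<eta> * t" "t \<in> {max 0 (1 - \<epsilon>)<..<1}"
    using eventually_happens'[OF trivial_limit_at_left_real] by blast
  then show ?thesis using \<eta> by (intro that[of \<eta> t]) auto
qed

text \<open>Near the circle, |B| can stay away from 1 only within pseudohyperbolic distance \<eta>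
  of a zero of the tail. Split off the factor b of that zero, B = b H: b is an automorphism, |H| is
  close to 1, and Schwarz-Pick then makes the hyperbolic derivative of H small, so B inherits nearly
  the derivative of b.\<close>

lemma thin_asymptotic:
  assumes thin: "(\<lambda>k. cmod (sub_blaschke a (- {k}) (a k))) \<longlonglongrightarrow> 1"
    and c: "cmod c = 1" and B: "\<And>z. z \<in> unit_disk \<Longrightarrow> B z = c * sub_blaschke a UNIV z"
    and "0 \<le> \<rho>" "\<rho> < 1" "0 < \<epsilon>"
  shows "\<exists>R<1. \<forall>w. R < cmod w \<and> cmod w < 1 \<and> cmod (B w) \<le> \<rho>
        \<longrightarrow> (1 - \<epsilon>) * (1 - (cmod (B w))\<^sup>2) \<le> (1 - (cmod w)\<^sup>2) * cmod (deriv B w)"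
proof (cases "\<epsilon> < 1")
  case False
  have "(1 - \<epsilon>) * (1 - (cmod (B w))\<^sup>2) \<le> (1 - (cmod w)\<^sup>2) * cmod (deriv B w)" if w: "cmod w < 1" for w
  proof -
    have "cmod (B w) \<le> 1" using B[of w] c sub_blaschke_le_1[OF w] w by (simp add: norm_mult)
    then have "(1 - \<epsilon>) * (1 - (cmod (B w))\<^sup>2) \<le> 0"
      using False by (intro mult_nonpos_nonneg) (auto simp: abs_square_le_1)
    also have "0 \<le> (1 - (cmod w)\<^sup>2) * cmod (deriv B w)" using w by (simp add: abs_square_le_1)
    finally show ?thesis .
  qed
  then show ?thesis by (intro exI[of _ 0]) auto
next
  case True
  obtain \<eta> t where \<eta>: "0 < \<eta>" "\<eta> < 1" and t: "0 < t" "t < 1" "\<rho> < \<eta> * t" "1 - \<epsilon> \<le> t"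
    "(2 - \<epsilon>) * (1 - t\<^sup>2) \<le> (1 - \<eta>\<^sup>2) * (t - (1 - \<epsilon>))"
    by (rule asymptotic_parameters[OF assms(4-6)])
  \<comment> \<open>The solution of (\<delta> - \<eta>) / (1 - \<delta> \<eta>) = t: from modulus
    \<delta> at a zero, Schwarz-Pick leaves modulus t at distance \<eta>.\<close>
  define \<delta> where "\<delta> = (t + \<eta>) / (1 + t * \<eta>)"
  have te: "0 < t * \<eta>" "t * \<eta> < 1" using t \<eta> mult_strict_mono[of t 1 \<eta> 1] by auto
  have \<delta>1: "\<delta> < 1"
  proof -
    have "0 < (1 - t) * (1 - \<eta>)" using t \<eta> by simp
    then show ?thesis using te by (simp add: \<delta>_def field_simps)
  qed
  have \<delta>0: "0 < \<delta>" using t \<eta> te by (simp add: \<delta>_def add_pos_pos)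
  have \<delta>\<eta>: "\<delta> * \<eta> < 1" using mult_strict_mono[of \<delta> 1 \<eta> 1] \<delta>1 \<eta> \<delta>0 by simp
  have t\<delta>: "t * (1 - \<delta> * \<eta>) \<le> \<delta> - \<eta>"
  proof -
    have "\<delta> * (1 + t * \<eta>) = t + \<eta>" using te by (simp add: \<delta>_def)
    then show ?thesis by (simp add: algebra_simps)
  qed
  have "\<forall>\<^sub>F k in sequentially. \<delta> < cmod (sub_blaschke a (- {k}) (a k))"
    using order_tendstoD(1)[OF thin \<delta>1] .
  then obtain N where N0: "\<And>k. k \<ge> N \<Longrightarrow> \<delta> < cmod (sub_blaschke a (- {k}) (a k))"
    unfolding eventually_sequentially by blast
  have N: "\<delta> \<le> cmod (sub_blaschke a (- {k}) (a k))" if "k \<ge> N" for k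
    using N0[OF that] by simp
  \<comment> \<open>Midpoint of \<rho> / (\<eta> t) and 1. With this lower bound for the finite
    head, head times tail still exceeds \<rho>.\<close>
  define q where "q = \<rho> / (\<eta> * t) + (1 - \<rho> / (\<eta> * t)) / 2"
  have q: "q < 1" "\<rho> < q * (\<eta> * t)"
  proof -
    have "\<rho> / (\<eta> * t) < 1" using t te by (simp add: mult.commute)
    then show "q < 1" by (simp add: q_def field_simps)
    have "\<rho> / (\<eta> * t) < q" using \<open>\<rho> / (\<eta> * t) < 1\<close> by (simp add: q_def)
    then show "\<rho> < q * (\<eta> * t)" using te by (simp add: pos_divide_less_eq mult.commute)
  qed
  obtain R where R: "R < 1" "\<And>w. R < cmod w \<Longrightarrow> cmod w < 1 \<Longrightarrow> q \<le> (\<Prod>j\<in>{..<N}. cmod (blaschke_factor (a j) w))"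
    using finite_blaschke_near_boundary[OF finite_lessThan[of N] q(1)] by blast
  have "(1 - \<epsilon>) * (1 - (cmod (B w))\<^sup>2) \<le> (1 - (cmod w)\<^sup>2) * cmod (deriv B w)"
    if w: "R < cmod w" "cmod w < 1" "cmod (B w) \<le> \<rho>" for w
  proof -
    \<comment> \<open>Otherwise the tail would be at least \<eta> t and the head at least q, and
      |B(w)| would exceed \<rho>.\<close>
    have "\<exists>k\<ge>N. cmod (blaschke_factor (a k) w) < \<eta>"
    proof (rule ccontr)
      assume "\<not> (\<exists>k\<ge>N. cmod (blaschke_factor (a k) w) < \<eta>)"
      then have "\<eta> \<le> cmod (blaschke_factor (a k) w)" if "k \<ge> N" for k using that not_less by blast
      then have "\<eta> * t \<le> cmod (sub_blaschke a {N..} w)"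
        by (intro tail_lower[OF N \<eta> t(1) less_imp_le[OF t(2)] t\<delta> \<delta>\<eta> w(2)])
      moreover have "q \<le> cmod (sub_blaschke a {..<N} w)"
        using R(2)[OF w(1,2)] by (simp add: sub_blaschke_finite[OF w(2)] prod_norm)
      moreover have "0 < q * (\<eta> * t)" using q(2) assms(4) by linarith
      then have "0 < q" using te by (simp only: mult.commute[of \<eta> t] zero_less_mult_pos2)
      ultimately have "q * (\<eta> * t) \<le> cmod (sub_blaschke a {..<N} w) * cmod (sub_blaschke a {N..} w)"
        using te by (intro mult_mono) (auto simp: mult.commute)
      also have "- {..<N} = {N..}" by auto
      then have "cmod (sub_blaschke a {..<N} w) * cmod (sub_blaschke a {N..} w) = cmod (B w)"
        using B[of w] w(2) c sub_blaschke_split[OF w(2), of "{..<N}"] by (simp add: norm_mult)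
      finally show False using q(2) w(3) by linarith
    qed
    then obtain k where k: "k \<ge> N" "cmod (blaschke_factor (a k) w) < \<eta>" by blast
    define b H where "b = blaschke_factor (a k)" and "H = (\<lambda>z. c * sub_blaschke a (- {k}) z)"
    have bh: "b holomorphic_on unit_disk" unfolding b_def by (rule blaschke_factor_holomorphic(1)[OF a_disk])
    have Hh: "H holomorphic_on unit_disk" unfolding H_def by (intro holomorphic_intros sub_blaschke_holomorphic)
    have H1: "cmod (H z) \<le> 1" if "z \<in> unit_disk" for z
      using sub_blaschke_le_1[of z] that c by (simp add: H_def norm_mult)
    have wD: "w \<in> unit_disk" using w(2) by simp
    have BH: "B z = b z * H z" if "z \<in> unit_disk" for z
    proof -
      have "sub_blaschke a UNIV z = b z * sub_blaschke a (- {k}) z"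
        using sub_blaschke_split[of z "{k}"] sub_blaschke_finite[of z "{k}"] that by (simp add: b_def)
      then show ?thesis unfolding B[OF that] H_def by simp
    qed
    have tH: "t \<le> cmod (H w)"
    proof -
      have "\<delta> - \<eta> \<le> cmod (H w) * (1 - \<delta> * \<eta>)"
      proof (rule Schwarz_Pick_lower[OF Hh H1, of "a k" w])
        show "cmod (w - a k) \<le> \<eta> * cmod (1 - cnj (a k) * w)"
          using k(2) Moebius_denominator_nonzero[OF a_disk, of w k] w(2)
          by (auto simp: blaschke_factor_cmod field_simps)
        show "\<delta> \<le> cmod (H (a k))" using N[OF k(1)] c by (simp add: H_def norm_mult)
      qed (use \<eta> a_disk wD in auto)
      then have "t * (1 - \<delta> * \<eta>) \<le> cmod (H w) * (1 - \<delta> * \<eta>)" using t\<delta> by linarith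
      then show ?thesis using \<delta>\<eta> by simp
    qed
    define \<beta> h where "\<beta> = cmod (b w)" and "h = cmod (H w)"
    have \<beta>: "0 \<le> \<beta>" "\<beta> < \<eta>" using k(2) by (auto simp: \<beta>_def b_def)
    have h: "t \<le> h" "h \<le> 1" using tH H1[OF wD] by (auto simp: h_def)
    have "(B has_field_derivative deriv b w * H w + deriv H w * b w) (at w)"
    proof (rule has_field_derivative_transform_within_open[of "\<lambda>z. b z * H z" _ w unit_disk])
      show "((\<lambda>z. b z * H z) has_field_derivative deriv b w * H w + deriv H w * b w) (at w)"
        using bh Hh wD by (intro DERIV_mult holomorphic_derivI) auto
    qed (use wD BH in auto)
    then have dB: "deriv B w = deriv b w * H w + deriv H w * b w" by (rule DERIV_imp_deriv)
    let ?s = "1 - (cmod w)\<^sup>2"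
    have s0: "0 \<le> ?s" using w by (simp add: abs_square_le_1)
    have "cmod (deriv b w * H w) - cmod (deriv H w * b w) \<le> cmod (deriv B w)"
      unfolding dB by (rule norm_diff_ineq)
    then have "?s * (cmod (deriv b w * H w) - cmod (deriv H w * b w)) \<le> ?s * cmod (deriv B w)"
      using s0 by (rule mult_left_mono)
    moreover have "?s * (cmod (deriv b w * H w) - cmod (deriv H w * b w)) = (?s * cmod (deriv b w)) * h - (?s * cmod (deriv H w)) * \<beta>"
      by (simp add: norm_mult h_def \<beta>_def algebra_simps)
    moreover have "?s * cmod (deriv b w) = 1 - \<beta>\<^sup>2"
      unfolding b_def \<beta>_def by (rule blaschke_factor_deriv[OF a_disk w(2)])
    moreover have sH: "?s * cmod (deriv H w) \<le> 1 - h\<^sup>2"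
      unfolding h_def by (rule Schwarz_Pick_deriv[OF Hh H1 wD])
    moreover have "(?s * cmod (deriv H w)) * \<beta> \<le> (1 - h\<^sup>2) * 1"
      using sH \<beta> \<eta> h t by (intro mult_mono) (auto simp: abs_square_le_1)
    \<comment> \<open>The product rule in hyperbolic form: 1 - \<beta>^2 is the exact share of b,
      and the derivative of H costs at most 1 - h^2.\<close>
    ultimately have low: "(1 - \<beta>\<^sup>2) * h - (1 - h\<^sup>2) \<le> ?s * cmod (deriv B w)" by simp
    have B2: "(cmod (B w))\<^sup>2 = \<beta>\<^sup>2 * h\<^sup>2" using BH[OF wD] by (simp add: norm_mult power_mult_distrib \<beta>_def h_def)
    have ht2: "t\<^sup>2 \<le> h\<^sup>2" using h t by (intro power_mono) auto
    have \<beta>2: "\<beta>\<^sup>2 \<le> \<eta>\<^sup>2" using \<beta> by (intro power_mono) auto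
    have \<beta>1: "0 \<le> 1 - \<beta>\<^sup>2" using \<beta> \<eta> by (simp add: abs_square_le_1)
    have "(1 - \<epsilon>) * (1 - \<beta>\<^sup>2 * h\<^sup>2) \<le> (1 - \<epsilon>) * ((1 - \<beta>\<^sup>2) + (1 - t\<^sup>2))"
    proof (intro mult_left_mono)
      have "\<beta>\<^sup>2 * (1 - h\<^sup>2) \<le> 1 * (1 - h\<^sup>2)"
        using \<beta>1 h t by (intro mult_right_mono) (auto simp: abs_square_le_1)
      then have "1 - \<beta>\<^sup>2 * h\<^sup>2 \<le> (1 - \<beta>\<^sup>2) + (1 - h\<^sup>2)" by (simp add: algebra_simps)
      then show "1 - \<beta>\<^sup>2 * h\<^sup>2 \<le> (1 - \<beta>\<^sup>2) + (1 - t\<^sup>2)" using ht2 by linarith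
    qed (use True in simp)
    \<comment> \<open>Rearranged, this is the last inequality on t and \<eta>, carried over from
      \<eta> to the smaller \<beta>.\<close>
    also have "\<dots> \<le> (1 - \<beta>\<^sup>2) * t - (1 - t\<^sup>2)"
    proof -
      have "(1 - \<eta>\<^sup>2) * (t - (1 - \<epsilon>)) \<le> (1 - \<beta>\<^sup>2) * (t - (1 - \<epsilon>))"
        using \<beta>2 t(4) by (intro mult_right_mono) auto
      with t(5) have "(2 - \<epsilon>) * (1 - t\<^sup>2) \<le> (1 - \<beta>\<^sup>2) * (t - (1 - \<epsilon>))" by linarith
      then show ?thesis by (simp add: algebra_simps)
    qed
    also have "\<dots> \<le> (1 - \<beta>\<^sup>2) * h - (1 - h\<^sup>2)"
      using mult_left_mono[OF h(1) \<beta>1] ht2 by linarith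
    finally show ?thesis using low B2 by simp
  qed
  then show ?thesis using R(1) by blast
qed

end

text \<open>Pseudohyperbolic distance is the modulus of a Blaschke factor, so the products in the
  definition of thinness are the moduli at a k of the subproducts without the factor k.\<close>

lemma thin_blaschke_asymptotic_isometry:
  assumes "thin_blaschke_product B"
  shows "asymptotic_isometry B"
proof -
  obtain a where a: "is_blaschke_product a B"
    and lim: "(\<lambda>k. \<Prod>j. if j = k then 1 else pseudohyp_dist (a j) (a k)) \<longlonglongrightarrow> 1"
    using assms unfolding thin_blaschke_product_def by blast
  obtain c where c: "cmod c = 1" "\<And>z. z \<in> unit_disk \<Longrightarrow> B z = c * (\<Prod>n. blaschke_factor (a n) z)"
    using a unfolding is_blaschke_product_def by blast
  interpret blaschke_sequence a
  proof
    show "cmod (a n) < 1" for n using a unfolding is_blaschke_product_def by (simp add: ball_def)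
    show "summable (\<lambda>n. 1 - cmod (a n))" using a unfolding is_blaschke_product_def by blast
  qed
  have B: "B z = c * sub_blaschke a UNIV z" if "z \<in> unit_disk" for z
    unfolding sub_blaschke_def c(2)[OF that] by (simp only: UNIV_I if_True)
  have d: "(\<Prod>j. if j = k then 1 else pseudohyp_dist (a j) (a k)) = cmod (sub_blaschke a (- {k}) (a k))" for k
  proof -
    have eq: "(if j = k then 1 else pseudohyp_dist (a j) (a k)) = cmod (fac (- {k}) j (a k))" for j
    proof (cases "j = k")
      case False
      have "cmod (1 - cnj (a k) * a j) = cmod (1 - cnj (a j) * a k)"
      proof -
        have "cnj (1 - cnj (a j) * a k) = 1 - cnj (a k) * a j" by (simp add: mult.commute)
        from arg_cong[OF this, of cmod] show ?thesis by (simp only: complex_mod_cnj)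
      qed
      then show ?thesis using False by (simp add: pseudohyp_dist_def blaschke_factor_cmod norm_divide)
    qed simp
    have "summable (\<lambda>n. norm (fac (- {k}) n (a k) - 1))"
    proof (rule summable_comparison_test)
      show "\<exists>N. \<forall>n\<ge>N. norm (norm (fac (- {k}) n (a k) - 1)) \<le> 2 / (1 - cmod (a k)) * (1 - cmod (a n))"
      proof (intro exI[of _ 0] allI impI)
        fix n
        have "0 \<le> 2 / (1 - cmod (a k)) * (1 - cmod (a n))" using a_disk[of k] a_disk[of n] by simp
        then show "norm (norm (fac (- {k}) n (a k) - 1)) \<le> 2 / (1 - cmod (a k)) * (1 - cmod (a n))"
          using blaschke_factor_near_1[OF a_disk[of n] order_refl a_disk[of k]]
          by (cases "n = k") simp_all
      qed
      show "summable (\<lambda>n. 2 / (1 - cmod (a k)) * (1 - cmod (a n)))"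
        by (intro summable_mult a_summable)
    qed
    then have "summable (\<lambda>n. norm (cmod (fac (- {k}) n (a k)) - 1))"
    proof (rule summable_comparison_test'[where N = 0])
      fix n
      show "norm (norm (cmod (fac (- {k}) n (a k)) - 1)) \<le> norm (fac (- {k}) n (a k) - 1)"
        unfolding real_norm_def abs_abs using norm_triangle_ineq3[of "fac (- {k}) n (a k)" 1]
        by (simp only: norm_one)
    qed
    \<comment> \<open>The product of the moduli is a separate infinite product of reals, and its
      value is determined only once its convergence is known.\<close>
    then have "convergent_prod (\<lambda>n. cmod (fac (- {k}) n (a k)))"
      by (intro abs_convergent_prod_imp_convergent_prod summable_imp_abs_convergent_prod)
    from convergent_prod_LIMSEQ[OF this]
    have "(\<lambda>N. \<Prod>n<Suc N. cmod (fac (- {k}) n (a k))) \<longlonglongrightarrow> (\<Prod>n. cmod (fac (- {k}) n (a k)))"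
      by (simp only: lessThan_Suc_atMost)
    from LIMSEQ_unique[OF LIMSEQ_imp_Suc[OF this] sub_blaschke_cmod_limit[OF a_disk]]
    show ?thesis by (simp only: eq)
  qed
  have thin: "(\<lambda>k. cmod (sub_blaschke a (- {k}) (a k))) \<longlonglongrightarrow> 1"
    by (rule Lim_transform_eventually[OF lim]) (intro always_eventually allI d)
  have asym: "\<exists>R<1. \<forall>w. R < cmod w \<and> cmod w < 1 \<and> cmod (B w) \<le> \<rho>
        \<longrightarrow> (1 - \<epsilon>) * (1 - (cmod (B w))\<^sup>2) \<le> (1 - (cmod w)\<^sup>2) * cmod (deriv B w)"
    if "0 \<le> \<rho>" "\<rho> < 1" "0 < \<epsilon>" for \<rho> \<epsilon> :: real
    by (rule thin_asymptotic[OF thin c(1) B that])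
  have split0: "cmod (B z) = cmod (blaschke_factor (a k) z) * cmod (sub_blaschke a (- {k}) z)" if "z \<in> unit_disk" for z k
  proof -
    have z: "cmod z < 1" using that by simp
    show ?thesis
      unfolding B[OF that] norm_mult c(1) sub_blaschke_split[OF z, of "{k}"]
      using sub_blaschke_finite[OF z, of "{k}"] by simp
  qed
  show ?thesis
  proof
    have "(\<lambda>z. c * sub_blaschke a UNIV z) holomorphic_on unit_disk"
      by (intro holomorphic_intros sub_blaschke_holomorphic)
    then show "B holomorphic_on unit_disk"
      by (rule holomorphic_transform) (rule B[symmetric])
    show "cmod (B z) < 1" if z: "z \<in> unit_disk" for z
    proof -
      have "cmod (B z) \<le> cmod (blaschke_factor (a 0) z) * 1"
        unfolding split0[OF z, of 0] using sub_blaschke_le_1 z by (intro mult_left_mono) auto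
      also have "\<dots> < 1" using blaschke_factor_lt_1[OF a_disk] z by simp
      finally show ?thesis .
    qed
    show "\<exists>R<1. \<forall>w. R < cmod w \<and> cmod w < 1 \<and> cmod (B w) \<le> \<rho>
        \<longrightarrow> (1 - \<epsilon>) * (1 - (cmod (B w))\<^sup>2) \<le> (1 - (cmod w)\<^sup>2) * cmod (deriv B w)"
      if r: "\<rho> < 1" "0 < \<epsilon>" for \<rho> \<epsilon> :: real
    proof -
      \<comment> \<open>The locale admits negative \<rho>; the estimate for
        \<open>max 0 \<rho>\<close> covers this case.\<close>
      obtain R where "R < 1" "\<And>w. R < cmod w \<Longrightarrow> cmod w < 1 \<Longrightarrow> cmod (B w) \<le> max 0 \<rho> \<Longrightarrow> (1 - \<epsilon>) * (1 - (cmod (B w))\<^sup>2) \<le> (1 - (cmod w)\<^sup>2) * cmod (deriv B w)"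
        using asym[of "max 0 \<rho>" \<epsilon>] r by auto
      then show ?thesis by (intro exI[of _ R]) auto
    qed
    \<comment> \<open>The zeros a n approach the circle; the estimate with \<rho> = 0 and \<epsilon>
      = 1/2 makes B' nonzero at one of them.\<close>
    show "\<exists>z\<in>unit_disk. deriv B z \<noteq> 0"
    proof -
      obtain R where R: "R < 1" "\<And>w. R < cmod w \<Longrightarrow> cmod w < 1 \<Longrightarrow> cmod (B w) \<le> 0 \<Longrightarrow> (1 - 1/2) * (1 - (cmod (B w))\<^sup>2) \<le> (1 - (cmod w)\<^sup>2) * cmod (deriv B w)"
        using asym[of 0 "1/2"] by auto
      have "(\<lambda>n. 1 - cmod (a n)) \<longlonglongrightarrow> 0" by (rule summable_LIMSEQ_zero[OF a_summable])
      then have "\<forall>\<^sub>F n in sequentially. 1 - cmod (a n) < 1 - R"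
        using R(1) by (intro order_tendstoD(2)[of _ 0]) auto
      then obtain n where n: "R < cmod (a n)"
        by (auto simp: eventually_sequentially)
      have "cmod (B (a n)) = 0"
        using split0[of "a n" n] a_disk[of n] by (simp add: blaschke_factor_cmod)
      then have "1/2 \<le> (1 - (cmod (a n))\<^sup>2) * cmod (deriv B (a n))"
        using R(2)[OF n a_disk] by simp
      then have "deriv B (a n) \<noteq> 0" by auto
      then show ?thesis using a_disk[of n] by (intro bexI[of _ "a n"]) auto
    qed
  qed
qed

section \<open>Sheets over regular values\<close>

lemma deriv_dominates_imp_bilipschitz:
  assumes f: "f holomorphic_on S" "open S" "cball w \<rho> \<subseteq> S"
    and d: "\<And>x. x \<in> cball w \<rho> \<Longrightarrow> cmod (deriv f x - deriv f w) \<le> cmod (deriv f w) / 2"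
    and ab: "a \<in> cball w \<rho>" "b \<in> cball w \<rho>"
  shows "cmod (deriv f w) / 2 * cmod (a - b) \<le> cmod (f a - f b)"
proof -
  \<comment> \<open>Without its linear part, f has Lipschitz constant at most |f'(w)|/2, which is
    too small to cancel the linear part.\<close>
  let ?g = "\<lambda>x. f x - deriv f w * x"
  have "cmod (?g a - ?g b) \<le> cmod (deriv f w) / 2 * cmod (a - b)"
  proof (rule field_differentiable_bound[OF convex_cball[of w \<rho>] _ d ab(1) ab(2)])
    fix z assume "z \<in> cball w \<rho>"
    then have "(f has_field_derivative deriv f z) (at z)" using f holomorphic_derivI by blast
    then have "(?g has_field_derivative deriv f z - deriv f w) (at z)"
      by (auto intro!: derivative_eq_intros)
    then show "(?g has_field_derivative deriv f z - deriv f w) (at z within cball w \<rho>)"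
      by (rule has_field_derivative_at_within)
  qed
  moreover have "?g a - ?g b = (f a - f b) - deriv f w * (a - b)" by (simp add: algebra_simps)
  moreover have "cmod (deriv f w * (a - b)) - cmod ((f a - f b) - deriv f w * (a - b)) \<le> cmod (f a - f b)"
    using norm_triangle_sub[of "deriv f w * (a - b)" "f a - f b"] by (simp add: norm_minus_commute)
  ultimately show ?thesis by (simp add: norm_mult)
qed

text \<open>Schwarz-Pick bounds f' by 2/(1 - |w|) on the disc of radius (1 - |w|)/2 around w;
  Cauchy's inequality on discs of radius (1 - |w|)/4 then bounds f''.\<close>

lemma deriv_lipschitz:
  assumes f: "f holomorphic_on unit_disk" "\<And>z. z \<in> unit_disk \<Longrightarrow> cmod (f z) \<le> 1"
    and w: "w \<in> unit_disk" and x: "cmod (x - w) \<le> (1 - cmod w) / 4"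
  shows "cmod (deriv f x - deriv f w) \<le> 8 / (1 - cmod w)\<^sup>2 * cmod (x - w)"
proof -
  let ?s = "1 - cmod w"
  have s: "0 < ?s" using w by simp
  have inD: "u \<in> unit_disk" "?s / 2 \<le> 1 - cmod u" if "cmod (u - w) \<le> ?s / 2" for u
    using that norm_triangle_ineq2[of u w] s by (auto simp: field_simps)
  have d1: "cmod (deriv f u) \<le> 2 / ?s" if u: "cmod (u - w) \<le> ?s / 2" for u
  proof -
    have uD: "u \<in> unit_disk" "?s / 2 \<le> 1 - cmod u" using inD[OF u] by auto
    have "(1 - cmod u) * cmod (deriv f u) \<le> (1 - (cmod u)\<^sup>2) * cmod (deriv f u)"
      using uD by (intro mult_right_mono) (auto simp: power2_eq_square mult_left_le)
    also have "\<dots> \<le> 1 - (cmod (f u))\<^sup>2" by (rule Schwarz_Pick_deriv[OF f uD(1)])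
    also have "\<dots> \<le> 1" by simp
    finally have "(1 - cmod u) * cmod (deriv f u) \<le> 1" .
    moreover have "?s / 2 * cmod (deriv f u) \<le> (1 - cmod u) * cmod (deriv f u)"
      using uD by (intro mult_right_mono) auto
    ultimately have "?s / 2 * cmod (deriv f u) \<le> 1" by linarith
    then show ?thesis using s by (simp add: field_simps)
  qed
  have dh: "deriv f holomorphic_on unit_disk" using f(1) holomorphic_deriv by blast
  have d2: "cmod (deriv (deriv f) u) \<le> 8 / ?s\<^sup>2" if u: "u \<in> cball w (?s / 4)" for u
  proof -
    have u': "cmod (u - w) \<le> ?s / 4" using u by (simp add: dist_norm norm_minus_commute)
    have sub: "cmod (v - w) \<le> ?s / 2" if "cmod (u - v) \<le> ?s / 4" for v
      using norm_triangle_ineq[of "v - u" "u - w"] that u' by (simp add: norm_minus_commute)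
    have cb: "cball u (?s / 4) \<subseteq> unit_disk"
      using inD(1) sub by (auto simp: dist_norm)
    have "cmod ((deriv ^^ 1) (deriv f) u) \<le> fact 1 * (2 / ?s) / (?s / 4) ^ 1"
    proof (rule Cauchy_inequality)
      show "deriv f holomorphic_on ball u (?s / 4)"
        using dh cb ball_subset_cball holomorphic_on_subset by blast
      show "continuous_on (cball u (?s / 4)) (deriv f)"
        using dh cb holomorphic_on_imp_continuous_on holomorphic_on_subset by blast
      show "0 < ?s / 4" using s by simp
      show "cmod (deriv f v) \<le> 2 / ?s" if "cmod (u - v) = ?s / 4" for v
        using d1[OF sub] that by simp
    qed
    also have "fact 1 * (2 / ?s) / (?s / 4) ^ 1 = 8 / ?s\<^sup>2" by (simp add: power2_eq_square)
    finally show ?thesis by simp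
  qed
  have cw: "cball w (?s / 4) \<subseteq> unit_disk"
    using inD(1) s by (auto simp: dist_norm norm_minus_commute)
  show ?thesis
  proof (rule field_differentiable_bound[OF convex_cball[of w "?s / 4"] _ d2])
    fix z assume "z \<in> cball w (?s / 4)"
    then show "(deriv f has_field_derivative deriv (deriv f) z) (at z within cball w (?s / 4))"
      using dh cw holomorphic_derivI[of "deriv f" unit_disk z] by (meson has_field_derivative_at_within open_ball subsetD)
  qed (use x s in \<open>auto simp: dist_norm norm_minus_commute\<close>)
qed

text \<open>The radius s is chosen so that f' varies by at most half of |f'(w)|: the Lipschitz
  constant 8/(1 - |w|)^2 times s is \<delta>/(2 (1 - |w|)). The image then contains a disc of radius
  \<delta>^2/32, independent of w; this uniformity provides one disc of values for a whole infinite
  fibre.\<close>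

lemma quantitative_inverse:
  assumes f: "f holomorphic_on unit_disk" "\<And>z. z \<in> unit_disk \<Longrightarrow> cmod (f z) \<le> 1"
    and w: "w \<in> unit_disk" and \<delta>: "0 < \<delta>" "\<delta> \<le> (1 - cmod w) * cmod (deriv f w)"
  defines "s \<equiv> \<delta> / 16 * (1 - cmod w)"
  shows "\<delta> \<le> 1" "0 < s" "cball w s \<subseteq> unit_disk"
    and "\<And>a b. a \<in> cball w s \<Longrightarrow> b \<in> cball w s \<Longrightarrow> \<delta> / (2 * (1 - cmod w)) * cmod (a - b) \<le> cmod (f a - f b)"
    and "ball (f w) (\<delta>\<^sup>2 / 32) \<subseteq> f ` ball w s"
proof -
  let ?r = "1 - cmod w"
  have r: "0 < ?r" using w by simp
  have "?r * cmod (deriv f w) \<le> (1 - (cmod w)\<^sup>2) * cmod (deriv f w)"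
    using r by (intro mult_right_mono) (auto simp: power2_eq_square mult_left_le)
  also have "\<dots> \<le> 1 - (cmod (f w))\<^sup>2" by (rule Schwarz_Pick_deriv[OF f w])
  also have "\<dots> \<le> 1" by simp
  finally show \<delta>1: "\<delta> \<le> 1" using \<delta> by linarith
  show s0: "0 < s" using \<delta> r by (simp add: s_def)
  have "\<delta> / 16 * ?r \<le> 1 / 4 * ?r" using \<delta>1 r by (intro mult_right_mono) auto
  then have s4: "s \<le> ?r / 4" by (simp add: s_def)
  show sub: "cball w s \<subseteq> unit_disk"
  proof
    fix u assume "u \<in> cball w s"
    then have "cmod (u - w) \<le> ?r / 4" using s4 by (simp add: dist_norm norm_minus_commute)
    then show "u \<in> unit_disk" using norm_triangle_ineq2[of u w] r by simp
  qed
  have dw: "\<delta> / ?r \<le> cmod (deriv f w)" using \<delta> r by (simp add: field_simps)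
  have d: "cmod (deriv f x - deriv f w) \<le> cmod (deriv f w) / 2" if "x \<in> cball w s" for x
  proof -
    have xs: "cmod (x - w) \<le> s" using that by (simp add: dist_norm norm_minus_commute)
    have "cmod (deriv f x - deriv f w) \<le> 8 / ?r\<^sup>2 * cmod (x - w)"
      using xs s4 by (intro deriv_lipschitz[OF f w]) auto
    also have "\<dots> \<le> 8 / ?r\<^sup>2 * s" using xs by (intro mult_left_mono) auto
    also have "\<dots> = (\<delta> / ?r) / 2"
    proof -
      have "8 / q\<^sup>2 * (\<delta> / 16 * q) = \<delta> / q / 2" if "0 < q" for q :: real
        using that by (simp add: power2_eq_square)
      from this[OF r] show ?thesis by (simp only: s_def)
    qed
    also have "\<dots> \<le> cmod (deriv f w) / 2" by (rule divide_right_mono[OF dw]) simp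
    finally show ?thesis .
  qed
  show lip: "\<delta> / (2 * ?r) * cmod (a - b) \<le> cmod (f a - f b)" if "a \<in> cball w s" "b \<in> cball w s" for a b
  proof -
    have "\<delta> / (2 * q) = \<delta> / q / 2" for q :: real by simp
    from this[of ?r] have "\<delta> / (2 * ?r) * cmod (a - b) \<le> cmod (deriv f w) / 2 * cmod (a - b)"
      using divide_right_mono[OF dw, of 2] by (intro mult_right_mono) (simp_all only: norm_ge_zero zero_le_numeral)
    also have "\<dots> \<le> cmod (f a - f b)"
      by (rule deriv_dominates_imp_bilipschitz[OF f(1) open_ball sub d that])
    finally show ?thesis .
  qed
  have inj: "inj_on f (cball w s)"
  proof (rule inj_onI)
    fix a b assume ab: "a \<in> cball w s" "b \<in> cball w s" "f a = f b"
    have pos: "0 < \<delta> / (2 * ?r)" using \<delta> r by simp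
    show "a = b"
    proof (rule ccontr)
      assume "a \<noteq> b"
      then have "0 < \<delta> / (2 * ?r) * cmod (a - b)" by (intro mult_pos_pos pos) simp
      also have "\<dots> \<le> cmod (f a - f b)" by (rule lip[OF ab(1,2)])
      finally show False using ab(3) by simp
    qed
  qed
  have bs: "ball w s \<subseteq> cball w s" by (rule ball_subset_cball)
  show "ball (f w) (\<delta>\<^sup>2 / 32) \<subseteq> f ` ball w s"
  proof (rule ball_subset_open_map_image)
    show "continuous_on (closure (ball w s)) f"
      using s0 sub f(1) by (simp add: holomorphic_on_imp_continuous_on holomorphic_on_subset)
    have "open (f ` ball w s)"
    proof (rule open_mapping_thm3)
      show "f holomorphic_on ball w s" using f(1) sub bs holomorphic_on_subset by blast
      show "inj_on f (ball w s)" using inj bs inj_on_subset by blast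
    qed simp
    then show "open (f ` interior (ball w s))" by simp
    fix z assume "z \<in> frontier (ball w s)"
    then have z: "cmod (z - w) = s" "z \<in> cball w s" using s0 by (auto simp: dist_norm norm_minus_commute)
    \<comment> \<open>The lower Lipschitz constant times the radius; the distance 1 - |w| to the
      circle cancels.\<close>
    have "\<delta>\<^sup>2 / 32 = \<delta> / (2 * q) * (\<delta> / 16 * q)" if "0 < q" for q :: real
      using that by (simp add: power2_eq_square)
    from this[OF r] have "\<delta>\<^sup>2 / 32 = \<delta> / (2 * ?r) * s" by (simp only: s_def)
    also have "\<dots> \<le> cmod (f z - f w)" using lip[OF z(2), of w] z(1) s0 by simp
    finally show "\<delta>\<^sup>2 / 32 \<le> cmod (f z - f w)" .
  qed (use s0 \<delta> in auto)
qed

definition regular_values :: "(complex \<Rightarrow> complex) \<Rightarrow> complex set" where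
  "regular_values B = {l. cmod l < 1 \<and> l \<notin> critical_values B}"

definition fibre :: "(complex \<Rightarrow> complex) \<Rightarrow> complex \<Rightarrow> complex set" where
  "fibre B l = {z \<in> unit_disk. B z = l}"

text \<open>Over the disc of radius \<^term>\<open>r\<close> around \<^term>\<open>l\<close>, the map \<^term>\<open>B\<close> is evenly covered; \<^term>\<open>\<sigma> z\<close> is
  the section through the point \<^term>\<open>z\<close> of the fibre over \<^term>\<open>l\<close>.\<close>

locale evenly_covered = asymptotic_isometry +
  fixes l :: complex and r c C \<delta> :: real and \<sigma> :: "complex \<Rightarrow> complex \<Rightarrow> complex"
  assumes pos: "0 < r" "0 < c" "c \<le> 1/4" "0 < C" "0 < \<delta>"
    and regular: "ball l r \<subseteq> regular_values B"
    and expanding: "\<And>w. w \<in> unit_disk \<Longrightarrow> B w \<in> ball l r \<Longrightarrow> \<delta> \<le> (1 - cmod w) * cmod (deriv B w)"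
    and \<sigma>_hol: "\<And>z. z \<in> fibre B l \<Longrightarrow> \<sigma> z holomorphic_on ball l r"
    and \<sigma>_center: "\<And>z. z \<in> fibre B l \<Longrightarrow> \<sigma> z l = z"
    and \<sigma>_section: "\<And>z m. z \<in> fibre B l \<Longrightarrow> m \<in> ball l r \<Longrightarrow> \<sigma> z m \<in> unit_disk \<and> B (\<sigma> z m) = m"
    and \<sigma>_near: "\<And>z m. z \<in> fibre B l \<Longrightarrow> m \<in> ball l r \<Longrightarrow> cmod (\<sigma> z m - z) \<le> C * cmod (m - l) * (1 - cmod z)"
    and \<sigma>_disc: "\<And>z m. z \<in> fibre B l \<Longrightarrow> m \<in> ball l r \<Longrightarrow> cmod (\<sigma> z m - z) < c * (1 - cmod z)"
    and \<sigma>_cover: "\<And>w. w \<in> unit_disk \<Longrightarrow> B w \<in> ball l r \<Longrightarrow> \<exists>z\<in>fibre B l. w = \<sigma> z (B w)"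
    and discs_disjoint: "\<And>z z'. z \<in> fibre B l \<Longrightarrow> z' \<in> fibre B l \<Longrightarrow> z \<noteq> z' \<Longrightarrow>
        ball z (c * (1 - cmod z)) \<inter> ball z' (c * (1 - cmod z')) = {}"

section \<open>Regular values, critical values and fibres\<close>

context asymptotic_isometry
begin

lemma le1: "z \<in> unit_disk \<Longrightarrow> cmod (B z) \<le> 1"
  using lt1 less_imp_le by blast

lemma deriv_hol: "deriv B holomorphic_on unit_disk"
  using hol holomorphic_deriv by blast

lemma nonconstant: "\<not> B constant_on unit_disk"
proof
  assume "B constant_on unit_disk"
  then obtain k where k: "\<And>z. z \<in> unit_disk \<Longrightarrow> B z = k" by (auto simp: constant_on_def)
  have "deriv B z = 0" if z: "z \<in> unit_disk" for z
  proof -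
    have "(B has_field_derivative 0) (at z)"
      by (rule has_field_derivative_transform_within_open[of "\<lambda>_. k" _ _ unit_disk]) (use z k in auto)
    then show ?thesis by (rule DERIV_imp_deriv)
  qed
  then show False using nonconst by blast
qed

lemma finite_fibre_compact:
  assumes "compact K" "K \<subseteq> unit_disk"
  shows "finite (K \<inter> fibre B l)"
proof -
  have "finite {z \<in> K. B z - l = 0}"
  proof (rule holomorphic_compact_finite_zeros[where S = unit_disk])
    show "(\<lambda>z. B z - l) holomorphic_on unit_disk" using hol by (intro holomorphic_intros)
    show "\<not> (\<lambda>z. B z - l) constant_on unit_disk"
      using nonconstant unfolding constant_on_def by (metis diff_add_cancel)
  qed (use assms in auto)
  moreover have "K \<inter> fibre B l = {z \<in> K. B z - l = 0}" using assms(2) by (auto simp: fibre_def)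
  ultimately show ?thesis by simp
qed

lemma disk_exhaustion: "(unit_disk :: complex set) = (\<Union>n. cball 0 (1 - 1 / real (Suc n)))"
proof
  show "unit_disk \<subseteq> (\<Union>n. cball 0 (1 - 1 / real (Suc n)))"
  proof
    fix z :: complex assume "z \<in> unit_disk"
    then obtain n where "inverse (real (Suc n)) < 1 - cmod z"
      using reals_Archimedean[of "1 - cmod z"] by auto
    then show "z \<in> (\<Union>n. cball 0 (1 - 1 / real (Suc n)))"
      by (auto simp: inverse_eq_divide intro!: exI[of _ n])
  qed
  have "cball 0 (1 - 1 / real (Suc n)) \<subseteq> (unit_disk :: complex set)" for n
  proof -
    have "1 - 1 / real (Suc n) < 1" by simp
    then show ?thesis unfolding cball_subset_ball_iff by simp
  qed
  then show "(\<Union>n. cball 0 (1 - 1 / real (Suc n))) \<subseteq> (unit_disk :: complex set)" by blast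
qed

lemma mem_disk_exhaustion: "z \<in> unit_disk \<longleftrightarrow> (\<exists>n. z \<in> cball (0::complex) (1 - 1 / real (Suc n)))"
  unfolding disk_exhaustion by blast

lemma countable_by_exhaustion:
  assumes "X \<subseteq> (unit_disk :: complex set)"
    and "\<And>K. compact K \<Longrightarrow> K \<subseteq> unit_disk \<Longrightarrow> finite (K \<inter> X)"
  shows "countable X"
proof -
  have "X = (\<Union>n. cball 0 (1 - 1 / real (Suc n)) \<inter> X)"
    using assms(1) mem_disk_exhaustion by blast
  moreover have "countable (\<Union>n. cball 0 (1 - 1 / real (Suc n)) \<inter> X)"
  proof (intro countable_UN countableI_type countable_finite assms(2) compact_cball)
    fix n show "cball 0 (1 - 1 / real (Suc n)) \<subseteq> (unit_disk :: complex set)"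
      using mem_disk_exhaustion by blast
  qed
  ultimately show ?thesis by (simp only:)
qed

lemma countable_fibre: "countable (fibre B l)"
proof (rule countable_by_exhaustion)
  show "fibre B l \<subseteq> unit_disk" by (auto simp: fibre_def)
qed (rule finite_fibre_compact)

text \<open>Where |B| \<le> \<rho>, asymptotic isometry with \<epsilon> = 1/2 excludes critical
  points near the circle, and a smaller closed disc contains only finitely many zeros of B'. Hence
  critical values accumulate only at the circle, which makes the set of regular values open.\<close>

lemma finite_critical_points:
  assumes "\<rho> < 1"
  shows "finite {w \<in> unit_disk. cmod (B w) \<le> \<rho> \<and> deriv B w = 0}"
proof -
  obtain R where R: "R < 1" "\<And>w. R < cmod w \<Longrightarrow> cmod w < 1 \<Longrightarrow> cmod (B w) \<le> \<rho> \<Longrightarrow>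
      (1 - 1/2) * (1 - (cmod (B w))\<^sup>2) \<le> (1 - (cmod w)\<^sup>2) * cmod (deriv B w)"
    using isometric[OF assms, of "1/2"] by auto
  have sub: "{w \<in> unit_disk. cmod (B w) \<le> \<rho> \<and> deriv B w = 0} \<subseteq> {w \<in> cball 0 R. deriv B w = 0}"
  proof
    fix w assume w: "w \<in> {w \<in> unit_disk. cmod (B w) \<le> \<rho> \<and> deriv B w = 0}"
    have "\<not> R < cmod w"
    proof
      assume "R < cmod w"
      then have "1 - (cmod (B w))\<^sup>2 \<le> 0" using R(2)[of w] w by simp
      moreover have "(cmod (B w))\<^sup>2 < 1" using lt1[of w] w by (simp add: abs_square_less_1)
      ultimately show False by simp
    qed
    then show "w \<in> {w \<in> cball 0 R. deriv B w = 0}" using w by simp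
  qed
  have cs: "cball 0 R \<subseteq> unit_disk" using R(1) unfolding cball_subset_ball_iff by simp
  have "finite {w \<in> cball 0 R. deriv B w = 0}"
  proof (cases "deriv B constant_on unit_disk")
    case True
    then have "deriv B w \<noteq> 0" if "w \<in> unit_disk" for w
      using nonconst that by (auto simp: constant_on_def)
    then have "{w \<in> cball 0 R. deriv B w = 0} = {}" using cs by blast
    then show ?thesis by (simp only: finite.emptyI)
  next
    case False
    then show ?thesis
      using cs by (intro holomorphic_compact_finite_zeros[OF deriv_hol]) auto
  qed
  then show ?thesis using sub finite_subset by blast
qed

lemma finite_critical_values:
  assumes "\<rho> < 1"
  shows "finite (critical_values B \<inter> cball 0 \<rho>)"
proof -
  have "critical_values B \<inter> cball 0 \<rho> \<subseteq> B ` {w \<in> unit_disk. cmod (B w) \<le> \<rho> \<and> deriv B w = 0}"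
    by (auto simp: critical_values_def)
  then show ?thesis using finite_critical_points[OF assms] finite_surj by blast
qed

lemma regular_valuesD: "l \<in> regular_values B \<Longrightarrow> cmod l < 1" "l \<in> regular_values B \<Longrightarrow> l \<notin> critical_values B"
  by (auto simp: regular_values_def)

lemma regular_domain_iff: "z \<in> regular_domain B \<longleftrightarrow> z \<in> unit_disk \<and> B z \<in> regular_values B"
  using lt1 by (auto simp: regular_domain_def regular_values_def)

lemma deriv_nonzero: "z \<in> regular_domain B \<Longrightarrow> deriv B z \<noteq> 0"
  by (auto simp: regular_domain_def critical_values_def)

lemma open_regular_values: "open (regular_values B)"
proof (rule openI)
  fix l assume l: "l \<in> regular_values B"
  define \<rho> where "\<rho> = (1 + cmod l) / 2"
  have \<rho>: "cmod l < \<rho>" "\<rho> < 1" using regular_valuesD(1)[OF l] by (auto simp: \<rho>_def)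
  have "open (ball 0 \<rho> - (critical_values B \<inter> cball 0 \<rho>))"
    by (intro open_Diff finite_imp_closed finite_critical_values \<rho>) auto
  moreover have "l \<in> ball 0 \<rho> - (critical_values B \<inter> cball 0 \<rho>)"
    using regular_valuesD(2)[OF l] \<rho> by simp
  ultimately obtain e where e: "0 < e" "ball l e \<subseteq> ball 0 \<rho> - (critical_values B \<inter> cball 0 \<rho>)"
    using open_contains_ball by blast
  have "ball l e \<subseteq> regular_values B"
  proof
    fix x assume "x \<in> ball l e"
    then have "x \<in> ball 0 \<rho>" "x \<notin> critical_values B \<inter> cball 0 \<rho>" using e by auto
    then show "x \<in> regular_values B" using \<rho> by (auto simp: regular_values_def)
  qed
  then show "\<exists>e>0. ball l e \<subseteq> regular_values B" using e by blast
qed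

text \<open>On a compact set |B| has a maximum below 1, so only finitely many critical values are
  taken there, each at finitely many points.\<close>

lemma irregular_finite_compact:
  assumes "compact K" "K \<subseteq> unit_disk"
  shows "finite (K - regular_domain B)"
proof (cases "K = {}")
  case False
  have "continuous_on K (\<lambda>z. cmod (B z))"
    using hol assms(2) by (intro continuous_on_norm holomorphic_on_imp_continuous_on) (rule holomorphic_on_subset)
  then obtain u where u: "u \<in> K" "\<And>z. z \<in> K \<Longrightarrow> cmod (B z) \<le> cmod (B u)"
    using continuous_attains_sup[OF assms(1) False] by blast
  define V where "V = critical_values B \<inter> cball 0 (cmod (B u))"
  have "finite V" unfolding V_def using lt1 u assms(2) by (intro finite_critical_values) blast
  moreover have "K - regular_domain B \<subseteq> (\<Union>l\<in>V. K \<inter> fibre B l)"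
    using u assms(2) by (auto simp: V_def fibre_def regular_domain_def)
  moreover have "finite (\<Union>l\<in>V. K \<inter> fibre B l)"
    using \<open>finite V\<close> finite_fibre_compact[OF assms] by blast
  ultimately show ?thesis using finite_subset by blast
qed simp

lemma countable_irregular: "countable (unit_disk - regular_domain B)"
proof (rule countable_by_exhaustion)
  fix K :: "complex set" assume K: "compact K" "K \<subseteq> unit_disk"
  have "K \<inter> (unit_disk - regular_domain B) \<subseteq> K - regular_domain B" by blast
  then show "finite (K \<inter> (unit_disk - regular_domain B))"
    using irregular_finite_compact[OF K] finite_subset by blast
qed blast

lemma open_regular_domain: "open (regular_domain B)"
proof -
  have "regular_domain B = unit_disk \<inter> B -` regular_values B"
    by (auto simp: regular_domain_iff)
  then show ?thesis
    using continuous_open_preimage[OF holomorphic_on_imp_continuous_on[OF hol] open_ball open_regular_values] by simp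
qed

text \<open>Removing a countable set from a connected open subset of the plane leaves it
  connected.\<close>

lemma connected_regular_domain: "connected (regular_domain B)"
proof -
  have "regular_domain B = unit_disk - (unit_disk - regular_domain B)"
    by (auto simp: regular_domain_def)
  then show ?thesis
    using connected_open_diff_countable[of unit_disk "unit_disk - regular_domain B"] countable_irregular by simp
qed

lemma regular_domain_nonempty: "regular_domain B \<noteq> {}"
proof
  assume "regular_domain B = {}"
  then have "countable unit_disk" using countable_irregular by simp
  then show False using uncountable_ball[of 1 "0::complex"] by simp
qed

text \<open>Near the circle the bound comes from asymptotic isometry with \<epsilon> = 1/2. The
  remaining points above the disc form a compact set on which B' has no zeros, so a positive minimum
  is attained.\<close>

lemma expanding_near_regular_value:
  assumes l: "l \<in> regular_values B"
  obtains r \<delta> where "0 < r" "0 < \<delta>" "cball l r \<subseteq> regular_values B"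
    "\<And>w. w \<in> unit_disk \<Longrightarrow> B w \<in> cball l r \<Longrightarrow> \<delta> \<le> (1 - cmod w) * cmod (deriv B w)"
proof -
  obtain r where r: "0 < r" "cball l r \<subseteq> regular_values B"
    using open_regular_values l open_contains_cball by blast
  have "compact (cball l r)" "cball l r \<noteq> {}" using r by auto
  then obtain u where u: "u \<in> cball l r" "\<And>m. m \<in> cball l r \<Longrightarrow> cmod m \<le> cmod u"
    using continuous_attains_sup[of "cball l r" cmod] continuous_on_norm_id by blast
  define \<rho> where "\<rho> = cmod u"
  have \<rho>: "0 \<le> \<rho>" "\<rho> < 1" using regular_valuesD(1) u(1) r(2) by (auto simp: \<rho>_def)
  obtain R where R: "R < 1" "\<And>w. R < cmod w \<Longrightarrow> cmod w < 1 \<Longrightarrow> cmod (B w) \<le> \<rho> \<Longrightarrow>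
      (1 - 1/2) * (1 - (cmod (B w))\<^sup>2) \<le> (1 - (cmod w)\<^sup>2) * cmod (deriv B w)"
    using isometric[OF \<rho>(2), of "1/2"] by auto
  have \<rho>2: "\<rho>\<^sup>2 < 1" using \<rho> by (simp add: abs_square_less_1)
  \<comment> \<open>One factor 1/2 comes from \<epsilon>, the other from 1 + |w| \<le> 2.\<close>
  have out: "(1 - \<rho>\<^sup>2) / 4 \<le> (1 - cmod w) * cmod (deriv B w)"
    if w: "w \<in> unit_disk" "B w \<in> cball l r" "R < cmod w" for w
  proof -
    have Bw: "cmod (B w) \<le> \<rho>" using u(2)[OF w(2)] by (simp add: \<rho>_def)
    then have "(cmod (B w))\<^sup>2 \<le> \<rho>\<^sup>2" by (intro power_mono) auto
    then have "(1 - \<rho>\<^sup>2) / 2 \<le> (1 - (cmod w)\<^sup>2) * cmod (deriv B w)"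
      using R(2)[OF w(3) _ Bw] w(1) by simp
    also have "1 - (cmod w)\<^sup>2 = (1 - cmod w) * (1 + cmod w)" by (simp add: power2_eq_square algebra_simps)
    also have "(1 - cmod w) * (1 + cmod w) * cmod (deriv B w) \<le> (1 - cmod w) * 2 * cmod (deriv B w)"
      using w(1) by (intro mult_right_mono mult_left_mono) auto
    finally show ?thesis by (simp add: algebra_simps)
  qed
  define K where "K = cball 0 R \<inter> B -` cball l r"
  have cs: "cball 0 R \<subseteq> unit_disk" using R(1) unfolding cball_subset_ball_iff by simp
  have contB: "continuous_on (cball 0 R) B"
    using hol cs holomorphic_on_imp_continuous_on holomorphic_on_subset by blast
  have contD: "continuous_on (cball 0 R) (deriv B)"
    using deriv_hol cs holomorphic_on_imp_continuous_on holomorphic_on_subset by blast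
  have K: "compact K"
    unfolding K_def using continuous_closed_preimage[OF contB closed_cball closed_cball]
      compact_eq_bounded_closed bounded_Int bounded_cball by blast
  have "\<exists>\<delta>>0. \<forall>w\<in>K. \<delta> \<le> (1 - cmod w) * cmod (deriv B w)"
  proof (cases "K = {}")
    case False
    have "continuous_on K (\<lambda>w. (1 - cmod w) * cmod (deriv B w))"
      using continuous_on_subset[OF contD, of K] by (intro continuous_intros) (auto simp: K_def)
    then obtain v where v: "v \<in> K" "\<And>w. w \<in> K \<Longrightarrow> (1 - cmod v) * cmod (deriv B v) \<le> (1 - cmod w) * cmod (deriv B w)"
      using continuous_attains_inf[OF K False] by blast
    have "v \<in> regular_domain B" using v(1) r(2) cs by (auto simp: K_def regular_domain_iff)
    then have "0 < (1 - cmod v) * cmod (deriv B v)"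
      using deriv_nonzero by (auto simp: regular_domain_def)
    then show ?thesis using v(2) by blast
  qed (auto intro: exI[of _ 1])
  then obtain d where d: "0 < d" "\<And>w. w \<in> K \<Longrightarrow> d \<le> (1 - cmod w) * cmod (deriv B w)" by blast
  show ?thesis
  proof (rule that[OF r(1) _ r(2)])
    show "0 < min d ((1 - \<rho>\<^sup>2) / 4)" using d(1) \<rho>2 by simp
    fix w assume w: "w \<in> unit_disk" "B w \<in> cball l r"
    show "min d ((1 - \<rho>\<^sup>2) / 4) \<le> (1 - cmod w) * cmod (deriv B w)"
    proof (cases "R < cmod w")
      case True
      show ?thesis by (rule order_trans[OF min.cobounded2 out[OF w True]])
    next
      case False
      then have "w \<in> K" using w by (simp add: K_def)
      from d(2)[OF this] show ?thesis by simp
    qed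
  qed
qed

text \<open>With one \<delta> for all points above the disc, the inverse function theorem gives
  sections through all points of the fibre over a common disc of values. A point w above the disc is
  reached by applying the theorem at w itself: its own image disc contains l, which yields a fibre
  point close to w.\<close>

theorem evenly_covered_exists:
  assumes l: "l \<in> regular_values B"
  shows "\<exists>r c C \<delta> \<sigma>. evenly_covered B l r c C \<delta> \<sigma>"
proof -
  obtain r0 \<delta> where r0: "0 < r0" "0 < \<delta>" "cball l r0 \<subseteq> regular_values B"
    and ex0: "\<And>w. w \<in> unit_disk \<Longrightarrow> B w \<in> cball l r0 \<Longrightarrow> \<delta> \<le> (1 - cmod w) * cmod (deriv B w)"
    using expanding_near_regular_value[OF l] by blast
  \<comment> \<open>An eighth of \<delta>^2/32. A section then stays within \<delta>/128 (1 - |z|)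
    of its centre z, well inside the disc of radius \<delta>/64 (1 - |z|), and each w above the disc
    lies in the injectivity disc of the fibre point found for it.\<close>
  define r where "r = min r0 (\<delta>\<^sup>2 / 256)"
  have r: "0 < r" "r \<le> r0" "r \<le> \<delta>\<^sup>2 / 256" using r0 by (auto simp: r_def)
  define rad where "rad = (\<lambda>w::complex. \<delta> / 16 * (1 - cmod w))"
  have ex: "\<delta> \<le> (1 - cmod w) * cmod (deriv B w)" if "w \<in> unit_disk" "B w \<in> ball l r" for w
    using ex0[OF that(1)] that(2) r(2) by simp
  have Q: "\<delta> \<le> 1" "0 < rad w" "cball w (rad w) \<subseteq> unit_disk"
    "\<And>a b. a \<in> cball w (rad w) \<Longrightarrow> b \<in> cball w (rad w) \<Longrightarrow> \<delta> / (2 * (1 - cmod w)) * cmod (a - b) \<le> cmod (B a - B b)"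
    "ball (B w) (\<delta>\<^sup>2 / 32) \<subseteq> B ` ball w (rad w)"
    if "w \<in> unit_disk" "B w \<in> ball l r" for w
    unfolding rad_def
    by (rule quantitative_inverse[OF hol le1 that(1) r0(2) ex[OF that]]; assumption)+
  have lip: "\<delta> * cmod (a - b) \<le> 2 * (1 - cmod w) * cmod (B a - B b)"
    if w: "w \<in> unit_disk" "B w \<in> ball l r" and ab: "a \<in> cball w (rad w)" "b \<in> cball w (rad w)" for w a b
  proof -
    have "\<delta> / (2 * (1 - cmod w)) * cmod (a - b) \<le> cmod (B a - B b)"
      using Q(4)[OF w ab] .
    moreover have "0 < 2 * (1 - cmod w)" using w(1) by simp
    moreover have "\<delta> * x \<le> q * y" if "\<delta> / q * x \<le> y" "0 < q" for q x y :: real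
      using that by (simp add: field_simps)
    ultimately show ?thesis by blast
  qed
  have inj: "a = b" if w: "w \<in> unit_disk" "B w \<in> ball l r" and ab: "a \<in> cball w (rad w)" "b \<in> cball w (rad w)" "B a = B b" for w a b
  proof -
    have "\<delta> * cmod (a - b) \<le> 0" using lip[OF w ab(1,2)] ab(3) by simp
    then have "cmod (a - b) \<le> 0" using r0(2) by (simp add: mult_le_0_iff)
    then show ?thesis by simp
  qed
  have fib: "z \<in> unit_disk" "B z \<in> ball l r" "B z = l" if "z \<in> fibre B l" for z
    using that r by (auto simp: fibre_def)
  have sec: "\<exists>g. g holomorphic_on ball l r \<and> (\<forall>m\<in>ball l r. g m \<in> ball z (rad z) \<and> B (g m) = m)" if z: "z \<in> fibre B l" for z
  proof -
    note zD = fib[OF z]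
    have sub: "ball z (rad z) \<subseteq> unit_disk"
      using Q(3)[OF zD(1,2)] ball_subset_cball by blast
    have "inj_on B (ball z (rad z))"
      using inj[OF zD(1,2)] ball_subset_cball by (meson inj_onI subsetD)
    moreover have Bh: "B holomorphic_on ball z (rad z)" using hol sub holomorphic_on_subset by blast
    ultimately obtain g where g: "g holomorphic_on B ` ball z (rad z)" "\<And>x. x \<in> ball z (rad z) \<Longrightarrow> g (B x) = x"
      using holomorphic_has_inverse[OF Bh open_ball] by metis
    have im: "ball l r \<subseteq> B ` ball z (rad z)"
    proof -
      have "0 \<le> \<delta>\<^sup>2" by simp
      then have "ball l r \<subseteq> ball l (\<delta>\<^sup>2 / 32)" using r(3) by (intro subset_ball) linarith
      then show ?thesis using Q(5)[OF zD(1,2)] zD(3) by simp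
    qed
    have "g m \<in> ball z (rad z) \<and> B (g m) = m" if m: "m \<in> ball l r" for m
    proof -
      obtain x where x: "x \<in> ball z (rad z)" "m = B x" using im m by blast
      then show ?thesis using g(2)[OF x(1)] by simp
    qed
    moreover have "g holomorphic_on ball l r" by (rule holomorphic_on_subset[OF g(1) im])
    ultimately have "g holomorphic_on ball l r \<and> (\<forall>m\<in>ball l r. g m \<in> ball z (rad z) \<and> B (g m) = m)" by simp
    then show ?thesis by (rule exI[where x = g])
  qed
  have "\<forall>z\<in>fibre B l. \<exists>g. g holomorphic_on ball l r \<and> (\<forall>m\<in>ball l r. g m \<in> ball z (rad z) \<and> B (g m) = m)"
    by (intro ballI sec)
  from bchoice[OF this] obtain \<sigma>
    where \<sigma>0: "\<forall>z\<in>fibre B l. \<sigma> z holomorphic_on ball l r \<and> (\<forall>m\<in>ball l r. \<sigma> z m \<in> ball z (rad z) \<and> B (\<sigma> z m) = m)"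
    by (rule exE)
  have \<sigma>: "\<sigma> z holomorphic_on ball l r"
    "\<And>m. m \<in> ball l r \<Longrightarrow> \<sigma> z m \<in> ball z (rad z) \<and> B (\<sigma> z m) = m" if "z \<in> fibre B l" for z
    by (rule conjunct1[OF bspec[OF \<sigma>0 that]]) (rule bspec[OF conjunct2[OF bspec[OF \<sigma>0 that]]])
  have \<sigma>c: "\<sigma> z m \<in> cball z (rad z)" if "z \<in> fibre B l" "m \<in> ball l r" for z m
    using \<sigma>(2)[OF that] ball_subset_cball by blast
  have zc: "z \<in> cball z (rad z)" if "z \<in> fibre B l" for z
    using Q(2)[OF fib(1,2)[OF that]] by simp
  have near: "\<delta> * cmod (\<sigma> z m - z) \<le> 2 * (1 - cmod z) * cmod (m - l)" if "z \<in> fibre B l" "m \<in> ball l r" for z m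
    using lip[OF fib(1,2)[OF that(1)] \<sigma>c[OF that] zc[OF that(1)]] \<sigma>(2)[OF that] fib(3)[OF that(1)] by simp
  have "evenly_covered B l r (\<delta> / 64) (2 / \<delta>) \<delta> \<sigma>" if nonempty: "fibre B l \<noteq> {}"
  proof
    obtain z0 where z0: "z0 \<in> fibre B l" using nonempty by blast
    have \<delta>1: "\<delta> \<le> 1" using Q(1)[OF fib(1,2)[OF z0]] .
    show "0 < r" by (rule r(1))
    show "0 < \<delta> / 64" "0 < 2 / \<delta>" "0 < \<delta>" using r0(2) by auto
    show "\<delta> / 64 \<le> 1 / 4" using \<delta>1 by simp
    show "ball l r \<subseteq> regular_values B"
    proof -
      have "ball l r \<subseteq> cball l r0" using r(2) by auto
      then show ?thesis using r0(3) by blast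
    qed
    show "\<delta> \<le> (1 - cmod w) * cmod (deriv B w)" if "w \<in> unit_disk" "B w \<in> ball l r" for w
      by (rule ex[OF that])
    fix z assume z: "z \<in> fibre B l"
    show "\<sigma> z holomorphic_on ball l r" by (rule \<sigma>(1)[OF z])
    have l_in: "l \<in> ball l r" using r by simp
    show "\<sigma> z l = z"
      using \<sigma>(2)[OF z l_in] fib(3)[OF z] by (intro inj[OF fib(1,2)[OF z] \<sigma>c[OF z l_in] zc[OF z]]) simp
    have zs: "0 < 1 - cmod z" using fib(1)[OF z] by simp
    { fix m assume m: "m \<in> ball l r"
      have "\<sigma> z m \<in> unit_disk"
        using \<sigma>c[OF z m] Q(3)[OF fib(1,2)[OF z]] by blast
      then show "\<sigma> z m \<in> unit_disk \<and> B (\<sigma> z m) = m" using \<sigma>(2)[OF z m] by blast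
      show n: "cmod (\<sigma> z m - z) \<le> 2 / \<delta> * cmod (m - l) * (1 - cmod z)"
        using near[OF z m] r0(2) by (simp add: field_simps)
      have "cmod (m - l) < \<delta>\<^sup>2 / 256" using m r(3) by (simp add: dist_norm norm_minus_commute)
      then have "2 / \<delta> * cmod (m - l) * (1 - cmod z) < 2 / \<delta> * (\<delta>\<^sup>2 / 256) * (1 - cmod z)"
        using r0(2) zs by (intro mult_strict_right_mono mult_strict_left_mono) auto
      also have "2 / \<delta> * (\<delta>\<^sup>2 / 256) = \<delta> / 128" using r0(2) by (simp add: power2_eq_square)
      also have "\<delta> / 128 * (1 - cmod z) \<le> \<delta> / 64 * (1 - cmod z)" using r0(2) zs by (intro mult_right_mono) auto
      finally show "cmod (\<sigma> z m - z) < \<delta> / 64 * (1 - cmod z)" using n by linarith }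
    { fix z' assume z': "z' \<in> fibre B l" "z \<noteq> z'"
      have zs': "0 < 1 - cmod z'" using fib(1)[OF z'(1)] by simp
      \<comment> \<open>B is injective on the closed disc of radius \<open>rad u\<close> around u,
        so two points of a fibre are farther apart than either radius, and discs of a quarter of
        these radii are disjoint.\<close>
      have sep: "rad u < cmod (u - v)" if "u \<in> fibre B l" "v \<in> fibre B l" "u \<noteq> v" for u v
      proof (rule ccontr)
        assume "\<not> rad u < cmod (u - v)"
        then have "v \<in> cball u (rad u)" by (simp add: dist_norm)
        then show False
          using inj[OF fib(1,2)[OF that(1)] zc[OF that(1)], of v] fib(3) that by simp
      qed
      have "rad z < cmod (z - z')" "rad z' < cmod (z - z')"
        using sep[OF z z'] sep[OF z'(1) z] z'(2) by (auto simp: norm_minus_commute)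
      then have far: "\<delta> / 64 * (1 - cmod z) + \<delta> / 64 * (1 - cmod z') < cmod (z - z')"
        unfolding rad_def using r0(2) zs zs' mult_pos_pos[OF r0(2) zs] by linarith
      show "ball z (\<delta> / 64 * (1 - cmod z)) \<inter> ball z' (\<delta> / 64 * (1 - cmod z')) = {}"
      proof (rule ccontr)
        assume "ball z (\<delta> / 64 * (1 - cmod z)) \<inter> ball z' (\<delta> / 64 * (1 - cmod z')) \<noteq> {}"
        then obtain x where "dist z x < \<delta> / 64 * (1 - cmod z)" "dist z' x < \<delta> / 64 * (1 - cmod z')" by auto
        then have "dist z z' < \<delta> / 64 * (1 - cmod z) + \<delta> / 64 * (1 - cmod z')"
          using dist_triangle2[of z z' x] by linarith
        then show False using far by (simp only: dist_norm)
      qed }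
  next
    fix w assume w: "w \<in> unit_disk" "B w \<in> ball l r"
    have \<delta>1: "\<delta> \<le> 1" using Q(1)[OF w] .
    have sw: "0 < 1 - cmod w" using w(1) by simp
    have "l \<in> ball (B w) (\<delta>\<^sup>2 / 32)"
    proof -
      have "dist (B w) l < \<delta>\<^sup>2 / 256" using w(2) r(3) by (simp add: dist_commute)
      moreover have "0 \<le> \<delta>\<^sup>2" by simp
      ultimately have "dist (B w) l < \<delta>\<^sup>2 / 32" by linarith
      then show ?thesis by simp
    qed
    then obtain z where z: "z \<in> ball w (rad w)" "B z = l" using Q(5)[OF w] by blast
    have zcb: "z \<in> cball w (rad w)" using z(1) ball_subset_cball by blast
    have zD: "z \<in> unit_disk" using zcb Q(3)[OF w] by blast
    have zf: "z \<in> fibre B l" using zD z(2) by (simp add: fibre_def)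
    have wcb: "w \<in> cball w (rad w)" using Q(2)[OF w] by simp
    have "\<delta> * cmod (w - z) \<le> 2 * (1 - cmod w) * cmod (B w - l)"
      using lip[OF w wcb zcb] z(2) by simp
    also have "\<dots> \<le> 2 * (1 - cmod w) * (\<delta>\<^sup>2 / 256)"
      using w(2) r(3) sw by (intro mult_left_mono) (auto simp: dist_norm norm_minus_commute)
    also have "\<dots> = \<delta> * (\<delta> / 128 * (1 - cmod w))" by (simp add: power2_eq_square)
    finally have wz: "cmod (w - z) \<le> \<delta> / 128 * (1 - cmod w)" using r0(2) by simp
    have "\<delta> / 128 * (1 - cmod w) \<le> 1 / 2 * (1 - cmod w)" using \<delta>1 sw by (intro mult_right_mono) auto
    with wz have "cmod (w - z) \<le> 1 / 2 * (1 - cmod w)" by (rule order_trans)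
    moreover have "cmod z - cmod w \<le> cmod (w - z)" by (metis norm_minus_commute norm_triangle_ineq2)
    moreover have "1 - x \<le> 2 * (1 - y)" if "d \<le> 1 / 2 * (1 - x)" "y - x \<le> d" for d x y :: real
      using that by (simp add: field_simps)
    \<comment> \<open>Being close relative to the circle, z and w have comparable distances to it.
      This converts the bound relative to w into one relative to z.\<close>
    ultimately have "1 - cmod w \<le> 2 * (1 - cmod z)" by blast
    then have "\<delta> / 128 * (1 - cmod w) \<le> \<delta> / 128 * (2 * (1 - cmod z))" using r0(2) by (intro mult_left_mono) auto
    also have "\<dots> \<le> rad z"
    proof -
      have "0 \<le> \<delta> * (1 - cmod z)" using r0(2) zD by (intro mult_nonneg_nonneg) auto
      then show ?thesis unfolding rad_def by linarith
    qed
    finally have "w \<in> cball z (rad z)" using wz by (simp add: dist_norm norm_minus_commute)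
    then have "w = \<sigma> z (B w)"
      using \<sigma>(2)[OF zf w(2)] by (intro inj[OF fib(1,2)[OF zf] _ \<sigma>c[OF zf w(2)]]) auto
    then show "\<exists>z\<in>fibre B l. w = \<sigma> z (B w)" using zf by blast
  qed
  \<comment> \<open>With an empty fibre no point certifies \<delta> \<le> 1, so c and C receive
    arbitrary admissible values; the inverse function theorem shows that then no point lies above
    the disc at all.\<close>
  moreover have "evenly_covered B l r (1/4) 1 \<delta> \<sigma>" if "fibre B l = {}"
  proof
    have none: False if w: "w \<in> unit_disk" "B w \<in> ball l r" for w
    proof -
      have "dist (B w) l < \<delta>\<^sup>2 / 256" using w(2) r(3) by (simp add: dist_commute)
      moreover have "0 \<le> \<delta>\<^sup>2" by simp
      ultimately have "dist (B w) l < \<delta>\<^sup>2 / 32" by linarith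
      then have "l \<in> ball (B w) (\<delta>\<^sup>2 / 32)" by simp
      then obtain z where z: "z \<in> ball w (rad w)" "B z = l" using Q(5)[OF w] by blast
      then have "z \<in> unit_disk" using Q(3)[OF w] ball_subset_cball by blast
      then show False using z(2) \<open>fibre B l = {}\<close> by (auto simp: fibre_def)
    qed
    show "\<exists>z\<in>fibre B l. w = \<sigma> z (B w)" "\<delta> \<le> (1 - cmod w) * cmod (deriv B w)"
      if "w \<in> unit_disk" "B w \<in> ball l r" for w
      using none[OF that] by auto
    show "ball l r \<subseteq> regular_values B"
    proof -
      have "ball l r \<subseteq> cball l r0" using r(2) by auto
      then show ?thesis using r0(3) by blast
    qed
  qed (use r r0 that in auto)
  ultimately show ?thesis by blast
qed

end

section \<open>Sections and sheets above an evenly covered disc\<close>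

context evenly_covered
begin

lemma fibre_disk: "z \<in> fibre B l \<Longrightarrow> z \<in> unit_disk" "z \<in> fibre B l \<Longrightarrow> B z = l"
  by (auto simp: fibre_def)

lemma center_in: "l \<in> ball l r"
  using pos by simp

lemma \<sigma>_deriv:
  assumes "z \<in> fibre B l" "m \<in> ball l r"
  shows "deriv (\<sigma> z) m * deriv B (\<sigma> z m) = 1"
proof -
  have s: "(\<sigma> z has_field_derivative deriv (\<sigma> z) m) (at m)"
    using holomorphic_derivI[OF \<sigma>_hol[OF assms(1)] open_ball assms(2)] .
  have "(B has_field_derivative deriv B (\<sigma> z m)) (at (\<sigma> z m))"
    using holomorphic_derivI[OF hol open_ball] \<sigma>_section[OF assms] by blast
  from DERIV_chain2[OF this s]
  have "((\<lambda>m. B (\<sigma> z m)) has_field_derivative deriv B (\<sigma> z m) * deriv (\<sigma> z) m) (at m)" .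
  moreover have "((\<lambda>m. B (\<sigma> z m)) has_field_derivative 1) (at m)"
    by (rule has_field_derivative_transform_within_open[OF DERIV_ident open_ball assms(2)])
      (use \<sigma>_section[OF assms(1)] in simp)
  ultimately show ?thesis using DERIV_unique by (metis mult.commute)
qed

lemma \<sigma>_unique:
  assumes "z \<in> fibre B l" "z' \<in> fibre B l" "m \<in> ball l r" "m' \<in> ball l r" "\<sigma> z m = \<sigma> z' m'"
  shows "z = z'" "m = m'"
proof -
  show "z = z'"
  proof (rule ccontr)
    assume "z \<noteq> z'"
    moreover have "\<sigma> z m \<in> ball z (c * (1 - cmod z))"
      using \<sigma>_disc[OF assms(1,3)] by (simp add: dist_norm norm_minus_commute)
    moreover have "\<sigma> z m \<in> ball z' (c * (1 - cmod z'))"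
      using \<sigma>_disc[OF assms(2,4)] assms(5) by (simp add: dist_norm norm_minus_commute)
    ultimately show False using discs_disjoint[OF assms(1,2)] by blast
  qed
  show "m = m'" using \<sigma>_section[OF assms(1,3)] \<sigma>_section[OF assms(2,4)] assms(5) by metis
qed

lemma \<sigma>_inj: "z \<in> fibre B l \<Longrightarrow> inj_on (\<sigma> z) (ball l r)"
  using \<sigma>_unique(2) by (meson inj_onI)

lemma \<sigma>_regular:
  assumes "z \<in> fibre B l" "m \<in> ball l r"
  shows "\<sigma> z m \<in> regular_domain B"
  unfolding regular_domain_iff using \<sigma>_section[OF assms] regular assms(2) by auto

lemma fibre_regular: "z \<in> fibre B l \<Longrightarrow> z \<in> regular_domain B"
  using \<sigma>_regular[of z l] \<sigma>_center center_in by simp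

lemma preimage_eq:
  assumes "A \<subseteq> ball l r"
  shows "{w \<in> unit_disk. B w \<in> A} = (\<Union>z\<in>fibre B l. \<sigma> z ` A)"
proof (intro equalityI subsetI)
  fix w assume w: "w \<in> {w \<in> unit_disk. B w \<in> A}"
  then obtain z where "z \<in> fibre B l" "w = \<sigma> z (B w)" using \<sigma>_cover assms by blast
  then show "w \<in> (\<Union>z\<in>fibre B l. \<sigma> z ` A)" using w by blast
next
  fix w assume "w \<in> (\<Union>z\<in>fibre B l. \<sigma> z ` A)"
  then obtain z m where "z \<in> fibre B l" "m \<in> A" "w = \<sigma> z m" by blast
  then show "w \<in> {w \<in> unit_disk. B w \<in> A}" using \<sigma>_section assms by auto
qed

lemma sheets_disjoint:
  assumes "A \<subseteq> ball l r"
  shows "disjoint_family_on (\<lambda>z. \<sigma> z ` A) (fibre B l)"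
  unfolding disjoint_family_on_def using \<sigma>_unique(1) assms by blast

lemma fibre_section:
  assumes "m \<in> ball l r"
  shows "fibre B m = (\<lambda>z. \<sigma> z m) ` fibre B l"
proof -
  have "fibre B m = {w \<in> unit_disk. B w \<in> {m}}" by (auto simp: fibre_def)
  also have "\<dots> = (\<Union>z\<in>fibre B l. \<sigma> z ` {m})" using assms by (intro preimage_eq) simp
  finally show ?thesis by auto
qed

lemma section_inj:
  assumes "m \<in> ball l r"
  shows "inj_on (\<lambda>z. \<sigma> z m) (fibre B l)"
  using \<sigma>_unique(1) assms by (meson inj_onI)

lemma open_sheet: "z \<in> fibre B l \<Longrightarrow> open (\<sigma> z ` ball l r)"
  using open_mapping_thm3[OF \<sigma>_hol open_ball \<sigma>_inj] .

lemma center_in_sheet: "z \<in> fibre B l \<Longrightarrow> z \<in> \<sigma> z ` ball l r"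
  using \<sigma>_center center_in by (metis imageI)

lemma sheet_B:
  assumes "z \<in> fibre B l" "x \<in> \<sigma> z ` ball l r"
  shows "B x \<in> ball l r" "x = \<sigma> z (B x)" "x \<in> unit_disk"
  using assms \<sigma>_section by auto

end

section \<open>Correspondences made of sheets; components and their multiplicity\<close>

context asymptotic_isometry
begin

text \<open>Abstracts the covering property of a component: whether a pair of sections lies in G
  does not depend on the point of the disc. In this form the property passes to the converse
  relation by inspection.\<close>

definition sheeted :: "(complex \<times> complex) set \<Rightarrow> bool" where
  "sheeted G \<longleftrightarrow> G \<subseteq> riemann_surface B \<and>
    (\<forall>l r c C \<delta> \<sigma>. evenly_covered B l r c C \<delta> \<sigma> \<longrightarrow>
      (\<forall>z\<in>fibre B l. \<forall>w\<in>fibre B l. \<forall>m\<in>ball l r. (\<sigma> z m, \<sigma> w m) \<in> G \<longleftrightarrow> (z, w) \<in> G))"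

lemma riemann_surface_iff:
  "(z, w) \<in> riemann_surface B \<longleftrightarrow> z \<in> regular_domain B \<and> w \<in> regular_domain B \<and> B z = B w"
  by (auto simp: riemann_surface_def regular_domain_iff)

text \<open>Two sections run in parallel over a disc trace a connected subset of the surface, which
  a component either contains or misses.\<close>

lemma component_sheeted:
  assumes G: "G \<in> components (riemann_surface B)"
  shows "sheeted G"
  unfolding sheeted_def
proof (intro conjI allI impI ballI)
  show "G \<subseteq> riemann_surface B" using in_components_subset[OF G] .
  fix l r c C \<delta> \<sigma> z w m
  assume ec: "evenly_covered B l r c C \<delta> \<sigma>" and zw: "z \<in> fibre B l" "w \<in> fibre B l" and m: "m \<in> ball l r"
  interpret evenly_covered B l r c C \<delta> \<sigma> by (rule ec)
  let ?T = "(\<lambda>m. (\<sigma> z m, \<sigma> w m)) ` ball l r"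
  have "connected ?T"
    using zw by (intro connected_continuous_image continuous_on_Pair holomorphic_on_imp_continuous_on \<sigma>_hol) auto
  moreover have "?T \<subseteq> riemann_surface B"
    using \<sigma>_regular \<sigma>_section zw by (auto simp: riemann_surface_iff)
  ultimately have sub: "G \<inter> ?T \<noteq> {} \<Longrightarrow> ?T \<subseteq> G"
    using components_maximal[OF G] by blast
  have "(\<sigma> z m, \<sigma> w m) \<in> ?T" using m by blast
  moreover have "(z, w) \<in> ?T"
    using \<sigma>_center zw center_in by (intro image_eqI[of _ _ l]) auto
  ultimately show "(\<sigma> z m, \<sigma> w m) \<in> G \<longleftrightarrow> (z, w) \<in> G" using sub by blast
qed

lemma sheeted_converse:
  assumes "sheeted G"
  shows "sheeted (G\<inverse>)"
proof -
  have "G\<inverse> \<subseteq> riemann_surface B"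
    using assms riemann_surface_iff unfolding sheeted_def by fastforce
  then show ?thesis using assms unfolding sheeted_def by simp
qed

lemma sheetedD:
  assumes "sheeted G" "(z, w) \<in> G"
  shows "z \<in> regular_domain B" "w \<in> regular_domain B" "B z = B w" "z \<in> unit_disk" "w \<in> unit_disk"
  using assms riemann_surface_iff[of z w] by (auto simp: sheeted_def regular_domain_def)

lemma sheeted_fibre_subset:
  assumes "sheeted G"
  shows "G `` {z} \<subseteq> fibre B (B z)"
  using sheetedD[OF assms] by (auto simp: fibre_def)

lemma sheeted_section:
  assumes G: "sheeted G" and ec: "evenly_covered B l r c C \<delta> \<sigma>"
    and z: "z \<in> fibre B l" and m: "m \<in> ball l r"
  shows "G `` {\<sigma> z m} = (\<lambda>w. \<sigma> w m) ` (G `` {z})" "inj_on (\<lambda>w. \<sigma> w m) (G `` {z})" "G `` {z} \<subseteq> fibre B l"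
proof -
  interpret evenly_covered B l r c C \<delta> \<sigma> by (rule ec)
  have Bz: "B z = l" using z fibre_disk by blast
  show sub: "G `` {z} \<subseteq> fibre B l" using sheeted_fibre_subset[OF G, of z] Bz by simp
  show "inj_on (\<lambda>w. \<sigma> w m) (G `` {z})" using section_inj[OF m] sub inj_on_subset by blast
  have iff: "(\<sigma> z m, \<sigma> w m) \<in> G \<longleftrightarrow> (z, w) \<in> G" if "w \<in> fibre B l" for w
    using G ec z that m unfolding sheeted_def by blast
  show "G `` {\<sigma> z m} = (\<lambda>w. \<sigma> w m) ` (G `` {z})"
  proof (intro equalityI subsetI)
    fix y assume "y \<in> G `` {\<sigma> z m}"
    then have y: "(\<sigma> z m, y) \<in> G" by simp
    then have "y \<in> fibre B m" using sheetedD[OF G y] \<sigma>_section[OF z m] by (simp add: fibre_def)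
    then obtain w where w: "w \<in> fibre B l" "y = \<sigma> w m" using fibre_section[OF m] by blast
    then show "y \<in> (\<lambda>w. \<sigma> w m) ` (G `` {z})" using iff[OF w(1)] y by blast
  next
    fix y assume "y \<in> (\<lambda>w. \<sigma> w m) ` (G `` {z})"
    then obtain w where w: "(z, w) \<in> G" "y = \<sigma> w m" by blast
    then show "y \<in> G `` {\<sigma> z m}" using iff sub by blast
  qed
qed

text \<open>The expression under the \<open>THE\<close> in
  \<open>multiplicity_of_component\<close>.\<close>

definition ecard :: "complex set \<Rightarrow> enat" where
  "ecard X = (if finite X then enat (card X) else \<infinity>)"

text \<open>Along a sheet the sections match the fibres of G bijectively, so their cardinality is
  locally constant, and the regular domain is connected.\<close>

lemma sheeted_ecard_constant:
  assumes G: "sheeted G" and "x \<in> regular_domain B" "y \<in> regular_domain B"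
  shows "ecard (G `` {x}) = ecard (G `` {y})"
proof -
  have "(\<lambda>x. ecard (G `` {x})) constant_on regular_domain B"
  proof (rule locally_constant_imp_constant[OF connected_regular_domain])
    fix z assume z: "z \<in> regular_domain B"
    define l where "l = B z"
    have l: "l \<in> regular_values B" and zf: "z \<in> fibre B l"
      using z by (auto simp: regular_domain_iff fibre_def l_def)
    obtain r c C \<delta> \<sigma> where ec: "evenly_covered B l r c C \<delta> \<sigma>"
      using evenly_covered_exists[OF l] by blast
    interpret evenly_covered B l r c C \<delta> \<sigma> by (rule ec)
    have "openin (top_of_set (regular_domain B)) (\<sigma> z ` ball l r)"
      using \<sigma>_regular[OF zf] by (intro open_subset open_sheet[OF zf]) auto
    moreover have "ecard (G `` {x}) = ecard (G `` {z})" if x: "x \<in> \<sigma> z ` ball l r" for x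
    proof -
      obtain m where m: "m \<in> ball l r" "x = \<sigma> z m" using x by blast
      note s = sheeted_section[OF G ec zf m(1)]
      show ?thesis
        unfolding ecard_def m(2) s(1) using finite_image_iff[OF s(2)] card_image[OF s(2)] by simp
    qed
    ultimately show "\<exists>T. openin (top_of_set (regular_domain B)) T \<and> z \<in> T \<and> (\<forall>x\<in>T. ecard (G `` {x}) = ecard (G `` {z}))"
      using center_in_sheet[OF zf] by blast
  qed
  then show ?thesis using assms(2,3) unfolding constant_on_def by metis
qed

text \<open>Resolves the \<open>THE\<close>: the count exists because it is constant, and a single
  point of the regular domain determines it.\<close>

lemma multiplicity_eq:
  assumes G: "G \<in> components (riemann_surface B)" and z: "z \<in> regular_domain B"
  shows "multiplicity_of_component B G = ecard (G `` {z})"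
proof -
  have I: "G `` {x} = {w. (x, w) \<in> G}" for x by blast
  show ?thesis
    unfolding multiplicity_of_component_def
  proof (rule the_equality)
    show "\<forall>x\<in>regular_domain B. ecard (G `` {z}) = (if finite {w. (x, w) \<in> G} then enat (card {w. (x, w) \<in> G}) else \<infinity>)"
    proof
      fix x assume "x \<in> regular_domain B"
      from sheeted_ecard_constant[OF component_sheeted[OF G] z this]
      show "ecard (G `` {z}) = (if finite {w. (x, w) \<in> G} then enat (card {w. (x, w) \<in> G}) else \<infinity>)"
        by (rule trans) (unfold ecard_def I, rule refl)
    qed
    fix m assume "\<forall>x\<in>regular_domain B. m = (if finite {w. (x, w) \<in> G} then enat (card {w. (x, w) \<in> G}) else \<infinity>)"
    then show "m = ecard (G `` {z})" using z unfolding ecard_def I[of z] by blast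
  qed
qed

text \<open>In a connected set D of the surface that contains the diagonal, the diagonal is closed
  as an equaliser and open because B is injective on a single sheet; hence D is the
  diagonal.\<close>

lemma trivial_component: "trivial_component B \<in> components (riemann_surface B)"
proof -
  let ?T = "trivial_component B"
  have T: "?T = (\<lambda>z. (z, z)) ` regular_domain B" by (auto simp: trivial_component_def)
  have TS: "?T \<subseteq> riemann_surface B" unfolding T by (auto simp: riemann_surface_iff)
  have conT: "connected ?T"
    unfolding T by (intro connected_continuous_image connected_regular_domain continuous_intros)
  have neT: "?T \<noteq> {}" unfolding T using regular_domain_nonempty by blast
  show ?thesis
    unfolding in_components_maximal
  proof (intro conjI neT TS conT allI impI)
    fix D assume D: "D \<noteq> {} \<and> ?T \<subseteq> D \<and> D \<subseteq> riemann_surface B \<and> connected D"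
    have "closedin (top_of_set D) ?T"
    proof -
      have "closed {p::complex \<times> complex. fst p = snd p}"
        by (intro closed_Collect_eq continuous_intros)
      moreover have "?T = D \<inter> {p. fst p = snd p}"
        using D unfolding T by (auto simp: riemann_surface_iff)
      ultimately show ?thesis by (metis closedin_closed_Int)
    qed
    moreover have "openin (top_of_set D) ?T"
      unfolding openin_subopen[of _ ?T]
    proof
      fix p assume "p \<in> ?T"
      then obtain z where z: "z \<in> regular_domain B" "p = (z, z)" unfolding T by blast
      define l where "l = B z"
      have l: "l \<in> regular_values B" and zf: "z \<in> fibre B l"
        using z by (auto simp: regular_domain_iff fibre_def l_def)
      obtain r c C \<delta> \<sigma> where ec: "evenly_covered B l r c C \<delta> \<sigma>"
        using evenly_covered_exists[OF l] by blast
      interpret evenly_covered B l r c C \<delta> \<sigma> by (rule ec)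
      let ?N = "\<sigma> z ` ball l r"
      have "openin (top_of_set D) (D \<inter> (?N \<times> ?N))"
        by (intro openin_open_Int open_Times open_sheet[OF zf])
      moreover have "p \<in> D \<inter> (?N \<times> ?N)"
        using center_in_sheet[OF zf] z D \<open>p \<in> ?T\<close> by blast
      moreover have "D \<inter> (?N \<times> ?N) \<subseteq> ?T"
      proof
        fix q assume q: "q \<in> D \<inter> (?N \<times> ?N)"
        then obtain x y where xy: "q = (x, y)" "x \<in> ?N" "y \<in> ?N" by blast
        have S: "(x, y) \<in> riemann_surface B" using q xy D by blast
        then have "B x = B y" "x \<in> regular_domain B" unfolding riemann_surface_iff by auto
        then have "x = y" using sheet_B(2)[OF zf xy(2)] sheet_B(2)[OF zf xy(3)] by simp
        then show "q \<in> ?T" using xy \<open>x \<in> regular_domain B\<close> unfolding T by blast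
      qed
      ultimately show "\<exists>U. openin (top_of_set D) U \<and> p \<in> U \<and> U \<subseteq> ?T" by blast
    qed
    ultimately show "D = ?T"
      using D neT connected_clopen by blast
  qed
qed

lemma nontrivial_component_off_diagonal:
  assumes "G \<in> nontrivial_components B" "(z, w) \<in> G"
  shows "z \<noteq> w"
proof
  assume "z = w"
  have G: "G \<in> components (riemann_surface B)" "G \<noteq> trivial_component B"
    using assms(1) by (auto simp: nontrivial_components_def)
  have "(z, z) \<in> trivial_component B"
    using sheetedD(1)[OF component_sheeted[OF G(1)] assms(2)] by (auto simp: trivial_component_def)
  then have "G \<inter> trivial_component B \<noteq> {}" using assms(2) \<open>z = w\<close> by blast
  then show False using components_nonoverlap[OF G(1) trivial_component] G(2) by blast
qed

lemma surface_point_cases: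
  assumes "(z, w) \<in> riemann_surface B"
  obtains "z = w" | G where "G \<in> nontrivial_components B" "(z, w) \<in> G"
proof -
  have "(z, w) \<in> \<Union> (components (riemann_surface B))" using assms Union_components by blast
  then obtain G where G: "G \<in> components (riemann_surface B)" "(z, w) \<in> G" by blast
  have "z = w \<or> G \<in> nontrivial_components B"
    using G by (auto simp: trivial_component_def nontrivial_components_def)
  then show thesis using that G(2) by blast
qed

end

section \<open>Concentration on a fibre\<close>

lemma lipschitz_of_bounded:
  assumes F: "F holomorphic_on S" "open S" "cball z \<rho> \<subseteq> S" "0 < \<rho>"
    and M: "\<And>x. x \<in> cball z \<rho> \<Longrightarrow> cmod (F x) \<le> M" and x: "cmod (x - z) \<le> \<rho> / 2"
  shows "cmod (F x - F z) \<le> 2 * M / \<rho> * cmod (x - z)"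
proof -
  have d: "cmod (deriv F u) \<le> 2 * M / \<rho>" if u: "u \<in> cball z (\<rho> / 2)" for u
  proof -
    have sub: "v \<in> cball z \<rho>" if "v \<in> cball u (\<rho> / 2)" for v
    proof -
      have "dist z v \<le> dist z u + dist u v" by (rule dist_triangle)
      then show ?thesis using u that by simp
    qed
    have subS: "cball u (\<rho> / 2) \<subseteq> S" using sub F(3) by blast
    have "cmod ((deriv ^^ 1) F u) \<le> fact 1 * M / (\<rho> / 2) ^ 1"
    proof (rule Cauchy_inequality)
      show "F holomorphic_on ball u (\<rho> / 2)"
        by (rule holomorphic_on_subset[OF F(1)]) (rule order_trans[OF ball_subset_cball subS])
      show "continuous_on (cball u (\<rho> / 2)) F"
        by (rule holomorphic_on_imp_continuous_on[OF holomorphic_on_subset[OF F(1) subS]])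
      show "0 < \<rho> / 2" using F(4) by simp
      show "cmod (F v) \<le> M" if "cmod (u - v) = \<rho> / 2" for v
        by (rule M[OF sub]) (use that in \<open>simp add: dist_norm\<close>)
    qed
    then show ?thesis by (simp add: mult.commute)
  qed
  have sub: "cball z (\<rho> / 2) \<subseteq> S"
  proof -
    have "cball z (\<rho> / 2) \<subseteq> cball z \<rho>" using F(4) by (intro subset_cball) simp
    then show ?thesis using F(3) by blast
  qed
  show ?thesis
  proof (rule field_differentiable_bound[OF convex_cball[of z "\<rho> / 2"] _ d])
    fix u assume "u \<in> cball z (\<rho> / 2)"
    then have "u \<in> S" using sub by blast
    then show "(F has_field_derivative deriv F u) (at u within cball z (\<rho> / 2))"
      by (rule has_field_derivative_at_within[OF holomorphic_derivI[OF F(1,2)]])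
  next
    show "x \<in> cball z (\<rho> / 2)" using x by (simp add: dist_norm norm_minus_commute)
    show "z \<in> cball z (\<rho> / 2)" using F(4) by simp
  qed
qed

text \<open>The measure |F|^2 dA. As a measure, it makes sums over disjoint sheets a matter of
  countable additivity.\<close>

definition mass :: "(complex \<Rightarrow> complex) \<Rightarrow> complex measure" where
  "mass F = density disk_area (\<lambda>x. ennreal ((cmod (F x))\<^sup>2))"

lemma sets_mass [simp, measurable_cong]: "sets (mass F) = sets borel"
  by (simp add: mass_def)

lemma mass_emeasure:
  assumes "F \<in> bergman" "A \<in> sets borel"
  shows "emeasure (mass F) A = (\<integral>\<^sup>+x. ennreal ((cmod (F x))\<^sup>2) * indicator A x \<partial>disk_area)"
proof -
  have [measurable]: "F \<in> borel_measurable borel" by (rule bergman_measurable[OF assms(1)])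
  show ?thesis unfolding mass_def by (rule emeasure_density) (use assms(2) in simp_all)
qed

lemma mass_UNIV: "F \<in> bergman \<Longrightarrow> emeasure (mass F) UNIV = ennreal ((bergman_norm F)\<^sup>2)"
  by (simp only: mass_emeasure sets.top[of borel, unfolded space_borel] bergman_nn_integral_eq(1) indicator_UNIV mult_1_right)

lemma mass_le:
  assumes "F \<in> bergman"
  shows "emeasure (mass F) A \<le> ennreal ((bergman_norm F)\<^sup>2)"
proof -
  have "emeasure (mass F) A \<le> emeasure (mass F) UNIV"
    by (rule emeasure_mono) simp_all
  then show ?thesis by (simp only: mass_UNIV[OF assms])
qed

definition mass_on :: "(complex \<Rightarrow> complex) \<Rightarrow> complex set \<Rightarrow> real" where
  "mass_on F A = measure (mass F) A"

lemma mass_on: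
  assumes "F \<in> bergman"
  shows "ennreal (mass_on F A) = emeasure (mass F) A" "0 \<le> mass_on F A"
proof -
  have "emeasure (mass F) A < \<infinity>"
    by (rule le_less_trans[OF mass_le[OF assms]]) simp
  then show "ennreal (mass_on F A) = emeasure (mass F) A"
    unfolding mass_on_def by (simp add: emeasure_eq_ennreal_measure less_top[symmetric])
  show "0 \<le> mass_on F A" by (simp add: mass_on_def)
qed

text \<open>The sub-mean value inequality on the disc of radius \<rho>/4 around x, which stays
  inside the disc around z; hence the constant 4.\<close>

lemma local_bound:
  assumes F: "F \<in> bergman" and \<rho>: "0 < \<rho>" "cmod z + \<rho> < 1" and x: "cmod (x - z) \<le> \<rho> / 2"
  shows "cmod (F x) \<le> 4 / \<rho> * sqrt (mass_on F (ball z \<rho>))"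
proof -
  have sub: "ball x (\<rho> / 4) \<subseteq> ball z \<rho>"
  proof
    fix u assume "u \<in> ball x (\<rho> / 4)"
    then have "dist x u < \<rho> / 4" by simp
    moreover have "dist z u \<le> dist z x + dist x u" by (rule dist_triangle)
    moreover have "dist z x \<le> \<rho> / 2" using x by (simp add: dist_norm norm_minus_commute)
    ultimately have "dist z u < \<rho>" using \<rho>(1) by linarith
    then show "u \<in> ball z \<rho>" by simp
  qed
  have "cmod x \<le> cmod z + cmod (x - z)" by (rule norm_triangle_sub)
  then have x1: "cmod x + \<rho> / 4 < 1" using x \<rho> by linarith
  have "0 < \<rho> / 4" using \<rho>(1) by simp
  from bergman_local_eval[OF F this x1]
  have "ennreal ((cmod (F x))\<^sup>2 * (\<rho> / 4)\<^sup>2) \<le> (\<integral>\<^sup>+w. ennreal ((cmod (F w))\<^sup>2) * indicator (ball x (\<rho> / 4)) w \<partial>disk_area)" .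
  also have "\<dots> = emeasure (mass F) (ball x (\<rho> / 4))"
    by (rule mass_emeasure[OF F, symmetric]) simp
  also have "\<dots> \<le> emeasure (mass F) (ball z \<rho>)"
    by (rule emeasure_mono[OF sub]) simp
  also have "\<dots> = ennreal (mass_on F (ball z \<rho>))" by (rule mass_on(1)[OF F, symmetric])
  finally have "(cmod (F x))\<^sup>2 * (\<rho> / 4)\<^sup>2 \<le> mass_on F (ball z \<rho>)"
    using mass_on(2)[OF F] by (simp only: ennreal_le_iff)
  then have "(cmod (F x) * (\<rho> / 4))\<^sup>2 \<le> mass_on F (ball z \<rho>)" by (simp only: power_mult_distrib)
  then have "cmod (F x) * (\<rho> / 4) \<le> sqrt (mass_on F (ball z \<rho>))" by (rule real_le_rsqrt)
  then show ?thesis using \<rho>(1) by (simp add: field_simps)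
qed

text \<open>Normalised area, as an inequality because part of the disc may lie outside the unit
  disk.\<close>

lemma disk_area_ball_le:
  assumes "0 < t"
  shows "emeasure disk_area (ball z t) \<le> ennreal (t\<^sup>2)"
proof -
  let ?c = "measure lborel unit_disk"
  have "ennreal ?c * emeasure disk_area (ball z t) = ennreal ?c * (\<integral>\<^sup>+x. indicator (ball z t) x \<partial>disk_area)"
    by simp
  also have "\<dots> = (\<integral>\<^sup>+x. indicator (ball z t) x * indicator unit_disk x \<partial>lborel)"
    by (subst nn_integral_disk_area) simp_all
  also have "\<dots> \<le> (\<integral>\<^sup>+x. indicator (ball z t) x \<partial>lborel)"
    by (intro nn_integral_mono) (simp split: split_indicator)
  also have "\<dots> = ennreal ?c * ennreal (t\<^sup>2)"
    using assms by (simp add: emeasure_ball_scale ennreal_mult')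
  finally show ?thesis
    using emeasure_unit_disk(2) by (subst (asm) ennreal_mult_le_mult_iff) (auto simp: less_imp_le)
qed

section \<open>Estimates summed over a fibre\<close>

context evenly_covered
begin

abbreviation rad :: "complex \<Rightarrow> real" where "rad z \<equiv> c * (1 - cmod z)"

lemma rad:
  assumes "z \<in> fibre B l"
  shows "0 < rad z" "cmod z + rad z < 1"
proof -
  have z: "0 < 1 - cmod z" using fibre_disk(1)[OF assms] by simp
  then show "0 < rad z" using pos by simp
  have "rad z \<le> 1/4 * (1 - cmod z)" using pos z by (intro mult_right_mono) auto
  moreover have "x + a < 1" if "a \<le> 1/4 * (1 - x)" "0 < 1 - x" for x a :: real
    using that by (simp add: field_simps)
  ultimately show "cmod z + rad z < 1" using z by blast
qed

lemma mass_sum_le: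
  assumes F: "F \<in> bergman" and Y: "Y \<subseteq> fibre B l"
  shows "(\<integral>\<^sup>+z. ennreal (mass_on F (ball z (rad z))) \<partial>count_space Y) \<le> ennreal ((bergman_norm F)\<^sup>2)"
proof -
  have "(\<integral>\<^sup>+z. ennreal (mass_on F (ball z (rad z))) \<partial>count_space Y) = (\<integral>\<^sup>+z. emeasure (mass F) (ball z (rad z)) \<partial>count_space Y)"
    by (simp only: mass_on(1)[OF F])
  also have "\<dots> = emeasure (mass F) (\<Union>z\<in>Y. ball z (rad z))"
  proof (rule emeasure_UN_countable[symmetric])
    show "countable Y" using Y countable_fibre countable_subset by blast
    show "disjoint_family_on (\<lambda>z. ball z (rad z)) Y"
      unfolding disjoint_family_on_def using discs_disjoint Y by blast
  qed simp
  also have "\<dots> \<le> ennreal ((bergman_norm F)\<^sup>2)" by (rule mass_le[OF F])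
  finally show ?thesis .
qed

text \<open>This is the o(1/(1 - |w|)) statement. A point z with |F(z)| (1 - |z|) \<ge> e forces at
  least (e c/4)^2 of the mass of |F|^2 into its own disc; the discs are disjoint and the total mass
  is finite.\<close>

lemma finite_large_values:
  assumes F: "F \<in> bergman" and Y: "Y \<subseteq> fibre B l" and e: "0 < e"
    and large: "\<And>z. z \<in> Y \<Longrightarrow> e \<le> cmod (F z) * (1 - cmod z)"
  shows "finite Y"
proof (rule ccontr)
  assume inf: "infinite Y"
  define k where "k = (e * c / 4)\<^sup>2"
  have k: "0 < k" using e pos by (simp add: k_def)
  have "ennreal k \<le> ennreal (mass_on F (ball z (rad z)))" if z: "z \<in> Y" for z
  proof -
    have zf: "z \<in> fibre B l" using Y z by blast
    have "cmod (F z) \<le> 4 / rad z * sqrt (mass_on F (ball z (rad z)))"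
      using rad(1)[OF zf] by (intro local_bound[OF F rad[OF zf]]) simp
    then have "cmod (F z) * rad z \<le> 4 * sqrt (mass_on F (ball z (rad z)))"
      using rad(1)[OF zf] by (simp only: pos_le_divide_eq[symmetric]) (simp add: ac_simps)
    moreover have "e * c \<le> cmod (F z) * rad z"
      using mult_right_mono[OF large[OF z], of c] pos by (simp add: ac_simps)
    ultimately have "e * c / 4 \<le> sqrt (mass_on F (ball z (rad z)))" by linarith
    then have "k \<le> (sqrt (mass_on F (ball z (rad z))))\<^sup>2"
      unfolding k_def using e pos by (intro power_mono) auto
    then show ?thesis using mass_on(2)[OF F] by (intro ennreal_leI) simp
  qed
  then have "(\<integral>\<^sup>+z. ennreal k \<partial>count_space Y) \<le> (\<integral>\<^sup>+z. ennreal (mass_on F (ball z (rad z))) \<partial>count_space Y)"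
    by (intro nn_integral_mono) simp
  also have "\<dots> \<le> ennreal ((bergman_norm F)\<^sup>2)" by (rule mass_sum_le[OF F Y])
  finally have "ennreal k * emeasure (count_space Y) Y \<le> ennreal ((bergman_norm F)\<^sup>2)"
    by simp
  moreover have "ennreal k * emeasure (count_space Y) Y = \<infinity>"
    using inf k by (simp add: emeasure_count_space_infinite ennreal_mult_top)
  ultimately show False by (simp add: top_unique)
qed

lemma sheet_in_ball:
  assumes z: "z \<in> fibre B l" and s: "0 < s" "s \<le> r" and x: "x \<in> \<sigma> z ` ball l s"
  shows "cmod (x - z) < C * s / c * rad z" "x \<in> ball z (C * s / c * rad z)"
proof -
  obtain m where m: "m \<in> ball l s" "x = \<sigma> z m" using x by blast
  have mr: "m \<in> ball l r" using m s by simp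
  have z1: "0 < 1 - cmod z" using fibre_disk(1)[OF z] by simp
  have "cmod (x - z) \<le> C * cmod (m - l) * (1 - cmod z)" unfolding m(2) by (rule \<sigma>_near[OF z mr])
  also have "\<dots> < C * s * (1 - cmod z)"
    using m(1) pos z1 by (intro mult_strict_right_mono mult_strict_left_mono) (auto simp: dist_norm norm_minus_commute)
  also have "\<dots> = C * s / c * rad z" using pos by simp
  finally show "cmod (x - z) < C * s / c * rad z" .
  then show "x \<in> ball z (C * s / c * rad z)" by (simp add: dist_norm norm_minus_commute)
qed

text \<open>A zero of F at the centre makes F small of order q = C s/c on the sheet above the disc
  of radius s, by the Cauchy bound for F'. This power of s beyond the area removes the sheet in the
  limit.\<close>

lemma vanishing_sheet_bound:
  assumes F: "F \<in> bergman" and G: "G \<in> bergman" and z: "z \<in> fibre B l" and van: "F z = 0"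
    and s: "0 < s" "s \<le> r" "C * s / c \<le> 1 / 4" and x: "x \<in> \<sigma> z ` ball l s"
  shows "cmod (F x) * cmod (G x) \<le> 64 * (C * s / c) / (rad z)\<^sup>2 * (mass_on F (ball z (rad z)) + mass_on G (ball z (rad z)))"
proof -
  let ?\<rho> = "rad z" and ?q = "C * s / c"
  let ?a = "sqrt (mass_on F (ball z ?\<rho>))" and ?b = "sqrt (mass_on G (ball z ?\<rho>))"
  note \<rho> = rad[OF z]
  have q: "0 < ?q" using pos s by simp
  have xz: "cmod (x - z) < ?q * ?\<rho>" by (rule sheet_in_ball(1)[OF z s(1,2) x])
  also have "?q * ?\<rho> \<le> 1 / 4 * ?\<rho>" using s(3) \<rho>(1) by (intro mult_right_mono) auto
  finally have x4: "cmod (x - z) < 1 / 4 * ?\<rho>" .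
  have ab: "0 \<le> ?a" "0 \<le> ?b" using mass_on(2)[OF F] mass_on(2)[OF G] by auto
  have sub: "cball z (?\<rho> / 2) \<subseteq> unit_disk"
  proof
    fix u assume "u \<in> cball z (?\<rho> / 2)"
    then have "cmod (u - z) \<le> ?\<rho> / 2" by (simp add: dist_norm norm_minus_commute)
    then show "u \<in> unit_disk" using norm_triangle_sub[of u z] \<rho> by simp
  qed
  have "cmod (F x - F z) \<le> 2 * (4 / ?\<rho> * ?a) / (?\<rho> / 2) * cmod (x - z)"
  proof (rule lipschitz_of_bounded[OF bergmanD(1)[OF F] open_ball sub])
    show "0 < ?\<rho> / 2" using \<rho> by simp
    show "cmod (F u) \<le> 4 / ?\<rho> * ?a" if "u \<in> cball z (?\<rho> / 2)" for u
      by (rule local_bound[OF F \<rho>]) (use that in \<open>simp add: dist_norm norm_minus_commute\<close>)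
    show "cmod (x - z) \<le> ?\<rho> / 2 / 2" using x4 by linarith
  qed
  also have "\<dots> \<le> 2 * (4 / ?\<rho> * ?a) / (?\<rho> / 2) * (?q * ?\<rho>)"
    using xz ab \<rho>(1) by (intro mult_left_mono) auto
  finally have Fx: "cmod (F x) \<le> 2 * (4 / ?\<rho> * ?a) / (?\<rho> / 2) * (?q * ?\<rho>)" using van by simp
  have Gx: "cmod (G x) \<le> 4 / ?\<rho> * ?b"
    by (rule local_bound[OF G \<rho>]) (use x4 \<rho>(1) in linarith)
  have "cmod (F x) * cmod (G x) \<le> (2 * (4 / ?\<rho> * ?a) / (?\<rho> / 2) * (?q * ?\<rho>)) * (4 / ?\<rho> * ?b)"
  proof (rule mult_mono[OF Fx Gx])
    show "0 \<le> 2 * (4 / ?\<rho> * ?a) / (?\<rho> / 2) * (?q * ?\<rho>)"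
      using order_trans[OF norm_ge_zero Fx] .
  qed simp
  also have "\<dots> = 64 * ?q / ?\<rho>\<^sup>2 * (?a * ?b)"
  proof -
    have "(2 * (4 / t * u) / (t / 2) * (k * t)) * (4 / t * v) = 64 * k / t\<^sup>2 * (u * v)" if "0 < t" for t u v k :: real
      using that by (simp add: power2_eq_square field_simps)
    from this[OF \<rho>(1)] show ?thesis .
  qed
  also have "\<dots> \<le> 64 * ?q / ?\<rho>\<^sup>2 * (?a\<^sup>2 + ?b\<^sup>2)"
  proof (rule mult_left_mono)
    have "2 * ?a * ?b \<le> ?a\<^sup>2 + ?b\<^sup>2" by (rule sum_squares_bound)
    moreover have "0 \<le> ?a * ?b" using ab by simp
    ultimately show "?a * ?b \<le> ?a\<^sup>2 + ?b\<^sup>2" by linarith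
    show "0 \<le> 64 * ?q / ?\<rho>\<^sup>2"
      by (intro divide_nonneg_nonneg mult_nonneg_nonneg) (use pos s in simp_all)
  qed
  also have "?a\<^sup>2 + ?b\<^sup>2 = mass_on F (ball z ?\<rho>) + mass_on G (ball z ?\<rho>)"
    using mass_on(2)[OF F] mass_on(2)[OF G] by simp
  finally show ?thesis .
qed

lemma sheet_borel: "z \<in> fibre B l \<Longrightarrow> A \<subseteq> ball l r \<Longrightarrow> A \<in> sets borel \<Longrightarrow> \<sigma> z ` A \<in> sets borel"
  by (rule holomorphic_image_borel[OF open_ball \<sigma>_hol \<sigma>_inj])

text \<open>On each sheet the pointwise bound of order q/rad^2 times the area (q rad)^2 gives q^3
  times the local mass, and the local masses in disjoint discs add up to at most the squared norms.
  After division by s^2, all these sheets together contribute O(s).\<close>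

lemma sheets_remainder:
  assumes F: "F \<in> bergman" and G: "G \<in> bergman" and Y: "Y \<subseteq> fibre B l"
    and van: "\<And>z. z \<in> Y \<Longrightarrow> F z = 0 \<or> G z = 0"
    and s: "0 < s" "s \<le> r" "C * s / c \<le> 1 / 4"
  shows "(\<integral>\<^sup>+x. ennreal (cmod (F x) * cmod (G x)) * indicator (\<Union>z\<in>Y. \<sigma> z ` ball l s) x \<partial>disk_area)
     \<le> ennreal (64 * (C * s / c) ^ 3 * ((bergman_norm F)\<^sup>2 + (bergman_norm G)\<^sup>2))"
proof -
  let ?q = "C * s / c"
  have q: "0 < ?q" using pos s by simp
  have [measurable]: "F \<in> borel_measurable borel" "G \<in> borel_measurable borel"
    using bergman_measurable F G by auto
  have sr: "ball l s \<subseteq> ball l r" using s by (intro subset_ball)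
  have bor: "\<sigma> z ` ball l s \<in> sets borel" if "z \<in> Y" for z
    using sheet_borel[OF _ sr] that Y by auto
  have cY: "countable Y" using Y countable_fibre countable_subset by blast
  define \<nu> where "\<nu> = density disk_area (\<lambda>x. ennreal (cmod (F x) * cmod (G x)))"
  have \<nu>: "emeasure \<nu> A = (\<integral>\<^sup>+x. ennreal (cmod (F x) * cmod (G x)) * indicator A x \<partial>disk_area)" if "A \<in> sets borel" for A
    unfolding \<nu>_def using that by (subst emeasure_density) simp_all
  have each: "emeasure \<nu> (\<sigma> z ` ball l s) \<le> ennreal (64 * ?q ^ 3) * (ennreal (mass_on F (ball z (rad z))) + ennreal (mass_on G (ball z (rad z))))"
    if z: "z \<in> Y" for z
  proof -
    have zf: "z \<in> fibre B l" using z Y by blast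
    let ?mm = "mass_on F (ball z (rad z)) + mass_on G (ball z (rad z))"
    let ?k = "64 * ?q / (rad z)\<^sup>2 * ?mm"
    have mm: "0 \<le> ?mm" using mass_on(2)[OF F] mass_on(2)[OF G] by (simp add: add_nonneg_nonneg)
    have k0: "0 \<le> ?k"
      by (intro mult_nonneg_nonneg divide_nonneg_nonneg mm) (use pos s in simp_all)
    have bd: "cmod (F x) * cmod (G x) \<le> ?k" if x: "x \<in> \<sigma> z ` ball l s" for x
      using van[OF z]
    proof
      assume "F z = 0"
      then show ?thesis by (rule vanishing_sheet_bound[OF F G zf _ s x])
    next
      assume "G z = 0"
      from vanishing_sheet_bound[OF G F zf this s x] show ?thesis by (simp add: ac_simps)
    qed
    have "emeasure \<nu> (\<sigma> z ` ball l s) \<le> (\<integral>\<^sup>+x. ennreal ?k * indicator (ball z (?q * rad z)) x \<partial>disk_area)"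
      unfolding \<nu>[OF bor[OF z]]
    proof (rule nn_integral_mono)
      fix x
      show "ennreal (cmod (F x) * cmod (G x)) * indicator (\<sigma> z ` ball l s) x \<le> ennreal ?k * indicator (ball z (?q * rad z)) x"
      proof (cases "x \<in> \<sigma> z ` ball l s")
        case True
        then show ?thesis using sheet_in_ball(2)[OF zf s(1,2) True] bd[OF True] by (simp add: ennreal_leI)
      qed simp
    qed
    also have "\<dots> = ennreal ?k * emeasure disk_area (ball z (?q * rad z))"
      by (subst nn_integral_cmult) simp_all
    also have "\<dots> \<le> ennreal ?k * ennreal ((?q * rad z)\<^sup>2)"
      by (intro mult_left_mono disk_area_ball_le mult_pos_pos q rad(1)[OF zf]) simp
    also have "\<dots> = ennreal (?k * (?q * rad z)\<^sup>2)"
      using k0 by (simp only: ennreal_mult')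
    also have "?k * (?q * rad z)\<^sup>2 = 64 * ?q ^ 3 * ?mm"
    proof -
      have "64 * k / t\<^sup>2 * u * (k * t)\<^sup>2 = 64 * k ^ 3 * u" if "0 < t" for t u k :: real
        using that by (simp add: power2_eq_square power3_eq_cube field_simps)
      from this[OF rad(1)[OF zf]] show ?thesis .
    qed
    also have "ennreal (64 * ?q ^ 3 * ?mm) = ennreal (64 * ?q ^ 3) * (ennreal (mass_on F (ball z (rad z))) + ennreal (mass_on G (ball z (rad z))))"
      using mm mass_on(2)[OF F] mass_on(2)[OF G] q by (subst ennreal_mult) auto
    finally show ?thesis .
  qed
  have "(\<integral>\<^sup>+x. ennreal (cmod (F x) * cmod (G x)) * indicator (\<Union>z\<in>Y. \<sigma> z ` ball l s) x \<partial>disk_area)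
      = emeasure \<nu> (\<Union>z\<in>Y. \<sigma> z ` ball l s)"
    by (rule \<nu>[symmetric]) (use bor cY in \<open>auto intro: sets.countable_UN''\<close>)
  also have "\<dots> = (\<integral>\<^sup>+z. emeasure \<nu> (\<sigma> z ` ball l s) \<partial>count_space Y)"
  proof (rule emeasure_UN_countable)
    show "\<sigma> z ` ball l s \<in> sets \<nu>" if "z \<in> Y" for z using bor[OF that] by (simp add: \<nu>_def)
    show "disjoint_family_on (\<lambda>z. \<sigma> z ` ball l s) Y"
      by (rule disjoint_family_on_mono[OF Y sheets_disjoint[OF sr]])
  qed (rule cY)
  also have "\<dots> \<le> (\<integral>\<^sup>+z. ennreal (64 * ?q ^ 3) * (ennreal (mass_on F (ball z (rad z))) + ennreal (mass_on G (ball z (rad z)))) \<partial>count_space Y)"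
    by (rule nn_integral_mono) (use each in simp)
  also have "\<dots> = ennreal (64 * ?q ^ 3) * ((\<integral>\<^sup>+z. ennreal (mass_on F (ball z (rad z))) \<partial>count_space Y) + (\<integral>\<^sup>+z. ennreal (mass_on G (ball z (rad z))) \<partial>count_space Y))"
    by (simp add: nn_integral_cmult nn_integral_add)
  also have "\<dots> \<le> ennreal (64 * ?q ^ 3) * (ennreal ((bergman_norm F)\<^sup>2) + ennreal ((bergman_norm G)\<^sup>2))"
    by (intro mult_left_mono add_mono mass_sum_le F G Y) simp
  also have "\<dots> = ennreal (64 * ?q ^ 3 * ((bergman_norm F)\<^sup>2 + (bergman_norm G)\<^sup>2))"
    using q by (simp add: ennreal_mult)
  finally show ?thesis .
qed

end

text \<open>The mass of the unscaled profile 1 - |u|^2. It appears as a positive factor on both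
  sides of the fibre identity and cancels.\<close>

definition bump_mass :: real where
  "bump_mass = (LINT u|lborel. indicator unit_disk u *\<^sub>R (1 - (cmod u)\<^sup>2))"

lemma bump_integrable: "integrable lborel (\<lambda>u::complex. indicator unit_disk u *\<^sub>R (1 - (cmod u)\<^sup>2))"
proof (rule Bochner_Integration.integrable_bound)
  have "emeasure lborel unit_disk < \<infinity>" using emeasure_unit_disk(1) by simp
  then show "integrable lborel (indicator unit_disk :: complex \<Rightarrow> real)" by simp
  show "(\<lambda>u::complex. indicator unit_disk u *\<^sub>R (1 - (cmod u)\<^sup>2)) \<in> borel_measurable lborel"
    by measurable
  show "AE u in lborel. norm (indicator unit_disk u *\<^sub>R (1 - (cmod u)\<^sup>2)) \<le> norm (indicator unit_disk u :: real)"
    by (intro AE_I2) (auto split: split_indicator simp: abs_square_le_1 abs_le_iff)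
qed

lemma bump_mass_pos: "0 < bump_mass"
proof -
  have "emeasure lborel (ball (0::complex) (1/2)) = ennreal (measure lborel unit_disk * (1/2)\<^sup>2)"
    by (rule emeasure_ball_scale) simp
  then have e: "emeasure lborel (ball (0::complex) (1/2)) < \<infinity>" "0 < measure lborel (ball (0::complex) (1/2))"
    using emeasure_unit_disk(2) by (auto simp: measure_def)
  have "0 < (3/4) * measure lborel (ball (0::complex) (1/2))" using e by simp
  also have "\<dots> = (LINT u|lborel. (3/4) * indicator (ball (0::complex) (1/2)) u)" by simp
  also have "\<dots> \<le> bump_mass"
    unfolding bump_mass_def
  proof (rule integral_mono[OF _ bump_integrable])
    show "integrable lborel (\<lambda>u. (3/4) * indicator (ball (0::complex) (1/2)) u :: real)" using e(1) by simp
    fix u :: complex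
    have "3/4 \<le> 1 - (cmod u)\<^sup>2" if "cmod u < 1/2"
    proof -
      have "(cmod u)\<^sup>2 \<le> (1/2)\<^sup>2" using that by (intro power_mono) auto
      then show ?thesis by (simp add: power2_eq_square)
    qed
    then show "(3/4) * indicator (ball (0::complex) (1/2)) u \<le> indicator unit_disk u *\<^sub>R (1 - (cmod u)\<^sup>2)"
      by (auto split: split_indicator simp: abs_square_le_1)
  qed
  finally show ?thesis .
qed

section \<open>Radial weights shrinking to a regular value\<close>

context asymptotic_isometry
begin

text \<open>A continuous function of |B - l|^2, as polynomial approximation requires, that vanishes
  unless |B - l| < s and so sees only thin sheets around the fibre.\<close>

definition weight :: "complex \<Rightarrow> real \<Rightarrow> complex \<Rightarrow> real" where
  "weight l s x = max 0 (1 - (cmod (B x - l))\<^sup>2 / s\<^sup>2)"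

lemma weight_bounds: "0 \<le> weight l s x" "weight l s x \<le> 1"
  by (auto simp: weight_def)

lemma weight_zero: "0 < s \<Longrightarrow> s \<le> cmod (B x - l) \<Longrightarrow> weight l s x = 0"
proof -
  assume s: "0 < s" "s \<le> cmod (B x - l)"
  then have "s\<^sup>2 \<le> (cmod (B x - l))\<^sup>2" by (intro power_mono) auto
  then have "1 \<le> (cmod (B x - l))\<^sup>2 / s\<^sup>2" using s(1) by simp
  then show ?thesis by (simp add: weight_def)
qed

text \<open>The values of \<open>k\<close> off the disk are irrelevant because the Bergman functions
  vanish there.\<close>

lemma disk_product_measurable:
  assumes "continuous_on unit_disk (k :: complex \<Rightarrow> complex)" "F \<in> bergman" "G \<in> bergman"
  shows "(\<lambda>x. k x * (F x * cnj (G x))) \<in> borel_measurable borel"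
proof -
  have "continuous_on unit_disk F" "continuous_on unit_disk G"
    using bergmanD(1) assms(2,3) holomorphic_on_imp_continuous_on by blast+
  then have "continuous_on unit_disk (\<lambda>x. k x * (F x * cnj (G x)))"
    by (intro continuous_intros assms(1))
  then have "(\<lambda>x. indicator unit_disk x *\<^sub>R (k x * (F x * cnj (G x)))) \<in> borel_measurable borel"
    by (intro borel_measurable_indicator_continuous[of unit_disk]) auto
  moreover have "(\<lambda>x. indicator unit_disk x *\<^sub>R (k x * (F x * cnj (G x)))) = (\<lambda>x. k x * (F x * cnj (G x)))"
  proof
    fix x show "indicator unit_disk x *\<^sub>R (k x * (F x * cnj (G x))) = k x * (F x * cnj (G x))"
      using bergmanD(2)[OF assms(2), of x] by (cases "x \<in> unit_disk") simp_all
  qed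
  ultimately show ?thesis by (simp only:)
qed

lemma B_continuous: "continuous_on unit_disk B"
  by (rule holomorphic_on_imp_continuous_on[OF hol])

lemma weight_continuous: "0 < s \<Longrightarrow> continuous_on unit_disk (\<lambda>x. complex_of_real (weight l s x))"
  unfolding weight_def by (intro continuous_intros B_continuous) simp

lemma weighted_integrable:
  assumes "F \<in> bergman" "G \<in> bergman" "0 < s"
  shows "integrable disk_area (\<lambda>x. of_real (weight l s x) * (F x * cnj (G x)))"
proof (rule Bochner_Integration.integrable_bound[OF bergman_integrable[OF assms(1,2)]])
  show "(\<lambda>x. of_real (weight l s x) * (F x * cnj (G x))) \<in> borel_measurable disk_area"
    using disk_product_measurable[OF weight_continuous[OF assms(3)] assms(1,2)]
    by (simp only: measurable_cong_sets[OF sets_disk_area refl])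
  show "AE x in disk_area. norm (of_real (weight l s x) * (F x * cnj (G x))) \<le> norm (F x * cnj (G x))"
  proof (rule AE_I2)
    fix x
    have "\<bar>weight l s x\<bar> * norm (F x * cnj (G x)) \<le> 1 * norm (F x * cnj (G x))"
      using weight_bounds[of l s x] by (intro mult_right_mono) auto
    then show "norm (of_real (weight l s x) * (F x * cnj (G x))) \<le> norm (F x * cnj (G x))"
      by (simp only: norm_mult norm_of_real mult_1)
  qed
qed

end

context evenly_covered
begin

text \<open>Substitution x = \<sigma> z (l + s u): the weight becomes the fixed profile 1 - |u|^2,
  and the Jacobian is s^2 |\<sigma>'|^2.\<close>

lemma sheet_integral:
  assumes F: "F \<in> bergman" and G: "G \<in> bergman" and z: "z \<in> fibre B l" and s: "0 < s" "s < r"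
  shows "(LINT x|disk_area. indicator (\<sigma> z ` ball l s) x *\<^sub>R (of_real (weight l s x) * (F x * cnj (G x))))
    = (s\<^sup>2 / measure lborel unit_disk) *\<^sub>R (LINT u|lborel. indicator unit_disk u *\<^sub>R
        (of_real (1 - (cmod u)\<^sup>2) * (F (\<sigma> z (l + of_real s * u)) * cnj (G (\<sigma> z (l + of_real s * u))) * of_real ((cmod (deriv (\<sigma> z) (l + of_real s * u)))\<^sup>2))))"
proof -
  define \<tau> where "\<tau> = (\<lambda>u. \<sigma> z (l + of_real s * u))"
  define q where "q = (\<lambda>x. of_real (weight l s x) * (F x * cnj (G x)))"
  have q[measurable]: "q \<in> borel_measurable borel"
    unfolding q_def by (rule disk_product_measurable[OF weight_continuous[OF s(1)] F G])
  have aff: "(\<lambda>u. l + of_real s * u) ` ball 0 1 = ball l s"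
  proof (intro equalityI subsetI)
    fix m assume "m \<in> (\<lambda>u. l + of_real s * u) ` ball 0 1"
    then obtain u where "cmod u < 1" "m = l + of_real s * u" by auto
    then show "m \<in> ball l s" using s(1) by (simp add: dist_norm norm_mult)
  next
    fix m assume "m \<in> ball l s"
    then have "cmod ((m - l) / of_real s) < 1" using s(1) by (simp add: norm_divide dist_norm norm_minus_commute)
    moreover have "m = l + of_real s * ((m - l) / of_real s)" using s(1) by simp
    ultimately show "m \<in> (\<lambda>u. l + of_real s * u) ` ball 0 1" by (intro image_eqI[of _ _ "(m - l) / of_real s"]) auto
  qed
  have mr: "l + of_real s * u \<in> ball l r" if "u \<in> unit_disk" for u
  proof -
    have "l + of_real s * u \<in> ball l s" using aff that by blast
    then show ?thesis using s by simp
  qed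
  have im: "\<tau> ` unit_disk = \<sigma> z ` ball l s"
    unfolding \<tau>_def aff[symmetric] image_image ..
  have hol\<tau>: "\<tau> holomorphic_on unit_disk"
  proof -
    have "\<sigma> z \<circ> (\<lambda>u. l + of_real s * u) holomorphic_on unit_disk"
    proof (rule holomorphic_on_compose_gen[OF _ \<sigma>_hol[OF z]])
      show "(\<lambda>u. l + of_real s * u) holomorphic_on unit_disk" by (intro holomorphic_intros)
      show "(\<lambda>u. l + of_real s * u) ` unit_disk \<subseteq> ball l r" using mr by blast
    qed
    then show ?thesis by (simp only: \<tau>_def o_def)
  qed
  have inj\<tau>: "inj_on \<tau> unit_disk"
  proof (rule inj_onI)
    fix u v assume uv: "u \<in> unit_disk" "v \<in> unit_disk" "\<tau> u = \<tau> v"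
    then have "l + of_real s * u = l + of_real s * v"
      using inj_onD[OF \<sigma>_inj[OF z] _ mr mr] by (simp only: \<tau>_def)
    then show "u = v" using s(1) by simp
  qed
  have in_disk: "\<tau> u \<in> unit_disk" "B (\<tau> u) = l + of_real s * u" if "u \<in> unit_disk" for u
    using \<sigma>_section[OF z mr[OF that]] by (auto simp: \<tau>_def)
  have bd: "bounded (\<tau> ` unit_disk)"
    using in_disk(1) by (intro bounded_subset[OF bounded_ball[of 0 1]]) blast
  have d\<tau>: "deriv \<tau> u = of_real s * deriv (\<sigma> z) (l + of_real s * u)" if "u \<in> unit_disk" for u
  proof -
    have "(\<sigma> z has_field_derivative deriv (\<sigma> z) (l + of_real s * u)) (at (l + of_real s * u))"
      using holomorphic_derivI[OF \<sigma>_hol[OF z] open_ball mr[OF that]] .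
    moreover have "((\<lambda>u. l + of_real s * u) has_field_derivative of_real s) (at u)"
      by (auto intro!: derivative_eq_intros)
    ultimately have "(\<tau> has_field_derivative deriv (\<sigma> z) (l + of_real s * u) * of_real s) (at u)"
      unfolding \<tau>_def by (rule DERIV_chain2)
    from DERIV_imp_deriv[OF this] show ?thesis by (simp only: mult.commute)
  qed
  have bor: "\<sigma> z ` ball l s \<in> sets borel"
    using s by (intro sheet_borel[OF z] subset_ball) auto
  have sub: "\<sigma> z ` ball l s \<subseteq> unit_disk" unfolding im[symmetric] using in_disk(1) by blast
  have "(LINT x|disk_area. indicator (\<sigma> z ` ball l s) x *\<^sub>R q x)
      = (1 / measure lborel unit_disk) *\<^sub>R (LINT x:unit_disk|lborel. indicator (\<sigma> z ` ball l s) x *\<^sub>R q x)"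
    using bor by (intro integral_disk_area(2)) simp
  also have "(LINT x:unit_disk|lborel. indicator (\<sigma> z ` ball l s) x *\<^sub>R q x) = (LINT x:\<tau> ` unit_disk|lborel. q x)"
    unfolding set_lebesgue_integral_def im
    by (intro Bochner_Integration.integral_cong refl) (use sub in \<open>auto split: split_indicator\<close>)
  also have "\<dots> = (LINT u:unit_disk|lborel. q (\<tau> u) * of_real ((cmod (deriv \<tau> u))\<^sup>2))"
    by (rule integral_holomorphic_image(2)[OF open_ball hol\<tau> inj\<tau> bd order_refl _ q]) simp
  also have "\<dots> = (LINT u|lborel. s\<^sup>2 *\<^sub>R (indicator unit_disk u *\<^sub>R
        (of_real (1 - (cmod u)\<^sup>2) * (F (\<tau> u) * cnj (G (\<tau> u)) * of_real ((cmod (deriv (\<sigma> z) (l + of_real s * u)))\<^sup>2)))))"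
    unfolding set_lebesgue_integral_def
  proof (intro Bochner_Integration.integral_cong refl)
    fix u
    show "indicator unit_disk u *\<^sub>R (q (\<tau> u) * of_real ((cmod (deriv \<tau> u))\<^sup>2)) = s\<^sup>2 *\<^sub>R (indicator unit_disk u *\<^sub>R
        (of_real (1 - (cmod u)\<^sup>2) * (F (\<tau> u) * cnj (G (\<tau> u)) * of_real ((cmod (deriv (\<sigma> z) (l + of_real s * u)))\<^sup>2))))"
    proof (cases "u \<in> unit_disk")
      case True
      have "(cmod (B (\<tau> u) - l))\<^sup>2 = s\<^sup>2 * (cmod u)\<^sup>2"
        unfolding in_disk(2)[OF True] by (simp add: norm_mult power_mult_distrib)
      then have w: "weight l s (\<tau> u) = 1 - (cmod u)\<^sup>2"
        using s(1) True by (simp add: weight_def abs_square_le_1)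
      have d: "(cmod (deriv \<tau> u))\<^sup>2 = s\<^sup>2 * (cmod (deriv (\<sigma> z) (l + of_real s * u)))\<^sup>2"
        unfolding d\<tau>[OF True] by (simp add: norm_mult power_mult_distrib)
      show ?thesis
        using True by (simp add: q_def w d scaleR_conv_of_real)
    qed simp
  qed
  also have "\<dots> = s\<^sup>2 *\<^sub>R (LINT u|lborel. indicator unit_disk u *\<^sub>R
        (of_real (1 - (cmod u)\<^sup>2) * (F (\<tau> u) * cnj (G (\<tau> u)) * of_real ((cmod (deriv (\<sigma> z) (l + of_real s * u)))\<^sup>2))))"
    by (rule integral_scaleR_right)
  finally show ?thesis
    unfolding q_def \<tau>_def by simp
qed

text \<open>After rescaling, the integrand converges pointwise to its value at l. It is dominated
  because l + s u stays in the compact disc of radius r/2.\<close>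

lemma sheet_integral_limit:
  assumes F: "F \<in> bergman" and G: "G \<in> bergman" and z: "z \<in> fibre B l"
    and s: "\<And>n. 0 < s n" "\<And>n. s n \<le> r / 2" "s \<longlonglongrightarrow> 0"
  shows "(\<lambda>n. (1 / (s n)\<^sup>2) *\<^sub>R (LINT x|disk_area. indicator (\<sigma> z ` ball l (s n)) x *\<^sub>R (of_real (weight l (s n) x) * (F x * cnj (G x)))))
    \<longlonglongrightarrow> of_real (bump_mass / measure lborel unit_disk) * (F z * cnj (G z) * of_real ((cmod (deriv (\<sigma> z) l))\<^sup>2))"
proof -
  define \<Phi> where "\<Phi> = (\<lambda>m. F (\<sigma> z m) * cnj (G (\<sigma> z m)) * of_real ((cmod (deriv (\<sigma> z) m))\<^sup>2))"
  have cont: "continuous_on (ball l r) \<Phi>"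
  proof -
    have "continuous_on (ball l r) (\<sigma> z)" by (rule holomorphic_on_imp_continuous_on[OF \<sigma>_hol[OF z]])
    moreover have "\<sigma> z ` ball l r \<subseteq> unit_disk" using \<sigma>_section[OF z] by blast
    ultimately have "continuous_on (ball l r) (\<lambda>m. F (\<sigma> z m))" "continuous_on (ball l r) (\<lambda>m. G (\<sigma> z m))"
      using continuous_on_compose2 holomorphic_on_imp_continuous_on[OF bergmanD(1)[OF F]]
        holomorphic_on_imp_continuous_on[OF bergmanD(1)[OF G]] by blast+
    moreover have "continuous_on (ball l r) (deriv (\<sigma> z))"
      by (rule holomorphic_on_imp_continuous_on[OF holomorphic_deriv[OF \<sigma>_hol[OF z] open_ball]])
    ultimately show ?thesis unfolding \<Phi>_def by (intro continuous_intros)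
  qed
  have csub: "cball l (r / 2) \<subseteq> ball l r" using pos by auto
  have "compact (\<Phi> ` cball l (r / 2))"
    by (intro compact_continuous_image continuous_on_subset[OF cont csub]) simp
  then obtain M where M: "\<And>m. m \<in> cball l (r / 2) \<Longrightarrow> norm (\<Phi> m) \<le> M"
    using compact_imp_bounded bounded_iff by (metis imageI)
  have M0: "0 \<le> M" using order_trans[OF norm_ge_zero M[of l]] pos by simp
  have mem: "l + of_real (s n) * u \<in> cball l (r / 2)" if "u \<in> unit_disk" for n u
  proof -
    have "s n * cmod u \<le> r / 2 * 1" using s(1)[of n] s(2)[of n] that by (intro mult_mono) auto
    then show ?thesis using s(1)[of n] by (simp add: dist_norm norm_mult)
  qed
  let ?g = "\<lambda>n u. indicator unit_disk u *\<^sub>R (of_real (1 - (cmod u)\<^sup>2) * \<Phi> (l + of_real (s n) * u))"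
  let ?h = "\<lambda>u. indicator unit_disk u *\<^sub>R (of_real (1 - (cmod u)\<^sup>2) * \<Phi> l)"
  have lim: "(\<lambda>n. LINT u|lborel. ?g n u) \<longlonglongrightarrow> (LINT u|lborel. ?h u)"
  proof (rule integral_dominated_convergence[where w = "\<lambda>u. M * indicator unit_disk u"])
    show "?h \<in> borel_measurable lborel" by measurable
    show "?g n \<in> borel_measurable lborel" for n
    proof -
      have "continuous_on unit_disk (\<lambda>u. of_real (1 - (cmod u)\<^sup>2) * \<Phi> (l + of_real (s n) * u))"
        using mem csub by (intro continuous_intros continuous_on_compose2[OF cont]) blast
      then show ?thesis
        using borel_measurable_indicator_continuous[of unit_disk _ unit_disk] by simp
    qed
    have "emeasure lborel unit_disk < \<infinity>" using emeasure_unit_disk(1) by simp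
    then show "integrable lborel (\<lambda>u. M * indicator unit_disk u :: real)" by simp
    show "AE u in lborel. (\<lambda>n. ?g n u) \<longlonglongrightarrow> ?h u"
    proof (rule AE_I2)
      fix u
      have "(\<lambda>n. l + of_real (s n) * u) \<longlonglongrightarrow> l + of_real 0 * u"
        by (intro tendsto_intros s(3))
      then have a: "(\<lambda>n. l + of_real (s n) * u) \<longlonglongrightarrow> l" by simp
      have "isCont \<Phi> l" using cont center_in by (simp add: continuous_on_eq_continuous_at)
      from isCont_tendsto_compose[OF this a]
      show "(\<lambda>n. ?g n u) \<longlonglongrightarrow> ?h u" by (intro tendsto_intros)
    qed
    show "AE u in lborel. norm (?g n u) \<le> M * indicator unit_disk u" for n
    proof (rule AE_I2)
      fix u
      show "norm (?g n u) \<le> M * indicator unit_disk u"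
      proof (cases "u \<in> unit_disk")
        case True
        have "\<bar>1 - (cmod u)\<^sup>2\<bar> * norm (\<Phi> (l + of_real (s n) * u)) \<le> 1 * M"
          using True M[OF mem[OF True]] by (intro mult_mono) (auto simp: abs_square_le_1 abs_le_iff)
        then show ?thesis using True by (simp add: norm_mult del: of_real_diff)
      qed simp
    qed
  qed
  have hI: "(LINT u|lborel. ?h u) = of_real bump_mass * \<Phi> l"
  proof -
    have "?h u = of_real (indicator unit_disk u *\<^sub>R (1 - (cmod u)\<^sup>2)) * \<Phi> l" for u
      by (simp add: scaleR_conv_of_real)
    then have "(LINT u|lborel. ?h u) = (LINT u|lborel. of_real (indicator unit_disk u *\<^sub>R (1 - (cmod u)\<^sup>2)) * \<Phi> l)"
      by presburger
    also have "\<dots> = (LINT u|lborel. complex_of_real (indicator unit_disk u *\<^sub>R (1 - (cmod u)\<^sup>2))) * \<Phi> l"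
      by (rule integral_mult_left_zero)
    also have "(LINT u|lborel. complex_of_real (indicator unit_disk u *\<^sub>R (1 - (cmod u)\<^sup>2))) = of_real bump_mass"
      unfolding bump_mass_def by (rule integral_complex_of_real)
    finally show ?thesis .
  qed
  have eq: "(1 / (s n)\<^sup>2) *\<^sub>R (LINT x|disk_area. indicator (\<sigma> z ` ball l (s n)) x *\<^sub>R (of_real (weight l (s n) x) * (F x * cnj (G x))))
      = (1 / measure lborel unit_disk) *\<^sub>R (LINT u|lborel. ?g n u)" for n
  proof -
    have "s n < r" using s(2)[of n] pos(1) by linarith
    from sheet_integral[OF F G z s(1) this]
    have "(LINT x|disk_area. indicator (\<sigma> z ` ball l (s n)) x *\<^sub>R (of_real (weight l (s n) x) * (F x * cnj (G x))))
      = ((s n)\<^sup>2 / measure lborel unit_disk) *\<^sub>R (LINT u|lborel. ?g n u)"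
      unfolding \<Phi>_def .
    then show ?thesis using s(1)[of n] by simp
  qed
  have "(\<lambda>n. (1 / measure lborel unit_disk) *\<^sub>R (LINT u|lborel. ?g n u)) \<longlonglongrightarrow> (1 / measure lborel unit_disk) *\<^sub>R (of_real bump_mass * \<Phi> l)"
    using lim unfolding hI by (intro tendsto_intros)
  moreover have "(1 / measure lborel unit_disk) *\<^sub>R (of_real bump_mass * \<Phi> l) = of_real (bump_mass / measure lborel unit_disk) * \<Phi> l"
    by (simp add: scaleR_conv_of_real)
  ultimately show ?thesis
    unfolding eq \<Phi>_def \<sigma>_center[OF z] by (simp only:)
qed

text \<open>The sheet through z contributes at order s^2 and gives the limit. On every other sheet F
  or G vanishes at the centre, so together they contribute only O(s^3).\<close>

lemma weighted_limit:
  assumes F: "F \<in> bergman" and G: "G \<in> bergman" and z: "z \<in> fibre B l"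
    and van: "\<And>x. x \<in> fibre B l \<Longrightarrow> x \<noteq> z \<Longrightarrow> F x = 0 \<or> G x = 0"
    and s: "\<And>n. 0 < s n" "\<And>n. s n \<le> r / 2" "\<And>n. C * s n / c \<le> 1 / 4" "s \<longlonglongrightarrow> 0"
  shows "(\<lambda>n. (1 / (s n)\<^sup>2) *\<^sub>R (LINT x|disk_area. of_real (weight l (s n) x) * (F x * cnj (G x))))
    \<longlonglongrightarrow> of_real (bump_mass / measure lborel unit_disk) * (F z * cnj (G z) * of_real ((cmod (deriv (\<sigma> z) l))\<^sup>2))"
proof -
  define Y where "Y = fibre B l - {z}"
  define K where "K = 64 * (C / c) ^ 3 * ((bergman_norm F)\<^sup>2 + (bergman_norm G)\<^sup>2)"
  define N where "N = (\<lambda>n. \<sigma> z ` ball l (s n))"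
  define R where "R = (\<lambda>n. \<Union>y\<in>Y. \<sigma> y ` ball l (s n))"
  define q where "q = (\<lambda>n x. of_real (weight l (s n) x) * (F x * cnj (G x)))"
  have sr: "s n < r" "ball l (s n) \<subseteq> ball l r" for n
    using s(2)[of n] pos(1) by auto
  have NB: "N n \<in> sets borel" for n unfolding N_def by (rule sheet_borel[OF z sr(2)]) simp
  have RB: "R n \<in> sets borel" for n
    unfolding R_def
  proof (rule sets.countable_UN'')
    show "countable Y" unfolding Y_def using countable_fibre by blast
    show "\<sigma> y ` ball l (s n) \<in> sets borel" if "y \<in> Y" for y
      using that by (intro sheet_borel sr(2)) (auto simp: Y_def)
  qed
  have qi: "integrable disk_area (q n)" for n
    unfolding q_def by (rule weighted_integrable[OF F G s(1)])
  \<comment> \<open>Where the weighted integrand is nonzero, x lies on exactly one sheet over the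
    small disc.\<close>
  have split: "q n x = indicator (N n) x *\<^sub>R q n x + indicator (R n) x *\<^sub>R q n x" for n x
  proof (cases "x \<in> unit_disk \<and> B x \<in> ball l (s n)")
    case True
    then have "x \<in> (\<Union>y\<in>fibre B l. \<sigma> y ` ball l (s n))" using preimage_eq[OF sr(2)] by blast
    then have "x \<in> N n \<or> x \<in> R n" unfolding N_def R_def Y_def by blast
    moreover have "\<not> (x \<in> N n \<and> x \<in> R n)"
    proof
      assume a: "x \<in> N n \<and> x \<in> R n"
      then obtain y where y: "y \<in> fibre B l" "y \<noteq> z" "x \<in> \<sigma> y ` ball l (s n)" unfolding R_def Y_def by blast
      then have "x \<in> \<sigma> y ` ball l (s n) \<inter> \<sigma> z ` ball l (s n)" using a unfolding N_def by blast
      then show False using sheets_disjoint[OF sr(2)] y z unfolding disjoint_family_on_def by blast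
    qed
    ultimately show ?thesis by (auto split: split_indicator)
  next
    case False
    have "q n x = 0"
    proof (cases "x \<in> unit_disk")
      case True
      then have "s n \<le> cmod (B x - l)" using False by (simp add: dist_norm norm_minus_commute)
      then show ?thesis unfolding q_def using weight_zero[OF s(1)] by simp
    next
      case False
      then show ?thesis unfolding q_def using bergmanD(2)[OF F] by simp
    qed
    then show ?thesis by simp
  qed
  have iN: "integrable disk_area (\<lambda>x. indicator (N n) x *\<^sub>R q n x)" for n
    using NB qi by (intro integrable_mult_indicator) auto
  have iR: "integrable disk_area (\<lambda>x. indicator (R n) x *\<^sub>R q n x)" for n
    using RB qi by (intro integrable_mult_indicator) auto
  have sum: "(LINT x|disk_area. q n x) = (LINT x|disk_area. indicator (N n) x *\<^sub>R q n x) + (LINT x|disk_area. indicator (R n) x *\<^sub>R q n x)" for n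
  proof -
    have "(LINT x|disk_area. q n x) = (LINT x|disk_area. indicator (N n) x *\<^sub>R q n x + indicator (R n) x *\<^sub>R q n x)"
      using split by (rule Bochner_Integration.integral_cong[OF refl])
    also have "\<dots> = (LINT x|disk_area. indicator (N n) x *\<^sub>R q n x) + (LINT x|disk_area. indicator (R n) x *\<^sub>R q n x)"
      by (rule Bochner_Integration.integral_add[OF iN iR])
    finally show ?thesis .
  qed
  have rest: "norm (LINT x|disk_area. indicator (R n) x *\<^sub>R q n x) \<le> K * s n ^ 3" for n
  proof -
    have "ennreal (norm (LINT x|disk_area. indicator (R n) x *\<^sub>R q n x)) \<le> (\<integral>\<^sup>+x. ennreal (norm (indicator (R n) x *\<^sub>R q n x)) \<partial>disk_area)"
      by (rule integral_norm_bound_ennreal[OF iR])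
    also have "\<dots> \<le> (\<integral>\<^sup>+x. ennreal (cmod (F x) * cmod (G x)) * indicator (R n) x \<partial>disk_area)"
    proof (rule nn_integral_mono)
      fix x
      have "weight l (s n) x * (cmod (F x) * cmod (G x)) \<le> 1 * (cmod (F x) * cmod (G x))"
        using weight_bounds[of l "s n" x] by (intro mult_right_mono) auto
      then have "norm (q n x) \<le> cmod (F x) * cmod (G x)"
        unfolding q_def norm_mult norm_of_real complex_mod_cnj using weight_bounds(1)[of l "s n" x] by simp
      then show "ennreal (norm (indicator (R n) x *\<^sub>R q n x)) \<le> ennreal (cmod (F x) * cmod (G x)) * indicator (R n) x"
        by (cases "x \<in> R n") (simp_all add: ennreal_leI)
    qed
    also have "\<dots> \<le> ennreal (64 * (C * s n / c) ^ 3 * ((bergman_norm F)\<^sup>2 + (bergman_norm G)\<^sup>2))"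
      unfolding R_def
      by (rule sheets_remainder[OF F G _ _ s(1) less_imp_le[OF sr(1)] s(3)]) (use van in \<open>auto simp: Y_def\<close>)
    also have "64 * (C * s n / c) ^ 3 * ((bergman_norm F)\<^sup>2 + (bergman_norm G)\<^sup>2) = K * s n ^ 3"
      by (simp add: K_def power_mult_distrib power_divide)
    finally show ?thesis
      using s(1)[of n] pos by (subst (asm) ennreal_le_iff) (auto simp: K_def)
  qed
  have restlim: "(\<lambda>n. (1 / (s n)\<^sup>2) *\<^sub>R (LINT x|disk_area. indicator (R n) x *\<^sub>R q n x)) \<longlonglongrightarrow> 0"
  proof (rule Lim_null_comparison[where g = "\<lambda>n. K * s n"])
    show "(\<lambda>n. K * s n) \<longlonglongrightarrow> 0" using tendsto_mult_right_zero[OF s(4)] .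
    have "norm ((1 / (s n)\<^sup>2) *\<^sub>R (LINT x|disk_area. indicator (R n) x *\<^sub>R q n x)) \<le> K * s n" for n
    proof -
      have "norm ((1 / (s n)\<^sup>2) *\<^sub>R (LINT x|disk_area. indicator (R n) x *\<^sub>R q n x)) = (1 / (s n)\<^sup>2) * norm (LINT x|disk_area. indicator (R n) x *\<^sub>R q n x)"
        by simp
      also have "\<dots> \<le> (1 / (s n)\<^sup>2) * (K * s n ^ 3)" by (rule mult_left_mono[OF rest]) simp
      also have "\<dots> = K * s n" using s(1)[of n] by (simp add: power2_eq_square power3_eq_cube)
      finally show ?thesis .
    qed
    then show "\<forall>\<^sub>F n in sequentially. norm ((1 / (s n)\<^sup>2) *\<^sub>R (LINT x|disk_area. indicator (R n) x *\<^sub>R q n x)) \<le> K * s n"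
      by (rule always_eventually[OF allI])
  qed
  have main: "(\<lambda>n. (1 / (s n)\<^sup>2) *\<^sub>R (LINT x|disk_area. indicator (N n) x *\<^sub>R q n x))
    \<longlonglongrightarrow> of_real (bump_mass / measure lborel unit_disk) * (F z * cnj (G z) * of_real ((cmod (deriv (\<sigma> z) l))\<^sup>2))"
    unfolding N_def q_def by (rule sheet_integral_limit[OF F G z s(1,2,4)])
  have "(1 / (s n)\<^sup>2) *\<^sub>R (LINT x|disk_area. q n x) = (1 / (s n)\<^sup>2) *\<^sub>R (LINT x|disk_area. indicator (N n) x *\<^sub>R q n x) + (1 / (s n)\<^sup>2) *\<^sub>R (LINT x|disk_area. indicator (R n) x *\<^sub>R q n x)" for n
    unfolding sum scaleR_add_right ..
  then show ?thesis
    using tendsto_add[OF main restlim] unfolding q_def by (simp only: add_0_right)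
qed

end

section \<open>Operators commuting with multiplication by the product and its adjoint\<close>

text \<open>\<open>V\<close> is the adjoint of \<open>U\<close>; its commutation with multiplication
  by B expresses that U commutes with the adjoint multiplication, in terms of multiplication
  alone.\<close>

locale star_pair = asymptotic_isometry +
  fixes U V :: bergman_op
  assumes U: "bounded_op U" and V: "bounded_op V"
    and adj: "\<And>f g. f \<in> bergman \<Longrightarrow> g \<in> bergman \<Longrightarrow> bergman_inner (U f) g = bergman_inner f (V g)"
    and U_comm: "\<And>f. f \<in> bergman \<Longrightarrow> U (\<lambda>z. B z * f z) = (\<lambda>z. B z * U f z)"
    and V_comm: "\<And>f. f \<in> bergman \<Longrightarrow> V (\<lambda>z. B z * f z) = (\<lambda>z. B z * V f z)"

lemma (in asymptotic_isometry) shifted_power_mult: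
  assumes "f \<in> bergman"
  shows "(\<lambda>z. (B z - l) ^ k * f z) \<in> bergman"
proof (rule bergman_mult_bounded(1)[OF _ _ assms])
  show "(\<lambda>z. (B z - l) ^ k) holomorphic_on unit_disk" by (intro holomorphic_intros hol)
  fix z assume "z \<in> unit_disk"
  then have "cmod (B z - l) \<le> 1 + cmod l" using norm_triangle_ineq4[of "B z" l] le1[of z] by linarith
  then show "cmod ((B z - l) ^ k) \<le> (1 + cmod l) ^ k" unfolding norm_power by (intro power_mono) auto
qed

lemma (in asymptotic_isometry) shifted_power_commute:
  assumes T: "bounded_op T" and comm: "\<And>f. f \<in> bergman \<Longrightarrow> T (\<lambda>z. B z * f z) = (\<lambda>z. B z * T f z)"
    and f: "f \<in> bergman"
  shows "T (\<lambda>z. (B z - l) ^ k * f z) = (\<lambda>z. (B z - l) ^ k * T f z)"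
proof (induction k)
  case 0
  show ?case by simp
next
  case (Suc k)
  let ?g = "\<lambda>z. (B z - l) ^ k * f z"
  have g: "?g \<in> bergman" by (rule shifted_power_mult[OF f])
  have Bg: "(\<lambda>z. B z * ?g z) \<in> bergman" by (rule bergman_mult_bounded(1)[OF hol le1 g])
  have "(\<lambda>z. (B z - l) ^ Suc k * f z) = (\<lambda>z. B z * ?g z - l * ?g z)"
    by (rule ext) (simp add: algebra_simps)
  then have "T (\<lambda>z. (B z - l) ^ Suc k * f z) = T (\<lambda>z. B z * ?g z - l * ?g z)" by (rule arg_cong)
  also have "\<dots> = (\<lambda>z. T (\<lambda>z. B z * ?g z) z - T (\<lambda>z. l * ?g z) z)"
    by (rule bounded_op_diff[OF T Bg bergman_scale[OF g]])
  also have "\<dots> = (\<lambda>z. B z * T ?g z - l * T ?g z)"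
    unfolding comm[OF g] bounded_opD(3)[OF T g] ..
  also have "\<dots> = (\<lambda>z. (B z - l) ^ Suc k * T f z)"
    unfolding Suc.IH by (rule ext) (simp add: algebra_simps)
  finally show ?case .
qed

section \<open>The adjoint relation with a radial weight inserted\<close>

context star_pair
begin

text \<open>Its integral is <U f, g> - <f, V g> = 0; the aim is that it remains 0 after insertion of
  a weight.\<close>

definition defect :: "(complex \<Rightarrow> complex) \<Rightarrow> (complex \<Rightarrow> complex) \<Rightarrow> complex \<Rightarrow> complex" where
  "defect f g x = U f x * cnj (g x) - f x * cnj (V g x)"

lemma defect_integrable:
  assumes "f \<in> bergman" "g \<in> bergman"
  shows "integrable disk_area (defect f g)"
  unfolding defect_def[abs_def]
  using assms bounded_opD(1)[OF U] bounded_opD(1)[OF V] by (intro Bochner_Integration.integrable_diff bergman_integrable) auto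

lemma defect_off_disk: "f \<in> bergman \<Longrightarrow> x \<notin> unit_disk \<Longrightarrow> defect f g x = 0"
  using bergmanD(2)[of f x] bergmanD(2)[OF bounded_opD(1)[OF U], of f x] by (simp add: defect_def)

lemma disk_weight_integrable:
  assumes fg: "f \<in> bergman" "g \<in> bergman" and h: "continuous_on UNIV (h :: real \<Rightarrow> real)"
  shows "integrable disk_area (\<lambda>x. of_real (h ((cmod (B x - l))\<^sup>2)) * defect f g x)"
proof -
  note Uf = bounded_opD(1)[OF U fg(1)] and Vg = bounded_opD(1)[OF V fg(2)]
  let ?k = "\<lambda>x. complex_of_real (h ((cmod (B x - l))\<^sup>2))"
  let ?M = "(1 + cmod l)\<^sup>2"
  have kc: "continuous_on unit_disk ?k"
    by (intro continuous_on_of_real continuous_on_compose2[OF h] continuous_intros B_continuous) auto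
  have "compact {0..?M}" by simp
  then have "bounded (h ` {0..?M})"
    using h by (meson compact_continuous_image compact_imp_bounded continuous_on_subset subset_UNIV)
  then obtain C where "\<forall>y\<in>h ` {0..?M}. norm y \<le> C"
    unfolding bounded_iff by blast
  then have C: "\<bar>h t\<bar> \<le> C" if "t \<in> {0..?M}" for t
    using that by simp
  have range: "(cmod (B x - l))\<^sup>2 \<in> {0..?M}" if "x \<in> unit_disk" for x
  proof -
    have "cmod (B x - l) \<le> 1 + cmod l" using norm_triangle_ineq4[of "B x" l] le1[OF that] by linarith
    then have "(cmod (B x - l))\<^sup>2 \<le> ?M" by (intro power_mono) auto
    then show ?thesis by simp
  qed
  show ?thesis
  proof (rule Bochner_Integration.integrable_bound[of _ "\<lambda>x. of_real C * defect f g x"])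
    show "integrable disk_area (\<lambda>x. of_real C * defect f g x)"
      by (intro integrable_mult_right defect_integrable fg)
    have "(\<lambda>x. ?k x * (U f x * cnj (g x)) - ?k x * (f x * cnj (V g x))) \<in> borel_measurable borel"
      by (intro borel_measurable_diff disk_product_measurable kc Uf Vg fg)
    then show "(\<lambda>x. ?k x * defect f g x) \<in> borel_measurable disk_area"
      unfolding defect_def right_diff_distrib by (simp only: measurable_cong_sets[OF sets_disk_area refl])
    show "AE x in disk_area. norm (?k x * defect f g x) \<le> norm (of_real C * defect f g x)"
    proof (rule AE_I2)
      fix x
      show "norm (?k x * defect f g x) \<le> norm (of_real C * defect f g x)"
      proof (cases "x \<in> unit_disk")
        case True
        have "\<bar>h ((cmod (B x - l))\<^sup>2)\<bar> \<le> \<bar>C\<bar>" using C[OF range[OF True]] by linarith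
        then show ?thesis unfolding norm_mult norm_of_real by (rule mult_right_mono) simp
      next
        case False
        then show ?thesis using defect_off_disk[OF fg(1)] by simp
      qed
    qed
  qed
qed

text \<open>|B - l|^(2k) is (B - l)^k times its conjugate. One factor goes to each side of the inner
  product, where it passes through U and V respectively.\<close>

lemma defect_moment:
  assumes fg: "f \<in> bergman" "g \<in> bergman"
  shows "(LINT x|disk_area. of_real (((cmod (B x - l))\<^sup>2) ^ k) * defect f g x) = 0"
proof -
  note Uf = bounded_opD(1)[OF U fg(1)] and Vg = bounded_opD(1)[OF V fg(2)]
  let ?p = "\<lambda>f z. (B z - l) ^ k * f z"
  have pb: "?p f \<in> bergman" "?p g \<in> bergman" "?p (U f) \<in> bergman" "?p (V g) \<in> bergman"
    by (intro shifted_power_mult fg Uf Vg)+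
  have cU: "U (?p f) = ?p (U f)" by (rule shifted_power_commute[OF U U_comm fg(1)])
  have cV: "V (?p g) = ?p (V g)" by (rule shifted_power_commute[OF V V_comm fg(2)])
  have eq: "bergman_inner (?p (U f)) (?p g) = bergman_inner (?p f) (?p (V g))"
    using adj[OF pb(1,2)] unfolding cU cV .
  have pt: "of_real (((cmod (B x - l))\<^sup>2) ^ k) * defect f g x = ?p (U f) x * cnj (?p g x) - ?p f x * cnj (?p (V g) x)" for x
  proof -
    have "complex_of_real (((cmod (B x - l))\<^sup>2) ^ k) = (B x - l) ^ k * cnj ((B x - l) ^ k)"
      by (simp only: of_real_power complex_norm_square[of "B x - l", unfolded of_real_power] complex_cnj_power power_mult_distrib)
    then show ?thesis by (simp only: defect_def complex_cnj_mult) (simp add: algebra_simps)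
  qed
  show ?thesis
    unfolding pt
    using eq bergman_integrable[OF pb(3,2)] bergman_integrable[OF pb(1,4)]
    by (simp only: Bochner_Integration.integral_diff bergman_inner_def) simp
qed

text \<open>Weierstrass approximation on the compact range of |B - l|^2: polynomials integrate to 0
  by the moments, and the uniform error is multiplied by the finite integral of the modulus of the
  defect.\<close>

lemma defect_weighted_zero:
  assumes fg: "f \<in> bergman" "g \<in> bergman" and h: "continuous_on UNIV (h :: real \<Rightarrow> real)"
  shows "(LINT x|disk_area. of_real (h ((cmod (B x - l))\<^sup>2)) * defect f g x) = 0"
proof -
  let ?t = "\<lambda>x. (cmod (B x - l))\<^sup>2" and ?M = "(1 + cmod l)\<^sup>2"
  let ?D = "LINT x|disk_area. norm (defect f g x)"
  have D0: "0 \<le> ?D" by (intro integral_nonneg_AE AE_I2) simp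
  have range: "?t x \<in> {0..?M}" if "x \<in> unit_disk" for x
  proof -
    have "cmod (B x - l) \<le> 1 + cmod l" using norm_triangle_ineq4[of "B x" l] le1[OF that] by linarith
    then have "?t x \<le> ?M" by (intro power_mono) auto
    then show ?thesis by simp
  qed
  have small: "norm (LINT x|disk_area. of_real (h (?t x)) * defect f g x) \<le> e * ?D" if e: "0 < e" for e
  proof -
    have "continuous_on {0..?M} h" using h continuous_on_subset by blast
    then obtain p where p: "real_polynomial_function p" "\<And>t. t \<in> {0..?M} \<Longrightarrow> \<bar>h t - p t\<bar> < e"
      using Stone_Weierstrass_real_polynomial_function[of "{0..?M}" h e] e by auto
    obtain a n where a: "p = (\<lambda>x. \<Sum>i\<le>n. a i * x ^ i)"
      using p(1) unfolding real_polynomial_function_iff_sum by blast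
    have pc: "continuous_on UNIV p" unfolding a by (intro continuous_intros)
    have mono: "continuous_on UNIV (\<lambda>t::real. t ^ i)" for i by (intro continuous_intros)
    have "(LINT x|disk_area. of_real (p (?t x)) * defect f g x) = (LINT x|disk_area. (\<Sum>i\<le>n. of_real (a i) * (of_real (?t x ^ i) * defect f g x)))"
      unfolding a by (simp only: of_real_sum of_real_mult sum_distrib_right mult.assoc)
    also have "\<dots> = (\<Sum>i\<le>n. LINT x|disk_area. of_real (a i) * (of_real (?t x ^ i) * defect f g x))"
      by (intro Bochner_Integration.integral_sum integrable_mult_right disk_weight_integrable[OF fg mono])
    also have "\<dots> = (\<Sum>i\<le>n. of_real (a i) * (LINT x|disk_area. of_real (?t x ^ i) * defect f g x))"
      by (intro sum.cong refl integral_mult_right_zero)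
    also have "\<dots> = 0" unfolding defect_moment[OF fg] by simp
    finally have pz: "(LINT x|disk_area. of_real (p (?t x)) * defect f g x) = 0" .
    note hi = disk_weight_integrable[OF fg h, of l] and pi = disk_weight_integrable[OF fg pc, of l]
    have "norm (LINT x|disk_area. of_real (h (?t x)) * defect f g x)
        = norm (LINT x|disk_area. of_real (h (?t x)) * defect f g x - of_real (p (?t x)) * defect f g x)"
      unfolding Bochner_Integration.integral_diff[OF hi pi] pz by simp
    also have "\<dots> \<le> (LINT x|disk_area. norm (of_real (h (?t x)) * defect f g x - of_real (p (?t x)) * defect f g x))"
      by (rule integral_norm_bound)
    also have "\<dots> \<le> (LINT x|disk_area. e * norm (defect f g x))"
    proof (rule integral_mono)
      show "integrable disk_area (\<lambda>x. norm (of_real (h (?t x)) * defect f g x - of_real (p (?t x)) * defect f g x))"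
        by (rule integrable_norm[OF Bochner_Integration.integrable_diff[OF hi pi]])
      show "integrable disk_area (\<lambda>x. e * norm (defect f g x))"
        by (rule integrable_mult_right, rule integrable_norm[OF defect_integrable[OF fg]])
      fix x
      show "norm (of_real (h (?t x)) * defect f g x - of_real (p (?t x)) * defect f g x) \<le> e * norm (defect f g x)"
      proof (cases "x \<in> unit_disk")
        case True
        have "norm (of_real (h (?t x)) * defect f g x - of_real (p (?t x)) * defect f g x) = \<bar>h (?t x) - p (?t x)\<bar> * norm (defect f g x)"
          unfolding left_diff_distrib[symmetric] of_real_diff[symmetric] norm_mult norm_of_real ..
        also have "\<dots> \<le> e * norm (defect f g x)"
          using p(2)[OF range[OF True]] by (intro mult_right_mono) auto
        finally show ?thesis .
      next
        case False
        then show ?thesis using defect_off_disk[OF fg(1)] by simp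
      qed
    qed
    also have "\<dots> = e * ?D" by (rule integral_mult_right_zero)
    finally show ?thesis .
  qed
  have "norm (LINT x|disk_area. of_real (h (?t x)) * defect f g x) \<le> 0"
  proof (rule field_le_epsilon)
    fix e :: real assume e: "0 < e"
    \<comment> \<open>The denominator ?D + 1 covers the case ?D = 0.\<close>
    have "norm (LINT x|disk_area. of_real (h (?t x)) * defect f g x) \<le> e / (?D + 1) * ?D"
    proof (rule small)
      have "0 < ?D + 1" using D0 by linarith
      then show "0 < e / (?D + 1)" by (rule divide_pos_pos[OF e])
    qed
    also have "e / (d + 1) * d \<le> e" if "0 \<le> d" for d
      using e that by (simp add: field_simps)
    from this[OF D0] have "e / (?D + 1) * ?D \<le> e" .
    finally show "norm (LINT x|disk_area. of_real (h (?t x)) * defect f g x) \<le> 0 + e" by simp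
  qed
  then show ?thesis by simp
qed

lemma weighted_adjoint:
  assumes fg: "f \<in> bergman" "g \<in> bergman" and s: "0 < s"
  shows "(LINT x|disk_area. of_real (weight l s x) * (U f x * cnj (g x))) = (LINT x|disk_area. of_real (weight l s x) * (f x * cnj (V g x)))"
proof -
  note Uf = bounded_opD(1)[OF U fg(1)] and Vg = bounded_opD(1)[OF V fg(2)]
  let ?h = "\<lambda>t. max 0 (1 - t / s\<^sup>2)"
  have "continuous_on UNIV ?h" using s by (intro continuous_intros) simp
  from defect_weighted_zero[OF fg this, of l]
  have "(LINT x|disk_area. of_real (weight l s x) * defect f g x) = 0"
    unfolding weight_def .
  moreover have "(LINT x|disk_area. of_real (weight l s x) * defect f g x)
      = (LINT x|disk_area. of_real (weight l s x) * (U f x * cnj (g x)) - of_real (weight l s x) * (f x * cnj (V g x)))"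
    unfolding defect_def right_diff_distrib ..
  moreover have "\<dots> = (LINT x|disk_area. of_real (weight l s x) * (U f x * cnj (g x))) - (LINT x|disk_area. of_real (weight l s x) * (f x * cnj (V g x)))"
    by (rule Bochner_Integration.integral_diff[OF weighted_integrable[OF Uf fg(2) s] weighted_integrable[OF fg(1) Vg s]])
  ultimately show ?thesis by simp
qed

text \<open>Both sides of the weighted identity concentrate on the fibre as the weight shrinks; when only
  one point of the fibre contributes on each side, the point values can be compared.\<close>

lemma fibre_identity:
  assumes l: "l \<in> regular_values B" and fg: "f \<in> bergman" "g \<in> bergman"
    and z: "z \<in> fibre B l" and w: "w \<in> fibre B l"
    and van1: "\<And>x. x \<in> fibre B l \<Longrightarrow> x \<noteq> z \<Longrightarrow> U f x = 0 \<or> g x = 0"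
    and van2: "\<And>x. x \<in> fibre B l \<Longrightarrow> x \<noteq> w \<Longrightarrow> f x = 0 \<or> V g x = 0"
  shows "U f z * cnj (g z) / of_real ((cmod (deriv B z))\<^sup>2) = f w * cnj (V g w) / of_real ((cmod (deriv B w))\<^sup>2)"
proof -
  note Uf = bounded_opD(1)[OF U fg(1)] and Vg = bounded_opD(1)[OF V fg(2)]
  obtain r c C \<delta> \<sigma> where ec: "evenly_covered B l r c C \<delta> \<sigma>"
    using evenly_covered_exists[OF l] by blast
  interpret evenly_covered B l r c C \<delta> \<sigma> by (rule ec)
  \<comment> \<open>Small enough for both requirements of \<open>weighted_limit\<close>, s \<le> r/2
    and C s/c \<le> 1/4.\<close>
  define s0 where "s0 = min (r / 2) (c / (4 * C))"
  define s where "s = (\<lambda>n. s0 / real (Suc n))"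
  have s0: "0 < s0" using pos by (simp add: s0_def)
  have sp: "0 < s n" "s n \<le> s0" for n using s0 by (auto simp: s_def field_simps)
  have s1: "s n \<le> r / 2" for n using sp(2)[of n] by (simp add: s0_def)
  have s2: "C * s n / c \<le> 1 / 4" for n
  proof -
    have "s n \<le> c / (4 * C)" using sp(2)[of n] by (simp add: s0_def)
    then show ?thesis using pos by (simp add: field_simps)
  qed
  have s3: "s \<longlonglongrightarrow> 0"
  proof -
    have "(\<lambda>n. s0 * (1 / real (Suc n))) \<longlonglongrightarrow> s0 * 0"
      by (intro tendsto_mult tendsto_const LIMSEQ_Suc lim_1_over_n)
    then show ?thesis by (simp add: s_def)
  qed
  \<comment> \<open>Sections invert B, which expresses the limit through B' at the points of the
    fibre.\<close>
  have dsig: "(cmod (deriv (\<sigma> x) l))\<^sup>2 = 1 / (cmod (deriv B x))\<^sup>2" if x: "x \<in> fibre B l" for x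
  proof -
    have "deriv (\<sigma> x) l * deriv B x = 1" using \<sigma>_deriv[OF x center_in] \<sigma>_center[OF x] by simp
    then have "cmod (deriv (\<sigma> x) l) * cmod (deriv B x) = 1" by (metis norm_mult norm_one)
    then have "(cmod (deriv (\<sigma> x) l))\<^sup>2 * (cmod (deriv B x))\<^sup>2 = 1" by (simp add: power_mult_distrib[symmetric])
    moreover have "(cmod (deriv B x))\<^sup>2 \<noteq> 0" using deriv_nonzero[OF fibre_regular[OF x]] by simp
    ultimately show ?thesis by (simp add: field_simps)
  qed
  let ?K = "complex_of_real (bump_mass / measure lborel unit_disk)"
  have K: "?K \<noteq> 0" using bump_mass_pos emeasure_unit_disk(2) by simp
  have L1: "(\<lambda>n. (1 / (s n)\<^sup>2) *\<^sub>R (LINT x|disk_area. of_real (weight l (s n) x) * (U f x * cnj (g x))))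
      \<longlonglongrightarrow> ?K * (U f z * cnj (g z) * of_real ((cmod (deriv (\<sigma> z) l))\<^sup>2))"
    by (rule weighted_limit[OF Uf fg(2) z van1 sp(1) s1 s2 s3])
  have L2: "(\<lambda>n. (1 / (s n)\<^sup>2) *\<^sub>R (LINT x|disk_area. of_real (weight l (s n) x) * (f x * cnj (V g x))))
      \<longlonglongrightarrow> ?K * (f w * cnj (V g w) * of_real ((cmod (deriv (\<sigma> w) l))\<^sup>2))"
    by (rule weighted_limit[OF fg(1) Vg w van2 sp(1) s1 s2 s3])
  have "?K * (U f z * cnj (g z) * of_real ((cmod (deriv (\<sigma> z) l))\<^sup>2)) = ?K * (f w * cnj (V g w) * of_real ((cmod (deriv (\<sigma> w) l))\<^sup>2))"
    using LIMSEQ_unique[OF L1] L2 unfolding weighted_adjoint[OF fg sp(1)] by blast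
  then have "U f z * cnj (g z) * of_real ((cmod (deriv (\<sigma> z) l))\<^sup>2) = f w * cnj (V g w) * of_real ((cmod (deriv (\<sigma> w) l))\<^sup>2)"
    using K by (simp only: mult_cancel_left) simp
  then show ?thesis
    unfolding dsig[OF z] dsig[OF w] by (simp add: of_real_divide)
qed

end

section \<open>Divided differences under a bounded operator\<close>

definition div_diff :: "(complex \<Rightarrow> complex) \<Rightarrow> complex \<Rightarrow> complex \<Rightarrow> complex" where
  "div_diff F y u = (if u = y then deriv F y else (F u - F y) / (u - y))"

definition disk_quot :: "(complex \<Rightarrow> complex) \<Rightarrow> complex \<Rightarrow> complex \<Rightarrow> complex" where
  "disk_quot F y u = indicator unit_disk u * div_diff F y u"

lemma div_diff_holomorphic:
  "F holomorphic_on unit_disk \<Longrightarrow> div_diff F y holomorphic_on unit_disk"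
  unfolding div_diff_def[abs_def] by (rule pole_lemma_open) simp_all

text \<open>Away from y the quotient is bounded by 2K over the distance; the maximum principle on
  the disc of radius (1 - |y|)/2 carries this bound across y.\<close>

lemma div_diff_bound:
  assumes F: "F holomorphic_on unit_disk" "\<And>u. u \<in> unit_disk \<Longrightarrow> cmod (F u) \<le> K"
    and y: "y \<in> unit_disk" and u: "u \<in> unit_disk"
  shows "cmod (div_diff F y u) \<le> 4 * K / (1 - cmod y)"
proof -
  define e where "e = (1 - cmod y) / 2"
  have e: "0 < e" using y by (simp add: e_def)
  have sub: "cball y e \<subseteq> unit_disk"
  proof
    fix v assume "v \<in> cball y e"
    then have "cmod (v - y) \<le> e" by (simp add: dist_norm norm_minus_commute)
    moreover have "cmod v \<le> cmod y + cmod (v - y)" by (rule norm_triangle_sub)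
    ultimately have "cmod v \<le> cmod y + e" by linarith
    also have "\<dots> < 1" using y by (simp add: e_def field_simps)
    finally show "v \<in> unit_disk" by simp
  qed
  have far: "cmod (div_diff F y v) \<le> 2 * K / e" if v: "v \<in> unit_disk" "e \<le> cmod (v - y)" for v
  proof -
    have h: "cmod (F v - F y) \<le> 2 * K" using norm_triangle_ineq4[of "F v" "F y"] F(2)[OF v(1)] F(2)[OF y] by linarith
    have "v \<noteq> y" using v e by auto
    then show ?thesis
      using frac_le[OF order_trans[OF norm_ge_zero h] h e v(2)] by (simp add: div_diff_def norm_divide)
  qed
  have "cmod (div_diff F y u) \<le> 2 * K / e"
  proof (cases "e \<le> cmod (u - y)")
    case True
    then show ?thesis by (rule far[OF u])
  next
    case False
    show ?thesis
    proof (rule maximum_modulus_frontier[of "div_diff F y" "ball y e"])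
      show "div_diff F y holomorphic_on interior (ball y e)"
        by (rule holomorphic_on_subset[OF div_diff_holomorphic[OF F(1)]])
          (use order_trans[OF ball_subset_cball sub] in simp)
      show "continuous_on (closure (ball y e)) (div_diff F y)"
        by (rule holomorphic_on_imp_continuous_on[OF holomorphic_on_subset[OF div_diff_holomorphic[OF F(1)]]])
          (use sub e in simp)
      show "u \<in> ball y e" using False by (simp add: dist_norm norm_minus_commute)
      fix v assume "v \<in> frontier (ball y e)"
      then have "cmod (v - y) = e" "v \<in> cball y e" using e by (auto simp: dist_norm norm_minus_commute)
      then show "cmod (div_diff F y v) \<le> 2 * K / e" using sub by (intro far) auto
    qed simp
  qed
  also have "2 * K / e = 4 * K / (1 - cmod y)" by (simp add: e_def)
  finally show ?thesis .
qed

text \<open>The recursion F[y',u] - F[y,u] = (y' - y) F[y,y',u] of divided differences, including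
  all coincidences among the three points. It turns the dependence on the parameter y into an
  explicit factor.\<close>

lemma div_diff_diff:
  assumes F: "F holomorphic_on unit_disk" and y: "y \<in> unit_disk" "y' \<in> unit_disk"
  shows "div_diff F y' u - div_diff F y u = (y' - y) * div_diff (div_diff F y) y' u"
proof (cases "y' = y")
  case neq: False
  consider "u = y'" | "u \<noteq> y'" "u = y" | "u \<noteq> y'" "u \<noteq> y" by blast
  then show ?thesis
  proof cases
    case 1
    have "(F has_field_derivative deriv F y') (at y')"
      by (rule holomorphic_derivI[OF F open_ball y(2)])
    then have "((\<lambda>u. (F u - F y) / (u - y)) has_field_derivative ((deriv F y' - 0) * (y' - y) - (F y' - F y) * (1 - 0)) / ((y' - y) * (y' - y))) (at y')"
      using neq by (intro DERIV_divide DERIV_diff DERIV_const DERIV_ident) auto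
    then have "(div_diff F y has_field_derivative ((deriv F y' - 0) * (y' - y) - (F y' - F y) * (1 - 0)) / ((y' - y) * (y' - y))) (at y')"
      by (rule has_field_derivative_transform_within_open[of _ _ _ "- {y}"]) (use neq in \<open>auto simp: div_diff_def\<close>)
    from DERIV_imp_deriv[OF this]
    have d: "div_diff (div_diff F y) y' y' = ((deriv F y' - 0) * (y' - y) - (F y' - F y) * (1 - 0)) / ((y' - y) * (y' - y))"
      by (rule trans[rotated]) (simp add: div_diff_def[of "div_diff F y"])
    have "a - b / q = q * ((a * q - b) / (q * q))" if "q \<noteq> 0" for a b q :: complex
      using that by (simp add: field_simps)
    from this[of "y' - y" "deriv F y'" "F y' - F y"] show ?thesis
      unfolding 1 d using neq by (simp add: div_diff_def)
  next
    case 2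
    have "b / q - d = q * ((d - b / q) / (- q))" if "q \<noteq> 0" for b q d :: complex
      using that by (simp add: field_simps)
    from this[of "y' - y" "F y' - F y" "deriv F y"]
    have "(F y' - F y) / (y' - y) - deriv F y = (y' - y) * ((deriv F y - (F y' - F y) / (y' - y)) / (y - y'))"
      using neq by simp
    moreover have "(F y - F y') / (y - y') = (F y' - F y) / (y' - y)"
      by (metis minus_diff_eq minus_divide_divide)
    ultimately show ?thesis using 2 neq by (simp add: div_diff_def)
  next
    case 3
    have "(a - b) / (p - q) - a / p = q * ((a / p - b / q) / (p - q))" if "p \<noteq> 0" "q \<noteq> 0" "p \<noteq> q" for a b p q :: complex
    proof -
      have "p - q \<noteq> 0" using that by simp
      then show ?thesis using that by (simp add: field_simps)
    qed
    from this[of "u - y" "y' - y" "F u - F y" "F y' - F y"] show ?thesis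
      using 3 neq by (simp add: div_diff_def)
  qed
qed simp

lemma disk_quot_bergman:
  assumes F: "F holomorphic_on unit_disk" "\<And>u. u \<in> unit_disk \<Longrightarrow> cmod (F u) \<le> K" and y: "y \<in> unit_disk"
  shows "disk_quot F y \<in> bergman" "bergman_norm (disk_quot F y) \<le> 4 * K / (1 - cmod y)"
proof -
  have b: "cmod (div_diff F y u) \<le> 4 * K / (1 - cmod y)" if "u \<in> unit_disk" for u
    by (rule div_diff_bound[OF F y that])
  note B = bergman_bounded[OF div_diff_holomorphic[OF F(1), of y] b]
  show "disk_quot F y \<in> bergman" unfolding disk_quot_def[abs_def] by (rule B(1))
  show "bergman_norm (disk_quot F y) \<le> 4 * K / (1 - cmod y)" unfolding disk_quot_def[abs_def] by (rule B(2))
qed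

text \<open>By linearity the recursion passes through T: a change of the parameter costs y' - y
  times T of another bounded divided difference. This takes the place of differentiating a family of
  Bergman functions.\<close>

lemma op_disk_quot_diff:
  assumes T: "bounded_op T" and F: "F holomorphic_on unit_disk" "\<And>u. u \<in> unit_disk \<Longrightarrow> cmod (F u) \<le> K"
    and y: "y \<in> unit_disk" "y' \<in> unit_disk"
  shows "T (disk_quot F y') x = T (disk_quot F y) x + (y' - y) * T (disk_quot (div_diff F y) y') x"
proof -
  have b: "cmod (div_diff F y u) \<le> 4 * K / (1 - cmod y)" if "u \<in> unit_disk" for u
    by (rule div_diff_bound[OF F y(1) that])
  have q: "disk_quot F y \<in> bergman" by (rule disk_quot_bergman(1)[OF F y(1)])
  have q': "disk_quot (div_diff F y) y' \<in> bergman"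
    by (rule disk_quot_bergman(1)[OF div_diff_holomorphic[OF F(1)] b y(2)])
  have "disk_quot F y' = (\<lambda>u. disk_quot F y u + (y' - y) * disk_quot (div_diff F y) y' u)"
  proof
    fix u
    have "div_diff F y' u = div_diff F y u + (y' - y) * div_diff (div_diff F y) y' u"
      using div_diff_diff[OF F(1) y, of u] by (simp add: algebra_simps)
    then show "disk_quot F y' u = disk_quot F y u + (y' - y) * disk_quot (div_diff F y) y' u"
      unfolding disk_quot_def by (cases "u \<in> unit_disk") simp_all
  qed
  then have "T (disk_quot F y') = T (\<lambda>u. disk_quot F y u + (y' - y) * disk_quot (div_diff F y) y' u)" by (rule arg_cong)
  also have "\<dots> = (\<lambda>u. T (disk_quot F y) u + T (\<lambda>u. (y' - y) * disk_quot (div_diff F y) y' u) u)"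
    by (rule bounded_opD(2)[OF T q bergman_scale[OF q']])
  finally have "T (disk_quot F y') x = T (disk_quot F y) x + T (\<lambda>u. (y' - y) * disk_quot (div_diff F y) y' u) x"
    by (rule fun_cong)
  then show ?thesis unfolding bounded_opD(3)[OF T q'] .
qed

text \<open>The evaluation bound and the norm of the second divided difference stay bounded near m0,
  so the factor y m - y m0 sends the remainder to 0.\<close>

lemma op_disk_quot_continuous:
  assumes T: "bounded_op T" and F: "F holomorphic_on unit_disk" "\<And>u. u \<in> unit_disk \<Longrightarrow> cmod (F u) \<le> K"
    and x: "isCont x m0" "x m0 \<in> unit_disk" and y: "isCont y m0" "y m0 \<in> unit_disk"
  shows "((\<lambda>m. T (disk_quot F (y m)) (x m)) \<longlongrightarrow> T (disk_quot F (y m0)) (x m0)) (at m0)"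
proof -
  obtain C where C: "0 \<le> C" "\<And>f. f \<in> bergman \<Longrightarrow> bergman_norm (T f) \<le> C * bergman_norm f"
    using bounded_op_bound[OF T] by metis
  let ?K = "4 * K / (1 - cmod (y m0))"
  let ?b = "\<lambda>m. 2 / (1 - cmod (x m)) * (C * (4 * ?K / (1 - cmod (y m))))"
  have b: "cmod (div_diff F (y m0) u) \<le> ?K" if "u \<in> unit_disk" for u
    by (rule div_diff_bound[OF F y(2) that])
  have xl: "(x \<longlongrightarrow> x m0) (at m0)" and yl: "(y \<longlongrightarrow> y m0) (at m0)"
    using x(1) y(1) by (simp_all add: isCont_def)
  have ex: "\<forall>\<^sub>F m in at m0. x m \<in> unit_disk" and ey: "\<forall>\<^sub>F m in at m0. y m \<in> unit_disk"
    using topological_tendstoD[OF xl open_ball x(2)] topological_tendstoD[OF yl open_ball y(2)] .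
  have qb: "disk_quot F (y m0) \<in> bergman" by (rule disk_quot_bergman(1)[OF F y(2)])
  have "isCont (T (disk_quot F (y m0))) (x m0)"
    using bergmanD(1)[OF bounded_opD(1)[OF T qb]] x(2)
    by (metis continuous_on_eq_continuous_at holomorphic_on_imp_continuous_on open_ball)
  then have l1: "((\<lambda>m. T (disk_quot F (y m0)) (x m)) \<longlongrightarrow> T (disk_quot F (y m0)) (x m0)) (at m0)"
    by (rule isCont_tendsto_compose[OF _ xl])
  have l2: "((\<lambda>m. (y m - y m0) * T (disk_quot (div_diff F (y m0)) (y m)) (x m)) \<longlongrightarrow> 0) (at m0)"
  proof (rule Lim_null_comparison[where g = "\<lambda>m. cmod (y m - y m0) * ?b m"])
    have "((\<lambda>m. cmod (y m - y m0) * ?b m) \<longlongrightarrow> cmod (y m0 - y m0) * ?b m0) (at m0)"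
      using x(2) y(2) by (intro tendsto_intros xl yl) auto
    then show "((\<lambda>m. cmod (y m - y m0) * ?b m) \<longlongrightarrow> 0) (at m0)" by simp
    show "\<forall>\<^sub>F m in at m0. norm ((y m - y m0) * T (disk_quot (div_diff F (y m0)) (y m)) (x m)) \<le> cmod (y m - y m0) * ?b m"
      using ex ey
    proof eventually_elim
      case (elim m)
      note q = disk_quot_bergman[OF div_diff_holomorphic[OF F(1)] b elim(2)]
      have qB: "disk_quot (div_diff F (y m0)) (y m) \<in> bergman" by (rule q(1))
      have "cmod (T (disk_quot (div_diff F (y m0)) (y m)) (x m)) \<le> 2 / (1 - cmod (x m)) * bergman_norm (T (disk_quot (div_diff F (y m0)) (y m)))"
        by (rule bergman_eval[OF bounded_opD(1)[OF T qB] elim(1)])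
      also have "\<dots> \<le> ?b m"
      proof (rule mult_left_mono)
        have "bergman_norm (disk_quot (div_diff F (y m0)) (y m)) \<le> 4 * ?K / (1 - cmod (y m))" by (rule q(2))
        from order_trans[OF C(2)[OF qB] mult_left_mono[OF this C(1)]]
        show "bergman_norm (T (disk_quot (div_diff F (y m0)) (y m))) \<le> C * (4 * ?K / (1 - cmod (y m)))" .
        show "0 \<le> 2 / (1 - cmod (x m))" using elim(1) by simp
      qed
      finally show ?case unfolding norm_mult by (rule mult_left_mono) simp
    qed
  qed
  have "((\<lambda>m. T (disk_quot F (y m0)) (x m) + (y m - y m0) * T (disk_quot (div_diff F (y m0)) (y m)) (x m)) \<longlongrightarrow> T (disk_quot F (y m0)) (x m0) + 0) (at m0)"
    by (rule tendsto_add[OF l1 l2])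
  moreover have "\<forall>\<^sub>F m in at m0. T (disk_quot F (y m0)) (x m) + (y m - y m0) * T (disk_quot (div_diff F (y m0)) (y m)) (x m) = T (disk_quot F (y m)) (x m)"
    using ey
  proof eventually_elim
    case (elim m)
    show ?case by (rule op_disk_quot_diff[OF T F y(2) elim, symmetric])
  qed
  ultimately show ?thesis unfolding add_0_right by (rule Lim_transform_eventually)
qed

text \<open>Both the evaluation point and the parameter move. The contribution of the parameter is y
  m - y m0 times a quantity continuous at m0, and such a product is differentiable in the sense of
  Caratheodory.\<close>

lemma op_disk_quot_differentiable:
  assumes T: "bounded_op T" and F: "F holomorphic_on unit_disk" "\<And>u. u \<in> unit_disk \<Longrightarrow> cmod (F u) \<le> K"
    and x: "(x has_field_derivative x') (at m0)" "x m0 \<in> unit_disk"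
    and y: "(y has_field_derivative y') (at m0)" "y m0 \<in> unit_disk"
  shows "(\<lambda>m. T (disk_quot F (y m)) (x m)) field_differentiable (at m0)"
proof -
  have b: "cmod (div_diff F (y m0) u) \<le> 4 * K / (1 - cmod (y m0))" if "u \<in> unit_disk" for u
    by (rule div_diff_bound[OF F y(2) that])
  let ?k = "\<lambda>m. T (disk_quot (div_diff F (y m0)) (y m)) (x m)"
  have k: "(?k \<longlongrightarrow> ?k m0) (at m0)"
    by (rule op_disk_quot_continuous[OF T div_diff_holomorphic[OF F(1)] b DERIV_isCont[OF x(1)] x(2) DERIV_isCont[OF y(1)] y(2)])
  have "((\<lambda>m. (y m - y m0) / (m - m0) * ?k m) \<longlongrightarrow> y' * ?k m0) (at m0)"
    using y(1) k by (intro tendsto_mult) (simp_all add: has_field_derivative_iff)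
  then have d2: "((\<lambda>m. (y m - y m0) * ?k m) has_field_derivative y' * ?k m0) (at m0)"
    by (simp add: has_field_derivative_iff)
  have qb: "disk_quot F (y m0) \<in> bergman" by (rule disk_quot_bergman(1)[OF F y(2)])
  have "(T (disk_quot F (y m0)) has_field_derivative deriv (T (disk_quot F (y m0))) (x m0)) (at (x m0))"
    by (rule holomorphic_derivI[OF bergmanD(1)[OF bounded_opD(1)[OF T qb]] open_ball x(2)])
  from DERIV_add[OF DERIV_chain2[OF this x(1)] d2]
  have d: "((\<lambda>m. T (disk_quot F (y m0)) (x m) + (y m - y m0) * ?k m) has_field_derivative
      (deriv (T (disk_quot F (y m0))) (x m0) * x' + y' * ?k m0)) (at m0)" .
  have "(y \<longlongrightarrow> y m0) (at m0)" using DERIV_isCont[OF y(1)] by (simp add: isCont_def)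
  then have "\<forall>\<^sub>F m in at m0. y m \<in> unit_disk" by (rule topological_tendstoD[OF _ open_ball y(2)])
  then have ev: "\<forall>\<^sub>F m in at m0. T (disk_quot F (y m0)) (x m) + (y m - y m0) * ?k m = T (disk_quot F (y m)) (x m)"
  proof eventually_elim
    case (elim m)
    show ?case by (rule op_disk_quot_diff[OF T F y(2) elim, symmetric])
  qed
  moreover have "T (disk_quot F (y m0)) (x m0) + (y m0 - y m0) * ?k m0 = T (disk_quot F (y m0)) (x m0)" by simp
  ultimately have "\<forall>\<^sub>F m in nhds m0. T (disk_quot F (y m0)) (x m) + (y m - y m0) * ?k m = T (disk_quot F (y m)) (x m)"
    unfolding eventually_nhds_conv_at by blast
  from DERIV_cong_ev[OF refl this refl] d show ?thesis
    unfolding field_differentiable_def by blast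
qed

text \<open>The derivative is complex linear and, through the conjugate, antilinear; comparing its
  values at 1 and i shows that it is 0.\<close>

lemma holomorphic_and_antiholomorphic_constant:
  assumes f: "\<And>m. m \<in> ball l r \<Longrightarrow> f field_differentiable (at m)"
    and cf: "\<And>m. m \<in> ball l r \<Longrightarrow> (\<lambda>m. cnj (f m)) field_differentiable (at m)" and m: "m \<in> ball l r" and r: "0 < r"
  shows "f m = f (l :: complex)"
proof -
  have "(f has_field_derivative 0) (at m within ball l r)" if m: "m \<in> ball l r" for m
  proof -
    obtain a where a: "(f has_field_derivative a) (at m)" using f[OF m] by (auto simp: field_differentiable_def)
    obtain b where b: "((\<lambda>m. cnj (f m)) has_field_derivative b) (at m)" using cf[OF m] by (auto simp: field_differentiable_def)
    have "((\<lambda>m. cnj (f m)) has_derivative (\<lambda>h. cnj (a * h))) (at m)"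
      using bounded_linear.has_derivative[OF bounded_linear_cnj a[unfolded has_field_derivative_def]] .
    then have "(\<lambda>h. cnj (a * h)) = (*) b"
      using b unfolding has_field_derivative_def by (rule has_derivative_unique)
    then have "cnj (a * 1) = b * 1" "cnj (a * \<i>) = b * \<i>" by (rule fun_cong)+
    then have "a = 0" by (simp add: complex_eq_iff)
    then show ?thesis using a has_field_derivative_at_within by blast
  qed
  from has_field_derivative_zero_constant[OF convex_ball this]
  obtain k where "\<And>x. x \<in> ball l r \<Longrightarrow> f x = k" by blast
  then show ?thesis using m r by simp
qed

section \<open>The kernel of an operator on the Riemann surface\<close>

context star_pair
begin

lemma disk_quot_B: "y \<in> unit_disk \<Longrightarrow> disk_quot B y \<in> bergman"
  by (rule disk_quot_bergman(1)[OF hol le1])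

lemma disk_quot_fibre:
  assumes "w \<in> fibre B l" "x \<in> fibre B l"
  shows "disk_quot B w x = (if x = w then deriv B w else 0)"
  using assms by (auto simp: disk_quot_def div_diff_def fibre_def)

text \<open>If U f(z) were the sum of c(z,w) f(w) B'(z)/B'(w) over the points w of the fibre of z,
  the divided difference at w would isolate one term, and this quotient would be c(z,w).\<close>

definition kap :: "complex \<Rightarrow> complex \<Rightarrow> complex" where
  "kap z w = U (disk_quot B w) z / deriv B z"

text \<open>In the fibre identity for the divided differences at w and at z each side reduces to one
  term, since each difference vanishes on the fibre except at its own point. The same number is thus
  expressed once through U and once through V.\<close>

lemma kap_adjoint:
  assumes l: "l \<in> regular_values B" and z: "z \<in> fibre B l" and w: "w \<in> fibre B l"
  shows "kap z w = cnj (V (disk_quot B z) w / deriv B w)"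
proof -
  have zD: "z \<in> unit_disk" "w \<in> unit_disk" using z w by (auto simp: fibre_def)
  have nz: "deriv B z \<noteq> 0" "deriv B w \<noteq> 0"
    using z w l by (auto intro!: deriv_nonzero simp: regular_domain_iff fibre_def)
  have "U (disk_quot B w) z * cnj (disk_quot B z z) / of_real ((cmod (deriv B z))\<^sup>2)
      = disk_quot B w w * cnj (V (disk_quot B z) w) / of_real ((cmod (deriv B w))\<^sup>2)"
  proof (rule fibre_identity[OF l disk_quot_B[OF zD(2)] disk_quot_B[OF zD(1)] z w])
    show "U (disk_quot B w) x = 0 \<or> disk_quot B z x = 0" if "x \<in> fibre B l" "x \<noteq> z" for x
      using disk_quot_fibre[OF z that(1)] that(2) by simp
    show "disk_quot B w x = 0 \<or> V (disk_quot B z) x = 0" if "x \<in> fibre B l" "x \<noteq> w" for x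
      using disk_quot_fibre[OF w that(1)] that(2) by simp
  qed
  then have "U (disk_quot B w) z * cnj (deriv B z) / (deriv B z * cnj (deriv B z))
      = deriv B w * cnj (V (disk_quot B z) w) / (deriv B w * cnj (deriv B w))"
    unfolding complex_norm_square disk_quot_fibre[OF z z] disk_quot_fibre[OF w w] by simp
  then show ?thesis
    unfolding kap_def complex_cnj_divide using nz by simp
qed

text \<open>Expressed through U the kernel is holomorphic along the pair of sections; expressed
  through V its conjugate is.\<close>

lemma kap_section:
  assumes ec: "evenly_covered B l r c C \<delta> \<sigma>" and z: "z \<in> fibre B l" and w: "w \<in> fibre B l" and m: "m \<in> ball l r"
  shows "kap (\<sigma> z m) (\<sigma> w m) = kap z w"
proof -
  interpret evenly_covered B l r c C \<delta> \<sigma> by (rule ec)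
  have reg: "k \<in> regular_values B" if "k \<in> ball l r" for k using regular that by blast
  have fib: "\<sigma> x k \<in> fibre B k" if "x \<in> fibre B l" "k \<in> ball l r" for x k
    using \<sigma>_section[OF that] by (simp add: fibre_def)
  have inv: "a / deriv B (\<sigma> x k) = a * deriv (\<sigma> x) k" if "x \<in> fibre B l" "k \<in> ball l r" for a x k
  proof -
    have "deriv (\<sigma> x) k * deriv B (\<sigma> x k) = 1" by (rule \<sigma>_deriv[OF that])
    then have "deriv (\<sigma> x) k = 1 / deriv B (\<sigma> x k)"
      by (metis div_by_1 mult.commute nonzero_eq_divide_eq mult_zero_right zero_neq_one)
    then show ?thesis by simp
  qed
  have dif: "(\<lambda>k. T (disk_quot B (\<sigma> y k)) (\<sigma> x k) * deriv (\<sigma> x) k) field_differentiable (at k)"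
    if T: "bounded_op T" and xy: "x \<in> fibre B l" "y \<in> fibre B l" and k: "k \<in> ball l r" for T x y k
  proof (rule field_differentiable_mult)
    show "(\<lambda>k. T (disk_quot B (\<sigma> y k)) (\<sigma> x k)) field_differentiable (at k)"
    proof (rule op_disk_quot_differentiable[OF T hol le1])
      show "(\<sigma> x has_field_derivative deriv (\<sigma> x) k) (at k)" by (rule holomorphic_derivI[OF \<sigma>_hol[OF xy(1)] open_ball k])
      show "(\<sigma> y has_field_derivative deriv (\<sigma> y) k) (at k)" by (rule holomorphic_derivI[OF \<sigma>_hol[OF xy(2)] open_ball k])
      show "\<sigma> x k \<in> unit_disk" "\<sigma> y k \<in> unit_disk" using \<sigma>_section xy k by blast+
    qed
    show "deriv (\<sigma> x) field_differentiable (at k)"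
      using holomorphic_deriv[OF \<sigma>_hol[OF xy(1)] open_ball] k holomorphic_on_imp_differentiable_at open_ball by blast
  qed
  let ?f = "\<lambda>k. U (disk_quot B (\<sigma> w k)) (\<sigma> z k) * deriv (\<sigma> z) k"
  have kf: "kap (\<sigma> z k) (\<sigma> w k) = ?f k" if "k \<in> ball l r" for k
    unfolding kap_def by (rule inv[OF z that])
  have cf: "cnj (?f k) = V (disk_quot B (\<sigma> z k)) (\<sigma> w k) * deriv (\<sigma> w) k" if k: "k \<in> ball l r" for k
    using kap_adjoint[OF reg[OF k] fib[OF z k] fib[OF w k]] kf[OF k] inv[OF w k] by simp
  have "?f m = ?f l"
  proof (rule holomorphic_and_antiholomorphic_constant[OF _ _ m pos(1)])
    show "?f field_differentiable (at k)" if "k \<in> ball l r" for k by (rule dif[OF U z w that])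
    fix k assume k: "k \<in> ball l r"
    obtain d where d: "((\<lambda>k. V (disk_quot B (\<sigma> z k)) (\<sigma> w k) * deriv (\<sigma> w) k) has_field_derivative d) (at k)"
      using dif[OF V w z k] unfolding field_differentiable_def by blast
    have "((\<lambda>k. cnj (?f k)) has_field_derivative d) (at k)"
      by (rule has_field_derivative_transform_within_open[OF d open_ball k]) (rule cf[symmetric])
    then show "(\<lambda>k. cnj (?f k)) field_differentiable (at k)" unfolding field_differentiable_def by blast
  qed
  then show ?thesis
    using kf[OF m] kf[OF center_in] \<sigma>_center[OF z] \<sigma>_center[OF w] by simp
qed

lemma kap_component:
  assumes G: "G \<in> components (riemann_surface B)" and p: "(z, w) \<in> G" "(z', w') \<in> G"
  shows "kap z w = kap z' w'"
proof -
  have "(\<lambda>p. kap (fst p) (snd p)) constant_on G"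
  proof (rule locally_constant_imp_constant[OF in_components_connected[OF G]])
    fix p assume "p \<in> G"
    then obtain z w where zw: "p = (z, w)" "(z, w) \<in> G" by (metis surj_pair)
    note d = sheetedD[OF component_sheeted[OF G] zw(2)]
    define l where "l = B z"
    have l: "l \<in> regular_values B" and zf: "z \<in> fibre B l" and wf: "w \<in> fibre B l"
      using d by (auto simp: regular_domain_iff fibre_def l_def)
    obtain r c C \<delta> \<sigma> where ec: "evenly_covered B l r c C \<delta> \<sigma>"
      using evenly_covered_exists[OF l] by blast
    interpret evenly_covered B l r c C \<delta> \<sigma> by (rule ec)
    let ?N = "\<sigma> z ` ball l r \<times> \<sigma> w ` ball l r"
    have "openin (top_of_set G) (G \<inter> ?N)"
      by (intro openin_open_Int open_Times open_sheet zf wf)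
    moreover have "p \<in> G \<inter> ?N"
      using center_in_sheet[OF zf] center_in_sheet[OF wf] zw by blast
    moreover have "kap (fst q) (snd q) = kap (fst p) (snd p)" if q: "q \<in> G \<inter> ?N" for q
    proof -
      obtain x y where xy: "q = (x, y)" "(x, y) \<in> G" "x \<in> \<sigma> z ` ball l r" "y \<in> \<sigma> w ` ball l r" using q by blast
      have "B x = B y" using sheetedD(3)[OF component_sheeted[OF G] xy(2)] .
      then have "x = \<sigma> z (B x)" "y = \<sigma> w (B x)" "B x \<in> ball l r"
        using sheet_B[OF zf xy(3)] sheet_B[OF wf xy(4)] by auto
      then show ?thesis using kap_section[OF ec zf wf, of "B x"] xy(1) zw(1) by simp
    qed
    ultimately show "\<exists>T. openin (top_of_set G) T \<and> p \<in> T \<and> (\<forall>x\<in>T. kap (fst x) (snd x) = kap (fst p) (snd p))"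
      by blast
  qed
  then have "kap (fst (z, w)) (snd (z, w)) = kap (fst (z', w')) (snd (z', w'))"
    using p unfolding constant_on_def by metis
  then show ?thesis by simp
qed

text \<open>For q the divided difference at z, a nonzero constant \<kappa> would give |V q(x)| =
  |\<kappa>| |B'(x)| \<ge> |\<kappa>| \<delta>/(1 - |x|) at all of the infinitely many x related to
  z; a Bergman function allows this at only finitely many points of a fibre.\<close>

lemma kap_zero_infinite:
  assumes G: "G \<in> components (riemann_surface B)" and inf: "multiplicity_of_component B G = \<infinity>"
    and p: "(z, w) \<in> G"
  shows "kap z w = 0"
proof (rule ccontr)
  assume nz: "kap z w \<noteq> 0"
  note sh = component_sheeted[OF G]
  note d = sheetedD[OF sh p]
  define l where "l = B z"
  have l: "l \<in> regular_values B" and zf: "z \<in> fibre B l"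
    using d by (auto simp: regular_domain_iff fibre_def l_def)
  obtain r c C \<delta> \<sigma> where ec: "evenly_covered B l r c C \<delta> \<sigma>"
    using evenly_covered_exists[OF l] by blast
  interpret evenly_covered B l r c C \<delta> \<sigma> by (rule ec)
  have sub: "G `` {z} \<subseteq> fibre B l" using sheeted_fibre_subset[OF sh, of z] by (simp add: l_def)
  have "finite (G `` {z})"
  proof (rule finite_large_values[OF _ sub])
    show "V (disk_quot B z) \<in> bergman" by (rule bounded_opD(1)[OF V disk_quot_B[OF d(4)]])
    show "0 < cmod (kap z w) * \<delta>" using nz pos by simp
    fix x assume x: "x \<in> G `` {z}"
    then have xG: "(z, x) \<in> G" by simp
    have xf: "x \<in> fibre B l" using x sub by blast
    have nzx: "deriv B x \<noteq> 0" by (rule deriv_nonzero[OF fibre_regular[OF xf]])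
    have "kap z w = cnj (V (disk_quot B z) x / deriv B x)"
      using kap_component[OF G p xG] kap_adjoint[OF l zf xf] by simp
    then have "cmod (kap z w) = cmod (V (disk_quot B z) x) / cmod (deriv B x)"
      by (simp only: complex_mod_cnj norm_divide)
    then have e: "cmod (V (disk_quot B z) x) = cmod (kap z w) * cmod (deriv B x)" using nzx by simp
    have "\<delta> \<le> (1 - cmod x) * cmod (deriv B x)"
      using expanding fibre_disk[OF xf] center_in by auto
    then have "cmod (kap z w) * \<delta> \<le> cmod (kap z w) * ((1 - cmod x) * cmod (deriv B x))"
      by (rule mult_left_mono) simp
    then show "cmod (kap z w) * \<delta> \<le> cmod (V (disk_quot B z) x) * (1 - cmod x)"
      unfolding e by (simp add: ac_simps)
  qed
  then show False using inf multiplicity_eq[OF G d(1)] by (simp add: ecard_def)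
qed

text \<open>Once the kernel vanishes off the diagonal, V of the divided difference at z vanishes at
  the other points of the fibre. This admits an arbitrary f in the fibre identity, which becomes U
  f(z) = c f(z) with c the constant kernel on the diagonal.\<close>

theorem scalar_if_infinite:
  assumes inf: "\<And>G. G \<in> nontrivial_components B \<Longrightarrow> multiplicity_of_component B G = \<infinity>"
  shows "U \<in> scalar_ops"
proof -
  have zero: "V (disk_quot B z) w = 0"
    if zE: "z \<in> regular_domain B" and w: "w \<in> fibre B (B z)" "w \<noteq> z" for z w
  proof -
    have l: "B z \<in> regular_values B" and zf: "z \<in> fibre B (B z)" and zw: "(z, w) \<in> riemann_surface B"
      using zE w by (auto simp: regular_domain_iff fibre_def riemann_surface_iff)
    obtain G where G: "G \<in> nontrivial_components B" "(z, w) \<in> G"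
      using surface_point_cases[OF zw] w(2) by metis
    then have "kap z w = 0"
      using inf[OF G(1)] by (intro kap_zero_infinite[of G]) (auto simp: nontrivial_components_def)
    moreover have "deriv B w \<noteq> 0"
      using zw deriv_nonzero by (simp add: riemann_surface_iff)
    ultimately show ?thesis using kap_adjoint[OF l zf w(1)] by simp
  qed
  obtain z0 where z0: "z0 \<in> regular_domain B" using regular_domain_nonempty by blast
  define c where "c = kap z0 z0"
  have c: "kap z z = c" if "z \<in> regular_domain B" for z
    unfolding c_def using that z0
    by (intro kap_component[OF trivial_component]) (auto simp: trivial_component_def)
  have onE: "U f z = c * f z" if f: "f \<in> bergman" and zE: "z \<in> regular_domain B" for f z
  proof -
    have zD: "z \<in> unit_disk" and l: "B z \<in> regular_values B" and zf: "z \<in> fibre B (B z)"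
      using zE by (auto simp: regular_domain_iff fibre_def)
    have nz: "deriv B z \<noteq> 0" by (rule deriv_nonzero[OF zE])
    have "U f z * cnj (disk_quot B z z) / of_real ((cmod (deriv B z))\<^sup>2)
        = f z * cnj (V (disk_quot B z) z) / of_real ((cmod (deriv B z))\<^sup>2)"
    proof (rule fibre_identity[OF l f disk_quot_B[OF zD] zf zf])
      show "U f x = 0 \<or> disk_quot B z x = 0" if "x \<in> fibre B (B z)" "x \<noteq> z" for x
        using disk_quot_fibre[OF zf that(1)] that(2) by simp
      show "f x = 0 \<or> V (disk_quot B z) x = 0" if "x \<in> fibre B (B z)" "x \<noteq> z" for x
        using zero[OF zE that] by simp
    qed
    then have "U f z * cnj (deriv B z) = f z * cnj (V (disk_quot B z) z)"
      unfolding disk_quot_fibre[OF zf zf] using nz by simp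
    moreover have "cnj (V (disk_quot B z) z) = c * cnj (deriv B z)"
      using kap_adjoint[OF l zf zf] c[OF zE] nz by (simp add: field_simps)
    ultimately show ?thesis using nz by simp
  qed
  have "U f = (\<lambda>z. c * f z)" if f: "f \<in> bergman" for f
  proof
    fix z
    note Uf = bounded_opD(1)[OF U f]
    show "U f z = c * f z"
    proof (cases "z \<in> unit_disk")
      case True
      show ?thesis
      proof (rule analytic_continuation_open[OF open_regular_domain open_ball regular_domain_nonempty connected_ball _ _ _ _ True])
        show "regular_domain B \<subseteq> unit_disk" by (auto simp: regular_domain_def)
        show "U f holomorphic_on unit_disk" by (rule bergmanD(1)[OF Uf])
        show "(\<lambda>z. c * f z) holomorphic_on unit_disk" by (intro holomorphic_intros bergmanD(1)[OF f])
        show "U f x = c * f x" if "x \<in> regular_domain B" for x by (rule onE[OF f that])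
      qed
    next
      case False
      then show ?thesis using bergmanD(2)[OF Uf False] bergmanD(2)[OF f False] by simp
    qed
  qed
  then have "U = (\<lambda>f\<in>bergman. \<lambda>z. c * f z)"
    using bounded_opD(4)[OF U] by (auto simp: fun_eq_iff restrict_def)
  then show ?thesis unfolding scalar_ops_def by blast
qed

end

text \<open>Taking adjoints in U A = A U, with A the adjoint of multiplication by B, gives the
  commutation of V with multiplication.\<close>

lemma (in asymptotic_isometry) V_star_star_pair:
  assumes "U \<in> V_star B"
  shows "\<exists>V. star_pair B U V"
proof -
  note M = mult_op_bounded[OF hol le1]
  have M': "bounded_op (mult_op B)" by (rule M)
  note A = adjoint_op[OF M']
  have U: "bounded_op U" and c1: "\<And>f. f \<in> bergman \<Longrightarrow> U (mult_op B f) = mult_op B (U f)"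
    and c2: "\<And>f. f \<in> bergman \<Longrightarrow> U (adjoint_op (mult_op B) f) = adjoint_op (mult_op B) (U f)"
    using assms by (auto simp: V_star_def commutant_def)
  obtain V where V: "bounded_op V" and adj: "\<And>f g. f \<in> bergman \<Longrightarrow> g \<in> bergman \<Longrightarrow> bergman_inner (U f) g = bergman_inner f (V g)"
    using adjoint_exists[OF U] by blast
  note Ub = bounded_opD(1)[OF U] and Vb = bounded_opD(1)[OF V] and Mb = bounded_opD(1)[OF M'] and Ab = bounded_opD(1)[OF A(1)]
  have MB: "mult_op B f = (\<lambda>z. B z * f z)" if "f \<in> bergman" for f
    using that by (simp add: mult_op_def)
  have adjM: "bergman_inner f (mult_op B g) = bergman_inner (adjoint_op (mult_op B) f) g" if "f \<in> bergman" "g \<in> bergman" for f g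
    using A(2)[OF that(2,1)] by (metis bergman_inner_commute)
  have "V (mult_op B g) = mult_op B (V g)" if g: "g \<in> bergman" for g
  proof (rule bergman_inner_ext[OF Vb[OF Mb[OF g]] Mb[OF Vb[OF g]]])
    fix f assume f: "f \<in> bergman"
    have "bergman_inner f (V (mult_op B g)) = bergman_inner (U f) (mult_op B g)"
      by (rule adj[OF f Mb[OF g], symmetric])
    also have "\<dots> = bergman_inner (adjoint_op (mult_op B) (U f)) g" by (rule adjM[OF Ub[OF f] g])
    also have "\<dots> = bergman_inner (U (adjoint_op (mult_op B) f)) g" by (simp only: c2[OF f])
    also have "\<dots> = bergman_inner (adjoint_op (mult_op B) f) (V g)" by (rule adj[OF Ab[OF f] g])
    also have "\<dots> = bergman_inner f (mult_op B (V g))" by (rule adjM[OF f Vb[OF g], symmetric])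
    finally show "bergman_inner f (V (mult_op B g)) = bergman_inner f (mult_op B (V g))" .
  qed
  then have V_comm: "V (\<lambda>z. B z * g z) = (\<lambda>z. B z * V g z)" if "g \<in> bergman" for g
    using MB[OF that] MB[OF Vb[OF that]] that by metis
  have U_comm: "U (\<lambda>z. B z * g z) = (\<lambda>z. B z * U g z)" if "g \<in> bergman" for g
    using c1[OF that] MB[OF that] MB[OF Ub[OF that]] by metis
  have "star_pair B U V"
    by unfold_locales (fact U V adj U_comm V_comm)+
  then show ?thesis by blast
qed

theorem (in asymptotic_isometry) V_star_scalar_if_infinite:
  assumes "\<And>G. G \<in> nontrivial_components B \<Longrightarrow> multiplicity_of_component B G = \<infinity>"
  shows "V_star B = scalar_ops"
proof
  show "scalar_ops \<subseteq> V_star B" by (rule scalar_op_in_V_star[OF hol le1])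
  show "V_star B \<subseteq> scalar_ops"
  proof
    fix U assume "U \<in> V_star B"
    then obtain V where "star_pair B U V" using V_star_star_pair by blast
    then interpret star_pair B U V .
    show "U \<in> scalar_ops" by (rule scalar_if_infinite[OF assms])
  qed
qed

section \<open>Components of finite multiplicity\<close>

lemma Moebius_ratio: "Moebius_function 0 a z = (z - a) / (1 - cnj a * z)"
  by (simp add: Moebius_function_def)

lemma Moebius_cmod_commute: "cmod (Moebius_function 0 a z) = cmod (Moebius_function 0 z a)"
proof -
  have "cmod (1 - cnj a * z) = cmod (cnj (1 - cnj a * z))" by (simp only: complex_mod_cnj)
  also have "\<dots> = cmod (1 - cnj z * a)" by (simp add: mult.commute)
  finally show ?thesis by (simp add: Moebius_ratio norm_divide norm_minus_commute)
qed

text \<open>The quotient by the Moebius factor is the divided difference at a times 1 -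
  \<open>cnj a * z\<close>, which is holomorphic at a as well. Its bound is Schwarz-Pick with f(a) =
  0, in the infinitesimal form when z = a.\<close>

lemma bounded_divide_zero:
  assumes f: "f holomorphic_on unit_disk" "\<And>z. z \<in> unit_disk \<Longrightarrow> cmod (f z) \<le> 1"
    and a: "a \<in> unit_disk" "f a = 0"
  shows "\<exists>g. g holomorphic_on unit_disk \<and> (\<forall>z\<in>unit_disk. cmod (g z) \<le> 1 \<and> f z = g z * Moebius_function 0 a z)"
proof (intro exI conjI ballI)
  let ?g = "\<lambda>z. div_diff f a z * (1 - cnj a * z)"
  show "?g holomorphic_on unit_disk"
    by (intro holomorphic_intros div_diff_holomorphic f(1))
  fix z :: complex assume z: "z \<in> unit_disk"
  have nz: "1 - cnj a * z \<noteq> 0" using a z by (intro Moebius_denominator_nonzero) auto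
  show "f z = ?g z * Moebius_function 0 a z"
    using nz a(2) by (cases "z = a") (simp_all add: div_diff_def Moebius_ratio)
  show "cmod (?g z) \<le> 1"
  proof (cases "z = a")
    case True
    have "(1 - (cmod a)\<^sup>2) * cmod (deriv f a) \<le> 1"
      using Schwarz_Pick_deriv[OF f a(1)] a(2) by simp
    moreover have "cmod (1 - cnj a * a) = 1 - (cmod a)\<^sup>2"
    proof -
      have "1 - cnj a * a = of_real (1 - (cmod a)\<^sup>2)" by (simp only: of_real_diff of_real_1 complex_norm_square mult.commute[of "cnj a"])
      moreover have "0 \<le> 1 - (cmod a)\<^sup>2" using a(1) by (simp add: power_le_one)
      ultimately show ?thesis by (simp only: norm_of_real abs_of_nonneg)
    qed
    ultimately show ?thesis unfolding True by (simp add: div_diff_def norm_mult mult.commute)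
  next
    case False
    have "cmod (f z) * cmod (1 - cnj a * z) \<le> cmod (z - a)"
      using Schwarz_Pick[OF f a(1) z] a(2) by simp
    then show ?thesis using False a(2) by (simp add: div_diff_def norm_mult norm_divide divide_le_eq)
  qed
qed

lemma bounded_divide_zeros:
  assumes "finite A" "A \<subseteq> unit_disk"
    and "f holomorphic_on unit_disk" "\<And>z. z \<in> unit_disk \<Longrightarrow> cmod (f z) \<le> 1" "\<And>a. a \<in> A \<Longrightarrow> f a = 0"
  shows "\<exists>g. g holomorphic_on unit_disk \<and> (\<forall>z\<in>unit_disk. cmod (g z) \<le> 1 \<and> f z = g z * (\<Prod>a\<in>A. Moebius_function 0 a z))"
  using assms
proof (induction A)
  case empty
  show ?case by (rule exI[of _ f]) (simp add: empty)
next
  case (insert b A)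
  have "A \<subseteq> unit_disk" "\<And>a. a \<in> A \<Longrightarrow> f a = 0" using insert.prems(1,4) by auto
  from insert.IH[OF this(1) insert.prems(2,3) this(2)]
  obtain g where g: "g holomorphic_on unit_disk" "\<And>z. z \<in> unit_disk \<Longrightarrow> cmod (g z) \<le> 1"
    "\<And>z. z \<in> unit_disk \<Longrightarrow> f z = g z * (\<Prod>a\<in>A. Moebius_function 0 a z)"
    by auto
  have b: "b \<in> unit_disk" using insert.prems(1) by simp
  \<comment> \<open>So the zero of f at b survives in the quotient g, which can be divided once
    more.\<close>
  have "(\<Prod>a\<in>A. Moebius_function 0 a b) \<noteq> 0"
  proof -
    have "Moebius_function 0 a b \<noteq> 0" if "a \<in> A" for a
    proof -
      have "1 - cnj a * b \<noteq> 0" using insert.prems(1) that b by (intro Moebius_denominator_nonzero) auto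
      moreover have "b \<noteq> a" using insert.hyps(2) that by blast
      ultimately show ?thesis by (simp add: Moebius_ratio)
    qed
    then show ?thesis using insert.hyps(1) by simp
  qed
  moreover have "f b = 0" using insert.prems(4) by simp
  ultimately have "g b = 0" using g(3)[OF b] by simp
  from bounded_divide_zero[OF g(1,2) b this]
  obtain h where h: "h holomorphic_on unit_disk" "\<forall>z\<in>unit_disk. cmod (h z) \<le> 1 \<and> g z = h z * Moebius_function 0 b z"
    by auto
  show ?case
  proof (intro exI[of _ h] conjI ballI h(1))
    fix z :: complex assume z: "z \<in> unit_disk"
    show "cmod (h z) \<le> 1" using h(2) z by blast
    have "f z = (h z * Moebius_function 0 b z) * (\<Prod>a\<in>A. Moebius_function 0 a z)"
      using g(3)[OF z] h(2) z by simp
    then show "f z = h z * (\<Prod>a\<in>insert b A. Moebius_function 0 a z)"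
      using insert.hyps by (simp add: mult.assoc)
  qed
qed

lemma deriv_mult_zero:
  assumes "u field_differentiable at x" "v field_differentiable at x" "u x = 0"
  shows "deriv (\<lambda>x. u x * v x) x = deriv u x * (v x :: complex)"
  using deriv_mult[OF assms(1,2)] assms(3) by simp

lemma Moebius_differentiable:
  assumes "a \<in> unit_disk" "z \<in> unit_disk"
  shows "Moebius_function 0 a field_differentiable at z"
  using Moebius_function_holomorphic[of a 0] assms
  by (auto intro: holomorphic_on_imp_differentiable_at)

lemma deriv_Moebius_center:
  assumes "a \<in> unit_disk"
  shows "(1 - (cmod a)\<^sup>2) * cmod (deriv (Moebius_function 0 a) a) = 1"
proof -
  have nz: "1 - cnj a * a \<noteq> 0" using assms by (intro Moebius_denominator_nonzero) auto
  have "((\<lambda>z. (z - a) / (1 - cnj a * z)) has_field_derivative ((1 - 0) * (1 - cnj a * a) - (a - a) * (0 - cnj a * 1)) / ((1 - cnj a * a) * (1 - cnj a * a))) (at a)"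
    using nz by (intro DERIV_divide DERIV_diff DERIV_const DERIV_ident DERIV_cmult) auto
  then have "(Moebius_function 0 a has_field_derivative ((1 - 0) * (1 - cnj a * a) - (a - a) * (0 - cnj a * 1)) / ((1 - cnj a * a) * (1 - cnj a * a))) (at a)"
    unfolding Moebius_ratio[abs_def] .
  from DERIV_imp_deriv[OF this] have "deriv (Moebius_function 0 a) a = 1 / (1 - cnj a * a)"
    using nz by simp
  moreover have "1 - cnj a * a = of_real (1 - (cmod a)\<^sup>2)" by (simp only: of_real_diff of_real_1 complex_norm_square mult.commute[of "cnj a"])
  moreover have "0 < 1 - (cmod a)\<^sup>2" using assms by (simp add: power_less_one_iff)
  ultimately show ?thesis by (simp only: norm_divide norm_of_real norm_one abs_of_pos) simp
qed

section \<open>Derivative bounds along fibres and removable singularities\<close>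

context asymptotic_isometry
begin

text \<open>Composed with the Moebius map that sends l to 0, B vanishes on A and at p. Dividing by
  the factors of A leaves a self-map of the disk that still vanishes at p, and Schwarz-Pick bounds
  its derivative there; every factor removed sharpens the bound for B'.\<close>

lemma deriv_le_prod_fibre:
  assumes p: "p \<in> fibre B l" and A: "finite A" "A \<subseteq> fibre B l" "p \<notin> A"
  shows "(1 - (cmod p)\<^sup>2) * cmod (deriv B p) \<le> (1 - (cmod l)\<^sup>2) * (\<Prod>a\<in>A. cmod (Moebius_function 0 p a))"
proof -
  have pD: "p \<in> unit_disk" "B p = l" using p by (auto simp: fibre_def)
  have l: "cmod l < 1" using lt1[OF pD(1)] pD(2) by simp
  have AD: "A \<subseteq> unit_disk" using A by (auto simp: fibre_def)
  let ?f = "\<lambda>z. Moebius_function 0 l (B z)"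
  have f: "?f holomorphic_on unit_disk"
    by (rule holomorphic_on_compose_gen[OF hol Moebius_function_holomorphic[of l 0], unfolded o_def])
      (use l lt1 in auto)
  have f1: "cmod (?f z) \<le> 1" if "z \<in> unit_disk" for z
    using Moebius_function_norm_lt_1[OF l lt1[OF that]] by (rule less_imp_le)
  have f0: "?f a = 0" if "a \<in> A" for a
    using that A(2) by (auto simp: fibre_def Moebius_ratio)
  obtain g where g: "g holomorphic_on unit_disk" "\<And>z. z \<in> unit_disk \<Longrightarrow> cmod (g z) \<le> 1"
    "\<And>z. z \<in> unit_disk \<Longrightarrow> ?f z = g z * (\<Prod>a\<in>A. Moebius_function 0 a z)"
    using bounded_divide_zeros[OF A(1) AD f f1 f0] by auto
  let ?P = "\<lambda>z. \<Prod>a\<in>A. Moebius_function 0 a z"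
  have Pnz: "?P p \<noteq> 0"
  proof -
    have "Moebius_function 0 a p \<noteq> 0" if "a \<in> A" for a
    proof -
      have "1 - cnj a * p \<noteq> 0" using AD that pD by (intro Moebius_denominator_nonzero) auto
      moreover have "p \<noteq> a" using A(3) that by blast
      ultimately show ?thesis by (simp add: Moebius_ratio)
    qed
    then show ?thesis using A(1) by simp
  qed
  have gp: "g p = 0" using g(3)[OF pD(1)] Pnz pD(2) by (simp add: Moebius_ratio)
  have dP: "?P field_differentiable at p"
  proof -
    have "?P holomorphic_on unit_disk"
      by (intro holomorphic_on_prod Moebius_function_holomorphic) (use AD in auto)
    then show ?thesis using pD(1) by (auto intro: holomorphic_on_imp_differentiable_at)
  qed
  have dg: "g field_differentiable at p"
    using g(1) pD(1) by (auto intro: holomorphic_on_imp_differentiable_at)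
  have dB: "B field_differentiable at p"
    using hol pD(1) by (auto intro: holomorphic_on_imp_differentiable_at)
  have lD: "l \<in> unit_disk" using l by simp
  have "deriv ?f p = deriv (\<lambda>z. g z * ?P z) p"
    by (rule deriv_cong_ev[OF _ refl], rule eventually_mono[OF eventually_nhds_in_open[OF open_ball pD(1)]], rule g(3))
  also have "\<dots> = deriv g p * ?P p" by (rule deriv_mult_zero[OF dg dP gp])
  finally have e1: "deriv ?f p = deriv g p * ?P p" .
  have "deriv ?f p = deriv (Moebius_function 0 l) l * deriv B p"
    using deriv_chain[OF dB, of "Moebius_function 0 l"] Moebius_differentiable[OF lD lD] pD(2) by (simp add: o_def)
  then have e2: "cmod (deriv (Moebius_function 0 l) l) * cmod (deriv B p) = cmod (deriv g p) * cmod (?P p)"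
    using e1 by (metis norm_mult)
  have gb: "(1 - (cmod p)\<^sup>2) * cmod (deriv g p) \<le> 1"
    using Schwarz_Pick_deriv[OF g(1,2) pD(1)] gp by simp
  have "(1 - (cmod p)\<^sup>2) * cmod (deriv B p)
      = (1 - (cmod l)\<^sup>2) * cmod (deriv (Moebius_function 0 l) l) * ((1 - (cmod p)\<^sup>2) * cmod (deriv B p))"
    unfolding deriv_Moebius_center[OF lD] by simp
  also have "\<dots> = (1 - (cmod l)\<^sup>2) * (1 - (cmod p)\<^sup>2) * (cmod (deriv (Moebius_function 0 l) l) * cmod (deriv B p))"
    by (simp add: ac_simps)
  also have "\<dots> = (1 - (cmod l)\<^sup>2) * cmod (?P p) * ((1 - (cmod p)\<^sup>2) * cmod (deriv g p))"
    unfolding e2 by (simp add: ac_simps)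
  also have "\<dots> \<le> (1 - (cmod l)\<^sup>2) * cmod (?P p) * 1"
    using l by (intro mult_left_mono gb mult_nonneg_nonneg) (auto simp: power_le_one)
  also have "cmod (?P p) = (\<Prod>a\<in>A. cmod (Moebius_function 0 p a))"
    unfolding prod_norm[symmetric] by (intro prod.cong refl Moebius_cmod_commute)
  finally show ?thesis by simp
qed

lemma regular_domain_subset: "regular_domain B \<subseteq> unit_disk"
  by (auto simp: regular_domain_def)

text \<open>Irregular points are finite in number on compact sets, hence isolated.\<close>

lemma eventually_regular_domain:
  assumes a: "a \<in> unit_disk"
  shows "\<exists>s>0. cball a s \<subseteq> unit_disk \<and> cball a s - {a} \<subseteq> regular_domain B"
proof -
  obtain d where d: "0 < d" "cball a d \<subseteq> unit_disk"
    using a open_contains_cball[of "unit_disk :: complex set"] open_ball[of "0 :: complex" 1] by metis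
  have "finite (cball a d - regular_domain B)"
    using d by (intro irregular_finite_compact) auto
  from finite_set_avoid[OF this, of a] obtain e where e: "0 < e" "\<And>x. x \<in> cball a d - regular_domain B \<Longrightarrow> x \<noteq> a \<Longrightarrow> e \<le> dist a x"
    by auto
  show ?thesis
  proof (intro exI[of _ "min d (e / 2)"] conjI subsetI)
    show "0 < min d (e / 2)" using d e by simp
    fix x
    show "x \<in> unit_disk" if "x \<in> cball a (min d (e / 2))" using that d by auto
    show "x \<in> regular_domain B" if x: "x \<in> cball a (min d (e / 2)) - {a}"
    proof (rule ccontr)
      assume "x \<notin> regular_domain B"
      then have "e \<le> dist a x" using x by (intro e(2)) auto
      moreover have "dist a x \<le> e / 2" using x by simp
      ultimately show False using e(1) by linarith
    qed
  qed
qed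

text \<open>Since irregular points are isolated, Riemann's criterion removes the singularities one
  at a time; the extended value is the limit of F.\<close>

lemma holomorphic_extend_disk:
  assumes F: "F holomorphic_on regular_domain B"
    and lim: "\<And>a. a \<in> unit_disk \<Longrightarrow> a \<notin> regular_domain B \<Longrightarrow> ((\<lambda>z. (z - a) * F z) \<longlongrightarrow> 0) (at a)"
  shows "\<exists>F'. F' holomorphic_on unit_disk \<and> (\<forall>z\<in>regular_domain B. F' z = F z)"
proof -
  let ?L = "\<lambda>a. Lim (at a) F"
  define F' where "F' a = (if a \<in> regular_domain B then F a else ?L a)" for a
  have "F' holomorphic_on unit_disk"
  proof (rule holomorphic_on_open[OF open_ball, THEN iffD2], rule ballI)
    fix a :: complex assume a: "a \<in> unit_disk"
    show "\<exists>f'. (F' has_field_derivative f') (at a)"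
    proof (cases "a \<in> regular_domain B")
      case True
      have "(F has_field_derivative deriv F a) (at a)" by (rule holomorphic_derivI[OF F open_regular_domain True])
      then have "(F' has_field_derivative deriv F a) (at a)"
        by (rule has_field_derivative_transform_within_open[OF _ open_regular_domain True]) (simp add: F'_def)
      then show ?thesis by blast
    next
      case False
      obtain s where s: "0 < s" "cball a s - {a} \<subseteq> regular_domain B"
        using eventually_regular_domain[OF a] by auto
      have sub: "ball a s - {a} \<subseteq> regular_domain B" by (rule order_trans[OF Diff_mono[OF ball_subset_cball order_refl] s(2)])
      have ai: "a \<in> interior (ball a s)" using s(1) by simp
      have Fh: "F holomorphic_on ball a s - {a}" by (rule holomorphic_on_subset[OF F sub])
      have lim': "((\<lambda>z. (z - a) * F z) \<longlongrightarrow> 0) (at a)" by (rule lim[OF a False])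
      obtain g where g: "g holomorphic_on ball a s" "\<And>z. z \<in> ball a s - {a} \<Longrightarrow> g z = F z"
        using holomorphic_on_extend_lim[OF Fh ai] lim' by auto
      have gd: "(g has_field_derivative deriv g a) (at a)"
        by (rule holomorphic_derivI[OF g(1) open_ball]) (use s in simp)
      then have "(g \<longlongrightarrow> g a) (at a)" using DERIV_isCont isCont_def by blast
      then have "(F \<longlongrightarrow> g a) (at a)"
        by (rule Lim_transform_within_open[OF _ open_ball]) (use s g(2) in auto)
      then have L: "?L a = g a" by (intro tendsto_Lim) simp_all
      have "(F' has_field_derivative deriv g a) (at a)"
      proof (rule has_field_derivative_transform_within_open[OF gd open_ball[of a s]])
        show "a \<in> ball a s" using s by simp
        fix x assume x: "x \<in> ball a s"
        show "g x = F' x"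
          using g(2)[of x] L x sub False by (cases "x = a") (auto simp: F'_def)
      qed
      then show ?thesis by blast
    qed
  qed
  then show ?thesis by (intro exI[of _ F']) (simp add: F'_def)
qed

text \<open>Boundedness implies the removability criterion, and the bound passes to the irregular
  points by continuity.\<close>

lemma bounded_holomorphic_extend_disk:
  assumes F: "F holomorphic_on regular_domain B" "\<And>z. z \<in> regular_domain B \<Longrightarrow> cmod (F z) \<le> K"
  shows "\<exists>F'. F' holomorphic_on unit_disk \<and> (\<forall>z\<in>regular_domain B. F' z = F z) \<and> (\<forall>z\<in>unit_disk. cmod (F' z) \<le> K)"
proof -
  have "\<exists>F'. F' holomorphic_on unit_disk \<and> (\<forall>z\<in>regular_domain B. F' z = F z)"
  proof (rule holomorphic_extend_disk[OF F(1)])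
    fix a :: complex assume "a \<in> unit_disk"
    then obtain s where s: "0 < s" "cball a s - {a} \<subseteq> regular_domain B"
      using eventually_regular_domain by metis
    show "((\<lambda>z. (z - a) * F z) \<longlongrightarrow> 0) (at a)"
    proof (rule Lim_null_comparison[where g = "\<lambda>z. cmod (z - a) * K"])
      have "((\<lambda>z. cmod (z - a) * K) \<longlongrightarrow> cmod (a - a) * K) (at a)" by (intro tendsto_intros)
      then show "((\<lambda>z. cmod (z - a) * K) \<longlongrightarrow> 0) (at a)" by simp
      have "\<forall>\<^sub>F z in at a. z \<in> ball a s \<and> z \<noteq> a \<and> z \<in> UNIV" by (rule eventually_at_ball'[OF s(1)])
      then show "\<forall>\<^sub>F z in at a. norm ((z - a) * F z) \<le> cmod (z - a) * K"
      proof eventually_elim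
        case (elim z)
        then have "z \<in> cball a s - {a}" by simp
        then have "z \<in> regular_domain B" using s(2) by blast
        then show ?case unfolding norm_mult by (intro mult_left_mono F(2)) auto
      qed
    qed
  qed
  then obtain F' where F': "F' holomorphic_on unit_disk" "\<And>z. z \<in> regular_domain B \<Longrightarrow> F' z = F z" by auto
  have "cmod (F' z) \<le> K" if z: "z \<in> unit_disk" for z
  proof -
    obtain s where s: "0 < s" "cball z s - {z} \<subseteq> regular_domain B"
      using eventually_regular_domain[OF z] by auto
    have "(F' has_field_derivative deriv F' z) (at z)" by (rule holomorphic_derivI[OF F'(1) open_ball z])
    then have "(F' \<longlongrightarrow> F' z) (at z)" using DERIV_isCont isCont_def by blast
    then have l: "((\<lambda>x. cmod (F' x)) \<longlongrightarrow> cmod (F' z)) (at z)" by (rule tendsto_norm)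
    show ?thesis
    proof (rule tendsto_upperbound[OF l])
      have "\<forall>\<^sub>F x in at z. x \<in> ball z s \<and> x \<noteq> z \<and> x \<in> UNIV" by (rule eventually_at_ball'[OF s(1)])
      then show "\<forall>\<^sub>F x in at z. cmod (F' x) \<le> K"
      proof eventually_elim
        case (elim x)
        then have "x \<in> cball z s - {z}" by simp
        then have "x \<in> regular_domain B" using s(2) by blast
        then show ?case using F(2) F'(2) by simp
      qed
    qed simp
  qed
  then show ?thesis using F' by blast
qed

text \<open>The sections are reparametrised by points x near z in place of values of B: \<tau> w x
  is \<sigma> w (B x).\<close>

lemma sheeted_local:
  assumes G: "sheeted G" and z: "z \<in> regular_domain B"
  obtains N \<tau> where "open N" "z \<in> N" "N \<subseteq> regular_domain B"
    "\<And>w. w \<in> G``{z} \<Longrightarrow> \<tau> w holomorphic_on N" "\<And>w. w \<in> G``{z} \<Longrightarrow> \<tau> w z = w"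
    "\<And>w. w \<in> G``{z} \<Longrightarrow> \<tau> w ` N \<subseteq> regular_domain B"
    "\<And>w x. w \<in> G``{z} \<Longrightarrow> x \<in> N \<Longrightarrow> B (\<tau> w x) = B x"
    "\<And>x. x \<in> N \<Longrightarrow> G``{x} = (\<lambda>w. \<tau> w x) ` (G``{z})"
    "\<And>x. x \<in> N \<Longrightarrow> inj_on (\<lambda>w. \<tau> w x) (G``{z})"
proof -
  define l where "l = B z"
  have l: "l \<in> regular_values B" and zf: "z \<in> fibre B l"
    using z by (auto simp: regular_domain_iff fibre_def l_def)
  obtain r c C \<delta> \<sigma> where ec: "evenly_covered B l r c C \<delta> \<sigma>"
    using evenly_covered_exists[OF l] by blast
  interpret evenly_covered B l r c C \<delta> \<sigma> by (rule ec)
  let ?N = "\<sigma> z ` ball l r"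
  note s = sheeted_section[OF G ec zf]
  have sub: "G``{z} \<subseteq> fibre B l" by (rule s(3)[OF center_in])
  show thesis
  proof (rule that[of ?N "\<lambda>w x. \<sigma> w (B x)"])
    show "open ?N" "z \<in> ?N" by (rule open_sheet[OF zf], rule center_in_sheet[OF zf])
    show "?N \<subseteq> regular_domain B" using \<sigma>_regular[OF zf] by auto
    fix w assume "w \<in> G``{z}"
    then have w: "w \<in> fibre B l" using sub by blast
    show "(\<lambda>x. \<sigma> w (B x)) holomorphic_on ?N"
    proof (rule holomorphic_on_compose_gen[OF _ \<sigma>_hol[OF w], unfolded o_def])
      show "B holomorphic_on ?N" by (rule holomorphic_on_subset[OF hol]) (use \<sigma>_section[OF zf] in auto)
      show "B ` ?N \<subseteq> ball l r" using \<sigma>_section[OF zf] by auto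
    qed
    show "\<sigma> w (B z) = w" using \<sigma>_center[OF w] by (simp add: l_def)
    show "(\<lambda>x. \<sigma> w (B x)) ` ?N \<subseteq> regular_domain B"
      using \<sigma>_regular[OF w] sheet_B(1)[OF zf] by blast
    fix x assume "x \<in> ?N"
    then show "B (\<sigma> w (B x)) = B x" using \<sigma>_section[OF w] sheet_B(1)[OF zf] by blast
  next
    fix x assume x: "x \<in> ?N"
    note sx = sheet_B(1,2)[OF zf x]
    show "G``{x} = (\<lambda>w. \<sigma> w (B x)) ` (G``{z})" using s(1)[OF sx(1)] sx(2) by simp
    show "inj_on (\<lambda>w. \<sigma> w (B x)) (G``{z})" by (rule s(2)[OF sx(1)])
  qed
qed

lemma holomorphic_on_localI:
  assumes "\<And>z. z \<in> S \<Longrightarrow> \<exists>N g. open N \<and> z \<in> N \<and> N \<subseteq> S \<and> g holomorphic_on N \<and> (\<forall>x\<in>N. f x = g x)"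
    and "open S"
  shows "f holomorphic_on S"
proof (rule holomorphic_on_open[OF assms(2), THEN iffD2], rule ballI)
  fix z assume "z \<in> S"
  then obtain N g where N: "open N" "z \<in> N" "g holomorphic_on N" "\<And>x. x \<in> N \<Longrightarrow> f x = g x"
    using assms(1) by metis
  have "(f has_field_derivative deriv g z) (at z)"
    by (rule has_field_derivative_transform_within_open[OF holomorphic_derivI[OF N(3,1,2)] N(1,2)]) (simp add: N(4))
  then show "\<exists>f'. (f has_field_derivative f') (at z)" by blast
qed

text \<open>Locally the sum and the product run over holomorphic branches, and reindexing makes the
  result independent of their labelling.\<close>

lemma sheeted_sum_holomorphic:
  assumes G: "sheeted G" and u: "u holomorphic_on regular_domain B"
  shows "(\<lambda>z. \<Sum>w\<in>G``{z}. u w) holomorphic_on regular_domain B"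
    and "(\<lambda>z. \<Prod>w\<in>G``{z}. u w) holomorphic_on regular_domain B"
proof -
  show "(\<lambda>z. \<Sum>w\<in>G``{z}. u w) holomorphic_on regular_domain B"
  proof (rule holomorphic_on_localI[OF _ open_regular_domain])
    fix z assume z: "z \<in> regular_domain B"
    obtain N \<tau> where N: "open N" "z \<in> N" "N \<subseteq> regular_domain B"
      "\<And>w. w \<in> G``{z} \<Longrightarrow> \<tau> w holomorphic_on N" "\<And>w. w \<in> G``{z} \<Longrightarrow> \<tau> w z = w"
      "\<And>w. w \<in> G``{z} \<Longrightarrow> \<tau> w ` N \<subseteq> regular_domain B"
      "\<And>w x. w \<in> G``{z} \<Longrightarrow> x \<in> N \<Longrightarrow> B (\<tau> w x) = B x"
      "\<And>x. x \<in> N \<Longrightarrow> G``{x} = (\<lambda>w. \<tau> w x) ` (G``{z})"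
      "\<And>x. x \<in> N \<Longrightarrow> inj_on (\<lambda>w. \<tau> w x) (G``{z})"
      by (rule sheeted_local[OF G z]) (rule that)
    have "(\<lambda>x. \<Sum>w\<in>G``{z}. u (\<tau> w x)) holomorphic_on N"
    proof (rule holomorphic_on_sum)
      fix w assume w: "w \<in> G``{z}"
      from holomorphic_on_compose_gen[OF N(4)[OF w] u N(6)[OF w]]
      show "(\<lambda>x. u (\<tau> w x)) holomorphic_on N" unfolding o_def .
    qed
    moreover have "\<forall>x\<in>N. (\<Sum>w\<in>G``{x}. u w) = (\<Sum>w\<in>G``{z}. u (\<tau> w x))"
    proof
      fix x assume x: "x \<in> N"
      show "(\<Sum>w\<in>G``{x}. u w) = (\<Sum>w\<in>G``{z}. u (\<tau> w x))"
        unfolding N(8)[OF x] sum.reindex[OF N(9)[OF x]] o_def ..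
    qed
    ultimately show "\<exists>N g. open N \<and> z \<in> N \<and> N \<subseteq> regular_domain B \<and> g holomorphic_on N \<and> (\<forall>x\<in>N. (\<Sum>w\<in>G``{x}. u w) = g x)"
      by (intro exI[of _ N] exI[of _ "\<lambda>x. \<Sum>w\<in>G``{z}. u (\<tau> w x)"] conjI N(1-3))
  qed
  show "(\<lambda>z. \<Prod>w\<in>G``{z}. u w) holomorphic_on regular_domain B"
  proof (rule holomorphic_on_localI[OF _ open_regular_domain])
    fix z assume z: "z \<in> regular_domain B"
    obtain N \<tau> where N: "open N" "z \<in> N" "N \<subseteq> regular_domain B"
      "\<And>w. w \<in> G``{z} \<Longrightarrow> \<tau> w holomorphic_on N" "\<And>w. w \<in> G``{z} \<Longrightarrow> \<tau> w z = w"
      "\<And>w. w \<in> G``{z} \<Longrightarrow> \<tau> w ` N \<subseteq> regular_domain B"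
      "\<And>w x. w \<in> G``{z} \<Longrightarrow> x \<in> N \<Longrightarrow> B (\<tau> w x) = B x"
      "\<And>x. x \<in> N \<Longrightarrow> G``{x} = (\<lambda>w. \<tau> w x) ` (G``{z})"
      "\<And>x. x \<in> N \<Longrightarrow> inj_on (\<lambda>w. \<tau> w x) (G``{z})"
      by (rule sheeted_local[OF G z]) (rule that)
    have "(\<lambda>x. \<Prod>w\<in>G``{z}. u (\<tau> w x)) holomorphic_on N"
    proof (rule holomorphic_on_prod)
      fix w assume w: "w \<in> G``{z}"
      from holomorphic_on_compose_gen[OF N(4)[OF w] u N(6)[OF w]]
      show "(\<lambda>x. u (\<tau> w x)) holomorphic_on N" unfolding o_def .
    qed
    moreover have "\<forall>x\<in>N. (\<Prod>w\<in>G``{x}. u w) = (\<Prod>w\<in>G``{z}. u (\<tau> w x))"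
    proof
      fix x assume x: "x \<in> N"
      show "(\<Prod>w\<in>G``{x}. u w) = (\<Prod>w\<in>G``{z}. u (\<tau> w x))"
        unfolding N(8)[OF x] prod.reindex[OF N(9)[OF x]] o_def ..
    qed
    ultimately show "\<exists>N g. open N \<and> z \<in> N \<and> N \<subseteq> regular_domain B \<and> g holomorphic_on N \<and> (\<forall>x\<in>N. (\<Prod>w\<in>G``{x}. u w) = g x)"
      by (intro exI[of _ N] exI[of _ "\<lambda>x. \<Prod>w\<in>G``{z}. u (\<tau> w x)"] conjI N(1-3))
  qed
qed

text \<open>The product of the Moebius functions of \<^term>\<open>p\<close> over the points of a fibre of \<^term>\<open>G\<close> is a
  holomorphic self-map of the disk that vanishes at the points related to \<^term>\<open>p\<close>; there the
  Schwarz-Pick inequality bounds the hyperbolic derivative of \<^term>\<open>B\<close> away from its asymptotic value.\<close>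

lemma deriv_le_at_related:
  assumes G: "sheeted G" and fin: "\<And>z. z \<in> regular_domain B \<Longrightarrow> finite (G``{z})"
    and p: "(z1, p) \<in> G"
  shows "(1 - (cmod z1)\<^sup>2) * cmod (deriv B z1) * (\<Prod>w\<in>G``{z1} - {p}. cmod (Moebius_function 0 p w))
    \<le> (1 - (cmod p)\<^sup>2) * cmod (deriv B p)"
proof -
  note d = sheetedD[OF G p]
  have pD: "p \<in> unit_disk" and p1: "cmod p < 1" using d by auto
  let ?M = "Moebius_function 0 p"
  let ?W = "G``{z1}"
  have M: "?M holomorphic_on regular_domain B"
    by (rule holomorphic_on_subset[OF Moebius_function_holomorphic[OF p1] regular_domain_subset])
  have Mb: "cmod (?M w) \<le> 1" if "w \<in> unit_disk" for w
    using Moebius_function_norm_lt_1[OF p1, of w 0] that by simp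
  let ?Q = "\<lambda>z. \<Prod>w\<in>G``{z}. ?M w"
  have Q: "?Q holomorphic_on regular_domain B" by (rule sheeted_sum_holomorphic(2)[OF G M])
  have Qb: "cmod (?Q z) \<le> 1" if "z \<in> regular_domain B" for z
    unfolding prod_norm[symmetric]
    by (rule prod_le_1) (use Mb sheetedD(5)[OF G] in auto)
  obtain Q' where Q': "Q' holomorphic_on unit_disk" "\<And>z. z \<in> regular_domain B \<Longrightarrow> Q' z = ?Q z"
    "\<And>z. z \<in> unit_disk \<Longrightarrow> cmod (Q' z) \<le> 1"
    using bounded_holomorphic_extend_disk[OF Q Qb] by auto
  obtain N \<tau> where N: "open N" "z1 \<in> N" "N \<subseteq> regular_domain B"
    "\<And>w. w \<in> G``{z1} \<Longrightarrow> \<tau> w holomorphic_on N" "\<And>w. w \<in> G``{z1} \<Longrightarrow> \<tau> w z1 = w"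
    "\<And>w. w \<in> G``{z1} \<Longrightarrow> \<tau> w ` N \<subseteq> regular_domain B"
    "\<And>w x. w \<in> G``{z1} \<Longrightarrow> x \<in> N \<Longrightarrow> B (\<tau> w x) = B x"
    "\<And>x. x \<in> N \<Longrightarrow> G``{x} = (\<lambda>w. \<tau> w x) ` (G``{z1})"
    "\<And>x. x \<in> N \<Longrightarrow> inj_on (\<lambda>w. \<tau> w x) (G``{z1})"
    by (rule sheeted_local[OF G d(1)]) (rule that)
  have W: "finite ?W" "p \<in> ?W" using fin[OF d(1)] p by auto
  define v where "v x = (\<Prod>w\<in>?W - {p}. ?M (\<tau> w x))" for x
  have Mt: "(\<lambda>x. ?M (\<tau> w x)) holomorphic_on N" if "w \<in> ?W" for w
    using holomorphic_on_compose_gen[OF N(4)[OF that] M N(6)[OF that]] unfolding o_def .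
  have vh: "v holomorphic_on N" unfolding v_def[abs_def]
    by (rule holomorphic_on_prod, rule Mt) blast
  \<comment> \<open>The branch through p is split off. Its factor vanishes at z1, so the derivative
    of Q' there is the derivative of that factor times the others.\<close>
  have Qv: "Q' x = ?M (\<tau> p x) * v x" if x: "x \<in> N" for x
  proof -
    have "Q' x = ?Q x" by (rule Q'(2)) (use N(3) x in blast)
    also have "\<dots> = (\<Prod>w\<in>?W. ?M (\<tau> w x))" unfolding N(8)[OF x] prod.reindex[OF N(9)[OF x]] o_def ..
    also have "\<dots> = ?M (\<tau> p x) * v x" unfolding v_def by (rule prod.remove[OF W])
    finally show ?thesis .
  qed
  have t1: "\<tau> p z1 = p" by (rule N(5)[OF W(2)])
  have u0: "?M (\<tau> p z1) = 0" unfolding t1 by (simp add: Moebius_ratio)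
  have dif: "f field_differentiable at z1" if "f holomorphic_on N" for f
    by (rule holomorphic_on_imp_differentiable_at[OF that N(1,2)])
  have "deriv Q' z1 = deriv (\<lambda>x. ?M (\<tau> p x) * v x) z1"
    by (rule deriv_cong_ev[OF _ refl], rule eventually_mono[OF eventually_nhds_in_open[OF N(1,2)]], rule Qv)
  also have "\<dots> = deriv (\<lambda>x. ?M (\<tau> p x)) z1 * v z1"
    by (rule deriv_mult_zero[OF dif[OF Mt[OF W(2)]] dif[OF vh] u0])
  also have "deriv (\<lambda>x. ?M (\<tau> p x)) z1 = deriv ?M p * deriv (\<tau> p) z1"
    using deriv_chain[OF dif[OF N(4)[OF W(2)]], of ?M] Moebius_differentiable[OF pD pD] t1 by (simp add: o_def)
  finally have dQ: "cmod (deriv Q' z1) = cmod (deriv ?M p) * cmod (deriv (\<tau> p) z1) * cmod (v z1)"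
    by (simp only: norm_mult)
  have Bd: "B field_differentiable at p" using hol pD by (auto intro: holomorphic_on_imp_differentiable_at)
  have "deriv B z1 = deriv (\<lambda>x. B (\<tau> p x)) z1"
    by (rule deriv_cong_ev[OF _ refl], rule eventually_mono[OF eventually_nhds_in_open[OF N(1,2)]], rule N(7)[OF W(2), symmetric])
  also have "\<dots> = deriv B p * deriv (\<tau> p) z1"
    using deriv_chain[OF dif[OF N(4)[OF W(2)]], of B] Bd t1 by (simp add: o_def)
  finally have dB: "cmod (deriv B z1) = cmod (deriv B p) * cmod (deriv (\<tau> p) z1)" by (simp only: norm_mult)
  have v1: "cmod (v z1) = (\<Prod>w\<in>?W - {p}. cmod (?M w))"
    unfolding v_def prod_norm[symmetric] by (rule prod.cong[OF refl]) (simp add: N(5))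
  have c: "(1 - (cmod z1)\<^sup>2) * cmod (deriv Q' z1) \<le> 1"
  proof -
    have "(1 - (cmod z1)\<^sup>2) * cmod (deriv Q' z1) \<le> 1 - (cmod (Q' z1))\<^sup>2"
      by (rule Schwarz_Pick_deriv[OF Q'(1,3) d(4)])
    then show ?thesis by (rule order_trans) simp
  qed
  have "(1 - (cmod z1)\<^sup>2) * cmod (deriv B z1) * cmod (v z1)
      = ((1 - (cmod p)\<^sup>2) * cmod (deriv ?M p)) * ((1 - (cmod z1)\<^sup>2) * cmod (deriv B z1) * cmod (v z1))"
    unfolding deriv_Moebius_center[OF pD] by simp
  also have "\<dots> = (1 - (cmod p)\<^sup>2) * cmod (deriv B p) * ((1 - (cmod z1)\<^sup>2) * cmod (deriv Q' z1))"
    unfolding dQ dB by (simp add: ac_simps)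
  also have "\<dots> \<le> (1 - (cmod p)\<^sup>2) * cmod (deriv B p) * 1"
    using p1 by (intro mult_left_mono c mult_nonneg_nonneg) (auto simp: power_le_one)
  finally show ?thesis unfolding v1 by simp
qed

text \<open>Suppose infinitely many z are related to p, and fix m + 1 of them; all points in
  question lie in one fibre of B. The m points to which z is related miss one of the chosen points,
  q, which adds a factor |M(q)| < 1 to the derivative bound at p. Combined with the bound at related
  points this keeps the hyperbolic derivative at z uniformly below 1, so asymptotic isometry
  confines z to a compact disc, where fibres are finite.\<close>

theorem finite_converse_fibre:
  assumes G: "sheeted G" and fin: "\<And>z. z \<in> regular_domain B \<Longrightarrow> finite (G``{z})"
    and p: "p \<in> regular_domain B"
  shows "finite (G\<inverse>``{p})"
proof (rule ccontr)
  let ?Y = "G\<inverse>``{p}"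
  let ?M = "Moebius_function 0 p"
  assume inf: "infinite ?Y"
  define l where "l = B p"
  have pf: "p \<in> fibre B l" and pD: "p \<in> unit_disk" using p by (auto simp: l_def fibre_def regular_domain_def)
  have p1: "cmod p < 1" using pD by simp
  have l: "cmod l < 1" unfolding l_def by (rule lt1[OF pD])
  have Yf: "?Y \<subseteq> fibre B l"
    using sheeted_fibre_subset[OF sheeted_converse[OF G], of p] by (simp add: l_def)
  define m where "m = card (G``{p})"
  have cardm: "card (G``{z}) = m" if "z \<in> regular_domain B" for z
    using sheeted_ecard_constant[OF G that p] fin[OF that] fin[OF p] by (simp add: ecard_def m_def)
  obtain Q where Q: "Q \<subseteq> ?Y" "finite Q" "card Q = Suc m"
    using infinite_arbitrarily_large[OF inf] by metis
  \<comment> \<open>The inserted 0 keeps the maximum defined when Q contains no point besides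
    p.\<close>
  define \<kappa> where "\<kappa> = Max (insert 0 ((\<lambda>q. cmod (?M q)) ` (Q - {p})))"
  have fk: "finite (insert 0 ((\<lambda>q. cmod (?M q)) ` (Q - {p})))" using Q(2) by simp
  have k1: "\<kappa> < 1"
    unfolding \<kappa>_def
  proof (subst Max_less_iff[OF fk])
    show "\<forall>a\<in>insert 0 ((\<lambda>q. cmod (?M q)) ` (Q - {p})). a < 1"
      using Moebius_function_norm_lt_1[OF p1] Q(1) Yf by (auto simp: fibre_def)
  qed simp
  have kQ: "cmod (?M q) \<le> \<kappa>" if "q \<in> Q" "q \<noteq> p" for q
    unfolding \<kappa>_def by (rule Max_ge[OF fk]) (use that in blast)
  have key: "(1 - (cmod z)\<^sup>2) * cmod (deriv B z) \<le> (1 - (cmod l)\<^sup>2) * \<kappa>" if z: "z \<in> ?Y" for z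
  proof -
    have zp: "(z, p) \<in> G" using z by simp
    note d = sheetedD[OF G zp]
    let ?W = "G``{z}"
    have W: "finite ?W" "card ?W = m" "p \<in> ?W" using fin[OF d(1)] cardm[OF d(1)] zp by auto
    have Wf: "?W \<subseteq> fibre B l" using sheeted_fibre_subset[OF G, of z] d(3) by (simp add: l_def)
    have "\<not> Q \<subseteq> ?W" using card_mono[OF W(1), of Q] W(2) Q(3) by linarith
    then obtain q where q: "q \<in> Q" "q \<notin> ?W" by blast
    have qp: "q \<noteq> p" using q W(3) by blast
    let ?P = "\<Prod>w\<in>?W - {p}. cmod (?M w)"
    have P0: "0 < ?P"
    proof (rule prod_pos)
      fix w assume w: "w \<in> ?W - {p}"
      have "w \<in> unit_disk" using w Wf by (auto simp: fibre_def)
      then have "1 - cnj p * w \<noteq> 0" using p1 by (intro Moebius_denominator_nonzero) auto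
      then show "0 < cmod (?M w)" using w by (simp add: Moebius_ratio)
    qed
    have "(1 - (cmod z)\<^sup>2) * cmod (deriv B z) * ?P \<le> (1 - (cmod p)\<^sup>2) * cmod (deriv B p)"
      by (rule deriv_le_at_related[OF G fin zp])
    \<comment> \<open>The product over the other points to which z is related occurs on both sides
      and will cancel; q is the surplus factor.\<close>
    also have "\<dots> \<le> (1 - (cmod l)\<^sup>2) * (\<Prod>a\<in>insert q (?W - {p}). cmod (?M a))"
      by (rule deriv_le_prod_fibre[OF pf]) (use W Wf q qp Q(1) Yf in auto)
    also have "(\<Prod>a\<in>insert q (?W - {p}). cmod (?M a)) = cmod (?M q) * ?P"
      using W(1) q(2) by (subst prod.insert) auto
    also have "(1 - (cmod l)\<^sup>2) * (cmod (?M q) * ?P) \<le> (1 - (cmod l)\<^sup>2) * (\<kappa> * ?P)"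
      using l P0 by (intro mult_left_mono mult_right_mono kQ[OF q(1) qp]) (auto simp: power_le_one)
    finally have "(1 - (cmod z)\<^sup>2) * cmod (deriv B z) * ?P \<le> ((1 - (cmod l)\<^sup>2) * \<kappa>) * ?P" by (simp add: mult.assoc)
    then show ?thesis using P0 by (rule mult_right_le_imp_le)
  qed
  \<comment> \<open>With \<epsilon> = (1 - \<kappa>)/2, the guaranteed value 1 - \<epsilon> is the
    midpoint of \<kappa> and 1.\<close>
  obtain R where R: "R < 1" "\<forall>w. R < cmod w \<and> cmod w < 1 \<and> cmod (B w) \<le> cmod l
      \<longrightarrow> (1 - (1 - \<kappa>) / 2) * (1 - (cmod (B w))\<^sup>2) \<le> (1 - (cmod w)\<^sup>2) * cmod (deriv B w)"
    using isometric[OF l, of "(1 - \<kappa>) / 2"] k1 by auto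
  have "cmod z \<le> R" if z: "z \<in> ?Y" for z
  proof (rule ccontr)
    assume "\<not> cmod z \<le> R"
    moreover have "cmod z < 1" "B z = l" using z Yf by (auto simp: fibre_def)
    ultimately have "(1 - (1 - \<kappa>) / 2) * (1 - (cmod l)\<^sup>2) \<le> (1 - (cmod z)\<^sup>2) * cmod (deriv B z)"
      using R(2) by auto
    also have "\<dots> \<le> (1 - (cmod l)\<^sup>2) * \<kappa>" by (rule key[OF z])
    finally have "(1 - (1 - \<kappa>) / 2) * (1 - (cmod l)\<^sup>2) \<le> \<kappa> * (1 - (cmod l)\<^sup>2)" by (simp only: mult.commute)
    moreover have "0 < 1 - (cmod l)\<^sup>2" using l by (simp add: power_less_one_iff)
    ultimately have "1 - (1 - \<kappa>) / 2 \<le> \<kappa>" by (rule mult_right_le_imp_le)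
    then show False using k1 by (simp add: field_simps)
  qed
  then have "?Y \<subseteq> cball 0 R \<inter> fibre B l" using Yf by auto
  moreover have "finite (cball 0 R \<inter> fibre B l)"
    using R(1) by (intro finite_fibre_compact) auto
  ultimately show False using inf finite_subset by blast
qed

end

section \<open>Exchanging a correspondence with its converse under the integral\<close>

context asymptotic_isometry
begin

lemma sheeted_sum_continuous:
  fixes H :: "complex \<Rightarrow> complex \<Rightarrow> real"
  assumes G: "sheeted G" and H: "continuous_on (regular_domain B \<times> regular_domain B) (\<lambda>p. H (fst p) (snd p))"
  shows "continuous_on (regular_domain B) (\<lambda>z. \<Sum>w\<in>G``{z}. H z w)"
  unfolding continuous_on_eq_continuous_at[OF open_regular_domain]
proof
  fix z assume z: "z \<in> regular_domain B"
  obtain N \<tau> where N: "open N" "z \<in> N" "N \<subseteq> regular_domain B"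
    "\<And>w. w \<in> G``{z} \<Longrightarrow> \<tau> w holomorphic_on N" "\<And>w. w \<in> G``{z} \<Longrightarrow> \<tau> w z = w"
    "\<And>w. w \<in> G``{z} \<Longrightarrow> \<tau> w ` N \<subseteq> regular_domain B"
    "\<And>w x. w \<in> G``{z} \<Longrightarrow> x \<in> N \<Longrightarrow> B (\<tau> w x) = B x"
    "\<And>x. x \<in> N \<Longrightarrow> G``{x} = (\<lambda>w. \<tau> w x) ` (G``{z})"
    "\<And>x. x \<in> N \<Longrightarrow> inj_on (\<lambda>w. \<tau> w x) (G``{z})"
    by (rule sheeted_local[OF G z]) (rule that)
  have "continuous_on N (\<lambda>x. \<Sum>w\<in>G``{z}. H x (\<tau> w x))"
  proof (rule continuous_on_sum)
    fix w assume w: "w \<in> G``{z}"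
    have t: "continuous_on N (\<tau> w)" by (rule holomorphic_on_imp_continuous_on[OF N(4)[OF w]])
    have c: "continuous_on N (\<lambda>x. (x, \<tau> w x))" by (intro continuous_on_Pair continuous_on_id t)
    have "(\<lambda>x. (x, \<tau> w x)) ` N \<subseteq> regular_domain B \<times> regular_domain B"
      using N(3) N(6)[OF w] by blast
    from continuous_on_compose2[OF H c this] show "continuous_on N (\<lambda>x. H x (\<tau> w x))" by simp
  qed
  moreover have "(\<Sum>w\<in>G``{x}. H x w) = (\<Sum>w\<in>G``{z}. H x (\<tau> w x))" if x: "x \<in> N" for x
    unfolding N(8)[OF x] sum.reindex[OF N(9)[OF x]] o_def ..
  ultimately have "continuous_on N (\<lambda>x. \<Sum>w\<in>G``{x}. H x w)"
    by (rule continuous_on_cong[OF refl, THEN iffD2, rotated])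
  then show "isCont (\<lambda>x. \<Sum>w\<in>G``{x}. H x w) z"
    unfolding continuous_on_eq_continuous_at[OF N(1)] using N(2) by blast
qed

end

lemma continuous_on_swap_arguments:
  assumes H: "continuous_on (S \<times> S) (\<lambda>p. H (fst p) (snd p))"
  shows "continuous_on (S \<times> S) (\<lambda>p. H (snd p) (fst p))"
proof -
  have c: "continuous_on (S \<times> S) (\<lambda>p. (snd p, fst p))" by (intro continuous_intros)
  have s: "(\<lambda>p. (snd p, fst p)) ` (S \<times> S) \<subseteq> S \<times> S" by auto
  from continuous_on_compose2[OF H c s] show ?thesis by simp
qed

text \<open>On each sheet |B'|^2 cancels the Jacobian of the section, so the integral is carried to
  the disc of values and becomes a sum over the pairs of G above l. In that form neither coordinate
  of a pair is preferred.\<close>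

lemma (in evenly_covered) energy_local:
  fixes H :: "complex \<Rightarrow> complex \<Rightarrow> real"
  assumes G: "sheeted G" and fin: "\<And>z. z \<in> regular_domain B \<Longrightarrow> finite (G``{z})"
    and H: "continuous_on (regular_domain B \<times> regular_domain B) (\<lambda>p. H (fst p) (snd p))" "\<And>z w. 0 \<le> H z w"
    and A: "A \<subseteq> ball l r" "A \<in> sets borel"
  shows "(\<integral>\<^sup>+x. ennreal ((cmod (deriv B x))\<^sup>2 * (\<Sum>w\<in>G``{x}. H x w)) * indicator {x \<in> unit_disk. B x \<in> A} x \<partial>lborel)
    = (\<integral>\<^sup>+z. \<integral>\<^sup>+w. indicator {p \<in> G. fst p \<in> fibre B l} (z, w) *
        (\<integral>\<^sup>+m. ennreal (H (\<sigma> z m) (\<sigma> w m)) * indicator A m \<partial>lborel) \<partial>count_space UNIV \<partial>count_space UNIV)"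
proof -
  define k where "k x = (cmod (deriv B x))\<^sup>2 * (\<Sum>w\<in>G``{x}. H x w)" for x
  define K where "K x = ennreal (indicator (regular_domain B) x *\<^sub>R k x)" for x
  define J where "J z w = (\<integral>\<^sup>+m. ennreal (H (\<sigma> z m) (\<sigma> w m)) * indicator A m \<partial>lborel)" for z w
  let ?EA = "{x \<in> unit_disk. B x \<in> A}"
  have kc: "continuous_on (regular_domain B) k"
    unfolding k_def[abs_def]
    by (intro continuous_intros sheeted_sum_continuous[OF G H(1)] holomorphic_on_imp_continuous_on
      holomorphic_on_subset[OF deriv_hol regular_domain_subset])
  have Km[measurable]: "K \<in> borel_measurable borel"
    unfolding K_def[abs_def]
    by (intro measurable_compose[OF _ measurable_ennreal] borel_measurable_indicator_continuous[OF open_regular_domain kc order_refl] borel_open open_regular_domain)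
  have EA: "?EA = (\<Union>z\<in>fibre B l. \<sigma> z ` A)" by (rule preimage_eq[OF A(1)])
  have bor: "\<sigma> z ` A \<in> sets borel" if "z \<in> fibre B l" for z by (rule sheet_borel[OF that A])
  have EAb: "?EA \<in> sets borel"
    unfolding EA by (rule sets.countable_UN'[OF countable_fibre]) (use bor in auto)
  have EAsub: "?EA \<subseteq> regular_domain B"
    unfolding EA using \<sigma>_regular A(1) by blast
  define \<nu> where "\<nu> = density lborel K"
  have \<nu>: "emeasure \<nu> X = (\<integral>\<^sup>+x. K x * indicator X x \<partial>lborel)" if "X \<in> sets borel" for X
    unfolding \<nu>_def using that by (subst emeasure_density) simp_all
  have sheet: "emeasure \<nu> (\<sigma> z ` A) = (\<integral>\<^sup>+w. indicator {p \<in> G. fst p \<in> fibre B l} (z, w) * J z w \<partial>count_space UNIV)"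
    if z: "z \<in> fibre B l" for z
  proof -
    note s = sheeted_section[OF G _ z]
    have ec: "evenly_covered B l r c C \<delta> \<sigma>" by unfold_locales
    have sub: "G``{z} \<subseteq> fibre B l" by (rule s(3)[OF ec center_in])
    have fz: "finite (G``{z})" by (rule fin[OF fibre_regular[OF z]])
    have meas: "(\<lambda>m. ennreal (H (\<sigma> z m) (\<sigma> w m)) * indicator A m) \<in> borel_measurable lborel" if w: "w \<in> fibre B l" for w
    proof -
      have c: "continuous_on (ball l r) (\<lambda>m. (\<sigma> z m, \<sigma> w m))"
        by (intro continuous_on_Pair holomorphic_on_imp_continuous_on \<sigma>_hol z w)
      have "(\<lambda>m. (\<sigma> z m, \<sigma> w m)) ` ball l r \<subseteq> regular_domain B \<times> regular_domain B"
        using \<sigma>_regular z w by blast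
      from continuous_on_compose2[OF H(1) c this]
      have "continuous_on (ball l r) (\<lambda>m. H (\<sigma> z m) (\<sigma> w m))" by simp
      from borel_measurable_indicator_continuous[OF open_ball this A]
      have "(\<lambda>m. ennreal (indicator A m *\<^sub>R H (\<sigma> z m) (\<sigma> w m))) \<in> borel_measurable borel"
        by (rule measurable_compose[OF _ measurable_ennreal])
      moreover have "(\<lambda>m. ennreal (indicator A m *\<^sub>R H (\<sigma> z m) (\<sigma> w m))) = (\<lambda>m. ennreal (H (\<sigma> z m) (\<sigma> w m)) * indicator A m)"
        by (rule ext) (simp split: split_indicator)
      ultimately show ?thesis by simp
    qed
    have bdd: "bounded (\<sigma> z ` ball l r)"
      by (rule bounded_subset[OF bounded_ball[of "0::complex" 1]]) (use \<sigma>_section[OF z] in auto)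
    have pt: "K (\<sigma> z m) * ennreal ((cmod (deriv (\<sigma> z) m))\<^sup>2) * indicator A m
        = (\<Sum>w\<in>G``{z}. ennreal (H (\<sigma> z m) (\<sigma> w m)) * indicator A m)" for m
    proof (cases "m \<in> A")
      case True
      then have m: "m \<in> ball l r" using A(1) by blast
      have "cmod (deriv (\<sigma> z) m) * cmod (deriv B (\<sigma> z m)) = 1"
        using \<sigma>_deriv[OF z m] by (metis norm_mult norm_one)
      then have one: "(cmod (deriv B (\<sigma> z m)))\<^sup>2 * (cmod (deriv (\<sigma> z) m))\<^sup>2 = 1"
        by (metis mult.commute one_power2 power_mult_distrib)
      have "(\<Sum>w\<in>G``{\<sigma> z m}. H (\<sigma> z m) w) = (\<Sum>w\<in>G``{z}. H (\<sigma> z m) (\<sigma> w m))"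
        unfolding s(1)[OF ec m] sum.reindex[OF s(2)[OF ec m]] o_def ..
      then have "k (\<sigma> z m) * (cmod (deriv (\<sigma> z) m))\<^sup>2 = ((cmod (deriv B (\<sigma> z m)))\<^sup>2 * (cmod (deriv (\<sigma> z) m))\<^sup>2) * (\<Sum>w\<in>G``{z}. H (\<sigma> z m) (\<sigma> w m))"
        unfolding k_def by (simp only: ac_simps)
      then have "ennreal (k (\<sigma> z m) * (cmod (deriv (\<sigma> z) m))\<^sup>2) = ennreal (\<Sum>w\<in>G``{z}. H (\<sigma> z m) (\<sigma> w m))"
        unfolding one by simp
      also have "\<dots> = (\<Sum>w\<in>G``{z}. ennreal (H (\<sigma> z m) (\<sigma> w m)))"
        by (rule sum_ennreal[symmetric]) (rule H(2))
      finally show ?thesis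
        using True \<sigma>_regular[OF z m] by (simp add: K_def ennreal_mult'')
    qed simp
    have "emeasure \<nu> (\<sigma> z ` A) = (\<integral>\<^sup>+m. K (\<sigma> z m) * ennreal ((cmod (deriv (\<sigma> z) m))\<^sup>2) * indicator A m \<partial>lborel)"
      unfolding \<nu>[OF bor[OF z]]
      by (rule nn_integral_holomorphic_image[OF open_ball \<sigma>_hol[OF z] \<sigma>_inj[OF z] bdd A Km])
    also have "\<dots> = (\<integral>\<^sup>+m. (\<Sum>w\<in>G``{z}. ennreal (H (\<sigma> z m) (\<sigma> w m)) * indicator A m) \<partial>lborel)"
      unfolding pt ..
    also have "\<dots> = (\<Sum>w\<in>G``{z}. J z w)"
      unfolding J_def by (rule nn_integral_sum) (use meas sub in blast)
    also have "\<dots> = (\<integral>\<^sup>+w. J z w \<partial>count_space (G``{z}))"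
      by (rule nn_integral_count_space_finite[OF fz, symmetric])
    also have "\<dots> = (\<integral>\<^sup>+w. J z w * indicator (G``{z}) w \<partial>count_space UNIV)"
      by (rule nn_integral_count_space_indicator) simp
    also have "\<dots> = (\<integral>\<^sup>+w. indicator {p \<in> G. fst p \<in> fibre B l} (z, w) * J z w \<partial>count_space UNIV)"
      by (rule nn_integral_cong) (use z in \<open>simp split: split_indicator\<close>)
    finally show ?thesis .
  qed
  have "(\<integral>\<^sup>+x. ennreal (k x) * indicator ?EA x \<partial>lborel) = emeasure \<nu> ?EA"
    unfolding \<nu>[OF EAb] K_def by (rule nn_integral_cong) (use EAsub in \<open>auto split: split_indicator\<close>)
  also have "\<dots> = (\<integral>\<^sup>+z. emeasure \<nu> (\<sigma> z ` A) \<partial>count_space (fibre B l))"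
    unfolding EA
    by (rule emeasure_UN_countable[OF _ countable_fibre sheets_disjoint[OF A(1)]]) (use bor in \<open>simp add: \<nu>_def\<close>)
  also have "\<dots> = (\<integral>\<^sup>+z. emeasure \<nu> (\<sigma> z ` A) * indicator (fibre B l) z \<partial>count_space UNIV)"
    by (rule nn_integral_count_space_indicator) simp
  also have "\<dots> = (\<integral>\<^sup>+z. \<integral>\<^sup>+w. indicator {p \<in> G. fst p \<in> fibre B l} (z, w) * J z w \<partial>count_space UNIV \<partial>count_space UNIV)"
  proof (rule nn_integral_cong)
    fix z
    show "emeasure \<nu> (\<sigma> z ` A) * indicator (fibre B l) z
      = (\<integral>\<^sup>+w. indicator {p \<in> G. fst p \<in> fibre B l} (z, w) * J z w \<partial>count_space UNIV)"
      by (cases "z \<in> fibre B l") (simp_all add: sheet)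
  qed
  finally show ?thesis unfolding k_def J_def .
qed

text \<open>Tonelli for counting measures. The two index sets correspond because both coordinates of
  a pair in G lie in the same fibre of B.\<close>

lemma (in evenly_covered) energy_swap_local:
  fixes H :: "complex \<Rightarrow> complex \<Rightarrow> real"
  assumes G: "sheeted G" and fin: "\<And>z. z \<in> regular_domain B \<Longrightarrow> finite (G``{z})"
    and fin': "\<And>z. z \<in> regular_domain B \<Longrightarrow> finite (G\<inverse>``{z})"
    and H: "continuous_on (regular_domain B \<times> regular_domain B) (\<lambda>p. H (fst p) (snd p))" "\<And>z w. 0 \<le> H z w"
    and A: "A \<subseteq> ball l r" "A \<in> sets borel"
  shows "(\<integral>\<^sup>+x. ennreal ((cmod (deriv B x))\<^sup>2 * (\<Sum>w\<in>G``{x}. H x w)) * indicator {x \<in> unit_disk. B x \<in> A} x \<partial>lborel)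
    = (\<integral>\<^sup>+x. ennreal ((cmod (deriv B x))\<^sup>2 * (\<Sum>z\<in>G\<inverse>``{x}. H z x)) * indicator {x \<in> unit_disk. B x \<in> A} x \<partial>lborel)"
proof -
  note H' = continuous_on_swap_arguments[OF H(1)]
  let ?J = "\<lambda>z w. \<integral>\<^sup>+m. ennreal (H (\<sigma> z m) (\<sigma> w m)) * indicator A m \<partial>lborel"
  let ?F = "\<lambda>p. indicator {p \<in> G. fst p \<in> fibre B l} p * ?J (fst p) (snd p)"
  have ind: "indicator {p \<in> G\<inverse>. fst p \<in> fibre B l} (w, z) = (indicator {p \<in> G. fst p \<in> fibre B l} (z, w) :: ennreal)" for z w
    using sheetedD[OF G, of z w] by (auto simp: fibre_def split: split_indicator)
  have "(\<integral>\<^sup>+z. \<integral>\<^sup>+w. ?F (z, w) \<partial>count_space UNIV \<partial>count_space UNIV) = (\<integral>\<^sup>+w. \<integral>\<^sup>+z. ?F (z, w) \<partial>count_space UNIV \<partial>count_space UNIV)"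
    by (rule trans[OF nn_integral_fst_count_space nn_integral_snd_count_space[symmetric]])
  then have sw: "(\<integral>\<^sup>+z. \<integral>\<^sup>+w. indicator {p \<in> G. fst p \<in> fibre B l} (z, w) * ?J z w \<partial>count_space UNIV \<partial>count_space UNIV)
      = (\<integral>\<^sup>+w. \<integral>\<^sup>+z. indicator {p \<in> G\<inverse>. fst p \<in> fibre B l} (w, z) * ?J z w \<partial>count_space UNIV \<partial>count_space UNIV)"
    unfolding ind fst_conv snd_conv .
  have e1: "(\<integral>\<^sup>+x. ennreal ((cmod (deriv B x))\<^sup>2 * (\<Sum>w\<in>G``{x}. H x w)) * indicator {x \<in> unit_disk. B x \<in> A} x \<partial>lborel)
      = (\<integral>\<^sup>+z. \<integral>\<^sup>+w. indicator {p \<in> G. fst p \<in> fibre B l} (z, w) * ?J z w \<partial>count_space UNIV \<partial>count_space UNIV)"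
    by (rule energy_local[OF G fin H A])
  have e2: "(\<integral>\<^sup>+x. ennreal ((cmod (deriv B x))\<^sup>2 * (\<Sum>z\<in>G\<inverse>``{x}. H z x)) * indicator {x \<in> unit_disk. B x \<in> A} x \<partial>lborel)
      = (\<integral>\<^sup>+w. \<integral>\<^sup>+z. indicator {p \<in> G\<inverse>. fst p \<in> fibre B l} (w, z) * ?J z w \<partial>count_space UNIV \<partial>count_space UNIV)"
    by (rule energy_local[OF sheeted_converse[OF G] fin' H' H(2) A])
  show ?thesis by (rule trans[OF e1 trans[OF sw e2[symmetric]]])
qed

context asymptotic_isometry
begin

text \<open>By Lindelof, countably many evenly covered discs exhaust the regular values. Made
  disjoint, they have preimages that partition the regular domain, and the local identities add up;
  this is why the local version is stated for Borel subsets of a disc.\<close>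

theorem energy_swap:
  fixes H :: "complex \<Rightarrow> complex \<Rightarrow> real"
  assumes G: "sheeted G" and fin: "\<And>z. z \<in> regular_domain B \<Longrightarrow> finite (G``{z})"
    and fin': "\<And>z. z \<in> regular_domain B \<Longrightarrow> finite (G\<inverse>``{z})"
    and H: "continuous_on (regular_domain B \<times> regular_domain B) (\<lambda>p. H (fst p) (snd p))" "\<And>z w. 0 \<le> H z w"
  shows "(\<integral>\<^sup>+x. ennreal ((cmod (deriv B x))\<^sup>2 * (\<Sum>w\<in>G``{x}. H x w)) * indicator (regular_domain B) x \<partial>lborel)
    = (\<integral>\<^sup>+x. ennreal ((cmod (deriv B x))\<^sup>2 * (\<Sum>z\<in>G\<inverse>``{x}. H z x)) * indicator (regular_domain B) x \<partial>lborel)"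
proof -
  define \<U> where "\<U> = {ball l r | l r. \<exists>c C \<delta> \<sigma>. evenly_covered B l r c C \<delta> \<sigma>}"
  have op: "open S" if "S \<in> \<U>" for S using that by (auto simp: \<U>_def)
  then obtain \<V> where V: "\<V> \<subseteq> \<U>" "countable \<V>" "\<Union>\<V> = \<Union>\<U>" using Lindelof by metis
  have UR: "\<Union>\<U> = regular_values B"
  proof (intro equalityI subsetI)
    fix m assume "m \<in> \<Union>\<U>"
    then obtain l r c C \<delta> \<sigma> where ec: "evenly_covered B l r c C \<delta> \<sigma>" and m: "m \<in> ball l r" unfolding \<U>_def by blast
    show "m \<in> regular_values B" using evenly_covered.regular[OF ec] m by blast
  next
    fix l assume "l \<in> regular_values B"
    then obtain r c C \<delta> \<sigma> where ec: "evenly_covered B l r c C \<delta> \<sigma>" using evenly_covered_exists by blast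
    have "l \<in> ball l r" using evenly_covered.pos(1)[OF ec] by simp
    then show "l \<in> \<Union>\<U>" unfolding \<U>_def using ec by blast
  qed
  have Vne: "\<V> \<noteq> {}"
  proof
    assume "\<V> = {}"
    then have "regular_values B = {}" using V(3) UR by simp
    then show False using regular_domain_nonempty regular_domain_iff by blast
  qed
  define D where "D = from_nat_into \<V>"
  have DU: "D n \<in> \<U>" for n unfolding D_def using from_nat_into[OF Vne] V(1) by blast
  have DR: "(\<Union>n. D n) = regular_values B"
    unfolding D_def using range_from_nat_into[OF Vne V(2)] V(3) UR by simp
  define A where "A = disjointed D"
  have Ab: "A n \<in> sets borel" for n
  proof -
    have "range D \<subseteq> sets borel" using borel_open[OF op[OF DU]] by blast
    from sets.range_disjointed_sets[OF this] show ?thesis unfolding A_def by blast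
  qed
  have AD: "A n \<subseteq> D n" for n unfolding A_def by (rule disjointed_subset)
  have Adis: "disjoint_family A" unfolding A_def by (rule disjoint_family_disjointed)
  have AU: "(\<Union>n. A n) = regular_values B" unfolding A_def UN_disjointed_eq DR ..
  let ?X = "\<lambda>n. {x \<in> unit_disk. B x \<in> A n}"
  have "(\<Union>n. ?X n) = {x \<in> unit_disk. B x \<in> (\<Union>n. A n)}" by auto
  then have XE: "(\<Union>n. ?X n) = regular_domain B" unfolding AU by (auto simp: regular_domain_iff)
  have Xdis: "disjoint_family_on ?X UNIV" using Adis unfolding disjoint_family_on_def by blast
  have Xb: "?X n \<in> sets borel" for n
  proof -
    have c: "continuous_on unit_disk B" by (rule holomorphic_on_imp_continuous_on[OF hol])
    have "B \<in> borel_measurable (restrict_space borel unit_disk)"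
      by (rule borel_measurable_continuous_on_restrict[OF c])
    from measurable_sets[OF this Ab]
    have "B -` A n \<inter> space (restrict_space borel unit_disk) \<in> sets (restrict_space borel unit_disk)" .
    moreover have "B -` A n \<inter> space (restrict_space borel unit_disk) = ?X n"
      by (auto simp: space_restrict_space)
    ultimately show ?thesis by (simp add: sets_restrict_space_iff)
  qed
  have Hs: "continuous_on (regular_domain B) (\<lambda>x. (cmod (deriv B x))\<^sup>2 * (\<Sum>w\<in>F``{x}. H' x w))"
    if "sheeted F" "continuous_on (regular_domain B \<times> regular_domain B) (\<lambda>p. H' (fst p) (snd p))" for F and H' :: "complex \<Rightarrow> complex \<Rightarrow> real"
    by (intro continuous_intros sheeted_sum_continuous[OF that] holomorphic_on_imp_continuous_on
      holomorphic_on_subset[OF deriv_hol regular_domain_subset])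
  have total: "(\<integral>\<^sup>+x. ennreal (k x) * indicator (regular_domain B) x \<partial>lborel) = (\<integral>\<^sup>+n. (\<integral>\<^sup>+x. ennreal (k x) * indicator (?X n) x \<partial>lborel) \<partial>count_space UNIV)"
    if k: "continuous_on (regular_domain B) k" for k :: "complex \<Rightarrow> real"
  proof -
    define K where "K x = ennreal (indicator (regular_domain B) x *\<^sub>R k x)" for x
    have Km[measurable]: "K \<in> borel_measurable borel"
      unfolding K_def[abs_def]
      by (intro measurable_compose[OF _ measurable_ennreal] borel_measurable_indicator_continuous[OF open_regular_domain k order_refl] borel_open open_regular_domain)
    have e: "emeasure (density lborel K) X = (\<integral>\<^sup>+x. ennreal (k x) * indicator X x \<partial>lborel)"
      if "X \<in> sets borel" "X \<subseteq> regular_domain B" for X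
    proof -
      have "emeasure (density lborel K) X = (\<integral>\<^sup>+x. K x * indicator X x \<partial>lborel)"
        using that(1) by (subst emeasure_density) simp_all
      also have "\<dots> = (\<integral>\<^sup>+x. ennreal (k x) * indicator X x \<partial>lborel)"
        by (rule nn_integral_cong) (use that(2) in \<open>auto simp: K_def split: split_indicator\<close>)
      finally show ?thesis .
    qed
    have Eb: "regular_domain B \<in> sets borel" by (intro borel_open open_regular_domain)
    have Xsub: "?X n \<subseteq> regular_domain B" for n unfolding XE[symmetric] by blast
    have "(\<integral>\<^sup>+x. ennreal (k x) * indicator (regular_domain B) x \<partial>lborel) = emeasure (density lborel K) (\<Union>n. ?X n)"
      unfolding XE by (rule e[OF Eb order_refl, symmetric])
    also have "\<dots> = (\<integral>\<^sup>+n. emeasure (density lborel K) (?X n) \<partial>count_space UNIV)"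
      by (rule emeasure_UN_countable[OF _ _ Xdis]) (use Xb in simp_all)
    also have "\<dots> = (\<integral>\<^sup>+n. (\<integral>\<^sup>+x. ennreal (k x) * indicator (?X n) x \<partial>lborel) \<partial>count_space UNIV)"
      by (rule nn_integral_cong) (rule e[OF Xb Xsub])
    finally show ?thesis .
  qed
  note H' = continuous_on_swap_arguments[OF H(1)]
  show ?thesis
    unfolding total[OF Hs[OF G H(1)]] total[OF Hs[OF sheeted_converse[OF G] H']]
  proof (rule nn_integral_cong)
    fix n
    obtain l r c C \<delta> \<sigma> where ec: "evenly_covered B l r c C \<delta> \<sigma>" and D: "D n = ball l r"
      using DU[of n] unfolding \<U>_def by blast
    show "(\<integral>\<^sup>+x. ennreal ((cmod (deriv B x))\<^sup>2 * (\<Sum>w\<in>G``{x}. H x w)) * indicator (?X n) x \<partial>lborel)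
      = (\<integral>\<^sup>+x. ennreal ((cmod (deriv B x))\<^sup>2 * (\<Sum>z\<in>G\<inverse>``{x}. H z x)) * indicator (?X n) x \<partial>lborel)"
      by (rule evenly_covered.energy_swap_local[OF ec G fin fin' H AD[of n, unfolded D] Ab])
  qed
qed

end

section \<open>The operator of a finite correspondence\<close>

context asymptotic_isometry
begin

text \<open>For a local branch w = \<rho>(z) of B(w) = B(z), differentiation gives \<rho>'(z) =
  B'(z)/B'(w). The summand is (f o \<rho>) \<rho>', the substitution that preserves area integrals
  of |f|^2.\<close>

definition transfer :: "(complex \<times> complex) set \<Rightarrow> (complex \<Rightarrow> complex) \<Rightarrow> complex \<Rightarrow> complex" where
  "transfer G f z = (\<Sum>w\<in>G``{z}. f w * deriv B z / deriv B w)"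

text \<open>The squared moduli of the branches of f shifted by g. By polarisation it contains the
  inner product of the transfer with g, while its positivity lets it be exchanged with the converse
  by Tonelli.\<close>

definition energy :: "(complex \<times> complex) set \<Rightarrow> (complex \<Rightarrow> complex) \<Rightarrow> (complex \<Rightarrow> complex) \<Rightarrow> complex \<Rightarrow> real" where
  "energy G f g z = (\<Sum>w\<in>G``{z}. (cmod (f w * deriv B z / deriv B w + g z))\<^sup>2)"

lemma deriv_hol_regular: "deriv B holomorphic_on regular_domain B"
  by (rule holomorphic_on_subset[OF deriv_hol regular_domain_subset])

lemma transfer_holomorphic:
  assumes G: "sheeted G" and f: "f holomorphic_on regular_domain B"
  shows "transfer G f holomorphic_on regular_domain B"
proof -
  have "(\<lambda>z. f z / deriv B z) holomorphic_on regular_domain B"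
    by (rule holomorphic_on_divide[OF f deriv_hol_regular deriv_nonzero])
  from holomorphic_on_mult[OF deriv_hol_regular sheeted_sum_holomorphic(1)[OF G this]]
  have "(\<lambda>z. deriv B z * (\<Sum>w\<in>G``{z}. f w / deriv B w)) holomorphic_on regular_domain B" .
  moreover have "(\<lambda>z. deriv B z * (\<Sum>w\<in>G``{z}. f w / deriv B w)) = transfer G f"
    by (rule ext) (simp add: transfer_def sum_distrib_left mult.commute)
  ultimately show ?thesis by simp
qed

text \<open>With |B'(x)|^2 pulled out, the summand treats f at w and g at x alike, which is the form
  needed for \<open>energy_swap\<close>.\<close>

lemma energy_weighted:
  assumes "x \<in> regular_domain B"
  shows "energy G f g x = (cmod (deriv B x))\<^sup>2 * (\<Sum>w\<in>G``{x}. (cmod (f w / deriv B w + g x / deriv B x))\<^sup>2)"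
proof -
  have "f w * deriv B x / deriv B w + g x = deriv B x * (f w / deriv B w + g x / deriv B x)" for w
    using deriv_nonzero[OF assms] by (simp add: distrib_left)
  then show ?thesis
    by (simp only: energy_def norm_mult power_mult_distrib sum_distrib_left)
qed

lemma energy_nonneg: "0 \<le> energy G f g x"
  unfolding energy_def by (intro sum_nonneg) simp

lemma quotient_sum_continuous:
  assumes f: "f holomorphic_on regular_domain B" and g: "g holomorphic_on regular_domain B"
  shows "continuous_on (regular_domain B \<times> regular_domain B)
    (\<lambda>p. (cmod (f (snd p) / deriv B (snd p) + g (fst p) / deriv B (fst p)))\<^sup>2)"
proof -
  have c: "continuous_on (regular_domain B) (\<lambda>z. f z / deriv B z)" "continuous_on (regular_domain B) (\<lambda>z. g z / deriv B z)"
    by (rule holomorphic_on_imp_continuous_on, rule holomorphic_on_divide[OF _ deriv_hol_regular deriv_nonzero], rule f g, assumption)+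
  have s: "continuous_on (regular_domain B \<times> regular_domain B) (\<lambda>p. f (snd p) / deriv B (snd p))"
    by (rule continuous_on_compose2[OF c(1) continuous_on_snd[OF continuous_on_id]]) auto
  have t: "continuous_on (regular_domain B \<times> regular_domain B) (\<lambda>p. g (fst p) / deriv B (fst p))"
    by (rule continuous_on_compose2[OF c(2) continuous_on_fst[OF continuous_on_id]]) auto
  show ?thesis by (intro continuous_on_power continuous_on_norm continuous_on_add s t)
qed

lemma energy_measurable:
  assumes G: "sheeted G" and f: "f holomorphic_on regular_domain B" and g: "g holomorphic_on regular_domain B"
  shows "(\<lambda>x. indicator (regular_domain B) x * energy G f g x) \<in> borel_measurable borel"
proof -
  have c: "continuous_on (regular_domain B) (\<lambda>x. (cmod (deriv B x))\<^sup>2 * (\<Sum>w\<in>G``{x}. (cmod (f w / deriv B w + g x / deriv B x))\<^sup>2))"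
    by (intro continuous_on_mult continuous_on_power continuous_on_norm holomorphic_on_imp_continuous_on[OF deriv_hol_regular]
      sheeted_sum_continuous[OF G] quotient_sum_continuous[OF f g])
  have "(\<lambda>x. indicator (regular_domain B) x *\<^sub>R ((cmod (deriv B x))\<^sup>2 * (\<Sum>w\<in>G``{x}. (cmod (f w / deriv B w + g x / deriv B x))\<^sup>2))) \<in> borel_measurable borel"
    by (intro borel_measurable_indicator_continuous[OF open_regular_domain c order_refl] borel_open open_regular_domain)
  also have "(\<lambda>x. indicator (regular_domain B) x *\<^sub>R ((cmod (deriv B x))\<^sup>2 * (\<Sum>w\<in>G``{x}. (cmod (f w / deriv B w + g x / deriv B x))\<^sup>2)))
      = (\<lambda>x. indicator (regular_domain B) x * energy G f g x)"
    by (rule ext) (simp add: energy_weighted split: split_indicator)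
  finally show ?thesis .
qed

lemma nn_integral_disk_area_cong:
  assumes [measurable]: "u \<in> borel_measurable borel" "v \<in> borel_measurable borel"
    and eq: "(\<integral>\<^sup>+x. u x * indicator unit_disk x \<partial>lborel) = (\<integral>\<^sup>+x. v x * indicator unit_disk x \<partial>lborel)"
  shows "(\<integral>\<^sup>+x. u x \<partial>disk_area) = (\<integral>\<^sup>+x. v x \<partial>disk_area)"
proof -
  have "ennreal (measure lborel (unit_disk :: complex set)) * (\<integral>\<^sup>+x. u x \<partial>disk_area) = ennreal (measure lborel (unit_disk :: complex set)) * (\<integral>\<^sup>+x. v x \<partial>disk_area)"
    unfolding nn_integral_disk_area[OF assms(1)] nn_integral_disk_area[OF assms(2)] by (rule eq)
  then show ?thesis
    unfolding ennreal_mult_cancel_left using emeasure_unit_disk(2) by (auto simp: ennreal_eq_0_iff)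
qed

text \<open>The irregular points of the disk are countable, hence null.\<close>

lemma AE_regular_domain: "AE x in disk_area. x \<in> regular_domain B"
  unfolding disk_area_def
proof (rule AE_uniform_measureI)
  have "AE x in lborel. x \<notin> unit_disk - regular_domain B"
    by (rule AE_not_in[OF countable_imp_null_set_lborel[OF countable_irregular]])
  then show "AE x in lborel. x \<in> unit_disk \<longrightarrow> x \<in> regular_domain B" by eventually_elim simp
qed simp

text \<open>The disc of radius |z - a|/2 around z avoids a and lies in a small neighbourhood of a,
  whose mass of |F|^2 tends to 0 with its size since points are null. The sub-mean value inequality
  bounds |F(z)|^2 |z - a|^2 by a multiple of that mass.\<close>

lemma square_integrable_pole_bound:
  assumes F: "F holomorphic_on regular_domain B"
    and fin: "(\<integral>\<^sup>+x. ennreal (indicator (regular_domain B) x * (cmod (F x))\<^sup>2) \<partial>lborel) < \<infinity>"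
    and a: "a \<in> unit_disk"
  shows "((\<lambda>z. (z - a) * F z) \<longlongrightarrow> 0) (at a)"
proof (rule tendstoI)
  fix e :: real assume e: "0 < e"
  let ?c = "measure lborel (unit_disk :: complex set)"
  have c0: "0 < ?c" by (rule emeasure_unit_disk(2))
  define K where "K x = ennreal (indicator (regular_domain B) x * (cmod (F x))\<^sup>2)" for x
  have cF: "continuous_on (regular_domain B) (\<lambda>x. (cmod (F x))\<^sup>2)"
    by (intro continuous_on_power continuous_on_norm holomorphic_on_imp_continuous_on F)
  have Km[measurable]: "K \<in> borel_measurable borel"
    using borel_measurable_indicator_continuous[OF open_regular_domain cF order_refl borel_open[OF open_regular_domain]]
    unfolding K_def[abs_def] real_scaleR_def by (rule measurable_compose[OF _ measurable_ennreal])
  define \<nu> where "\<nu> = density lborel K"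
  have \<nu>: "emeasure \<nu> X = (\<integral>\<^sup>+x. K x * indicator X x \<partial>lborel)" if "X \<in> sets borel" for X
    unfolding \<nu>_def using that by (subst emeasure_density) simp_all
  have sets: "sets \<nu> = sets borel" by (simp add: \<nu>_def)
  let ?A = "\<lambda>n. ball a (1 / real (Suc n))"
  have finA: "emeasure \<nu> (?A n) \<noteq> \<infinity>" for n
  proof -
    have "emeasure \<nu> (?A n) \<le> (\<integral>\<^sup>+x. K x \<partial>lborel)"
      unfolding \<nu>[OF ball_in_borel] by (rule nn_integral_mono) (simp split: split_indicator)
    then show ?thesis using fin unfolding K_def by (metis leD)
  qed
  have dec: "decseq ?A"
    by (intro decseq_SucI subset_ball) (simp add: field_simps)
  have inter: "(\<Inter>n. ?A n) = {a}"
  proof (intro equalityI subsetI)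
    fix x assume x: "x \<in> (\<Inter>n. ?A n)"
    show "x \<in> {a}"
    proof (rule ccontr)
      assume "x \<notin> {a}"
      then have "0 < dist a x" by simp
      then obtain n where n: "inverse (real (Suc n)) < dist a x" using reals_Archimedean by blast
      have "x \<in> ?A n" using x by blast
      then show False using n by (simp add: inverse_eq_divide)
    qed
  qed simp
  have "emeasure \<nu> {a} = 0"
    using \<nu>[of "{a}"] nn_integral_null_set[OF countable_imp_null_set_lborel[of "{a}"]] by simp
  moreover have "range ?A \<subseteq> sets \<nu>" unfolding sets by (rule image_subsetI) (rule ball_in_borel)
  ultimately have "(\<lambda>n. emeasure \<nu> (?A n)) \<longlonglongrightarrow> 0"
    using Lim_emeasure_decseq[of ?A \<nu>, OF _ dec finA] unfolding inter by metis
  moreover have "0 < ennreal ((e / 2)\<^sup>2 * ?c)" using e c0 by simp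
  ultimately have "\<forall>\<^sub>F n in sequentially. emeasure \<nu> (?A n) < ennreal ((e / 2)\<^sup>2 * ?c)"
    by (rule order_tendstoD(2))
  then obtain n where n: "emeasure \<nu> (?A n) < ennreal ((e / 2)\<^sup>2 * ?c)"
    by (auto simp: eventually_sequentially)
  obtain s where s: "0 < s" "cball a s - {a} \<subseteq> regular_domain B" using eventually_regular_domain[OF a] by auto
  \<comment> \<open>Points within 3d/2 of a, other than a itself, are then regular and lie in the
    ball of small mass.\<close>
  define d where "d = min (s / 2) (1 / (2 * real (Suc n)))"
  have d: "0 < d" "2 * d \<le> s" "2 * d \<le> 1 / real (Suc n)"
    using s(1) by (auto simp: d_def min_def field_simps)
  have "dist ((z - a) * F z) 0 < e" if z: "z \<noteq> a" "dist z a < d" for z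
  proof -
    define t where "t = dist z a / 2"
    have t: "0 < t" "2 * t < d" using z by (auto simp: t_def)
    have near: "dist a x \<le> 3 * t \<and> x \<noteq> a" if "x \<in> cball z t" for x
    proof
      have "dist a x \<le> dist a z + dist z x" by (rule dist_triangle)
      then show "dist a x \<le> 3 * t" using that by (simp add: t_def dist_commute)
      show "x \<noteq> a" using that t by (auto simp: t_def)
    qed
    have sub: "cball z t \<subseteq> regular_domain B"
    proof
      fix x assume "x \<in> cball z t"
      from near[OF this] have "x \<in> cball a s - {a}" using t d by simp
      then show "x \<in> regular_domain B" using s(2) by blast
    qed
    have subA: "ball z t \<subseteq> ?A n"
    proof
      fix x assume "x \<in> ball z t"
      then have "dist a x \<le> 3 * t" using near[of x] by simp
      then have "dist a x < 1 / real (Suc n)" using t d(1,3) by linarith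
      then show "x \<in> ?A n" by simp
    qed
    have "ennreal ((cmod (F z))\<^sup>2 * (?c * t\<^sup>2)) \<le> (\<integral>\<^sup>+w. ennreal ((cmod (F w))\<^sup>2) * indicator (ball z t) w \<partial>lborel)"
      by (rule area_submean_value[OF F open_regular_domain sub t(1)])
    also have "\<dots> \<le> emeasure \<nu> (?A n)"
      unfolding \<nu>[OF ball_in_borel]
    proof (rule nn_integral_mono)
      fix w
      show "ennreal ((cmod (F w))\<^sup>2) * indicator (ball z t) w \<le> K w * indicator (?A n) w"
      proof (cases "w \<in> ball z t")
        case True
        then have "w \<in> regular_domain B" "w \<in> ?A n" using sub subA by auto
        then show ?thesis using True by (simp add: K_def)
      qed simp
    qed
    also note n
    finally have "(cmod (F z))\<^sup>2 * (?c * t\<^sup>2) < (e / 2)\<^sup>2 * ?c" by (simp add: ennreal_less_iff)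
    then have "(cmod (F z) * t)\<^sup>2 * ?c < (e / 2)\<^sup>2 * ?c" by (simp add: power_mult_distrib ac_simps)
    then have "(cmod (F z) * t)\<^sup>2 < (e / 2)\<^sup>2" using c0 by (simp only: mult_less_cancel_right_pos)
    then have "cmod (F z) * t < e / 2" by (rule power_less_imp_less_base) (use e in simp)
    moreover have "cmod ((z - a) * F z) = 2 * (cmod (F z) * t)" by (simp add: t_def norm_mult dist_norm)
    ultimately show ?thesis by simp
  qed
  then show "\<forall>\<^sub>F z in at a. dist ((z - a) * F z) 0 < e"
    unfolding eventually_at using d(1) by blast
qed

lemma bergman_eqI:
  assumes f: "f \<in> bergman" and g: "g \<in> bergman" and eq: "\<And>z. z \<in> regular_domain B \<Longrightarrow> f z = g z"
  shows "f = g"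
proof
  fix z
  show "f z = g z"
  proof (cases "z \<in> unit_disk")
    case True
    show ?thesis
      by (rule analytic_continuation_open[OF open_regular_domain open_ball regular_domain_nonempty connected_ball
        regular_domain_subset bergmanD(1)[OF f] bergmanD(1)[OF g] eq True])
  next
    case False
    show ?thesis unfolding bergmanD(2)[OF f False] bergmanD(2)[OF g False] ..
  qed
qed

lemma bergman_holomorphic_regular: "f \<in> bergman \<Longrightarrow> f holomorphic_on regular_domain B"
  by (rule holomorphic_on_subset[OF bergmanD(1) regular_domain_subset])

text \<open>\<open>SOME\<close> selects the extension across the irregular points, which is unique
  by \<open>bergman_eqI\<close>; the restriction to \<open>bergman\<close> keeps the operator
  extensional.\<close>

definition transfer_op :: "(complex \<times> complex) set \<Rightarrow> bergman_op" where
  "transfer_op G = (\<lambda>f\<in>bergman. SOME h. h \<in> bergman \<and> (\<forall>z\<in>regular_domain B. h z = transfer G f z))"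

end

text \<open>Both multiplicities enter the operator norm, which is at most sqrt (m m'): m through
  Cauchy-Schwarz over the branches, m' through the number of times a point is hit.\<close>

locale finite_correspondence = asymptotic_isometry +
  fixes G :: "(complex \<times> complex) set" and m m' :: nat
  assumes sheeted_G: "sheeted G"
    and fin: "\<And>z. z \<in> regular_domain B \<Longrightarrow> finite (G``{z})"
    and fin': "\<And>z. z \<in> regular_domain B \<Longrightarrow> finite (G\<inverse>``{z})"
    and card: "\<And>z. z \<in> regular_domain B \<Longrightarrow> card (G``{z}) = m"
    and card': "\<And>z. z \<in> regular_domain B \<Longrightarrow> card (G\<inverse>``{z}) = m'"
begin

lemma converse: "finite_correspondence B (G\<inverse>) m' m"
proof unfold_locales
  show "sheeted (G\<inverse>)" by (rule sheeted_converse[OF sheeted_G])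
  show "finite ((G\<inverse>)\<inverse>``{z})" "card ((G\<inverse>)\<inverse>``{z}) = m" if "z \<in> regular_domain B" for z
    using fin[OF that] card[OF that] by simp_all
qed (rule fin' card', assumption)+

lemma energy_converse:
  assumes f: "f holomorphic_on regular_domain B" and g: "g holomorphic_on regular_domain B"
  shows "(\<integral>\<^sup>+x. ennreal (indicator (regular_domain B) x * energy G f g x) \<partial>disk_area)
    = (\<integral>\<^sup>+x. ennreal (indicator (regular_domain B) x * energy (G\<inverse>) g f x) \<partial>disk_area)"
proof (rule nn_integral_disk_area_cong)
  let ?H = "\<lambda>z w. (cmod (f w / deriv B w + g z / deriv B z))\<^sup>2"
  have e: "ennreal (indicator (regular_domain B) x * energy F u v x) * indicator unit_disk x
      = ennreal ((cmod (deriv B x))\<^sup>2 * (\<Sum>w\<in>F``{x}. (cmod (u w / deriv B w + v x / deriv B x))\<^sup>2)) * indicator (regular_domain B) x" for F u v x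
    using regular_domain_subset by (cases "x \<in> regular_domain B") (auto simp: energy_weighted)
  show "(\<integral>\<^sup>+x. ennreal (indicator (regular_domain B) x * energy G f g x) * indicator unit_disk x \<partial>lborel)
    = (\<integral>\<^sup>+x. ennreal (indicator (regular_domain B) x * energy (G\<inverse>) g f x) * indicator unit_disk x \<partial>lborel)"
    unfolding e
  proof (rule trans[OF energy_swap[OF sheeted_G fin fin' quotient_sum_continuous[OF f g]]])
    show "0 \<le> ?H z w" for z w by simp
  qed (simp_all add: add.commute)
  show "(\<lambda>x. ennreal (indicator (regular_domain B) x * energy G f g x)) \<in> borel_measurable borel"
    by (rule measurable_compose[OF energy_measurable[OF sheeted_G f g] measurable_ennreal])
  show "(\<lambda>x. ennreal (indicator (regular_domain B) x * energy (G\<inverse>) g f x)) \<in> borel_measurable borel"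
    by (rule measurable_compose[OF energy_measurable[OF sheeted_converse[OF sheeted_G] g f] measurable_ennreal])
qed

text \<open>After exchange with the converse, the branches of f turn into m' copies of f at the base
  point.\<close>

lemma energy_zero:
  assumes f: "f \<in> bergman"
  shows "has_bochner_integral disk_area (\<lambda>x. indicator (regular_domain B) x * energy G f (\<lambda>_. 0) x) (real m' * (bergman_norm f)\<^sup>2)"
proof (rule has_bochner_integral_nn_integral)
  note fh = bergman_holomorphic_regular[OF f]
  have zh: "(\<lambda>_. 0) holomorphic_on regular_domain B" by (rule holomorphic_on_const)
  have [measurable]: "f \<in> borel_measurable borel" by (rule bergman_measurable[OF f])
  show "(\<lambda>x. indicator (regular_domain B) x * energy G f (\<lambda>_. 0) x) \<in> borel_measurable disk_area"
    using energy_measurable[OF sheeted_G fh zh] by (simp cong: measurable_cong_sets)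
  show "AE x in disk_area. 0 \<le> indicator (regular_domain B) x * energy G f (\<lambda>_. 0) x"
    by (intro AE_I2 mult_nonneg_nonneg energy_nonneg) simp
  show "0 \<le> real m' * (bergman_norm f)\<^sup>2" by simp
  have "(\<integral>\<^sup>+x. ennreal (indicator (regular_domain B) x * energy G f (\<lambda>_. 0) x) \<partial>disk_area)
      = (\<integral>\<^sup>+x. ennreal (indicator (regular_domain B) x * energy (G\<inverse>) (\<lambda>_. 0) f x) \<partial>disk_area)"
    by (rule energy_converse[OF fh zh])
  also have "\<dots> = (\<integral>\<^sup>+x. ennreal (real m') * ennreal ((cmod (f x))\<^sup>2) \<partial>disk_area)"
  proof (rule nn_integral_cong_AE)
    show "AE x in disk_area. ennreal (indicator (regular_domain B) x * energy (G\<inverse>) (\<lambda>_. 0) f x) = ennreal (real m') * ennreal ((cmod (f x))\<^sup>2)"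
      using AE_regular_domain
    proof eventually_elim
      case (elim x)
      have "energy (G\<inverse>) (\<lambda>_. 0) f x = real m' * (cmod (f x))\<^sup>2"
        unfolding energy_def using card'[OF elim] by simp
      then show ?case using elim by (simp add: ennreal_mult')
    qed
  qed
  also have "\<dots> = ennreal (real m') * ennreal ((bergman_norm f)\<^sup>2)"
    unfolding bergman_nn_integral_eq(1)[OF f] by (subst nn_integral_cmult) simp_all
  also have "\<dots> = ennreal (real m' * (bergman_norm f)\<^sup>2)" by (simp add: ennreal_mult')
  finally show "(\<integral>\<^sup>+x. ennreal (indicator (regular_domain B) x * energy G f (\<lambda>_. 0) x) \<partial>disk_area) = ennreal (real m' * (bergman_norm f)\<^sup>2)" .
qed

lemma transfer_sq_le:
  assumes x: "x \<in> regular_domain B"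
  shows "(cmod (transfer G f x))\<^sup>2 \<le> real m * energy G f (\<lambda>_. 0) x"
proof -
  have "cmod (transfer G f x) \<le> (\<Sum>w\<in>G``{x}. cmod (f w * deriv B x / deriv B w))"
    unfolding transfer_def by (rule norm_sum)
  then have "(cmod (transfer G f x))\<^sup>2 \<le> (\<Sum>w\<in>G``{x}. cmod (f w * deriv B x / deriv B w))\<^sup>2"
    by (rule power_mono) simp
  also have "\<dots> \<le> (\<Sum>w\<in>G``{x}. (cmod (f w * deriv B x / deriv B w))\<^sup>2) * real (card (G``{x}))"
    by (rule sum_squared_le_sum_of_squares)
  also have "\<dots> = real m * energy G f (\<lambda>_. 0) x"
    unfolding energy_def card[OF x] by (simp add: mult.commute)
  finally show ?thesis .
qed

lemma transfer_sq_integral_le: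
  assumes f: "f \<in> bergman"
  shows "(\<integral>\<^sup>+x. ennreal (indicator (regular_domain B) x * (cmod (transfer G f x))\<^sup>2) \<partial>disk_area)
    \<le> ennreal (real m * (real m' * (bergman_norm f)\<^sup>2))"
proof -
  note e = energy_zero[OF f, unfolded has_bochner_integral_iff]
  have em: "(\<lambda>x. indicator (regular_domain B) x * energy G f (\<lambda>_. 0) x) \<in> borel_measurable borel"
    by (rule energy_measurable[OF sheeted_G bergman_holomorphic_regular[OF f] holomorphic_on_const])
  have "(\<integral>\<^sup>+x. ennreal (indicator (regular_domain B) x * (cmod (transfer G f x))\<^sup>2) \<partial>disk_area)
      \<le> (\<integral>\<^sup>+x. ennreal (real m) * ennreal (indicator (regular_domain B) x * energy G f (\<lambda>_. 0) x) \<partial>disk_area)"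
  proof (rule nn_integral_mono)
    fix x
    show "ennreal (indicator (regular_domain B) x * (cmod (transfer G f x))\<^sup>2)
      \<le> ennreal (real m) * ennreal (indicator (regular_domain B) x * energy G f (\<lambda>_. 0) x)"
    proof (cases "x \<in> regular_domain B")
      case True
      show ?thesis
        using ennreal_leI[OF transfer_sq_le[OF True, of f]] True by (simp add: ennreal_mult')
    qed simp
  qed
  also have "\<dots> = ennreal (real m) * (\<integral>\<^sup>+x. ennreal (indicator (regular_domain B) x * energy G f (\<lambda>_. 0) x) \<partial>disk_area)"
    using measurable_compose[OF em measurable_ennreal] by (intro nn_integral_cmult) (simp cong: measurable_cong_sets)
  also have "(\<integral>\<^sup>+x. ennreal (indicator (regular_domain B) x * energy G f (\<lambda>_. 0) x) \<partial>disk_area) = ennreal (real m' * (bergman_norm f)\<^sup>2)"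
    using e by (subst nn_integral_eq_integral) (auto intro!: mult_nonneg_nonneg energy_nonneg)
  finally show ?thesis by (simp add: ennreal_mult')
qed

text \<open>Cauchy-Schwarz over the m branches and the energy make the transfer square integrable,
  and square integrability makes its singularities at irregular points removable.\<close>

lemma transfer_extension:
  assumes f: "f \<in> bergman"
  shows "\<exists>h\<in>bergman. (\<forall>z\<in>regular_domain B. h z = transfer G f z) \<and> (bergman_norm h)\<^sup>2 \<le> real m * (real m' * (bergman_norm f)\<^sup>2)"
proof -
  let ?T = "transfer G f"
  let ?C = "real m * (real m' * (bergman_norm f)\<^sup>2)"
  have T: "?T holomorphic_on regular_domain B"
    by (rule transfer_holomorphic[OF sheeted_G bergman_holomorphic_regular[OF f]])
  let ?u = "\<lambda>x. ennreal (indicator (regular_domain B) x * (cmod (?T x))\<^sup>2)"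
  have cT: "continuous_on (regular_domain B) (\<lambda>x. (cmod (?T x))\<^sup>2)"
    by (intro continuous_on_power continuous_on_norm holomorphic_on_imp_continuous_on T)
  have um: "?u \<in> borel_measurable borel"
    using borel_measurable_indicator_continuous[OF open_regular_domain cT order_refl borel_open[OF open_regular_domain]]
    unfolding real_scaleR_def by (rule measurable_compose[OF _ measurable_ennreal])
  have "(\<integral>\<^sup>+x. ?u x \<partial>lborel) = (\<integral>\<^sup>+x. ?u x * indicator unit_disk x \<partial>lborel)"
    by (rule nn_integral_cong) (use regular_domain_subset in \<open>auto split: split_indicator\<close>)
  also have "\<dots> = ennreal (measure lborel (unit_disk :: complex set)) * (\<integral>\<^sup>+x. ?u x \<partial>disk_area)"
    by (rule nn_integral_disk_area[OF um, symmetric])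
  also have "\<dots> \<le> ennreal (measure lborel (unit_disk :: complex set)) * ennreal ?C"
    by (intro mult_left_mono transfer_sq_integral_le f) simp
  also have "\<dots> < \<infinity>" by (simp add: ennreal_mult_less_top)
  finally have fin2: "(\<integral>\<^sup>+x. ?u x \<partial>lborel) < \<infinity>" .
  obtain F where F: "F holomorphic_on unit_disk" "\<And>z. z \<in> regular_domain B \<Longrightarrow> F z = ?T z"
    using holomorphic_extend_disk[OF T square_integrable_pole_bound[OF T fin2]] by auto
  define h where "h z = indicator unit_disk z * F z" for z
  have hh: "h holomorphic_on unit_disk"
    by (rule holomorphic_transform[OF F(1)]) (simp add: h_def)
  have h0: "h z = 0" if "z \<notin> unit_disk" for z using that by (simp add: h_def)
  have hE: "h z = ?T z" if "z \<in> regular_domain B" for z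
    using that regular_domain_subset F(2) by (auto simp: h_def)
  have "(\<integral>\<^sup>+z. ennreal ((cmod (h z))\<^sup>2) \<partial>disk_area) = (\<integral>\<^sup>+x. ?u x \<partial>disk_area)"
  proof (rule nn_integral_cong_AE)
    show "AE x in disk_area. ennreal ((cmod (h x))\<^sup>2) = ?u x"
      using AE_regular_domain by eventually_elim (simp add: hE)
  qed
  also have "\<dots> \<le> ennreal ?C" by (rule transfer_sq_integral_le[OF f])
  finally have le: "(\<integral>\<^sup>+z. ennreal ((cmod (h z))\<^sup>2) \<partial>disk_area) \<le> ennreal ?C" .
  have C0: "0 \<le> ?C" by simp
  show ?thesis
    using bergmanI_nn(1)[OF hh h0 le] bergmanI_nn(2)[OF hh h0 le C0] hE by blast
qed

lemma transfer_op:
  assumes f: "f \<in> bergman"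
  shows "transfer_op G f \<in> bergman" "z \<in> regular_domain B \<Longrightarrow> transfer_op G f z = transfer G f z"
    "(bergman_norm (transfer_op G f))\<^sup>2 \<le> real m * (real m' * (bergman_norm f)\<^sup>2)"
proof -
  obtain h where h: "h \<in> bergman" "\<forall>z\<in>regular_domain B. h z = transfer G f z"
    "(bergman_norm h)\<^sup>2 \<le> real m * (real m' * (bergman_norm f)\<^sup>2)"
    using transfer_extension[OF f] by blast
  have "transfer_op G f = (SOME h. h \<in> bergman \<and> (\<forall>z\<in>regular_domain B. h z = transfer G f z))"
    using f by (simp add: transfer_op_def)
  then have t: "transfer_op G f \<in> bergman \<and> (\<forall>z\<in>regular_domain B. transfer_op G f z = transfer G f z)"
    using someI[of "\<lambda>h. h \<in> bergman \<and> (\<forall>z\<in>regular_domain B. h z = transfer G f z)" h] h(1,2) by simp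
  then show "transfer_op G f \<in> bergman" "z \<in> regular_domain B \<Longrightarrow> transfer_op G f z = transfer G f z" by auto
  have "transfer_op G f = h" by (rule bergman_eqI) (use t h in auto)
  then show "(bergman_norm (transfer_op G f))\<^sup>2 \<le> real m * (real m' * (bergman_norm f)\<^sup>2)" using h(3) by simp
qed

lemma transfer_op_eqI:
  assumes f: "f \<in> bergman" and h: "h \<in> bergman" "\<And>z. z \<in> regular_domain B \<Longrightarrow> transfer G f z = h z"
  shows "transfer_op G f = h"
  by (rule bergman_eqI[OF transfer_op(1)[OF f] h(1)]) (simp add: transfer_op(2)[OF f] h(2))

lemma transfer_op_bounded: "bounded_op (transfer_op G)"
  unfolding bounded_op_def
proof (intro conjI ballI allI)
  show "transfer_op G \<in> bergman \<rightarrow>\<^sub>E bergman"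
    using transfer_op(1) by (auto simp: transfer_op_def)
  show "transfer_op G (\<lambda>z. f z + g z) = (\<lambda>z. transfer_op G f z + transfer_op G g z)" if f: "f \<in> bergman" and g: "g \<in> bergman" for f g
    by (rule transfer_op_eqI[OF bergman_add[OF f g] bergman_add[OF transfer_op(1)[OF f] transfer_op(1)[OF g]]])
      (simp add: transfer_op(2)[OF f] transfer_op(2)[OF g] transfer_def sum.distrib distrib_right add_divide_distrib)
  show "transfer_op G (\<lambda>z. c * f z) = (\<lambda>z. c * transfer_op G f z)" if f: "f \<in> bergman" for c f
    by (rule transfer_op_eqI[OF bergman_scale[OF f] bergman_scale[OF transfer_op(1)[OF f]]])
      (simp add: transfer_op(2)[OF f] transfer_def sum_distrib_left mult.assoc)
  show "\<exists>C. \<forall>f\<in>bergman. bergman_norm (transfer_op G f) \<le> C * bergman_norm f"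
  proof (intro exI[of _ "sqrt (real m * real m')"] ballI)
    fix f assume f: "f \<in> bergman"
    have "(bergman_norm (transfer_op G f))\<^sup>2 \<le> (sqrt (real m * real m') * bergman_norm f)\<^sup>2"
      using transfer_op(3)[OF f] by (simp add: power_mult_distrib mult.assoc)
    then show "bergman_norm (transfer_op G f) \<le> sqrt (real m * real m') * bergman_norm f"
      by (rule power2_le_imp_le) (simp add: bergman_nn_integral_eq(3)[OF f])
  qed
qed

lemma energy_expand:
  assumes x: "x \<in> regular_domain B"
  shows "energy G f g x = energy G f (\<lambda>_. 0) x + real m * (cmod (g x))\<^sup>2 + 2 * Re (transfer G f x * cnj (g x))"
proof -
  have e: "(cmod (a + b))\<^sup>2 = (cmod a)\<^sup>2 + (cmod b)\<^sup>2 + 2 * Re (a * cnj b)" for a b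
    by (simp only: cmod_power2) (simp add: power2_eq_square algebra_simps)
  define t where "t w = f w * deriv B x / deriv B w" for w
  have "energy G f g x = (\<Sum>w\<in>G``{x}. (cmod (t w))\<^sup>2 + (cmod (g x))\<^sup>2 + 2 * Re (t w * cnj (g x)))"
    unfolding energy_def t_def by (rule sum.cong[OF refl e])
  also have "\<dots> = (\<Sum>w\<in>G``{x}. (cmod (t w))\<^sup>2) + (\<Sum>w\<in>G``{x}. (cmod (g x))\<^sup>2) + (\<Sum>w\<in>G``{x}. 2 * Re (t w * cnj (g x)))"
    by (simp only: sum.distrib)
  also have "(\<Sum>w\<in>G``{x}. (cmod (t w))\<^sup>2) = energy G f (\<lambda>_. 0) x"
    by (simp only: energy_def t_def add_0_right)
  also have "(\<Sum>w\<in>G``{x}. (cmod (g x))\<^sup>2) = real m * (cmod (g x))\<^sup>2"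
    by (simp only: sum_constant card[OF x])
  also have "(\<Sum>w\<in>G``{x}. 2 * Re (t w * cnj (g x))) = 2 * Re (transfer G f x * cnj (g x))"
    unfolding transfer_def t_def sum_distrib_right Re_sum sum_distrib_left ..
  finally show ?thesis .
qed

lemma energy_integral:
  assumes f: "f \<in> bergman" and g: "g \<in> bergman"
  shows "(LINT x|disk_area. indicator (regular_domain B) x * energy G f g x)
    = real m' * (bergman_norm f)\<^sup>2 + real m * (bergman_norm g)\<^sup>2 + 2 * Re (bergman_inner (transfer_op G f) g)"
proof -
  let ?E = "regular_domain B"
  note e = energy_zero[OF f, unfolded has_bochner_integral_iff]
  note i = bergman_integrable[OF transfer_op(1)[OF f] g]
  have lin: "(LINT x|disk_area. a x + real m * b x + 2 * c x) = (LINT x|disk_area. a x) + real m * (LINT x|disk_area. b x) + 2 * (LINT x|disk_area. c x)"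
    if "integrable disk_area a" "integrable disk_area b" "integrable disk_area c" for a b c :: "complex \<Rightarrow> real"
    using that by simp
  have "(LINT x|disk_area. indicator ?E x * energy G f g x)
      = (LINT x|disk_area. indicator ?E x * energy G f (\<lambda>_. 0) x + real m * (cmod (g x))\<^sup>2 + 2 * Re (transfer_op G f x * cnj (g x)))"
  proof (rule integral_cong_AE)
    have [measurable]: "g \<in> borel_measurable borel" "transfer_op G f \<in> borel_measurable borel"
      by (rule bergman_measurable[OF g], rule bergman_measurable[OF transfer_op(1)[OF f]])
    have [measurable]: "(\<lambda>x. indicator ?E x * energy G f g x) \<in> borel_measurable borel"
      "(\<lambda>x. indicator ?E x * energy G f (\<lambda>_. 0) x) \<in> borel_measurable borel"
      by (rule energy_measurable[OF sheeted_G bergman_holomorphic_regular[OF f] bergman_holomorphic_regular[OF g]],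
          rule energy_measurable[OF sheeted_G bergman_holomorphic_regular[OF f] holomorphic_on_const])
    show "(\<lambda>x. indicator ?E x * energy G f g x) \<in> borel_measurable disk_area" by measurable
    show "(\<lambda>x. indicator ?E x * energy G f (\<lambda>_. 0) x + real m * (cmod (g x))\<^sup>2 + 2 * Re (transfer_op G f x * cnj (g x))) \<in> borel_measurable disk_area"
      by measurable
    show "AE x in disk_area. indicator ?E x * energy G f g x = indicator ?E x * energy G f (\<lambda>_. 0) x + real m * (cmod (g x))\<^sup>2 + 2 * Re (transfer_op G f x * cnj (g x))"
      using AE_regular_domain
    proof eventually_elim
      case (elim x)
      show ?case unfolding energy_expand[OF elim, of f g] transfer_op(2)[OF f elim] using elim by simp
    qed
  qed
  also have "\<dots> = (LINT x|disk_area. indicator ?E x * energy G f (\<lambda>_. 0) x) + real m * (LINT x|disk_area. (cmod (g x))\<^sup>2)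
      + 2 * (LINT x|disk_area. Re (transfer_op G f x * cnj (g x)))"
    using lin[OF e[THEN conjunct1] bergmanD(3)[OF g] integrable_Re[OF i]] .
  also have "(LINT x|disk_area. Re (transfer_op G f x * cnj (g x))) = Re (bergman_inner (transfer_op G f) g)"
    unfolding bergman_inner_def by (rule integral_Re[OF i])
  also have "(LINT x|disk_area. (cmod (g x))\<^sup>2) = (bergman_norm g)\<^sup>2" by (rule bergman_nn_integral_eq(2)[OF g, symmetric])
  finally show ?thesis using e by simp
qed

end

section \<open>The adjoint of the operator and its membership in the commutant\<close>

context finite_correspondence
begin

text \<open>Polarisation: the energy integrals of G for (f, g) and of the converse for (g, f)
  coincide, and so do their quadratic terms, which leaves the real parts of the two inner products.
  Replacing g by i g gives the imaginary parts.\<close>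

lemma transfer_op_adjoint:
  assumes f: "f \<in> bergman" and g: "g \<in> bergman"
  shows "bergman_inner (transfer_op G f) g = bergman_inner f (transfer_op (G\<inverse>) g)"
proof -
  interpret C: finite_correspondence B "G\<inverse>" m' m by (rule converse)
  have re: "Re (bergman_inner (transfer_op G f) g) = Re (bergman_inner (transfer_op (G\<inverse>) g) f)" if g: "g \<in> bergman" for g
  proof -
    let ?E = "regular_domain B"
    note fh = bergman_holomorphic_regular[OF f] and gh = bergman_holomorphic_regular[OF g]
    have nn: "(LINT x|disk_area. indicator ?E x * energy F u v x) = enn2real (\<integral>\<^sup>+x. ennreal (indicator ?E x * energy F u v x) \<partial>disk_area)"
      if "sheeted F" "u holomorphic_on ?E" "v holomorphic_on ?E" for F u v
    proof (rule integral_eq_nn_integral)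
      show "(\<lambda>x. indicator ?E x * energy F u v x) \<in> borel_measurable disk_area"
        using energy_measurable[OF that] by (simp cong: measurable_cong_sets)
      show "AE x in disk_area. 0 \<le> indicator ?E x * energy F u v x"
        by (intro AE_I2 mult_nonneg_nonneg energy_nonneg) simp
    qed
    have "(LINT x|disk_area. indicator ?E x * energy G f g x) = (LINT x|disk_area. indicator ?E x * energy (G\<inverse>) g f x)"
      unfolding nn[OF sheeted_G fh gh] nn[OF C.sheeted_G gh fh] energy_converse[OF fh gh] ..
    then show ?thesis
      unfolding energy_integral[OF f g] C.energy_integral[OF g f] by simp
  qed
  note Tg = C.transfer_op(1)[OF g]
  have ig: "(\<lambda>z. \<i> * g z) \<in> bergman" by (rule bergman_scale[OF g])
  have "transfer_op (G\<inverse>) (\<lambda>z. \<i> * g z) = (\<lambda>z. \<i> * transfer_op (G\<inverse>) g z)"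
    by (rule bounded_opD(3)[OF C.transfer_op_bounded g])
  then have "Re (cnj \<i> * bergman_inner (transfer_op G f) g) = Re (\<i> * bergman_inner (transfer_op (G\<inverse>) g) f)"
    using re[OF ig] by (simp only: bergman_inner_scale_left bergman_inner_scale_right)
  then have "Im (bergman_inner (transfer_op G f) g) = - Im (bergman_inner (transfer_op (G\<inverse>) g) f)" by simp
  with re[OF g] have "bergman_inner (transfer_op G f) g = cnj (bergman_inner (transfer_op (G\<inverse>) g) f)"
    by (simp add: complex_eq_iff)
  then show ?thesis by (simp only: bergman_inner_commute[of f])
qed

text \<open>B takes the same value at both coordinates of a pair in G, so it factors out of the
  sum.\<close>

lemma transfer_op_mult:
  assumes f: "f \<in> bergman"
  shows "transfer_op G (mult_op B f) = mult_op B (transfer_op G f)"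
proof -
  have T: "transfer_op G f \<in> bergman" by (rule transfer_op(1)[OF f])
  have Bf: "mult_op B f = (\<lambda>z. B z * f z)" "mult_op B (transfer_op G f) = (\<lambda>z. B z * transfer_op G f z)"
    using f T by (simp_all add: mult_op_def)
  show ?thesis
    unfolding Bf
  proof (rule transfer_op_eqI[OF bergman_mult_bounded(1)[OF hol le1 f] bergman_mult_bounded(1)[OF hol le1 T]])
    fix z assume z: "z \<in> regular_domain B"
    have "transfer G (\<lambda>z. B z * f z) z = (\<Sum>w\<in>G``{z}. B z * (f w * deriv B z / deriv B w))"
      unfolding transfer_def
    proof (rule sum.cong[OF refl])
      fix w assume "w \<in> G``{z}"
      then have "B z = B w" using sheetedD(3)[OF sheeted_G] by blast
      then show "B w * f w * deriv B z / deriv B w = B z * (f w * deriv B z / deriv B w)" by simp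
    qed
    then show "transfer G (\<lambda>z. B z * f z) z = B z * transfer_op G f z"
      unfolding transfer_op(2)[OF f z] transfer_def sum_distrib_left .
  qed
qed

text \<open>Commutation with the adjoint multiplication is obtained by taking adjoints in the
  commutation of the operator of the converse with multiplication.\<close>

theorem transfer_op_in_V_star: "transfer_op G \<in> V_star B"
proof -
  interpret C: finite_correspondence B "G\<inverse>" m' m by (rule converse)
  have M: "bounded_op (mult_op B)" by (rule mult_op_bounded[OF hol le1])
  note A = adjoint_op[OF M]
  note Tb = transfer_op(1) and Mb = bounded_opD(1)[OF M] and Ab = bounded_opD(1)[OF A(1)]
  have adjM: "bergman_inner f (mult_op B g) = bergman_inner (adjoint_op (mult_op B) f) g" if "f \<in> bergman" "g \<in> bergman" for f g
    using A(2)[OF that(2,1)] by (metis bergman_inner_commute)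
  have "transfer_op G (adjoint_op (mult_op B) f) = adjoint_op (mult_op B) (transfer_op G f)" if f: "f \<in> bergman" for f
  proof (rule bergman_inner_ext[OF Tb[OF Ab[OF f]] Ab[OF Tb[OF f]]])
    fix g assume g: "g \<in> bergman"
    let ?T = "transfer_op G" and ?S = "transfer_op (G\<inverse>)" and ?A = "adjoint_op (mult_op B)"
    have Sg: "?S g \<in> bergman" by (rule C.transfer_op(1)[OF g])
    have "bergman_inner (?T (?A f)) g = bergman_inner (?A f) (?S g)" by (rule transfer_op_adjoint[OF Ab[OF f] g])
    also have "\<dots> = bergman_inner f (mult_op B (?S g))" by (rule adjM[OF f Sg, symmetric])
    also have "\<dots> = bergman_inner f (?S (mult_op B g))" by (simp only: C.transfer_op_mult[OF g])
    also have "\<dots> = bergman_inner (?T f) (mult_op B g)" by (rule transfer_op_adjoint[OF f Mb[OF g], symmetric])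
    also have "\<dots> = bergman_inner (?A (?T f)) g" by (rule adjM[OF Tb[OF f] g])
    finally show "bergman_inner g (?T (?A f)) = bergman_inner g (?A (?T f))"
      unfolding bergman_inner_commute[of g] by (rule arg_cong)
  qed
  then show ?thesis
    unfolding V_star_def commutant_def using transfer_op_bounded transfer_op_mult by simp
qed

text \<open>The divided difference of \<^term>\<open>B\<close> at \<^term>\<open>w\<close> vanishes at all points of the fibre of \<^term>\<open>w\<close>
  except \<^term>\<open>w\<close>, whereas its transfer does not vanish at the points related to \<^term>\<open>w\<close>.\<close>

lemma transfer_op_not_scalar:
  assumes p: "(z, w) \<in> G" "z \<noteq> w"
  shows "transfer_op G \<notin> scalar_ops"
proof
  assume "transfer_op G \<in> scalar_ops"
  then obtain c where c: "transfer_op G = (\<lambda>f\<in>bergman. \<lambda>z. c * f z)" unfolding scalar_ops_def by blast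
  note d = sheetedD[OF sheeted_G p(1)]
  let ?q = "disk_quot B w"
  have q: "?q \<in> bergman" by (rule disk_quot_bergman(1)[OF hol le1 d(5)])
  have qv: "?q x = (if x = w then deriv B w else 0)" if "x \<in> unit_disk" "B x = B w" for x
    using that by (simp add: disk_quot_def div_diff_def)
  have "transfer_op G ?q z = c * ?q z" unfolding c using q by simp
  then have "transfer G ?q z = 0" using transfer_op(2)[OF q d(1)] qv[OF d(4,3)] p(2) by simp
  moreover have "transfer G ?q z = deriv B z"
  proof -
    have "transfer G ?q z = (\<Sum>x\<in>G``{z}. if x = w then deriv B z else 0)"
      unfolding transfer_def
    proof (rule sum.cong[OF refl])
      fix x assume "x \<in> G``{z}"
      then have x: "(z, x) \<in> G" by simp
      note dx = sheetedD[OF sheeted_G x]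
      have "B x = B w" using dx(3) d(3) by simp
      from qv[OF dx(5) this] show "?q x * deriv B z / deriv B x = (if x = w then deriv B z else 0)"
        using deriv_nonzero[OF d(2)] by simp
    qed
    also have "\<dots> = deriv B z" using fin[OF d(1)] p(1) by simp
    finally show ?thesis .
  qed
  ultimately show False using deriv_nonzero[OF d(1)] by simp
qed

end

text \<open>Finiteness of the converse fibres and constancy of both cardinalities make G a finite
  correspondence; since its pairs lie off the diagonal, its operator is not a scalar.\<close>

theorem (in asymptotic_isometry) V_star_nontrivial_if_finite:
  assumes G: "G \<in> nontrivial_components B" and fin: "multiplicity_of_component B G \<noteq> \<infinity>"
  shows "V_star B \<noteq> scalar_ops"
proof -
  have GC: "G \<in> components (riemann_surface B)" using G by (simp add: nontrivial_components_def)
  note sh = component_sheeted[OF GC]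
  have f: "finite (G``{z})" if "z \<in> regular_domain B" for z
    using fin multiplicity_eq[OF GC that] by (auto simp: ecard_def split: if_splits)
  have f': "finite (G\<inverse>``{z})" if "z \<in> regular_domain B" for z
    by (rule finite_converse_fibre[OF sh f that])
  obtain z0 where z0: "z0 \<in> regular_domain B" using regular_domain_nonempty by blast
  have cd: "card (F``{z}) = card (F``{z0})"
    if F: "sheeted F" "finite (F``{z})" "finite (F``{z0})" and z: "z \<in> regular_domain B" for F z
    using sheeted_ecard_constant[OF F(1) z z0] F(2,3) by (simp add: ecard_def)
  interpret finite_correspondence B G "card (G``{z0})" "card (G\<inverse>``{z0})"
  proof unfold_locales
    show "sheeted G" by (rule sh)
    fix z assume z: "z \<in> regular_domain B"
    show "finite (G``{z})" "finite (G\<inverse>``{z})" by (rule f[OF z], rule f'[OF z])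
    show "card (G``{z}) = card (G``{z0})" by (rule cd[OF sh f[OF z] f[OF z0] z])
    show "card (G\<inverse>``{z}) = card (G\<inverse>``{z0})" by (rule cd[OF sheeted_converse[OF sh] f'[OF z] f'[OF z0] z])
  qed
  have "G \<noteq> {}" using in_components_nonempty[OF GC] .
  then obtain z w where zw: "(z, w) \<in> G" by (metis ex_in_conv surj_pair)
  have "transfer_op G \<notin> scalar_ops"
    by (rule transfer_op_not_scalar[OF zw nontrivial_component_off_diagonal[OF G zw]])
  then show ?thesis using transfer_op_in_V_star by metis
qed

theorem theorem6p1:
  fixes B :: "complex \<Rightarrow> complex"
  assumes "thin_blaschke_product B"
    and "\<not> sphere 0 1 \<subseteq> closure (disk_zeros B)"
  shows "V_star B \<noteq> scalar_ops \<longleftrightarrow>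
    (\<exists>G\<in>nontrivial_components B. multiplicity_of_component B G \<noteq> \<infinity>)"
proof -
  interpret asymptotic_isometry B by (rule thin_blaschke_asymptotic_isometry[OF assms(1)])
  show ?thesis using V_star_scalar_if_infinite V_star_nontrivial_if_finite by blast
qed

end
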